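(* Let $G$ be an abelian group, and let $\mathcal{D}$ be a real algebra isomorphic to $M_n(\mathbb{C})$. If there is a division $G$-grading $\Gamma$ on $\mathcal{D}$ with homogeneous components of (real) dimension $1$, then $n=2^m$ for some integer $m\ge0$ and the support of $\Gamma$ is a subgroup $T$ of $G$ isomorphic either to $\mathbb{Z}_2^{2m+1}$ or to $\mathbb{Z}_2^{2m-1}\times\mathbb{Z}_4$. Moreover, the following possibilities appear: (1) If the support is isomorphic to $\mathbb{Z}_2^{2m+1}$, the isomorphism classes of such gradings are in one-to-one correspondence with the pairs $(T,\mu)$ formed by a subgroup $T$ of $G$ isomorphic to $\mathbb{Z}_2^{2m+1}$, and a quadratic form $\mu$ on $T$ of type II. All such gradings belong to one equivalence class, represented by the product grading on $M_2(\mathbb{R})\otimes\cdots\otimes M_2(\mathbb{R})\otimes\mathbb{C}\cong M_n(\mathbb{C})$ ($m$ factors $M_2(\mathbb{R})$; grading group $(\mathbb{Z}_2^2)^m\times\mathbb{Z}_2$). (2) If the support is isomorphic to $\mathbb{Z}_2^{2m-1}\times\mathbb{Z}_4$, the isomorphism classes of such gradings are in one-to-one correspondence with the triples $(T,\beta,\mu)$ formed by a subgroup $T$ of $G$ isomorphic to $\mathbb{Z}_2^{2m-1}\times\mathbb{Z}_4$, an alternating bicharacter $\beta$ on $T$ of type II, and a quadratic form $\mu$ on $T_2:=\{t\in T\mid t^2=e\}$; such that the restriction of $\beta$ to $T_2\times T_2$ is the associated alternating bicharacter of $\mu$, and that $\mu$ takes the value $-1$ on $f$, where $f$ is the generator of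 $T^2=\{t^2\mid t\in T\}$. All such gradings belong to one equivalence class, represented by the product grading on $M_2(\mathbb{R})\otimes\cdots\otimes M_2(\mathbb{R})\otimes M_2(\mathbb{C})\cong M_n(\mathbb{C})$ ($m-1$ factors $M_2(\mathbb{R})$; grading group $(\mathbb{Z}_2^2)^{m-1}\times(\mathbb{Z}_2\times\mathbb{Z}_4)$, $n\ge2$). The factors $M_2(\mathbb{R})$, $\mathbb{C}$, $M_2(\mathbb{C})$ in these representatives carry the gradings with one-dimensional components described in the context.
   Context: Algebras are associative; $M_n(\mathbb{C})$ is regarded as a real algebra, dimensions and tensor products are over $\mathbb{R}$. A $G$-grading on an algebra $\mathcal{D}$ is a decomposition $\mathcal{D}=\bigoplus_{g\in G}\mathcal{D}_g$ into ($\mathbb{R}$-)subspaces with $\mathcal{D}_g\mathcal{D}_h\subseteq\mathcal{D}_{gh}$. Its support is $\{g\in G\mid \mathcal{D}_g\ne0\}$. It is a division grading if $\mathcal{D}$ is unital and every nonzero homogeneous element is invertible; the support is then a subgroup and all nonzero homogeneous components have the same dimension ("homogeneous components of dimension $d$" refers to the nonzero ones). Two $G$-gradings, on $\mathcal{D}$ and $\mathcal{D}'$, are isomorphic if there is an isomorphism of real algebras $\varphi:\mathcal{D}\to\mathcal{D}'$ with $\varphi(\mathcal{D}_g)=\mathcal{D}'_g$ for all $g\in G$. A $G$-grading $\Gamma$ on $\mathcal{D}$ and an $H$-grading $\Gamma'$ on $\mathcal{D}'$ are equivalent if there are an isomorphism of real algebras $\varphi:\mathcal{D}\to\mathcal{D}'$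 and a bijection $\alpha:\mathrm{supp}(\Gamma)\to\mathrm{supp}(\Gamma')$ with $\varphi(\mathcal{D}_t)=\mathcal{D}'_{\alpha(t)}$ for all $t\in\mathrm{supp}(\Gamma)$. Product grading: if $\mathcal{D}$ is $G$-graded and $\mathcal{D}'$ is $H$-graded, $\mathcal{D}\otimes\mathcal{D}'$ is $G\times H$-graded by $(\mathcal{D}\otimes\mathcal{D}')_{(g,h)}=\mathcal{D}_g\otimes\mathcal{D}'_h$. An alternating bicharacter on an abelian group $T$ is a map $\beta:T\times T\to\mathbb{R}^\times$ multiplicative in each variable with $\beta(t,t)=1$ for all $t$. Its radical is $\mathrm{rad}(\beta)=\{t\in T\mid\beta(u,t)=+1\ \forall u\in T\}$. It has type II if $\mathrm{rad}(\beta)$ has exactly two elements. For an elementary abelian $2$-group $T$, a quadratic form (multiplicative notation) is a map $\mu:T\to\{\pm1\}$ with $\mu(e)=+1$ such that $\beta(u,v):=\mu(uv)\mu(u)^{-1}\mu(v)^{-1}$ is multiplicative in each variable; $\beta$ is its associated alternating bicharacter. The quadratic form $\mu$ has type II if there is $f\in T$ with $f\neq e$, $\mathrm{rad}(\beta)=\{e,f\}$ and $\mu(f)=-1$. Gradings with one-dimensional components: $\mathbb{C}=\mathbb{R}1\oplus\mathbb{R}i$ graded by $\mathbb{Z}_2$ with $\deg i=\bar1$; $$M_2(\mathbb{R})=\mathbb{R}\begin{pmatrix}1&0\\0&1\end{pmatrix}\oplus\mathbb{R}\begin{pmatrix}0&1\\1&0\end{pmatrix}\oplus\mathbb{R}\begin{pmatrix}-1&0\\0&1\end{pmatrix}\oplus\mathbb{R}\begin{pmatrix}0&-1\\1&0\end{pmatrix}$$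 graded by $\mathbb{Z}_2^2$, with degrees $(\bar0,\bar0),(\bar1,\bar0),(\bar0,\bar1),(\bar1,\bar1)$ respectively; and, with $\omega:=e^{i\pi/4}$, $$M_2(\mathbb{C})=\mathbb{R}\begin{pmatrix}1&0\\0&1\end{pmatrix}\oplus\mathbb{R}\begin{pmatrix}\omega&0\\0&-\omega\end{pmatrix}\oplus\mathbb{R}\begin{pmatrix}i&0\\0&i\end{pmatrix}\oplus\mathbb{R}\begin{pmatrix}\omega^3&0\\0&-\omega^3\end{pmatrix}\oplus\mathbb{R}\begin{pmatrix}0&1\\1&0\end{pmatrix}\oplus\mathbb{R}\begin{pmatrix}0&-\omega\\\omega&0\end{pmatrix}\oplus\mathbb{R}\begin{pmatrix}0&i\\i&0\end{pmatrix}\oplus\mathbb{R}\begin{pmatrix}0&-\omega^3\\\omega^3&0\end{pmatrix}$$ graded by $\mathbb{Z}_2\times\mathbb{Z}_4=\{e,b,b^2,b^3,a,ab,ab^2,ab^3\}$ ($a$ of order $2$, $b$ of order $4$), the summands having these degrees in this order. *)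

theory Defs
  imports
    "HOL-Algebra.Product_Groups"
    "HOL-Algebra.QuotRing"
    "Jordan_Normal_Form.VS_Connect"
begin

text \<open>A real algebra is an HOL-Algebra module record over the field of real numbers
  (\<open>class_ring\<close> at type \<^typ>\<open>real\<close>) whose multiplication is bilinear, associative and unital.\<close>

definition unital_real_algebra :: "(real, 'd) module \<Rightarrow> bool" where
  "unital_real_algebra A \<longleftrightarrow> ring A \<and> vectorspace (class_ring :: real ring) A \<and>
     (\<forall>r. \<forall>x\<in>carrier A. \<forall>y\<in>carrier A.
        (r \<odot>\<^bsub>A\<^esub> x) \<otimes>\<^bsub>A\<^esub> y = r \<odot>\<^bsub>A\<^esub> (x \<otimes>\<^bsub>A\<^esub> y) \<and>
        x \<otimes>\<^bsub>A\<^esub> (r \<odot>\<^bsub>A\<^esub> y) = r \<odot>\<^bsub>A\<^esub> (x \<otimes>\<^bsub>A\<^esub> y))"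

definition alg_iso :: "(real, 'a) module \<Rightarrow> (real, 'b) module \<Rightarrow> ('a \<Rightarrow> 'b) set" where
  "alg_iso A B = {\<phi> \<in> ring_iso A B. \<forall>r. \<forall>x\<in>carrier A. \<phi> (r \<odot>\<^bsub>A\<^esub> x) = r \<odot>\<^bsub>B\<^esub> \<phi> x}"

definition isomorphic_algebras :: "(real, 'a) module \<Rightarrow> (real, 'b) module \<Rightarrow> bool" where
  "isomorphic_algebras A B \<longleftrightarrow> alg_iso A B \<noteq> {}"

abbreviation real_span :: "(real, 'd) module \<Rightarrow> 'd set \<Rightarrow> 'd set" where
  "real_span A S \<equiv> LinearCombinations.module.span (class_ring :: real ring) A S"

text \<open>\<open>vectorspace.dim\<close> is a least number that is unspecified without \<open>fin_dim\<close>.\<close>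

definition has_real_dim :: "(real, 'd) module \<Rightarrow> 'd set \<Rightarrow> nat \<Rightarrow> bool" where
  "has_real_dim A V d \<longleftrightarrow>
     vectorspace.fin_dim (class_ring :: real ring) (A\<lparr>carrier := V\<rparr>) \<and>
     vectorspace.dim (class_ring :: real ring) (A\<lparr>carrier := V\<rparr>) = d"

definition matrix_algebra :: "nat \<Rightarrow> (real, 'a::{comm_ring_1, real_algebra_1} mat) module" where
  "matrix_algebra n =
     \<lparr>carrier = carrier_mat n n, mult = (*), one = 1\<^sub>m n, zero = 0\<^sub>m n n, add = (+),
      smult = (\<lambda>r x. of_real r \<cdot>\<^sub>m x)\<rparr>"

definition complex_algebra :: "(real, complex) module" where
  "complex_algebra =
     \<lparr>carrier = UNIV, mult = (*), one = 1, zero = 0, add = (+), smult = (\<lambda>r z. of_real r * z)\<rparr>"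

text \<open>A grading on \<open>A\<close> by \<open>G\<close> is given by the family of its homogeneous components.  Only the
  values of the family on \<open>carrier G\<close> are relevant.\<close>

definition grading :: "('g, 'c) monoid_scheme \<Rightarrow> (real, 'd) module \<Rightarrow> ('g \<Rightarrow> 'd set) \<Rightarrow> bool" where
  "grading G A \<Gamma> \<longleftrightarrow>
     (\<forall>g\<in>carrier G. subspace (class_ring :: real ring) (\<Gamma> g) A) \<and>
     (\<forall>x\<in>carrier A. \<exists>S f. finite S \<and> S \<subseteq> carrier G \<and> (\<forall>g\<in>S. f g \<in> \<Gamma> g) \<and> x = finsum A f S) \<and>
     (\<forall>S f. finite S \<and> S \<subseteq> carrier G \<and> (\<forall>g\<in>S. f g \<in> \<Gamma> g) \<and> finsum A f S = \<zero>\<^bsub>A\<^esub>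
        \<longrightarrow> (\<forall>g\<in>S. f g = \<zero>\<^bsub>A\<^esub>)) \<and>
     (\<forall>g\<in>carrier G. \<forall>h\<in>carrier G. \<forall>x\<in>\<Gamma> g. \<forall>y\<in>\<Gamma> h. x \<otimes>\<^bsub>A\<^esub> y \<in> \<Gamma> (g \<otimes>\<^bsub>G\<^esub> h))"

definition grading_support ::
  "('g, 'c) monoid_scheme \<Rightarrow> (real, 'd) module \<Rightarrow> ('g \<Rightarrow> 'd set) \<Rightarrow> 'g set" where
  "grading_support G A \<Gamma> = {g \<in> carrier G. \<Gamma> g \<noteq> {\<zero>\<^bsub>A\<^esub>}}"

definition division_grading ::
  "('g, 'c) monoid_scheme \<Rightarrow> (real, 'd) module \<Rightarrow> ('g \<Rightarrow> 'd set) \<Rightarrow> bool" where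
  "division_grading G A \<Gamma> \<longleftrightarrow> grading G A \<Gamma> \<and>
     (\<forall>g\<in>carrier G. \<forall>x\<in>\<Gamma> g. x \<noteq> \<zero>\<^bsub>A\<^esub> \<longrightarrow> x \<in> Units A)"

definition components_of_dim ::
  "nat \<Rightarrow> ('g, 'c) monoid_scheme \<Rightarrow> (real, 'd) module \<Rightarrow> ('g \<Rightarrow> 'd set) \<Rightarrow> bool" where
  "components_of_dim d G A \<Gamma> \<longleftrightarrow> (\<forall>g\<in>grading_support G A \<Gamma>. has_real_dim A (\<Gamma> g) d)"

definition division_gradings_dim1 ::
  "('g, 'c) monoid_scheme \<Rightarrow> (real, 'd) module \<Rightarrow> ('g \<Rightarrow> 'd set) set" where
  "division_gradings_dim1 G A = {\<Gamma>. division_grading G A \<Gamma> \<and> components_of_dim 1 G A \<Gamma>}"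

definition division_gradings_dim1_supp ::
  "('g, 'c) monoid_scheme \<Rightarrow> (real, 'd) module \<Rightarrow> 'k monoid \<Rightarrow> ('g \<Rightarrow> 'd set) set" where
  "division_gradings_dim1_supp G A K =
     {\<Gamma> \<in> division_gradings_dim1 G A. G\<lparr>carrier := grading_support G A \<Gamma>\<rparr> \<cong> K}"

definition gradings_isomorphic ::
  "('g, 'c) monoid_scheme \<Rightarrow> (real, 'a) module \<Rightarrow> ('g \<Rightarrow> 'a set) \<Rightarrow>
   (real, 'b) module \<Rightarrow> ('g \<Rightarrow> 'b set) \<Rightarrow> bool" where
  "gradings_isomorphic G A \<Gamma> B \<Gamma>' \<longleftrightarrow>
     (\<exists>\<phi>\<in>alg_iso A B. \<forall>g\<in>carrier G. \<phi> ` \<Gamma> g = \<Gamma>' g)"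

definition gradings_equivalent ::
  "('g, 'c) monoid_scheme \<Rightarrow> (real, 'a) module \<Rightarrow> ('g \<Rightarrow> 'a set) \<Rightarrow>
   ('h, 'e) monoid_scheme \<Rightarrow> (real, 'b) module \<Rightarrow> ('h \<Rightarrow> 'b set) \<Rightarrow> bool" where
  "gradings_equivalent G A \<Gamma> H B \<Gamma>' \<longleftrightarrow>
     (\<exists>\<phi>\<in>alg_iso A B. \<exists>\<alpha>. bij_betw \<alpha> (grading_support G A \<Gamma>) (grading_support H B \<Gamma>') \<and>
        (\<forall>t\<in>grading_support G A \<Gamma>. \<phi> ` \<Gamma> t = \<Gamma>' (\<alpha> t)))"

definition isomorphism_classes ::
  "('g, 'c) monoid_scheme \<Rightarrow> (real, 'd) module \<Rightarrow> ('g \<Rightarrow> 'd set) set \<Rightarrow> ('g \<Rightarrow> 'd set) set set" where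
  "isomorphism_classes G A S =
     S // {(\<Gamma>, \<Gamma>'). \<Gamma> \<in> S \<and> \<Gamma>' \<in> S \<and> gradings_isomorphic G A \<Gamma> A \<Gamma>'}"

definition monoid_algebra :: "('m, 'c) monoid_scheme \<Rightarrow> (real, 'm \<Rightarrow> real) module" where
  "monoid_algebra M =
     \<lparr>carrier = {p. finite {u. p u \<noteq> 0} \<and> {u. p u \<noteq> 0} \<subseteq> carrier M},
      mult = (\<lambda>p q w. \<Sum>u\<in>{u. p u \<noteq> 0}. \<Sum>v\<in>{v. q v \<noteq> 0}. if u \<otimes>\<^bsub>M\<^esub> v = w then p u * q v else 0),
      one = (\<lambda>w. if w = \<one>\<^bsub>M\<^esub> then 1 else 0),
      zero = (\<lambda>w. 0),
      add = (\<lambda>p q w. p w + q w),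
      smult = (\<lambda>r p w. r * p w)\<rparr>"

definition delta :: "'m \<Rightarrow> 'm \<Rightarrow> real" where
  "delta u w = (if w = u then 1 else 0)"

definition quotient_algebra :: "(real, 'd) module \<Rightarrow> 'd set \<Rightarrow> (real, 'd set) module" where
  "quotient_algebra A J =
     \<lparr>carrier = carrier (A Quot J), mult = mult (A Quot J), one = one (A Quot J),
      zero = zero (A Quot J), add = add (A Quot J),
      smult = (\<lambda>r X. \<Union>x\<in>X. J +>\<^bsub>A\<^esub> (r \<odot>\<^bsub>A\<^esub> x))\<rparr>"

text \<open>The tensor product of a family \<open>A i\<close>, \<open>i \<in> I\<close>, and one further algebra \<open>B\<close>, all over the
  reals: the free vector space on the tuples \<open>(x, y)\<close> with \<open>x i \<in> A i\<close> and \<open>y \<in> B\<close>, modulo the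
  relations of multilinearity.  Since tuples are multiplied componentwise, this free vector space
  is a monoid algebra, and the span of the relations is an ideal of it.  The last factor is kept
  apart because its elements may have another type.\<close>

definition tuple_monoid ::
  "'i set \<Rightarrow> ('i \<Rightarrow> (real, 'a) module) \<Rightarrow> (real, 'b) module \<Rightarrow> (('i \<Rightarrow> 'a) \<times> 'b) monoid" where
  "tuple_monoid I A B = product_group I A \<times>\<times> B"

definition multilinear_relations ::
  "'i set \<Rightarrow> ('i \<Rightarrow> (real, 'a) module) \<Rightarrow> (real, 'b) module \<Rightarrow> (('i \<Rightarrow> 'a) \<times> 'b \<Rightarrow> real) set" where
  "multilinear_relations I A B =
     {(\<lambda>w. delta (x(i := a \<oplus>\<^bsub>A i\<^esub> a'), y) w - delta (x(i := a), y) w - delta (x(i := a'), y) w) |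
        x i a a' y. x \<in> (\<Pi>\<^sub>E i\<in>I. carrier (A i)) \<and> i \<in> I \<and> a \<in> carrier (A i) \<and>
          a' \<in> carrier (A i) \<and> y \<in> carrier B} \<union>
     {(\<lambda>w. delta (x(i := r \<odot>\<^bsub>A i\<^esub> a), y) w - r * delta (x(i := a), y) w) |
        x i a r y. x \<in> (\<Pi>\<^sub>E i\<in>I. carrier (A i)) \<and> i \<in> I \<and> a \<in> carrier (A i) \<and> y \<in> carrier B} \<union>
     {(\<lambda>w. delta (x, y \<oplus>\<^bsub>B\<^esub> y') w - delta (x, y) w - delta (x, y') w) |
        x y y'. x \<in> (\<Pi>\<^sub>E i\<in>I. carrier (A i)) \<and> y \<in> carrier B \<and> y' \<in> carrier B} \<union>
     {(\<lambda>w. delta (x, r \<odot>\<^bsub>B\<^esub> y) w - r * delta (x, y) w) |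
        x r y. x \<in> (\<Pi>\<^sub>E i\<in>I. carrier (A i)) \<and> y \<in> carrier B}"

definition tensor_ideal ::
  "'i set \<Rightarrow> ('i \<Rightarrow> (real, 'a) module) \<Rightarrow> (real, 'b) module \<Rightarrow> (('i \<Rightarrow> 'a) \<times> 'b \<Rightarrow> real) set" where
  "tensor_ideal I A B =
     genideal (monoid_algebra (tuple_monoid I A B)) (multilinear_relations I A B)"

definition tensor_algebra ::
  "'i set \<Rightarrow> ('i \<Rightarrow> (real, 'a) module) \<Rightarrow> (real, 'b) module \<Rightarrow>
   (real, (('i \<Rightarrow> 'a) \<times> 'b \<Rightarrow> real) set) module" where
  "tensor_algebra I A B =
     quotient_algebra (monoid_algebra (tuple_monoid I A B)) (tensor_ideal I A B)"

definition pure_tensor ::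
  "'i set \<Rightarrow> ('i \<Rightarrow> (real, 'a) module) \<Rightarrow> (real, 'b) module \<Rightarrow>
   ('i \<Rightarrow> 'a) \<times> 'b \<Rightarrow> (('i \<Rightarrow> 'a) \<times> 'b \<Rightarrow> real) set" where
  "pure_tensor I A B u =
     tensor_ideal I A B +>\<^bsub>monoid_algebra (tuple_monoid I A B)\<^esub> delta u"

definition product_grading ::
  "'i set \<Rightarrow> ('i \<Rightarrow> (real, 'a) module) \<Rightarrow> (real, 'b) module \<Rightarrow>
   ('i \<Rightarrow> 'g \<Rightarrow> 'a set) \<Rightarrow> ('h \<Rightarrow> 'b set) \<Rightarrow>
   ('i \<Rightarrow> 'g) \<times> 'h \<Rightarrow> (('i \<Rightarrow> 'a) \<times> 'b \<Rightarrow> real) set set" where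
  "product_grading I A B \<Gamma> \<Gamma>' = (\<lambda>(g, h).
     real_span (tensor_algebra I A B)
       {pure_tensor I A B (x, y) | x y. x \<in> (\<Pi>\<^sub>E i\<in>I. \<Gamma> i (g i)) \<and> y \<in> \<Gamma>' h})"

definition Z2_pow :: "nat \<Rightarrow> (nat \<Rightarrow> int) monoid" where
  "Z2_pow k = product_group {..<k} (\<lambda>_. integer_mod_group 2)"

definition Z2_pow_Z4 :: "nat \<Rightarrow> ((nat \<Rightarrow> int) \<times> int) monoid" where
  "Z2_pow_Z4 k = Z2_pow k \<times>\<times> integer_mod_group 4"

definition multiplicative_in_each ::
  "('g, 'c) monoid_scheme \<Rightarrow> ('g \<times> 'g \<Rightarrow> real) \<Rightarrow> bool" where
  "multiplicative_in_each T \<beta> \<longleftrightarrow>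
     (\<forall>u\<in>carrier T. \<forall>v\<in>carrier T. \<forall>w\<in>carrier T.
        \<beta> (u \<otimes>\<^bsub>T\<^esub> v, w) = \<beta> (u, w) * \<beta> (v, w) \<and> \<beta> (w, u \<otimes>\<^bsub>T\<^esub> v) = \<beta> (w, u) * \<beta> (w, v))"

text \<open>Bicharacters and quadratic forms are extensional functions on their domain, so that equality
  of HOL functions is equality of bicharacters and of quadratic forms.\<close>

definition alternating_bicharacter ::
  "('g, 'c) monoid_scheme \<Rightarrow> ('g \<times> 'g \<Rightarrow> real) \<Rightarrow> bool" where
  "alternating_bicharacter T \<beta> \<longleftrightarrow>
     \<beta> \<in> (carrier T \<times> carrier T) \<rightarrow>\<^sub>E (UNIV - {0}) \<and> multiplicative_in_each T \<beta> \<and>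
     (\<forall>t\<in>carrier T. \<beta> (t, t) = 1)"

definition bichar_radical ::
  "('g, 'c) monoid_scheme \<Rightarrow> ('g \<times> 'g \<Rightarrow> real) \<Rightarrow> 'g set" where
  "bichar_radical T \<beta> = {t \<in> carrier T. \<forall>u\<in>carrier T. \<beta> (u, t) = 1}"

definition bichar_type_II :: "('g, 'c) monoid_scheme \<Rightarrow> ('g \<times> 'g \<Rightarrow> real) \<Rightarrow> bool" where
  "bichar_type_II T \<beta> \<longleftrightarrow> card (bichar_radical T \<beta>) = 2"

definition assoc_bichar :: "('g, 'c) monoid_scheme \<Rightarrow> ('g \<Rightarrow> real) \<Rightarrow> 'g \<times> 'g \<Rightarrow> real" where
  "assoc_bichar T \<mu> =
     (\<lambda>(u, v)\<in>carrier T \<times> carrier T. \<mu> (u \<otimes>\<^bsub>T\<^esub> v) * inverse (\<mu> u) * inverse (\<mu> v))"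

definition quadratic_form :: "('g, 'c) monoid_scheme \<Rightarrow> ('g \<Rightarrow> real) \<Rightarrow> bool" where
  "quadratic_form T \<mu> \<longleftrightarrow>
     \<mu> \<in> carrier T \<rightarrow>\<^sub>E {1, -1} \<and> \<mu> \<one>\<^bsub>T\<^esub> = 1 \<and> multiplicative_in_each T (assoc_bichar T \<mu>)"

definition quad_type_II :: "('g, 'c) monoid_scheme \<Rightarrow> ('g \<Rightarrow> real) \<Rightarrow> bool" where
  "quad_type_II T \<mu> \<longleftrightarrow>
     (\<exists>f\<in>carrier T. f \<noteq> \<one>\<^bsub>T\<^esub> \<and> bichar_radical T (assoc_bichar T \<mu>) = {\<one>\<^bsub>T\<^esub>, f} \<and> \<mu> f = -1)"

definition two_torsion :: "('g, 'c) monoid_scheme \<Rightarrow> 'g set \<Rightarrow> 'g set" where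
  "two_torsion G T = {t \<in> T. t \<otimes>\<^bsub>G\<^esub> t = \<one>\<^bsub>G\<^esub>}"

definition squares :: "('g, 'c) monoid_scheme \<Rightarrow> 'g set \<Rightarrow> 'g set" where
  "squares G T = {t \<otimes>\<^bsub>G\<^esub> t | t. t \<in> T}"

definition quadratic_pairs :: "('g, 'c) monoid_scheme \<Rightarrow> nat \<Rightarrow> ('g set \<times> ('g \<Rightarrow> real)) set" where
  "quadratic_pairs G m =
     {(T, \<mu>). subgroup T G \<and> G\<lparr>carrier := T\<rparr> \<cong> Z2_pow (2 * m + 1) \<and>
        quadratic_form (G\<lparr>carrier := T\<rparr>) \<mu> \<and> quad_type_II (G\<lparr>carrier := T\<rparr>) \<mu>}"

text \<open>The exponent \<open>2 * m - 1\<close> is a subtraction of natural numbers: \<open>m \<ge> 1\<close> is intended here and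
  for the second family of representatives below.\<close>

definition quadratic_triples ::
  "('g, 'c) monoid_scheme \<Rightarrow> nat \<Rightarrow> ('g set \<times> ('g \<times> 'g \<Rightarrow> real) \<times> ('g \<Rightarrow> real)) set" where
  "quadratic_triples G m =
     {(T, \<beta>, \<mu>). subgroup T G \<and> G\<lparr>carrier := T\<rparr> \<cong> Z2_pow_Z4 (2 * m - 1) \<and>
        alternating_bicharacter (G\<lparr>carrier := T\<rparr>) \<beta> \<and> bichar_type_II (G\<lparr>carrier := T\<rparr>) \<beta> \<and>
        quadratic_form (G\<lparr>carrier := two_torsion G T\<rparr>) \<mu> \<and>
        restrict \<beta> (two_torsion G T \<times> two_torsion G T) =
          assoc_bichar (G\<lparr>carrier := two_torsion G T\<rparr>) \<mu> \<and>
        (\<exists>f\<in>T. generate G {f} = squares G T \<and> \<mu> f = -1)}"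

text \<open>The data read off from a grading: \<open>\<mu>\<close> records the sign of \<open>x\<^sup>2 \<in> \<real>1\<close> for nonzero homogeneous
  \<open>x\<close> of degree \<open>t\<close>, and \<open>\<beta>\<close> records the commutation factors of homogeneous elements.\<close>

definition square_signs ::
  "(real, 'd) module \<Rightarrow> ('g \<Rightarrow> 'd set) \<Rightarrow> 'g set \<Rightarrow> ('g \<Rightarrow> real) \<Rightarrow> bool" where
  "square_signs A \<Gamma> S \<mu> \<longleftrightarrow>
     (\<forall>t\<in>S. \<forall>x\<in>\<Gamma> t. x \<noteq> \<zero>\<^bsub>A\<^esub> \<longrightarrow> (\<exists>r>0. x \<otimes>\<^bsub>A\<^esub> x = (r * \<mu> t) \<odot>\<^bsub>A\<^esub> \<one>\<^bsub>A\<^esub>))"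

definition commutation_factors ::
  "(real, 'd) module \<Rightarrow> ('g \<Rightarrow> 'd set) \<Rightarrow> 'g set \<Rightarrow> ('g \<times> 'g \<Rightarrow> real) \<Rightarrow> bool" where
  "commutation_factors A \<Gamma> S \<beta> \<longleftrightarrow>
     (\<forall>u\<in>S. \<forall>v\<in>S. \<forall>x\<in>\<Gamma> u. \<forall>y\<in>\<Gamma> v. x \<otimes>\<^bsub>A\<^esub> y = \<beta> (u, v) \<odot>\<^bsub>A\<^esub> (y \<otimes>\<^bsub>A\<^esub> x))"

abbreviation Z2 :: "int monoid" where "Z2 \<equiv> integer_mod_group 2"
abbreviation Z4 :: "int monoid" where "Z4 \<equiv> integer_mod_group 4"

definition C_grading :: "int \<Rightarrow> complex set" where
  "C_grading k = real_span complex_algebra {if k = 0 then 1 else \<i>}"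

abbreviation M2R :: "(real, real mat) module" where "M2R \<equiv> matrix_algebra 2"

definition M2R_grading :: "int \<times> int \<Rightarrow> real mat set" where
  "M2R_grading g = real_span M2R {mat_of_rows_list 2
     (if g = (0, 0) then [[1, 0], [0, 1]]
      else if g = (1, 0) then [[0, 1], [1, 0]]
      else if g = (0, 1) then [[-1, 0], [0, 1]]
      else [[0, -1], [1, 0]])}"

abbreviation M2C :: "(real, complex mat) module" where "M2C \<equiv> matrix_algebra 2"

definition omega :: complex where
  "omega = exp (\<i> * of_real pi / 4)"

text \<open>The pair \<open>(j, k)\<close> stands for the group element \<open>a\<^sup>j b\<^sup>k\<close>.\<close>

definition M2C_grading :: "int \<times> int \<Rightarrow> complex mat set" where
  "M2C_grading g = real_span M2C {mat_of_rows_list 2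
     (if g = (0, 0) then [[1, 0], [0, 1]]
      else if g = (0, 1) then [[omega, 0], [0, - omega]]
      else if g = (0, 2) then [[\<i>, 0], [0, \<i>]]
      else if g = (0, 3) then [[omega ^ 3, 0], [0, - (omega ^ 3)]]
      else if g = (1, 0) then [[0, 1], [1, 0]]
      else if g = (1, 1) then [[0, - omega], [omega, 0]]
      else if g = (1, 2) then [[0, \<i>], [\<i>, 0]]
      else [[0, - (omega ^ 3)], [omega ^ 3, 0]])}"

definition rep1_group :: "nat \<Rightarrow> ((nat \<Rightarrow> int \<times> int) \<times> int) monoid" where
  "rep1_group m = product_group {..<m} (\<lambda>_. Z2 \<times>\<times> Z2) \<times>\<times> Z2"

definition rep1_algebra :: "nat \<Rightarrow> (real, ((nat \<Rightarrow> real mat) \<times> complex \<Rightarrow> real) set) module" where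
  "rep1_algebra m = tensor_algebra {..<m} (\<lambda>_. M2R) complex_algebra"

definition rep1_grading ::
  "nat \<Rightarrow> (nat \<Rightarrow> int \<times> int) \<times> int \<Rightarrow> ((nat \<Rightarrow> real mat) \<times> complex \<Rightarrow> real) set set" where
  "rep1_grading m =
     product_grading {..<m} (\<lambda>_. M2R) complex_algebra (\<lambda>_. M2R_grading) C_grading"

definition rep2_group :: "nat \<Rightarrow> ((nat \<Rightarrow> int \<times> int) \<times> (int \<times> int)) monoid" where
  "rep2_group m = product_group {..<m - 1} (\<lambda>_. Z2 \<times>\<times> Z2) \<times>\<times> (Z2 \<times>\<times> Z4)"

definition rep2_algebra :: "nat \<Rightarrow> (real, ((nat \<Rightarrow> real mat) \<times> complex mat \<Rightarrow> real) set) module" where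
  "rep2_algebra m = tensor_algebra {..<m - 1} (\<lambda>_. M2R) M2C"

definition rep2_grading ::
  "nat \<Rightarrow> (nat \<Rightarrow> int \<times> int) \<times> (int \<times> int) \<Rightarrow>
   ((nat \<Rightarrow> real mat) \<times> complex mat \<Rightarrow> real) set set" where
  "rep2_grading m =
     product_grading {..<m - 1} (\<lambda>_. M2R) M2C (\<lambda>_. M2R_grading) M2C_grading"

end

theory Submission
  imports Defs
begin

text \<open>
  Choose \<open>X t \<noteq> 0\<close> in every nonzero component, with \<open>X 1 = 1\<close>.  Then
  \<open>X s X t = \<sigma> s t X (s t)\<close>, so the algebra is a twisted group algebra of the support \<open>T\<close>,
  and \<open>\<beta> s t = \<sigma> s t / \<sigma> t s\<close> is a bicharacter with values \<open>\<plusminus>1\<close>.  The centre is a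
  copy of the complex numbers spanned by the \<open>X t\<close> with \<open>t\<close> in the radical of \<open>\<beta>\<close>; hence the radical is \<open>{1, f}\<close> with
  \<open>(X f)\<^sup>2 < 0\<close>, and squares of elements of \<open>T\<close> lie in it because \<open>\<beta>\<close> is \<open>\<plusminus>1\<close>-valued.
  This determines \<open>T\<close>: it is elementary abelian or has one cyclic factor of order 4.

  Two such cocycles with the same \<open>\<beta>\<close> and the same signs \<open>\<mu>\<close> of the squares \<open>(X t)\<^sup>2\<close>, \<open>t\<^sup>2 = 1\<close>,
  differ by a symmetric cocycle \<open>\<tau>\<close> with \<open>\<tau> t t > 0\<close> whenever \<open>t\<^sup>2 = 1\<close>, and such a cocycle is a
  coboundary over the reals; so \<open>(T, \<beta>, \<mu>)\<close> determines the grading up to isomorphism.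
  Conversely, any two admissible pairs \<open>(\<beta>, \<mu>)\<close> on isomorphic groups are carried into each
  other by an isomorphism, which is built by splitting off hyperbolic planes.  Hence all gradings
  are equivalent to the product grading, and every \<open>(T, \<beta>, \<mu>)\<close> is realised by transport
  from it.
\<close>

section \<open>Bases of real algebras\<close>

text \<open>Two features of \<open>f\<close> shape the argument. In the data, multiplication by
  \<open>f\<close> flips the sign \<open>\<mu>\<close> of an involution and leaves
  \<open>\<beta>\<close> unchanged. All hyperbolic pairs can therefore be normalised to sign 1 and
  no Arf invariant survives, which is why each of the two cases forms a single equivalence class. In
  the algebra, a homogeneous element of order four has its square on the line of \<open>X f\<close>,
  and the sign of \<open>X f\<close> is a free choice. Hence signs make sense on the 2-torsion only,
  and this same freedom makes the one delicate radicand in the coboundary argument positive. The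
  other obstacle is the tensor product. As a quotient of a monoid algebra it gives no direct
  evidence that anything in it is nonzero. The evidence is a map on tuples that is multilinear and
  multiplicative at once, an iterated Kronecker product with values in complex matrices: every
  linear relation between pure tensors survives in its images, and there the images of the basis
  tensors form a basis.\<close>

locale ualg = ring A for A :: "(real, 'd) module" (structure) +
  assumes vs: "vectorspace (class_ring :: real ring) A"
    and smult_mult: "\<And>r x y. x \<in> carrier A \<Longrightarrow> y \<in> carrier A \<Longrightarrow>
      (r \<odot> x) \<otimes> y = r \<odot> (x \<otimes> y) \<and> x \<otimes> (r \<odot> y) = r \<odot> (x \<otimes> y)"
begin

sublocale V: vectorspace "class_ring :: real ring" A by (rule vs)

lemma sm_closed [simp, intro]: "x \<in> carrier A \<Longrightarrow> r \<odot> x \<in> carrier A"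
  using V.smult_closed[of r x] by simp

lemma sm_add_l: "x \<in> carrier A \<Longrightarrow> (r + s) \<odot> x = r \<odot> x \<oplus> s \<odot> x"
  using V.smult_l_distr[of r s x] by simp

lemma sm_add_r: "x \<in> carrier A \<Longrightarrow> y \<in> carrier A \<Longrightarrow> r \<odot> (x \<oplus> y) = r \<odot> x \<oplus> r \<odot> y"
  using V.smult_r_distr[of r x y] by simp

lemma sm_assoc [simp]: "x \<in> carrier A \<Longrightarrow> r \<odot> (s \<odot> x) = (r * s) \<odot> x"
  using V.smult_assoc1[of r s x] by simp

lemma sm_one [simp]: "x \<in> carrier A \<Longrightarrow> 1 \<odot> x = x"
  using V.smult_one[of x] by simp

lemma sm_0 [simp]: "x \<in> carrier A \<Longrightarrow> 0 \<odot> x = \<zero>"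
  using V.smult_l_null[of x] by simp

lemma sm_zero [simp]: "r \<odot> \<zero> = \<zero>"
  using V.smult_r_null[of r] by simp

lemma sm_minus: "x \<in> carrier A \<Longrightarrow> (- r) \<odot> x = \<ominus> (r \<odot> x)"
  using sm_add_l[of x "-r" r] by (simp add: minus_equality)

lemma sm_mult_l [simp]: "x \<in> carrier A \<Longrightarrow> y \<in> carrier A \<Longrightarrow> (r \<odot> x) \<otimes> y = r \<odot> (x \<otimes> y)"
  and sm_mult_r [simp]: "x \<in> carrier A \<Longrightarrow> y \<in> carrier A \<Longrightarrow> x \<otimes> (r \<odot> y) = r \<odot> (x \<otimes> y)"
  using smult_mult by auto

lemma sm_eq_0: "x \<in> carrier A \<Longrightarrow> r \<odot> x = \<zero> \<Longrightarrow> r = 0 \<or> x = \<zero>"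
  using sm_assoc[of x "inverse r" r] by (cases "r = 0") auto

lemma sm_cancel: "x \<in> carrier A \<Longrightarrow> x \<noteq> \<zero> \<Longrightarrow> r \<odot> x = s \<odot> x \<Longrightarrow> r = s"
proof -
  assume a: "x \<in> carrier A" "x \<noteq> \<zero>" "r \<odot> x = s \<odot> x"
  have "(r - s) \<odot> x = r \<odot> x \<oplus> (- s) \<odot> x" using sm_add_l[of x r "-s"] a by simp
  also have "\<dots> = \<zero>" using a by (simp add: sm_minus r_neg)
  finally show "r = s" using sm_eq_0[of x "r - s"] a by auto
qed

lemma subspaceI:
  assumes "W \<subseteq> carrier A" "\<zero> \<in> W" "\<And>x y. x \<in> W \<Longrightarrow> y \<in> W \<Longrightarrow> x \<oplus> y \<in> W"
    "\<And>r x. x \<in> W \<Longrightarrow> r \<odot> x \<in> W"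
  shows "subspace (class_ring :: real ring) W A"
  unfolding VectorSpace.subspace_def submodule_def
  using assms V.module_axioms vs by auto

lemma subspaceD:
  assumes "subspace (class_ring :: real ring) W A"
  shows "W \<subseteq> carrier A" "\<zero> \<in> W" "\<And>x y. x \<in> W \<Longrightarrow> y \<in> W \<Longrightarrow> x \<oplus> y \<in> W"
    "\<And>r x. x \<in> W \<Longrightarrow> r \<odot> x \<in> W"
  using assms unfolding VectorSpace.subspace_def submodule_def by auto

lemma span_least:
  assumes "S \<subseteq> W" "subspace (class_ring :: real ring) W A"
  shows "real_span A S \<subseteq> W"
  using assms V.span_is_subset[of S W] V.is_module by blast

lemma span_subspace:
  assumes "S \<subseteq> carrier A"
  shows "subspace (class_ring :: real ring) (real_span A S) A"
  using V.span_is_subspace[OF assms] .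

lemma span_single:
  assumes "x \<in> carrier A"
  shows "real_span A {x} = {r \<odot> x | r. True}"
proof
  show "real_span A {x} \<subseteq> {r \<odot> x | r. True}"
  proof (rule span_least)
    show "{x} \<subseteq> {r \<odot> x | r. True}" using assms by (auto intro!: exI[of _ 1])
    show "subspace class_ring {r \<odot> x | r. True} A"
    proof (rule subspaceI)
      show "{r \<odot> x | r. True} \<subseteq> carrier A" using assms by auto
      show "\<zero> \<in> {r \<odot> x | r. True}" using assms by (auto intro!: exI[of _ 0])
      show "u \<oplus> v \<in> {r \<odot> x | r. True}" if "u \<in> {r \<odot> x | r. True}" "v \<in> {r \<odot> x | r. True}" for u v
        using that assms by (auto simp: sm_add_l[symmetric])
      show "r \<odot> u \<in> {r \<odot> x | r. True}" if "u \<in> {r \<odot> x | r. True}" for r u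
        using that assms by auto
    qed
  qed
  have "x \<in> real_span A {x}" using V.in_own_span[of "{x}"] assms by auto
  then show "{r \<odot> x | r. True} \<subseteq> real_span A {x}"
    using subspaceD(4)[OF span_subspace[of "{x}"]] assms by auto
qed

text \<open>Combinations run over an indexed family and not over a set of vectors as in
  \<open>V.lincomb\<close>: the index will be a degree, and coordinates can be compared before the
  family is known to be injective.\<close>

definition lc :: "'i set \<Rightarrow> ('i \<Rightarrow> 'd) \<Rightarrow> ('i \<Rightarrow> real) \<Rightarrow> 'd" where
  "lc I X c = finsum A (\<lambda>i. c i \<odot> X i) I"

lemma lc_closed [simp, intro]: "X \<in> I \<rightarrow> carrier A \<Longrightarrow> lc I X c \<in> carrier A"
  unfolding lc_def by (rule finsum_closed) auto

lemma lc_add: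
  assumes "X \<in> I \<rightarrow> carrier A"
  shows "lc I X (\<lambda>i. c i + d i) = lc I X c \<oplus> lc I X d"
proof (cases "finite I")
  case True
  have "lc I X (\<lambda>i. c i + d i) = finsum A (\<lambda>i. c i \<odot> X i \<oplus> d i \<odot> X i) I"
    unfolding lc_def using assms by (intro finsum_cong') (auto simp: sm_add_l Pi_iff)
  also have "\<dots> = lc I X c \<oplus> lc I X d"
    unfolding lc_def using assms by (intro finsum_addf) auto
  finally show ?thesis .
qed (simp add: lc_def finsum_infinite)

lemma sm_finsum:
  "f \<in> I \<rightarrow> carrier A \<Longrightarrow> r \<odot> finsum A f I = finsum A (\<lambda>i. r \<odot> f i) I"
proof (induction I rule: infinite_finite_induct)
  case (insert i I)
  then show ?case by (subst (1 2) finsum_insert) (auto simp: sm_add_r Pi_def)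
qed (simp_all add: finsum_infinite)

lemma lc_smult:
  assumes "X \<in> I \<rightarrow> carrier A"
  shows "lc I X (\<lambda>i. r * c i) = r \<odot> lc I X c"
proof -
  have "lc I X (\<lambda>i. r * c i) = finsum A (\<lambda>i. r \<odot> (c i \<odot> X i)) I"
    unfolding lc_def using assms by (intro finsum_cong') (auto simp: Pi_iff)
  then show ?thesis unfolding lc_def using assms by (subst sm_finsum) auto
qed

lemma lc_minus:
  assumes "X \<in> I \<rightarrow> carrier A"
  shows "lc I X (\<lambda>i. c i - d i) = lc I X c \<ominus> lc I X d"
proof -
  have "lc I X (\<lambda>i. c i - d i) = lc I X c \<oplus> lc I X (\<lambda>i. (-1) * d i)"
    by (subst lc_add[OF assms, symmetric]) simp
  also have "lc I X (\<lambda>i. (-1) * d i) = \<ominus> lc I X d"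
    using lc_smult[OF assms, of "-1" d] assms by (simp add: sm_minus)
  finally show ?thesis by (simp add: a_minus_def)
qed

lemma lc_cong: "X \<in> I \<rightarrow> carrier A \<Longrightarrow> (\<And>i. i \<in> I \<Longrightarrow> c i = d i) \<Longrightarrow> lc I X c = lc I X d"
  unfolding lc_def by (intro finsum_cong') auto

lemma lc_zero: "lc I X (\<lambda>_. 0) = \<zero>" if "X \<in> I \<rightarrow> carrier A"
  unfolding lc_def by (rule add.finprod_one_eqI) (use that in \<open>auto simp: Pi_iff\<close>)

lemma lc_single:
  assumes "finite I" "i \<in> I" "X \<in> I \<rightarrow> carrier A"
  shows "lc I X (\<lambda>j. if j = i then r else 0) = r \<odot> X i"
proof -
  have "lc I X (\<lambda>j. if j = i then r else 0) = finsum A (\<lambda>j. if i = j then r \<odot> X j else \<zero>) I"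
    unfolding lc_def using assms by (intro finsum_cong') (auto simp: Pi_iff)
  also have "\<dots> = r \<odot> X i" using assms by (intro finsum_singleton) (auto simp: Pi_iff)
  finally show ?thesis .
qed

definition indep :: "'i set \<Rightarrow> ('i \<Rightarrow> 'd) \<Rightarrow> bool" where
  "indep I X \<longleftrightarrow> (\<forall>c. lc I X c = \<zero> \<longrightarrow> (\<forall>i\<in>I. c i = 0))"

definition fbasis :: "'i set \<Rightarrow> ('i \<Rightarrow> 'd) \<Rightarrow> bool" where
  "fbasis I X \<longleftrightarrow> finite I \<and> X \<in> I \<rightarrow> carrier A \<and>
     (\<forall>a\<in>carrier A. \<exists>c. a = lc I X c) \<and> indep I X"

lemma indep_eq:
  assumes "X \<in> I \<rightarrow> carrier A" "indep I X" "lc I X c = lc I X d" "i \<in> I"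
  shows "c i = d i"
proof -
  have "lc I X (\<lambda>i. c i - d i) = \<zero>"
    using lc_minus[OF assms(1), of c d] assms by (simp add: a_minus_def r_neg)
  then show ?thesis using assms unfolding indep_def by fastforce
qed

lemma indep_nonzero:
  assumes "finite I" "X \<in> I \<rightarrow> carrier A" "indep I X" "i \<in> I"
  shows "X i \<noteq> \<zero>"
  using lc_single[OF assms(1,4,2), of 1] assms(3,4) unfolding indep_def by fastforce

lemma indep_inj:
  assumes "finite I" "X \<in> I \<rightarrow> carrier A" "indep I X"
  shows "inj_on X I"
proof (rule inj_onI, rule ccontr)
  fix i j assume ij: "i \<in> I" "j \<in> I" "X i = X j" "i \<noteq> j"
  have "lc I X (\<lambda>k. if k = i then 1 else 0) = lc I X (\<lambda>k. if k = j then 1 else 0)"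
    using ij assms by (simp add: lc_single)
  from indep_eq[OF assms(2,3) this ij(1)] ij(4) show False by simp
qed

lemma lincomb_image:
  assumes "inj_on X I" "X \<in> I \<rightarrow> carrier A"
  shows "V.lincomb c (X ` I) = lc I X (c \<circ> X)"
  unfolding V.lincomb_def lc_def comp_def using assms
  by (subst finsum_reindex) (auto simp: Pi_def)

lemma lin_indpt_image:
  assumes "finite I" "X \<in> I \<rightarrow> carrier A" "indep I X"
  shows "V.lin_indpt (X ` I)"
proof (rule V.finite_lin_indpt2)
  fix c assume "V.lincomb c (X ` I) = \<zero>"
  then have "lc I X (c \<circ> X) = \<zero>" using lincomb_image[OF indep_inj[OF assms] assms(2)] by metis
  then show "\<forall>v\<in>X ` I. c v = \<zero>\<^bsub>class_ring\<^esub>" using assms(3) unfolding indep_def by auto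
qed (use assms in auto)

text \<open>The bridge to bases as sets of vectors. It makes dimension available, hence the
  comparison of the cardinalities of two index sets, and it expresses the carrier as a span.\<close>

lemma fbasis_basis:
  assumes "fbasis I X"
  shows "V.basis (X ` I)"
  unfolding V.basis_def
proof (intro conjI)
  have f: "finite I" "X \<in> I \<rightarrow> carrier A" "indep I X" using assms by (auto simp: fbasis_def)
  show "V.lin_indpt (X ` I)" by (rule lin_indpt_image[OF f])
  show "X ` I \<subseteq> carrier A" using f by auto
  show "real_span A (X ` I) = carrier A"
  proof
    show "real_span A (X ` I) \<subseteq> carrier A" by (rule V.span_is_subset2) (use f in auto)
    show "carrier A \<subseteq> real_span A (X ` I)"
    proof
      fix a assume "a \<in> carrier A"
      then obtain c where c: "a = lc I X c" using assms by (auto simp: fbasis_def)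
      have i: "inj_on X I" by (rule indep_inj[OF f])
      have "lc I X c = V.lincomb (c \<circ> the_inv_into I X) (X ` I)"
        unfolding lincomb_image[OF i f(2)]
        by (rule lc_cong) (use f i in \<open>auto simp: the_inv_into_f_f\<close>)
      then show "a \<in> real_span A (X ` I)" unfolding c V.span_def using f by auto
    qed
  qed
qed

lemma fbasis_card_image: "fbasis I X \<Longrightarrow> card (X ` I) = card I"
  by (rule card_image) (auto simp: fbasis_def intro: indep_inj)

lemma fbasis_dim: "fbasis I X \<Longrightarrow> V.fin_dim \<and> V.dim = card I"
  using V.dim_basis[of "X ` I"] fbasis_basis[of I X] fbasis_card_image[of I X]
  unfolding V.fin_dim_def V.basis_def fbasis_def by auto

lemma fbasis_card_eq: "fbasis I X \<Longrightarrow> fbasis J Y \<Longrightarrow> card I = card J"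
  using fbasis_dim by metis

lemma fbasis_indep_card:
  assumes "fbasis J Y" "finite I" "X \<in> I \<rightarrow> carrier A" "indep I X"
  shows "card I \<le> card J"
  using V.li_le_dim(2)[of "X ` I"] fbasis_dim[OF assms(1)] lin_indpt_image[OF assms(2-4)]
    card_image[OF indep_inj[OF assms(2-4)]] assms(3) by auto

lemma fbasis_induct [consumes 2, case_names zero add smult basis]:
  assumes "fbasis I X" "a \<in> carrier A" "P \<zero>"
    "\<And>x y. x \<in> carrier A \<Longrightarrow> y \<in> carrier A \<Longrightarrow> P x \<Longrightarrow> P y \<Longrightarrow> P (x \<oplus> y)"
    "\<And>r x. x \<in> carrier A \<Longrightarrow> P x \<Longrightarrow> P (r \<odot> x)"
    "\<And>i. i \<in> I \<Longrightarrow> P (X i)"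
  shows "P a"
proof -
  have f: "finite I" "X \<in> I \<rightarrow> carrier A" using assms by (auto simp: fbasis_def)
  obtain c where c: "a = finsum A (\<lambda>i. c i \<odot> X i) I" using assms by (auto simp: fbasis_def lc_def)
  have "finite J \<Longrightarrow> J \<subseteq> I \<Longrightarrow> P (finsum A (\<lambda>i. c i \<odot> X i) J)" for J
  proof (induction J rule: finite_induct)
    case (insert i J)
    have "X i \<in> carrier A" "(\<lambda>i. c i \<odot> X i) \<in> J \<rightarrow> carrier A" using insert f by auto
    then show ?case using insert by (subst finsum_insert) (auto intro!: assms(4,5,6))
  qed (simp add: assms)
  with f c show ?thesis by auto
qed

lemma lc_reindex:
  assumes "bij_betw h J I" "X \<in> I \<rightarrow> carrier A"
  shows "lc I X c = lc J (X \<circ> h) (c \<circ> h)"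
proof -
  have h: "inj_on h J" "h ` J = I" using assms(1) by (auto simp: bij_betw_def)
  have "finsum A (\<lambda>i. c i \<odot> X i) (h ` J) = finsum A (\<lambda>j. c (h j) \<odot> X (h j)) J"
    by (rule finsum_reindex) (use assms(2) h in \<open>auto simp: Pi_iff\<close>)
  then show ?thesis unfolding lc_def comp_def h(2) .
qed

lemma fbasis_reindex:
  assumes "bij_betw h J I" "fbasis I X"
  shows "fbasis J (X \<circ> h)"
proof -
  have f: "finite I" "X \<in> I \<rightarrow> carrier A" "indep I X" using assms by (auto simp: fbasis_def)
  have inv: "h (the_inv_into J h i) = i" if "i \<in> I" for i
    using assms(1) that by (meson bij_betw_def f_the_inv_into_f_bij_betw)
  show ?thesis unfolding fbasis_def
  proof (intro conjI)
    show "finite J" using assms f bij_betw_finite by blast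
    show "X \<circ> h \<in> J \<rightarrow> carrier A" using f assms by (auto simp: bij_betw_def)
    show "\<forall>a\<in>carrier A. \<exists>c. a = lc J (X \<circ> h) c"
      using assms(2) lc_reindex[OF assms(1) f(2)] unfolding fbasis_def by metis
    show "indep J (X \<circ> h)" unfolding indep_def
    proof (intro allI impI ballI)
      fix c j assume c: "lc J (X \<circ> h) c = \<zero>" and j: "j \<in> J"
      let ?d = "c \<circ> the_inv_into J h"
      have J: "X \<circ> h \<in> J \<rightarrow> carrier A" using f assms by (auto simp: bij_betw_def)
      have e: "?d (h i) = c i" if "i \<in> J" for i
        using assms(1) that by (simp add: bij_betw_def the_inv_into_f_f)
      have "lc I X ?d = lc J (X \<circ> h) (?d \<circ> h)" by (rule lc_reindex[OF assms(1) f(2)])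
      also have "\<dots> = lc J (X \<circ> h) c" by (rule lc_cong[OF J]) (use e in auto)
      finally have "\<forall>i\<in>I. ?d i = 0" using c f(3) unfolding indep_def by auto
      moreover have "h j \<in> I" using assms(1) j by (auto simp: bij_betw_def)
      ultimately show "c j = 0" using e[OF j] by auto
    qed
  qed
qed

lemma fbasis_scale:
  assumes "fbasis I X" "\<And>i. i \<in> I \<Longrightarrow> s i \<noteq> 0"
  shows "fbasis I (\<lambda>i. s i \<odot> X i)"
proof -
  have f: "finite I" "X \<in> I \<rightarrow> carrier A" "indep I X" using assms by (auto simp: fbasis_def)
  have e: "lc I (\<lambda>i. s i \<odot> X i) c = lc I X (\<lambda>i. c i * s i)" for c
    unfolding lc_def using f by (intro finsum_cong') (auto simp: Pi_iff)
  show ?thesis unfolding fbasis_def e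
  proof (intro conjI ballI)
    show "\<exists>c. a = lc I X (\<lambda>i. c i * s i)" if a: "a \<in> carrier A" for a
    proof -
      obtain c where c: "a = lc I X c" using a assms by (auto simp: fbasis_def)
      show ?thesis
        by (rule exI[of _ "\<lambda>i. c i / s i"], unfold c, rule lc_cong[OF f(2)]) (use assms(2) in auto)
    qed
    show "indep I (\<lambda>i. s i \<odot> X i)" using f(3) assms(2) unfolding indep_def e by auto
  qed (use f in auto)
qed

end

lemma unital_real_algebra_ualg: "unital_real_algebra A \<longleftrightarrow> ualg A"
  unfolding unital_real_algebra_def ualg_def ualg_axioms_def by blast

lemma unital_real_algebraI:
  fixes A (structure)
  assumes "ring A"
    and "\<And>r x. x \<in> carrier A \<Longrightarrow> r \<odot> x \<in> carrier A"
    and "\<And>r s x. x \<in> carrier A \<Longrightarrow> (r + s) \<odot> x = r \<odot> x \<oplus> s \<odot> x"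
    and "\<And>r x y. x \<in> carrier A \<Longrightarrow> y \<in> carrier A \<Longrightarrow> r \<odot> (x \<oplus> y) = r \<odot> x \<oplus> r \<odot> y"
    and "\<And>r s x. x \<in> carrier A \<Longrightarrow> (r * s) \<odot> x = r \<odot> (s \<odot> x)"
    and "\<And>x. x \<in> carrier A \<Longrightarrow> 1 \<odot> x = x"
    and "\<And>r x y. x \<in> carrier A \<Longrightarrow> y \<in> carrier A \<Longrightarrow> (r \<odot> x) \<otimes> y = r \<odot> (x \<otimes> y)"
    and "\<And>r x y. x \<in> carrier A \<Longrightarrow> y \<in> carrier A \<Longrightarrow> x \<otimes> (r \<odot> y) = r \<odot> (x \<otimes> y)"
  shows "unital_real_algebra A"
proof -
  interpret ring A by fact
  have "module (class_ring :: real ring) A"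
    by (rule moduleI) (use assms in \<open>auto simp: class_cring.cring_axioms abelian_group_axioms\<close>)
  then have "vectorspace (class_ring :: real ring) A"
    unfolding vectorspace_def using class_field.field_axioms by blast
  then show ?thesis unfolding unital_real_algebra_def using assms(1,7,8) by auto
qed

text \<open>Multiplicativity of a linear map is a bilinear condition, so pairs of basis vectors
  suffice. Products of basis vectors are single multiples \<open>r \<odot> X k\<close> with the same
  \<open>k\<close> and \<open>r\<close> on both sides, the shape that occurs in twisted group
  algebras.\<close>

lemma alg_iso_from_bases:
  fixes A :: "(real, 'a) module" (structure) and B :: "(real, 'b) module"
  assumes "ualg A" "ualg B" "ualg.fbasis A I X" "ualg.fbasis B I Y"
    and mult: "\<And>i j. i \<in> I \<Longrightarrow> j \<in> I \<Longrightarrow> \<exists>k\<in>I. \<exists>r. X i \<otimes> X j = r \<odot> X k \<and> Y i \<otimes>\<^bsub>B\<^esub> Y j = r \<odot>\<^bsub>B\<^esub> Y k"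
  shows "\<exists>\<phi>\<in>alg_iso A B. \<forall>i\<in>I. \<phi> (X i) = Y i"
proof -
  interpret A: ualg A by fact
  interpret B: ualg B by fact
  have fX: "finite I" "X \<in> I \<rightarrow> carrier A" "A.indep I X" using assms by (auto simp: A.fbasis_def)
  have fY: "Y \<in> I \<rightarrow> carrier B" "B.indep I Y" using assms by (auto simp: B.fbasis_def)
  \<comment> \<open>A choice of coordinates. By independence any two choices agree on
    \<open>I\<close>, so the map built from them sends each combination of the \<open>X i\<close> to
    the same combination of the \<open>Y i\<close>.\<close>
  define cf where "cf a = (SOME c. a = A.lc I X c)" for a
  define \<phi> where "\<phi> a = B.lc I Y (cf a)" for a
  have cf: "A.lc I X (cf a) = a" if "a \<in> carrier A" for a
    unfolding cf_def using that assms(3) unfolding A.fbasis_def by (metis (mono_tags, lifting) someI_ex)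
  have phi: "\<phi> (A.lc I X c) = B.lc I Y c" for c
    unfolding \<phi>_def
    by (rule B.lc_cong) (use fX fY A.indep_eq[OF fX(2,3)] cf[of "A.lc I X c"] in auto)
  have clo: "\<phi> a \<in> carrier B" for a unfolding \<phi>_def using fY by auto
  have phiX: "\<phi> (X i) = Y i" if "i \<in> I" for i
    using phi[of "\<lambda>j. if j = i then 1 else 0"] that fX fY
    by (simp add: A.lc_single B.lc_single Pi_iff)
  have add: "\<phi> (a \<oplus> b) = \<phi> a \<oplus>\<^bsub>B\<^esub> \<phi> b" if "a \<in> carrier A" "b \<in> carrier A" for a b
    by (subst (1) cf[OF that(1), symmetric], subst (1) cf[OF that(2), symmetric])
      (simp only: A.lc_add[OF fX(2), symmetric] phi, simp add: \<phi>_def B.lc_add[OF fY(1)])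
  have sm: "\<phi> (r \<odot> a) = r \<odot>\<^bsub>B\<^esub> \<phi> a" if "a \<in> carrier A" for a r
    by (subst (1) cf[OF that(1), symmetric])
      (simp only: A.lc_smult[OF fX(2), symmetric] phi, simp add: \<phi>_def B.lc_smult[OF fY(1)])
  have z: "\<phi> \<zero> = \<zero>\<^bsub>B\<^esub>"
    using sm[of "\<zero>" 0] clo by simp
  have mXb: "\<phi> (X i \<otimes> b) = \<phi> (X i) \<otimes>\<^bsub>B\<^esub> \<phi> b" if i: "i \<in> I" and b: "b \<in> carrier A" for i b
    using assms(3) b
  proof (induction rule: A.fbasis_induct)
    have Xi: "X i \<in> carrier A" using i fX by auto
    case zero then show ?case using clo z Xi by simp
    case (add x y) then show ?case using clo Xi by (simp add: A.r_distr B.r_distr \<open>\<And>a b. _ \<Longrightarrow> _ \<Longrightarrow> \<phi> (a \<oplus> b) = _\<close>)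
    case (smult r x) then show ?case using clo Xi by (simp add: sm)
  next
    case (basis j)
    obtain k r where k: "k \<in> I" "X i \<otimes> X j = r \<odot> X k" "Y i \<otimes>\<^bsub>B\<^esub> Y j = r \<odot>\<^bsub>B\<^esub> Y k"
      using mult[OF i basis] by blast
    have "\<phi> (X i \<otimes> X j) = r \<odot>\<^bsub>B\<^esub> Y k" using k(1,2) sm[of "X k" r] fX phiX by auto
    then show ?case using k i basis phiX by simp
  qed
  have mul: "\<phi> (a \<otimes> b) = \<phi> a \<otimes>\<^bsub>B\<^esub> \<phi> b" if a: "a \<in> carrier A" and b: "b \<in> carrier A" for a b
    using assms(3) a
  proof (induction rule: A.fbasis_induct)
    case zero then show ?case using clo z b by simp
    case (add x y) then show ?case using clo b by (simp add: A.l_distr B.l_distr \<open>\<And>a b. _ \<Longrightarrow> _ \<Longrightarrow> \<phi> (a \<oplus> b) = _\<close>)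
    case (smult r x) then show ?case using clo b by (simp add: sm)
  next
    case (basis j) then show ?case using mXb b by simp
  qed
  have bij: "bij_betw \<phi> (carrier A) (carrier B)"
  proof (rule bij_betwI')
    fix a b assume ab: "a \<in> carrier A" "b \<in> carrier A"
    show "(\<phi> a = \<phi> b) = (a = b)"
    proof
      assume "\<phi> a = \<phi> b"
      then have "B.lc I Y (cf a) = B.lc I Y (cf b)" by (simp add: \<phi>_def)
      then have "\<forall>i\<in>I. cf a i = cf b i" using B.indep_eq[OF fY] by blast
      then have "A.lc I X (cf a) = A.lc I X (cf b)" using A.lc_cong[OF fX(2)] by blast
      then show "a = b" using cf ab by simp
    qed simp
  next
    fix b assume "b \<in> carrier B"
    then obtain c where "b = B.lc I Y c" using assms(4) by (auto simp: B.fbasis_def)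
    then show "\<exists>a\<in>carrier A. b = \<phi> a" using phi fX by (intro bexI[of _ "A.lc I X c"]) auto
  qed (use clo in auto)
  \<comment> \<open>The unit need not be a basis vector, so it is reached through surjectivity: if
    \<open>u\<close> is mapped to the unit of \<open>B\<close>, then the image of 1 equals the image
    of \<open>u\<close> times the image of 1, that is, the image of \<open>u\<close>.\<close>
  have one: "\<phi> \<one> = \<one>\<^bsub>B\<^esub>"
  proof -
    obtain u where u: "u \<in> carrier A" "\<phi> u = \<one>\<^bsub>B\<^esub>"
      using bij unfolding bij_betw_def by (metis B.one_closed imageE)
    have "\<phi> \<one> = \<phi> u \<otimes>\<^bsub>B\<^esub> \<phi> \<one>" using u clo by simp
    also have "\<dots> = \<phi> (u \<otimes> \<one>)" by (rule mul[symmetric]) (use u in auto)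
    finally show ?thesis using u clo by simp
  qed
  have "\<phi> \<in> alg_iso A B"
    unfolding alg_iso_def ring_iso_def Ring.ring_hom_def using clo mul add one sm bij by auto
  with phiX show ?thesis by blast
qed

section \<open>Commutation factors and signs of squares on a finite abelian group\<close>

text \<open>\<open>\<beta>\<close> stands for the commutation factors and \<open>\<mu>\<close> for the signs of the squares of homogeneous
  elements.  Values of \<open>\<mu>\<close> outside the 2-torsion are irrelevant.\<close>

locale qdata = comm_group T for T :: "('g, 'c) monoid_scheme" (structure) +
  fixes \<beta> :: "'g \<Rightarrow> 'g \<Rightarrow> real" and \<mu> :: "'g \<Rightarrow> real" and f :: 'g
  assumes fin: "finite (carrier T)"
    and beta_val: "\<And>u v. u \<in> carrier T \<Longrightarrow> v \<in> carrier T \<Longrightarrow> \<beta> u v = 1 \<or> \<beta> u v = -1"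
    and beta_mult: "\<And>u v w. u \<in> carrier T \<Longrightarrow> v \<in> carrier T \<Longrightarrow> w \<in> carrier T \<Longrightarrow>
      \<beta> (u \<otimes> v) w = \<beta> u w * \<beta> v w"
    and beta_sym: "\<And>u v. u \<in> carrier T \<Longrightarrow> v \<in> carrier T \<Longrightarrow> \<beta> u v = \<beta> v u"
    and beta_alt: "\<And>u. u \<in> carrier T \<Longrightarrow> \<beta> u u = 1"
    and f_closed [simp]: "f \<in> carrier T" and f_ne: "f \<noteq> \<one>"
    and radical: "\<And>t. t \<in> carrier T \<Longrightarrow> (\<forall>u\<in>carrier T. \<beta> u t = 1) \<longleftrightarrow> t = \<one> \<or> t = f"
    and square: "\<And>t. t \<in> carrier T \<Longrightarrow> t \<otimes> t = \<one> \<or> t \<otimes> t = f"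
    and mu_val: "\<And>t. t \<in> carrier T \<Longrightarrow> t \<otimes> t = \<one> \<Longrightarrow> \<mu> t = 1 \<or> \<mu> t = -1"
    and mu_mult: "\<And>s t. s \<in> carrier T \<Longrightarrow> t \<in> carrier T \<Longrightarrow> s \<otimes> s = \<one> \<Longrightarrow> t \<otimes> t = \<one> \<Longrightarrow>
      \<mu> (s \<otimes> t) = \<mu> s * \<mu> t * \<beta> s t"
    and mu_f: "\<mu> f = -1"
begin

abbreviation elementary where "elementary \<equiv> \<forall>t\<in>carrier T. t \<otimes> t = \<one>"

lemma beta_mult_r: "u \<in> carrier T \<Longrightarrow> v \<in> carrier T \<Longrightarrow> w \<in> carrier T \<Longrightarrow>
      \<beta> w (u \<otimes> v) = \<beta> w u * \<beta> w v"
  using beta_mult[of u v w] beta_sym by simp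

lemma beta_one [simp]: "u \<in> carrier T \<Longrightarrow> \<beta> u \<one> = 1" "u \<in> carrier T \<Longrightarrow> \<beta> \<one> u = 1"
  using radical[of \<one>] beta_sym by auto

lemma beta_f [simp]: "u \<in> carrier T \<Longrightarrow> \<beta> u f = 1" "u \<in> carrier T \<Longrightarrow> \<beta> f u = 1"
  using radical[of f] beta_sym by auto

lemma f_square [simp]: "f \<otimes> f = \<one>"
  using square[of f] f_ne by auto

lemma mu_one [simp]: "\<mu> \<one> = 1"
  using mu_mult[of \<one> \<one>] mu_val[of \<one>] by auto

lemma square_mult: "s \<in> carrier T \<Longrightarrow> t \<in> carrier T \<Longrightarrow> (s \<otimes> t) \<otimes> (s \<otimes> t) = (s \<otimes> s) \<otimes> (t \<otimes> t)"
  by (simp add: m_ac)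

text \<open>Translation by \<open>s\<close> permutes the group and multiplies the sum by
  \<open>\<chi> s \<noteq> 1\<close>.\<close>

lemma character_sum:
  assumes "\<And>s t. s \<in> carrier T \<Longrightarrow> t \<in> carrier T \<Longrightarrow> \<chi> (s \<otimes> t) = \<chi> s * (\<chi> t :: real)"
    and "s \<in> carrier T" "\<chi> s \<noteq> 1"
  shows "(\<Sum>t\<in>carrier T. \<chi> t) = 0"
proof -
  have "bij_betw (\<lambda>t. s \<otimes> t) (carrier T) (carrier T)"
    by (rule bij_betwI[where g = "\<lambda>t. inv s \<otimes> t"]) (use assms(2) in \<open>auto simp: m_assoc[symmetric]\<close>)
  then have "(\<Sum>t\<in>carrier T. \<chi> t) = (\<Sum>t\<in>carrier T. \<chi> (s \<otimes> t))"
    by (rule sum.reindex_bij_betw[symmetric])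
  also have "\<dots> = \<chi> s * (\<Sum>t\<in>carrier T. \<chi> t)"
    unfolding sum_distrib_left by (rule sum.cong) (use assms in auto)
  finally show ?thesis using assms(3) by simp
qed

text \<open>Every sign character trivial on \<open>f\<close> is pairing with some element. Sum
  \<open>\<chi> t * \<beta> c t\<close> over all \<open>c\<close> and \<open>t\<close>: summing over
  \<open>c\<close> first kills every \<open>t\<close> outside the radical, and \<open>\<one>\<close>
  and \<open>f\<close> contribute positively. So for some \<open>c\<close> the sum over
  \<open>t\<close> is nonzero, which forces the character \<open>\<chi> t * \<beta> c t\<close> to
  be trivial.\<close>

lemma duality:
  assumes mult: "\<And>s t. s \<in> carrier T \<Longrightarrow> t \<in> carrier T \<Longrightarrow> \<chi> (s \<otimes> t) = \<chi> s * (\<chi> t :: real)"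
    and val: "\<And>s. s \<in> carrier T \<Longrightarrow> \<chi> s = 1 \<or> \<chi> s = -1" and f: "\<chi> f = 1"
  obtains c where "c \<in> carrier T" "\<And>t. t \<in> carrier T \<Longrightarrow> \<chi> t = \<beta> c t"
proof -
  have one: "\<chi> \<one> = 1" using mult[of \<one> \<one>] val[of \<one>] by auto
  have "(\<Sum>c\<in>carrier T. \<Sum>t\<in>carrier T. \<chi> t * \<beta> c t) = (\<Sum>t\<in>carrier T. \<chi> t * (\<Sum>c\<in>carrier T. \<beta> c t))"
    by (subst sum.swap) (simp add: sum_distrib_left)
  also have "\<dots> = (\<Sum>t\<in>carrier T. if t = \<one> \<or> t = f then real (card (carrier T)) else 0)"
  proof (rule sum.cong[OF refl])
    fix t assume t: "t \<in> carrier T"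
    show "\<chi> t * (\<Sum>c\<in>carrier T. \<beta> c t) = (if t = \<one> \<or> t = f then real (card (carrier T)) else 0)"
    proof (cases "t = \<one> \<or> t = f")
      case True then show ?thesis using one f by auto
    next
      case False
      then obtain u where "u \<in> carrier T" "\<beta> u t \<noteq> 1" using radical[OF t] by auto
      then have "(\<Sum>c\<in>carrier T. \<beta> c t) = 0"
        using character_sum[of "\<lambda>c. \<beta> c t" u] beta_mult t by auto
      then show ?thesis using False by simp
    qed
  qed
  also have "\<dots> = (\<Sum>t\<in>{\<one>, f}. real (card (carrier T)))"
    by (rule sum.mono_neutral_cong_right) (auto simp: fin)
  also have "\<dots> > 0" using f_ne fin by (auto simp: card_gt_0_iff)
  finally obtain c where c: "c \<in> carrier T" "(\<Sum>t\<in>carrier T. \<chi> t * \<beta> c t) \<noteq> 0"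
    by (metis (no_types, lifting) less_irrefl sum.neutral)
  have "\<chi> t * \<beta> c t = 1" if "t \<in> carrier T" for t
    using character_sum[of "\<lambda>t. \<chi> t * \<beta> c t" t] mult beta_mult_r c that by auto
  then have "\<chi> t = \<beta> c t" if "t \<in> carrier T" for t
    using val[OF that] beta_val[OF c(1) that] that by (metis mult_1 mult_cancel_left1 mult_minus1)
  then show thesis using c that by blast
qed

text \<open>Squaring is a homomorphism onto \<open>{\<one>, f}\<close>, hence a sign character, and
  it kills \<open>f\<close>. By duality it is pairing with some \<open>a\<close>, whose orthogonal
  complement is therefore exactly the 2-torsion. Since \<open>\<beta> a a = 1\<close>, the element
  \<open>a\<close> is itself an involution.\<close>

lemma order_four_partner:
  assumes b: "b \<in> carrier T" "b \<otimes> b = f"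
  obtains a where "a \<in> carrier T" "a \<otimes> a = \<one>" "\<beta> a b = -1"
    "\<And>t. t \<in> carrier T \<Longrightarrow> \<beta> a t = 1 \<Longrightarrow> t \<otimes> t = \<one>" "\<mu> a = 1"
proof -
  let ?\<chi> = "\<lambda>t. if t \<otimes> t = \<one> then 1 else -1 :: real"
  obtain c where c: "c \<in> carrier T" "\<And>t. t \<in> carrier T \<Longrightarrow> ?\<chi> t = \<beta> c t"
  proof (rule duality[of ?\<chi>])
    fix s t assume st: "s \<in> carrier T" "t \<in> carrier T"
    show "?\<chi> (s \<otimes> t) = ?\<chi> s * ?\<chi> t"
    proof -
      have "(s \<otimes> t) \<otimes> (s \<otimes> t) = \<one> \<longleftrightarrow> (s \<otimes> s = \<one> \<longleftrightarrow> t \<otimes> t = \<one>)"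
        unfolding square_mult[OF st] using square[OF st(1)] square[OF st(2)] f_ne f_square st
        by (metis f_closed l_one r_one one_closed)
      then show ?thesis by auto
    qed
  qed auto
  have c2: "c \<otimes> c = \<one>" using c(2)[OF c(1)] beta_alt[OF c(1)] by (auto split: if_splits)
  have cb: "\<beta> c b = -1" using c(2)[OF b(1)] b f_ne by auto
  have ct: "t \<otimes> t = \<one>" if "t \<in> carrier T" "\<beta> c t = 1" for t using c(2)[OF that(1)] that by (auto split: if_splits)
  show thesis
  proof (cases "\<mu> c = 1")
    case True then show ?thesis using that c c2 cb ct by blast
  next
    case False
    \<comment> \<open>Multiplying by the radical element \<open>f\<close> repairs the sign and keeps
      all pairings.\<close>
    have "\<mu> (c \<otimes> f) = 1" using False mu_val[OF c(1) c2] mu_mult[of c f] mu_f c c2 by auto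
    moreover have "\<beta> (c \<otimes> f) t = \<beta> c t" if "t \<in> carrier T" for t
      using beta_mult[of c f t] c that by simp
    moreover have "(c \<otimes> f) \<otimes> (c \<otimes> f) = \<one>" using c c2 by (simp add: square_mult)
    ultimately show ?thesis using that[of "c \<otimes> f"] c cb ct b by auto
  qed
qed

text \<open>An element outside the radical has a partner with pairing -1, and each of the two may be
  multiplied by \<open>f\<close> to give it sign 1. Because \<open>\<mu> f = -1\<close>, planes with
  other signs need no separate treatment.\<close>

lemma hyperbolic_pair:
  assumes "elementary" "carrier T \<noteq> {\<one>, f}"
  obtains u v where "u \<in> carrier T" "v \<in> carrier T" "\<beta> u v = -1" "\<mu> u = 1" "\<mu> v = 1"
proof -
  obtain t where t: "t \<in> carrier T" "t \<noteq> \<one>" "t \<noteq> f" using assms(2) by auto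
  then obtain s where s: "s \<in> carrier T" "\<beta> s t = -1" using radical[OF t(1)] beta_val by blast
  have adj: "\<exists>x'\<in>carrier T. \<mu> x' = 1 \<and> (\<forall>y\<in>carrier T. \<beta> x' y = \<beta> x y)" if x: "x \<in> carrier T" for x
  proof (cases "\<mu> x = 1")
    case False
    have "\<mu> (x \<otimes> f) = 1" using False mu_val[of x] mu_mult[of x f] mu_f assms(1) x by auto
    moreover have "\<beta> (x \<otimes> f) y = \<beta> x y" if "y \<in> carrier T" for y
      using beta_mult[of x f y] x that by simp
    ultimately show ?thesis using x by (intro bexI[of _ "x \<otimes> f"]) auto
  qed (use x in auto)
  obtain u where u: "u \<in> carrier T" "\<mu> u = 1" "\<forall>y\<in>carrier T. \<beta> u y = \<beta> s y" using adj[OF s(1)] by blast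
  obtain v where v: "v \<in> carrier T" "\<mu> v = 1" "\<forall>y\<in>carrier T. \<beta> v y = \<beta> t y" using adj[OF t(1)] by blast
  have "\<beta> u v = \<beta> s v" using u v by auto
  also have "\<dots> = \<beta> t s" using v s beta_sym by metis
  also have "\<dots> = -1" using s t beta_sym by metis
  finally show thesis using that u v by blast
qed

definition perp :: "'g \<Rightarrow> 'g \<Rightarrow> 'g set" where
  "perp u v = {p \<in> carrier T. \<beta> p u = 1 \<and> \<beta> p v = 1}"

text \<open>A power with exponent in the integers modulo 2. With truth values as exponents, addition
  is \<open>i \<noteq> k\<close> and the carry is \<open>j \<and> l\<close>.\<close>

definition pw :: "'g \<Rightarrow> bool \<Rightarrow> 'g" where "pw u i = (if i then u else \<one>)"

lemma pw_simps [simp]: "pw u True = u" "pw u False = \<one>" by (auto simp: pw_def)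

lemma pw_closed [simp]: "u \<in> carrier T \<Longrightarrow> pw u i \<in> carrier T" by (auto simp: pw_def)

definition cmb :: "'g \<Rightarrow> 'g \<Rightarrow> bool \<Rightarrow> bool \<Rightarrow> 'g \<Rightarrow> 'g" where
  "cmb u v i j p = pw u i \<otimes> pw v j \<otimes> p"

lemma perp_mult: "p \<in> perp u v \<Longrightarrow> q \<in> perp u v \<Longrightarrow> u \<in> carrier T \<Longrightarrow> v \<in> carrier T \<Longrightarrow> p \<otimes> q \<in> perp u v"
  unfolding perp_def using beta_mult by auto

lemma f_perp [simp]: "u \<in> carrier T \<Longrightarrow> v \<in> carrier T \<Longrightarrow> f \<in> perp u v"
  and one_perp [simp]: "u \<in> carrier T \<Longrightarrow> v \<in> carrier T \<Longrightarrow> \<one> \<in> perp u v"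
  unfolding perp_def by auto

context
  fixes u v
  assumes uv: "u \<in> carrier T" "v \<in> carrier T" "u \<otimes> u = \<one>" "\<beta> u v = -1"
begin

lemma uv': "\<beta> v u = -1" using uv beta_sym by metis

lemma vv_perp: "v \<otimes> v \<in> perp u v" using square[OF uv(2)] f_perp one_perp uv by metis

lemma cmb_closed [simp]: "p \<in> perp u v \<Longrightarrow> cmb u v i j p \<in> carrier T"
  unfolding cmb_def perp_def using uv by auto

text \<open>The factor \<open>pw (v \<otimes> v) (j \<and> l)\<close> is a carry. Only
  \<open>u\<close> is assumed to be an involution; if \<open>v\<close> has order four, then
  \<open>v \<otimes> v = f\<close> is a nontrivial element of the complement, so that
  \<open>u\<close> and \<open>v\<close> do not generate a complementary direct factor.\<close>

lemma cmb_mult: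
  assumes "p \<in> perp u v" "q \<in> perp u v"
  shows "cmb u v i j p \<otimes> cmb u v k l q =
    cmb u v (i \<noteq> k) (j \<noteq> l) (p \<otimes> q \<otimes> pw (v \<otimes> v) (j \<and> l))"
proof -
  have pq: "p \<in> carrier T" "q \<in> carrier T" using assms by (auto simp: perp_def)
  have uu: "u \<otimes> (u \<otimes> x) = x" if "x \<in> carrier T" for x
    using m_assoc[of u u x] uv that by simp
  show ?thesis unfolding cmb_def
    by (cases i; cases j; cases k; cases l) (use pq uv in \<open>auto simp: m_ac uu\<close>)
qed

lemma beta_cmb:
  assumes "p \<in> perp u v" "q \<in> perp u v"
  shows "\<beta> (cmb u v i j p) (cmb u v k l q) =
    (if i \<and> l then -1 else 1) * (if j \<and> k then -1 else 1) * \<beta> p q"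
proof -
  have pq: "p \<in> carrier T" "q \<in> carrier T" "\<beta> p u = 1" "\<beta> p v = 1" "\<beta> q u = 1" "\<beta> q v = 1"
    using assms by (auto simp: perp_def)
  have pq': "\<beta> u q = 1" "\<beta> v q = 1" using pq beta_sym uv by metis+
  show ?thesis unfolding cmb_def
    by (cases i; cases j; cases k; cases l)
      (use pq pq' uv uv' beta_alt in \<open>auto simp: beta_mult beta_mult_r\<close>)
qed

text \<open>Pairing with \<open>v\<close> reads off the exponent of \<open>u\<close>, and pairing
  with \<open>u\<close> that of \<open>v\<close>. Uniqueness and existence of the coordinates both
  rest on this.\<close>

lemma beta_cmb_v: "p \<in> perp u v \<Longrightarrow> \<beta> (cmb u v i j p) v = (if i then -1 else 1)"
  and beta_cmb_u: "p \<in> perp u v \<Longrightarrow> \<beta> (cmb u v i j p) u = (if j then -1 else 1)"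
  using beta_cmb[of p \<one> i j False True] beta_cmb[of p \<one> i j True False] uv
  by (auto simp: cmb_def perp_def)

lemma cmb_inj:
  assumes "p \<in> perp u v" "q \<in> perp u v" "cmb u v i j p = cmb u v k l q"
  shows "i = k \<and> j = l \<and> p = q"
proof -
  have "i = k" using beta_cmb_v[OF assms(1), of i j] beta_cmb_v[OF assms(2), of k l] assms(3)
    by (auto split: if_splits)
  moreover have "j = l" using beta_cmb_u[OF assms(1), of i j] beta_cmb_u[OF assms(2), of k l] assms(3)
    by (auto split: if_splits)
  ultimately show ?thesis using assms uv unfolding cmb_def perp_def by auto
qed

lemma cmb_surj:
  assumes "t \<in> carrier T"
  obtains i j p where "p \<in> perp u v" "t = cmb u v i j p"
proof -
  \<comment> \<open>The exponents are dictated by the pairings of \<open>t\<close>: with this choice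
    \<open>c\<close> pairs with \<open>u\<close> and \<open>v\<close> as \<open>t\<close> does, so
    the remaining factor \<open>p\<close> is orthogonal to both.\<close>
  define i where "i = (\<beta> t v = -1)"
  define j where "j = (\<beta> t u = -1)"
  define c where "c = cmb u v i j \<one>"
  define p where "p = inv c \<otimes> t"
  have c: "c \<in> carrier T" unfolding c_def using uv by auto
  have t: "t = c \<otimes> p" unfolding p_def using c assms by (simp add: m_assoc[symmetric])
  have pT: "p \<in> carrier T" unfolding p_def using c assms by auto
  have "\<beta> c v = \<beta> t v" "\<beta> c u = \<beta> t u"
    unfolding c_def using beta_cmb_v[of \<one> i j] beta_cmb_u[of \<one> i j] uv beta_val[OF assms]
    unfolding i_def j_def by auto
  then have "\<beta> p v = 1" "\<beta> p u = 1"
    using beta_mult[OF c pT uv(2)] beta_mult[OF c pT uv(1)] t beta_val[OF c uv(1)] beta_val[OF c uv(2)]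
    by auto
  then have "p \<in> perp u v" using pT by (auto simp: perp_def)
  moreover have "t = cmb u v i j p"
    unfolding t c_def cmb_def using uv pT by auto
  ultimately show thesis using that by blast
qed

text \<open>The complement has a quarter of the order. This drives the induction below and keeps the
  complements in two groups of equal order equally large.\<close>

lemma perp_card: "card (carrier T) = 4 * card (perp u v)"
proof -
  have "bij_betw (\<lambda>(i, j, p). cmb u v i j p) (UNIV \<times> UNIV \<times> perp u v) (carrier T)"
    unfolding bij_betw_def
  proof
    show "inj_on (\<lambda>(i, j, p). cmb u v i j p) (UNIV \<times> UNIV \<times> perp u v)"
    proof (rule inj_onI)
      fix x y assume xy: "x \<in> UNIV \<times> UNIV \<times> perp u v" "y \<in> UNIV \<times> UNIV \<times> perp u v"
        "(case x of (i, j, p) \<Rightarrow> cmb u v i j p) = (case y of (i, j, p) \<Rightarrow> cmb u v i j p)"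
      obtain i j p k l q where e: "x = (i, j, p)" "y = (k, l, q)" using prod_cases3 by metis
      then show "x = y" using cmb_inj[of p q i j k l] xy by simp
    qed
    show "(\<lambda>(i, j, p). cmb u v i j p) ` (UNIV \<times> UNIV \<times> perp u v) = carrier T"
    proof
      show "carrier T \<subseteq> (\<lambda>(i, j, p). cmb u v i j p) ` (UNIV \<times> UNIV \<times> perp u v)"
      proof
        fix t assume "t \<in> carrier T"
        then obtain i j p where "p \<in> perp u v" "t = cmb u v i j p" using cmb_surj by blast
        then show "t \<in> (\<lambda>(i, j, p). cmb u v i j p) ` (UNIV \<times> UNIV \<times> perp u v)"
          by (intro image_eqI[of _ _ "(i, j, p)"]) auto
      qed
    qed auto
  qed
  from bij_betw_same_card[OF this] show ?thesis by (simp add: card_cartesian_product)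
qed

text \<open>The axiom that needs an argument is the one on the radical: an element of the complement
  that is orthogonal to the whole complement is also orthogonal to \<open>u\<close> and
  \<open>v\<close>, hence to every \<open>cmb u v i j p\<close>, that is, to the whole
  group.\<close>

lemma qdata_perp: "qdata (T\<lparr>carrier := perp u v\<rparr>) \<beta> \<mu> f"
proof -
  have sub: "subgroup (perp u v) T"
  proof (rule subgroupI)
    show "inv p \<in> perp u v" if p: "p \<in> perp u v" for p
    proof -
      have pT: "p \<in> carrier T" using p by (auto simp: perp_def)
      \<comment> \<open>Squares lie in \<open>{\<one>, f}\<close>, so the inverse of
        \<open>p\<close> is \<open>p\<close> or \<open>p \<otimes> f\<close>, and \<open>f\<close>
        belongs to the complement.\<close>
      have "inv p = p \<or> inv p = p \<otimes> f"
      proof (cases "p \<otimes> p = \<one>")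
        case True then show ?thesis using pT inv_equality by blast
      next
        case False
        then have "p \<otimes> p = f" using square[OF pT] by simp
        then have "(p \<otimes> f) \<otimes> p = \<one>" using pT by (metis m_assoc m_comm f_closed f_square)
        then show ?thesis using pT inv_equality[of "p \<otimes> f" p] by simp
      qed
      then show ?thesis using p perp_mult uv by auto
    qed
    show "perp u v \<noteq> {}" using one_perp[OF uv(1,2)] by auto
    show "p \<otimes> q \<in> perp u v" if "p \<in> perp u v" "q \<in> perp u v" for p q
      using perp_mult that uv by blast
  qed (auto simp: perp_def)
  interpret P: group "T\<lparr>carrier := perp u v\<rparr>" using subgroup.subgroup_is_group[OF sub] is_group by blast
  have c: "perp u v \<subseteq> carrier T" by (auto simp: perp_def)
  have cg: "comm_group (T\<lparr>carrier := perp u v\<rparr>)"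
    by (rule P.group_comm_groupI) (use c m_comm in auto)
  have rad: "(\<forall>p\<in>perp u v. \<beta> p t = 1) \<longleftrightarrow> t = \<one> \<or> t = f" if t: "t \<in> perp u v" for t
  proof
    assume a: "\<forall>p\<in>perp u v. \<beta> p t = 1"
    have "\<beta> x t = 1" if "x \<in> carrier T" for x
    proof -
      obtain i j p where p: "p \<in> perp u v" "x = cmb u v i j p" using cmb_surj[OF \<open>x \<in> carrier T\<close>] .
      have "\<beta> (cmb u v i j p) (cmb u v False False t) = \<beta> p t"
        using beta_cmb[OF p(1), of t i j False False] t by simp
      then show ?thesis using p a t c by (auto simp: cmb_def)
    qed
    then show "t = \<one> \<or> t = f" using radical t c by auto
  next
    assume "t = \<one> \<or> t = f"
    then show "\<forall>p\<in>perp u v. \<beta> p t = 1" using c by auto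
  qed
  have mm: "\<mu> (x \<otimes> y) = \<mu> x * \<mu> y * \<beta> x y"
    if "x \<in> perp u v" "y \<in> perp u v" "x \<otimes> x = \<one>" "y \<otimes> y = \<one>" for x y
    using that mu_mult c by auto
  have "finite (perp u v)" "f \<in> perp u v" using finite_subset[OF c fin] uv by auto
  note facts = this rad mm mu_f f_ne
  show ?thesis
  proof (rule qdata.intro[OF cg], rule qdata_axioms.intro, goal_cases)
    case (2 x y) then show ?case using beta_val c by auto
  next
    case (3 x y z) then show ?case using beta_mult c by auto
  next
    case (4 x y) then show ?case using beta_sym c by auto
  next
    case (5 x) then show ?case using beta_alt c by auto
  next
    case (9 x) then show ?case using square c by auto
  next
    case (10 x) then show ?case using mu_val c by auto
  qed (use facts in simp_all)
qed

end

end

section \<open>Isomorphisms respecting commutation factors and signs\<close>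

definition qiso :: "('g, 'c) monoid_scheme \<Rightarrow> ('g \<Rightarrow> 'g \<Rightarrow> real) \<Rightarrow> ('g \<Rightarrow> real) \<Rightarrow>
    ('h, 'e) monoid_scheme \<Rightarrow> ('h \<Rightarrow> 'h \<Rightarrow> real) \<Rightarrow> ('h \<Rightarrow> real) \<Rightarrow> ('g \<Rightarrow> 'h) \<Rightarrow> bool" where
  "qiso T \<beta> \<mu> T' \<beta>' \<mu>' \<alpha> \<longleftrightarrow> \<alpha> \<in> iso T T' \<and>
     (\<forall>s\<in>carrier T. \<forall>t\<in>carrier T. \<beta>' (\<alpha> s) (\<alpha> t) = \<beta> s t) \<and>
     (\<forall>t\<in>carrier T. t \<otimes>\<^bsub>T\<^esub> t = \<one>\<^bsub>T\<^esub> \<longrightarrow> \<mu>' (\<alpha> t) = \<mu> t)"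

text \<open>\<open>f\<close> is intrinsic, being the only nontrivial element of the radical; this is
  why \<open>qiso\<close> does not list it.\<close>

lemma qiso_f:
  assumes "qdata T \<beta> \<mu> f" "qdata T' \<beta>' \<mu>' f'" "qiso T \<beta> \<mu> T' \<beta>' \<mu>' \<alpha>"
  shows "\<alpha> f = f'"
proof -
  interpret A: qdata T \<beta> \<mu> f by fact
  interpret B: qdata T' \<beta>' \<mu>' f' by fact
  have a: "\<alpha> \<in> hom T T'" "inj_on \<alpha> (carrier T)" "\<alpha> ` carrier T = carrier T'"
    using assms(3) by (auto simp: qiso_def iso_def bij_betw_def)
  interpret group_hom T T' \<alpha> using a by unfold_locales
  have "\<alpha> f \<noteq> \<one>\<^bsub>T'\<^esub>" using a(2) A.f_ne inj_on_eq_iff[OF a(2), of f "\<one>\<^bsub>T\<^esub>"] by simp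
  moreover have "\<beta>' u (\<alpha> f) = 1" if "u \<in> carrier T'" for u
  proof -
    obtain t where "t \<in> carrier T" "u = \<alpha> t" using \<open>u \<in> carrier T'\<close> a(3) by blast
    then show ?thesis using assms(3) by (auto simp: qiso_def)
  qed
  ultimately show ?thesis using B.radical[of "\<alpha> f"] by auto
qed

text \<open>The extension sends \<open>u^i v^j p\<close> to \<open>u'^i v'^j \<alpha>(p)\<close>.
  The multiplication law of these coordinates involves the pair only through the square of
  \<open>v\<close>, and \<open>\<alpha>\<close> matches the two squares, since by \<open>vv\<close>
  both are trivial or both are the distinguished radical element. Assumption \<open>el\<close> makes
  the whole complement 2-torsion, so that \<open>\<alpha>\<close> preserves signs on all of
  it.\<close>

lemma qiso_extend:
  fixes T (structure)
  assumes A: "qdata T \<beta> \<mu> f" and B: "qdata T' \<beta>' \<mu>' f'"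
    and uv: "u \<in> carrier T" "v \<in> carrier T" "u \<otimes> u = \<one>" "\<beta> u v = -1"
    and uv': "u' \<in> carrier T'" "v' \<in> carrier T'" "u' \<otimes>\<^bsub>T'\<^esub> u' = \<one>\<^bsub>T'\<^esub>" "\<beta>' u' v' = -1"
    and vv: "v \<otimes> v = \<one> \<longleftrightarrow> v' \<otimes>\<^bsub>T'\<^esub> v' = \<one>\<^bsub>T'\<^esub>"
    and mu: "\<mu> u = 1" "\<mu>' u' = 1" "v \<otimes> v = \<one> \<Longrightarrow> \<mu> v = \<mu>' v'"
    and el: "\<And>p. p \<in> qdata.perp T \<beta> u v \<Longrightarrow> p \<otimes> p = \<one>"
    and card: "card (carrier T) = card (carrier T')"
    and al: "qiso (T\<lparr>carrier := qdata.perp T \<beta> u v\<rparr>) \<beta> \<mu> (T'\<lparr>carrier := qdata.perp T' \<beta>' u' v'\<rparr>) \<beta>' \<mu>' \<alpha>"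
  shows "\<exists>\<alpha>. qiso T \<beta> \<mu> T' \<beta>' \<mu>' \<alpha>"
proof -
  interpret A: qdata T \<beta> \<mu> f by fact
  interpret B: qdata T' \<beta>' \<mu>' f' by fact
  let ?P = "A.perp u v" and ?P' = "B.perp u' v'"
  let ?c = "A.cmb u v" and ?c' = "B.cmb u' v'"
  have af: "\<alpha> f = f'"
    by (rule qiso_f[OF A.qdata_perp[OF uv] B.qdata_perp[OF uv'] al])
  have a: "\<alpha> p \<in> ?P'" "\<alpha> (p \<otimes> q) = \<alpha> p \<otimes>\<^bsub>T'\<^esub> \<alpha> q" "\<beta>' (\<alpha> p) (\<alpha> q) = \<beta> p q" "\<mu>' (\<alpha> p) = \<mu> p"
    if "p \<in> ?P" "q \<in> ?P" for p q
    using al that el[OF that(1)] by (auto simp: qiso_def iso_def hom_def Pi_iff)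
  have ai: "inj_on \<alpha> ?P" using al by (auto simp: qiso_def iso_def bij_betw_def)
  have a1: "\<alpha> \<one> = \<one>\<^bsub>T'\<^esub>"
  proof -
    have "\<alpha> \<one> = \<alpha> \<one> \<otimes>\<^bsub>T'\<^esub> \<alpha> \<one>" using a(2)[of "\<one>" "\<one>"] uv by simp
    then show ?thesis using a(1)[of "\<one>" "\<one>"] uv by (auto simp: B.perp_def)
  qed
  have avv: "\<alpha> (v \<otimes> v) = v' \<otimes>\<^bsub>T'\<^esub> v'"
    using vv af a1 A.square[OF uv(2)] B.square[OF uv'(2)] by auto
  have PT: "p \<in> carrier T" if "p \<in> ?P" for p using that by (auto simp: A.perp_def)
  have PT': "p \<in> carrier T'" if "p \<in> ?P'" for p using that by (auto simp: B.perp_def)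
  \<comment> \<open>The description is definite because the coordinates of \<open>t\<close> are
    unique.\<close>
  define \<gamma> where "\<gamma> t = (THE s. \<exists>i j p. p \<in> ?P \<and> t = ?c i j p \<and> s = ?c' i j (\<alpha> p))" for t
  have g: "\<gamma> (?c i j p) = ?c' i j (\<alpha> p)" if "p \<in> ?P" for i j p
    unfolding \<gamma>_def
    by (rule the_equality) (use that A.cmb_inj[OF uv] in blast)+
  have hom: "\<gamma> (s \<otimes> t) = \<gamma> s \<otimes>\<^bsub>T'\<^esub> \<gamma> t" and bet: "\<beta>' (\<gamma> s) (\<gamma> t) = \<beta> s t"
    if st: "s \<in> carrier T" "t \<in> carrier T" for s t
  proof -
    obtain i j p where p: "p \<in> ?P" "s = ?c i j p" using A.cmb_surj[OF uv st(1)] .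
    obtain k l q where q: "q \<in> ?P" "t = ?c k l q" using A.cmb_surj[OF uv st(2)] .
    have w: "A.pw (v \<otimes> v) (j \<and> l) \<in> ?P" using A.vv_perp[OF uv] uv by (cases "j \<and> l") auto
    have pq: "p \<otimes> q \<in> ?P" "p \<otimes> q \<otimes> A.pw (v \<otimes> v) (j \<and> l) \<in> ?P"
      using p q w A.perp_mult uv by auto
    have aw: "\<alpha> (A.pw (v \<otimes> v) (j \<and> l)) = B.pw (v' \<otimes>\<^bsub>T'\<^esub> v') (j \<and> l)"
      using avv a1 by (cases "j \<and> l") auto
    have "\<gamma> (s \<otimes> t) = ?c' (i \<noteq> k) (j \<noteq> l) (\<alpha> (p \<otimes> q \<otimes> A.pw (v \<otimes> v) (j \<and> l)))"
      unfolding p q A.cmb_mult[OF uv p(1) q(1)] by (rule g[OF pq(2)])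
    also have "\<alpha> (p \<otimes> q \<otimes> A.pw (v \<otimes> v) (j \<and> l)) =
        \<alpha> p \<otimes>\<^bsub>T'\<^esub> \<alpha> q \<otimes>\<^bsub>T'\<^esub> B.pw (v' \<otimes>\<^bsub>T'\<^esub> v') (j \<and> l)"
      using a(2)[OF pq(1) w] a(2)[OF p(1) q(1)] aw by simp
    also have "?c' (i \<noteq> k) (j \<noteq> l) (\<alpha> p \<otimes>\<^bsub>T'\<^esub> \<alpha> q \<otimes>\<^bsub>T'\<^esub> B.pw (v' \<otimes>\<^bsub>T'\<^esub> v') (j \<and> l)) = \<gamma> s \<otimes>\<^bsub>T'\<^esub> \<gamma> t"
      unfolding p q g[OF p(1)] g[OF q(1)]
      by (rule B.cmb_mult[OF uv', symmetric]) (use a p q in auto)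
    finally show "\<gamma> (s \<otimes> t) = \<gamma> s \<otimes>\<^bsub>T'\<^esub> \<gamma> t" .
    show "\<beta>' (\<gamma> s) (\<gamma> t) = \<beta> s t"
      unfolding p q g[OF p(1)] g[OF q(1)] A.beta_cmb[OF uv p(1) q(1)]
      using B.beta_cmb[OF uv' a(1)[OF p(1) p(1)] a(1)[OF q(1) q(1)]] a(3)[OF p(1) q(1)] by simp
  qed
  have clo: "\<gamma> t \<in> carrier T'" if t: "t \<in> carrier T" for t
  proof -
    obtain i j p where p: "p \<in> ?P" "t = ?c i j p" using A.cmb_surj[OF uv t] .
    show ?thesis unfolding p g[OF p(1)] by (rule B.cmb_closed[OF uv']) (use a p in auto)
  qed
  have inj: "inj_on \<gamma> (carrier T)"
  proof (rule inj_onI)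
    fix s t assume st: "s \<in> carrier T" "t \<in> carrier T" "\<gamma> s = \<gamma> t"
    obtain i j p where p: "p \<in> ?P" "s = ?c i j p" using A.cmb_surj[OF uv st(1)] .
    obtain k l q where q: "q \<in> ?P" "t = ?c k l q" using A.cmb_surj[OF uv st(2)] .
    have "i = k \<and> j = l \<and> \<alpha> p = \<alpha> q"
      by (rule B.cmb_inj[OF uv']) (use st p q g a in auto)
    then show "s = t" using p q ai by (auto dest: inj_onD)
  qed
  have surj: "\<gamma> ` carrier T = carrier T'"
    by (rule card_subset_eq) (use clo inj card B.fin in \<open>auto simp: card_image\<close>)
  have muc: "\<mu>' (\<gamma> t) = \<mu> t" if t: "t \<in> carrier T" "t \<otimes> t = \<one>" for t
  proof -
    obtain i j p where p: "p \<in> ?P" "t = ?c i j p" using A.cmb_surj[OF uv t(1)] .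
    have p': "\<alpha> p \<in> ?P'" "\<mu>' (\<alpha> p) = \<mu> p" "p \<otimes> p = \<one>" using a p el by auto
    have p2': "\<alpha> p \<otimes>\<^bsub>T'\<^esub> \<alpha> p = \<one>\<^bsub>T'\<^esub>" using a(2)[OF p(1) p(1)] p' a1 by simp
    \<comment> \<open>An involution has coordinate \<open>j\<close> only if \<open>v\<close> is an
      involution: as \<open>p\<close> is one, the square of \<open>t\<close> equals that of
      \<open>v\<close> when \<open>j\<close> holds. So a sign of \<open>v\<close> enters only where
      it is meaningful.\<close>
    have j: "j \<longrightarrow> v \<otimes> v = \<one>"
    proof
      assume j
      have "t \<otimes> t = ?c False False (p \<otimes> p \<otimes> (v \<otimes> v))"
        unfolding p A.cmb_mult[OF uv p(1) p(1)] using \<open>j\<close> by simp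
      then show "v \<otimes> v = \<one>" using t p' uv by (simp add: A.cmb_def)
    qed
    define x where "x = A.pw u i \<otimes> A.pw v j"
    define x' where "x' = B.pw u' i \<otimes>\<^bsub>T'\<^esub> B.pw v' j"
    have x: "x \<in> carrier T" "x \<otimes> x = \<one>" "x' \<in> carrier T'" "x' \<otimes>\<^bsub>T'\<^esub> x' = \<one>\<^bsub>T'\<^esub>"
      unfolding x_def x'_def using uv uv' j vv
      by (cases i; cases j; auto simp: A.square_mult B.square_mult)+
    have mx: "\<mu>' x' = \<mu> x"
      unfolding x_def x'_def using uv uv' j vv mu
      by (cases i; cases j) (auto simp: A.mu_mult B.mu_mult)
    have "\<beta>' x' (\<alpha> p) = \<beta> x p"
      using A.beta_cmb[OF uv A.one_perp[OF uv(1,2)] p(1), of i j False False]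
        B.beta_cmb[OF uv' B.one_perp[OF uv'(1,2)] p'(1), of i j False False]
      using p(1) p'(1) uv uv' PT PT' by (simp add: A.cmb_def B.cmb_def x_def x'_def)
    moreover have "t = x \<otimes> p" "\<gamma> t = x' \<otimes>\<^bsub>T'\<^esub> \<alpha> p"
      unfolding p(2) g[OF p(1)] x_def x'_def by (simp_all add: A.cmb_def B.cmb_def)
    ultimately show ?thesis
      using A.mu_mult[OF x(1) PT[OF p(1)] x(2) p'(3)] B.mu_mult[OF x(3) PT'[OF p'(1)] x(4) p2'] mx p'
      by simp
  qed
  have "qiso T \<beta> \<mu> T' \<beta>' \<mu>' \<gamma>"
    unfolding qiso_def iso_def hom_def bij_betw_def using hom bet clo inj surj muc by auto
  then show ?thesis by blast
qed

text \<open>With sign 1 on both generators, the hyperbolic planes chosen in the two groups look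
  alike, and their complements have equal, smaller order. The induction ends at the radical
  \<open>{\<one>, f}\<close>, where \<open>\<mu>\<close> is already fixed, and not at the trivial
  group.\<close>

lemma qiso_elementary:
  assumes "qdata T \<beta> \<mu> f" "qdata T' \<beta>' \<mu>' f'" "card (carrier T) = card (carrier T')"
    and "\<forall>t\<in>carrier T. t \<otimes>\<^bsub>T\<^esub> t = \<one>\<^bsub>T\<^esub>" "\<forall>t\<in>carrier T'. t \<otimes>\<^bsub>T'\<^esub> t = \<one>\<^bsub>T'\<^esub>"
  shows "\<exists>\<alpha>. qiso T \<beta> \<mu> T' \<beta>' \<mu>' \<alpha>"
  using assms
proof (induction "card (carrier T)" arbitrary: T T' rule: less_induct)
  case less
  interpret A: qdata T \<beta> \<mu> f by fact
  interpret B: qdata T' \<beta>' \<mu>' f' by fact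
  show ?case
  proof (cases "carrier T = {\<one>\<^bsub>T\<^esub>, f}")
    case True
    have "card {\<one>\<^bsub>T'\<^esub>, f'} = card (carrier T')" using less(4) True A.f_ne B.f_ne by auto
    then have T': "carrier T' = {\<one>\<^bsub>T'\<^esub>, f'}" using B.fin by (metis B.f_closed B.one_closed card_subset_eq empty_subsetI insert_subset)
    have "qiso T \<beta> \<mu> T' \<beta>' \<mu>' (\<lambda>t. if t = f then f' else \<one>\<^bsub>T'\<^esub>)"
      unfolding qiso_def iso_def hom_def bij_betw_def inj_on_def using True T' A.f_ne B.f_ne A.mu_f B.mu_f
      by (auto simp: A.beta_alt B.beta_alt)
    then show ?thesis by blast
  next
    case False
    have T': "carrier T' \<noteq> {\<one>\<^bsub>T'\<^esub>, f'}"
    proof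
      assume "carrier T' = {\<one>\<^bsub>T'\<^esub>, f'}"
      then have "card (carrier T) = card {\<one>\<^bsub>T\<^esub>, f}" using less(4) A.f_ne B.f_ne by auto
      then show False using False A.fin by (metis A.f_closed A.one_closed card_subset_eq empty_subsetI insert_subset)
    qed
    obtain u v where uv: "u \<in> carrier T" "v \<in> carrier T" "\<beta> u v = -1" "\<mu> u = 1" "\<mu> v = 1"
      using A.hyperbolic_pair less(5) False by blast
    obtain u' v' where uv': "u' \<in> carrier T'" "v' \<in> carrier T'" "\<beta>' u' v' = -1" "\<mu>' u' = 1" "\<mu>' v' = 1"
      using B.hyperbolic_pair less(6) T' by blast
    have e: "u \<otimes>\<^bsub>T\<^esub> u = \<one>\<^bsub>T\<^esub>" "v \<otimes>\<^bsub>T\<^esub> v = \<one>\<^bsub>T\<^esub>" "u' \<otimes>\<^bsub>T'\<^esub> u' = \<one>\<^bsub>T'\<^esub>" "v' \<otimes>\<^bsub>T'\<^esub> v' = \<one>\<^bsub>T'\<^esub>"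
      using less uv uv' by auto
    have pT: "A.perp u v \<subseteq> carrier T" "B.perp u' v' \<subseteq> carrier T'" by (auto simp: A.perp_def B.perp_def)
    have c: "card (A.perp u v) = card (B.perp u' v')" "card (A.perp u v) < card (carrier T)"
      using A.perp_card[OF uv(1,2) e(1) uv(3)] B.perp_card[OF uv'(1,2) e(3) uv'(3)] less(4)
        card_gt_0_iff[of "carrier T"] A.fin by auto
    have "\<exists>\<alpha>. qiso (T\<lparr>carrier := A.perp u v\<rparr>) \<beta> \<mu> (T'\<lparr>carrier := B.perp u' v'\<rparr>) \<beta>' \<mu>' \<alpha>"
      by (rule less(1)) (use c A.qdata_perp[OF uv(1,2) e(1) uv(3)] B.qdata_perp[OF uv'(1,2) e(3) uv'(3)]
          less(5,6) pT in auto)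
    then obtain \<alpha> where al: "qiso (T\<lparr>carrier := A.perp u v\<rparr>) \<beta> \<mu> (T'\<lparr>carrier := B.perp u' v'\<rparr>) \<beta>' \<mu>' \<alpha>"
      by blast
    show ?thesis
      by (rule qiso_extend[OF less(2,3) uv(1,2) e(1) uv(3) uv'(1,2) e(3) uv'(3) _ uv(4) uv'(4) _ _ less(4) al])
        (use e uv uv' less(5) pT in auto)
  qed
qed

text \<open>In the case with elements of order four the first plane is spanned by such a
  \<open>b\<close> and its partner \<open>a\<close>. Everything orthogonal to \<open>a\<close> is an
  involution, so after this single step of mixed type the complements are elementary.\<close>

lemma qiso_exists:
  fixes T (structure)
  assumes A: "qdata T \<beta> \<mu> f" and B: "qdata T' \<beta>' \<mu>' f'" and card: "card (carrier T) = card (carrier T')"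
    and el: "(\<forall>t\<in>carrier T. t \<otimes> t = \<one>) \<longleftrightarrow> (\<forall>t\<in>carrier T'. t \<otimes>\<^bsub>T'\<^esub> t = \<one>\<^bsub>T'\<^esub>)"
  shows "\<exists>\<alpha>. qiso T \<beta> \<mu> T' \<beta>' \<mu>' \<alpha>"
proof (cases "\<forall>t\<in>carrier T. t \<otimes> t = \<one>")
  case True
  then show ?thesis using qiso_elementary[OF A B card] el by blast
next
  case False
  interpret A: qdata T \<beta> \<mu> f by fact
  interpret B: qdata T' \<beta>' \<mu>' f' by fact
  obtain b where b: "b \<in> carrier T" "b \<otimes> b = f" using False A.square by blast
  obtain b' where b': "b' \<in> carrier T'" "b' \<otimes>\<^bsub>T'\<^esub> b' = f'" using False el B.square by blast
  obtain a where a: "a \<in> carrier T" "a \<otimes> a = \<one>" "\<beta> a b = -1"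
    "\<And>t. t \<in> carrier T \<Longrightarrow> \<beta> a t = 1 \<Longrightarrow> t \<otimes> t = \<one>" "\<mu> a = 1"
    using A.order_four_partner[OF b] by blast
  obtain a' where a': "a' \<in> carrier T'" "a' \<otimes>\<^bsub>T'\<^esub> a' = \<one>\<^bsub>T'\<^esub>" "\<beta>' a' b' = -1"
    "\<And>t. t \<in> carrier T' \<Longrightarrow> \<beta>' a' t = 1 \<Longrightarrow> t \<otimes>\<^bsub>T'\<^esub> t = \<one>\<^bsub>T'\<^esub>" "\<mu>' a' = 1"
    using B.order_four_partner[OF b'] by blast
  have p: "p \<otimes> p = \<one>" if "p \<in> A.perp a b" for p
    using that a A.beta_sym by (auto simp: A.perp_def)
  have p': "p \<otimes>\<^bsub>T'\<^esub> p = \<one>\<^bsub>T'\<^esub>" if "p \<in> B.perp a' b'" for p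
    using that a' B.beta_sym by (auto simp: B.perp_def)
  have "\<exists>\<alpha>. qiso (T\<lparr>carrier := A.perp a b\<rparr>) \<beta> \<mu> (T'\<lparr>carrier := B.perp a' b'\<rparr>) \<beta>' \<mu>' \<alpha>"
    by (rule qiso_elementary[OF A.qdata_perp[OF a(1) b(1) a(2,3)] B.qdata_perp[OF a'(1) b'(1) a'(2,3)]])
      (use A.perp_card[OF a(1) b(1) a(2,3)] B.perp_card[OF a'(1) b'(1) a'(2,3)] card p p' in auto)
  then obtain \<alpha> where al: "qiso (T\<lparr>carrier := A.perp a b\<rparr>) \<beta> \<mu> (T'\<lparr>carrier := B.perp a' b'\<rparr>) \<beta>' \<mu>' \<alpha>"
    by blast
  show ?thesis
    by (rule qiso_extend[OF A B a(1) b(1) a(2,3) a'(1) b'(1) a'(2,3) _ a(5) a'(5) _ _ card al])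
      (use p b b' A.f_ne B.f_ne in auto)
qed

section \<open>Cocycles and graded bases\<close>

text \<open>A symmetric normalised 2-cocycle with values in the nonzero reals, in other words a
  commutative extension of \<open>T\<close> by that group. Showing that it is a coboundary means
  splitting the extension.\<close>

locale cocycle = comm_group T for T :: "('g, 'c) monoid_scheme" (structure) +
  fixes \<tau> :: "'g \<Rightarrow> 'g \<Rightarrow> real"
  assumes tau_nz: "\<And>s t. s \<in> carrier T \<Longrightarrow> t \<in> carrier T \<Longrightarrow> \<tau> s t \<noteq> 0"
    and tau_one: "\<And>t. t \<in> carrier T \<Longrightarrow> \<tau> \<one> t = 1"
    and tau_sym: "\<And>s t. s \<in> carrier T \<Longrightarrow> t \<in> carrier T \<Longrightarrow> \<tau> s t = \<tau> t s"
    and tau_cocycle: "\<And>s t u. s \<in> carrier T \<Longrightarrow> t \<in> carrier T \<Longrightarrow> u \<in> carrier T \<Longrightarrow>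
      \<tau> s t * \<tau> (s \<otimes> t) u = \<tau> s (t \<otimes> u) * \<tau> t u"
begin

text \<open>On the subgroup \<open>S\<close> the cocycle is the coboundary of \<open>\<chi>\<close>.
  The subgroup is part of the notion because the splitting is enlarged by one generator at a
  time.\<close>

definition split_on :: "'g set \<Rightarrow> ('g \<Rightarrow> real) \<Rightarrow> bool" where
  "split_on S \<chi> \<longleftrightarrow> subgroup S T \<and> (\<forall>s\<in>S. \<chi> s \<noteq> 0) \<and>
     (\<forall>s\<in>S. \<forall>t\<in>S. \<tau> s t * \<chi> (s \<otimes> t) = \<chi> s * \<chi> t)"

text \<open>In the commutative algebra with basis \<open>e_t\<close> and products
  \<open>e_s e_t = \<tau> s t e_(st)\<close>, this compares the coefficients of
  \<open>e_s (e_t e_x)\<close> and \<open>e_t (e_s e_x)\<close>.\<close>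

lemma tau_1:
  assumes "s \<in> carrier T" "x \<in> carrier T" "t \<in> carrier T"
  shows "\<tau> s (t \<otimes> x) * \<tau> t x = \<tau> s x * \<tau> t (s \<otimes> x)"
  using tau_cocycle[of s t x] tau_cocycle[of t s x] assms tau_sym[of s t] by (simp add: m_comm mult.commute)

text \<open>In the same algebra this is \<open>(e_t e_s)(e_t e_x) = (e_t e_t)(e_s e_x)\<close>, the
  form required for a product of two elements of one coset \<open>tS\<close>.\<close>

lemma tau_2:
  assumes "s \<in> carrier T" "x \<in> carrier T" "t \<in> carrier T"
  shows "\<tau> (t \<otimes> s) (t \<otimes> x) * \<tau> t s * \<tau> t x = \<tau> t t * \<tau> s x * \<tau> (t \<otimes> t) (s \<otimes> x)"
proof -
  have e: "s \<otimes> (t \<otimes> x) = t \<otimes> (s \<otimes> x)" using assms m_lcomm by blast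
  have "\<tau> t s * \<tau> (t \<otimes> s) (t \<otimes> x) = \<tau> t (t \<otimes> (s \<otimes> x)) * \<tau> s (t \<otimes> x)"
    using tau_cocycle[of t s "t \<otimes> x"] assms e by simp
  moreover have "\<tau> s (t \<otimes> x) * \<tau> t x = \<tau> s x * \<tau> t (s \<otimes> x)" by (rule tau_1[OF assms])
  moreover have "\<tau> t t * \<tau> (t \<otimes> t) (s \<otimes> x) = \<tau> t (t \<otimes> (s \<otimes> x)) * \<tau> t (s \<otimes> x)"
    using tau_cocycle[of t t "s \<otimes> x"] assms by simp
  moreover have "b * a * c = m * d * n" if "a * b = p * q" "q * c = d * e" "m * n = p * e" for a b c d e m n p q :: real
  proof -
    have "b * a * c = (a * b) * c" by simp
    also have "\<dots> = p * (q * c)" unfolding that(1) by simp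
    also have "\<dots> = d * (m * n)" unfolding that(2,3) by simp
    finally show ?thesis by simp
  qed
  ultimately show ?thesis by blast
qed

text \<open>Since \<open>t\<^sup>2 \<in> S\<close>, the only constraint on the new value \<open>c\<close> at \<open>t\<close> is that it is a square root,
  and the hypotheses of \<open>graded_iso\<close> make the radicand positive.\<close>

lemma split_on_extend:
  assumes S: "split_on S \<chi>" and t: "t \<in> carrier T" "t \<notin> S" "t \<otimes> t \<in> S"
    and c: "c * c = \<tau> t t * \<chi> (t \<otimes> t)" "c \<noteq> 0"
  shows "\<exists>S' \<chi>'. split_on S' \<chi>' \<and> S \<subseteq> S' \<and> t \<in> S' \<and> (\<forall>s\<in>S. \<chi>' s = \<chi> s) \<and> \<chi>' t = c"
proof -
  interpret S: subgroup S T using S by (simp add: split_on_def)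
  have chi: "\<chi> s \<noteq> 0" "\<tau> s x * \<chi> (s \<otimes> x) = \<chi> s * \<chi> x" if "s \<in> S" "x \<in> S" for s x
    using S that by (auto simp: split_on_def)
  have ST: "s \<in> carrier T" if "s \<in> S" for s using that by auto
  define S' where "S' = S \<union> (\<lambda>s. t \<otimes> s) ` S"
  \<comment> \<open>On the coset of \<open>t\<close> the value is forced by the coboundary relation
    for \<open>t\<close> and \<open>s\<close> as soon as the value at \<open>t\<close> is
    \<open>c\<close>; here \<open>inv t \<otimes> x\<close> recovers \<open>s\<close> from
    \<open>x\<close>.\<close>
  define \<chi>' where "\<chi>' x = (if x \<in> S then \<chi> x else \<chi> (inv t \<otimes> x) * c / \<tau> t (inv t \<otimes> x))" for x
  have nt: "t \<otimes> s \<notin> S" if "s \<in> S" for s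
  proof
    assume "t \<otimes> s \<in> S"
    then have "(t \<otimes> s) \<otimes> inv s \<in> S" using that by auto
    then show False using t that by (simp add: m_assoc)
  qed
  have c1: "\<chi>' s = \<chi> s" if "s \<in> S" for s using that by (simp add: \<chi>'_def)
  have c2: "\<chi>' (t \<otimes> s) = \<chi> s * c / \<tau> t s" if "s \<in> S" for s
    using nt[OF that] t that by (simp add: \<chi>'_def m_assoc[symmetric])
  have chi_one: "\<chi> \<one> = 1" using chi[of \<one> \<one>] tau_one[of \<one>] by simp
  have tt: "(t \<otimes> s) \<otimes> (t \<otimes> x) = (t \<otimes> t) \<otimes> (s \<otimes> x)" if "s \<in> S" "x \<in> S" for s x
    using that t by (simp add: m_ac)
  have sub: "subgroup S' T"
  proof (rule subgroupI)
    show "S' \<subseteq> carrier T" unfolding S'_def using t by auto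
    show "S' \<noteq> {}" unfolding S'_def using S.one_closed by blast
    show "inv x \<in> S'" if "x \<in> S'" for x
      using that unfolding S'_def
    proof
      assume "x \<in> (\<lambda>s. t \<otimes> s) ` S"
      then obtain s where s: "s \<in> S" "x = t \<otimes> s" by auto
      have "(t \<otimes> s) \<otimes> (t \<otimes> (inv (t \<otimes> t) \<otimes> inv s)) = (t \<otimes> t) \<otimes> (s \<otimes> (inv (t \<otimes> t) \<otimes> inv s))"
        by (rule tt) (use s t in auto)
      also have "\<dots> = ((t \<otimes> t) \<otimes> inv (t \<otimes> t)) \<otimes> (s \<otimes> inv s)" using s t by (simp add: m_ac del: r_inv)
      also have "\<dots> = \<one>" using s t by simp
      finally have "inv x = t \<otimes> (inv (t \<otimes> t) \<otimes> inv s)"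
        unfolding s(2) using s t ST by (intro inv_equality) (auto simp: m_comm)
      then show "inv x \<in> S \<union> (\<lambda>s. t \<otimes> s) ` S" using s t by auto
    qed auto
    show "x \<otimes> y \<in> S'" if xy: "x \<in> S'" "y \<in> S'" for x y
    proof -
      have "x \<otimes> (t \<otimes> s) = t \<otimes> (x \<otimes> s)" if "x \<in> S" "s \<in> S" for x s
        using that t by (simp add: m_lcomm)
      moreover have "(t \<otimes> s) \<otimes> y = t \<otimes> (s \<otimes> y)" if "y \<in> S" "s \<in> S" for y s
        using that t by (simp add: m_assoc)
      ultimately show ?thesis using xy tt t(3) unfolding S'_def by fastforce
    qed
  qed
  have mul: "\<tau> x y * \<chi>' (x \<otimes> y) = \<chi>' x * \<chi>' y" if xy: "x \<in> S'" "y \<in> S'" for x y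
  proof -
    have mixed: "\<tau> s (t \<otimes> z) * \<chi>' (s \<otimes> (t \<otimes> z)) = \<chi>' s * \<chi>' (t \<otimes> z)"
      if sz: "s \<in> S" "z \<in> S" for s z
    proof -
      have e: "s \<otimes> (t \<otimes> z) = t \<otimes> (s \<otimes> z)" using sz t by (simp add: m_lcomm)
      have 1: "\<tau> s (t \<otimes> z) * \<tau> t z = \<tau> s z * \<tau> t (s \<otimes> z)" using tau_1 sz t by auto
      have 2: "\<tau> s z * \<chi> (s \<otimes> z) = \<chi> s * \<chi> z" using chi sz by auto
      have nz: "\<tau> t z \<noteq> 0" "\<tau> t (s \<otimes> z) \<noteq> 0" using tau_nz sz t by auto
      have "\<tau> s (t \<otimes> z) * \<chi> (s \<otimes> z) * \<tau> t z = \<chi> s * \<chi> z * \<tau> t (s \<otimes> z)"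
      proof -
        have "a * c * b = h * k * e" if "a * b = d * e" "d * c = h * k" for a b c d e h k :: real
        proof -
          have "a * c * b = (d * c) * e" using that(1) by (simp add: mult.assoc mult.commute mult.left_commute)
          then show ?thesis unfolding that(2) .
        qed
        then show ?thesis using 1 2 by blast
      qed
      then show ?thesis
        unfolding e c1[OF sz(1)] c2[OF sz(2)] c2[OF S.m_closed[OF sz]] using nz c(2)
        by (simp add: field_simps)
    qed
    \<comment> \<open>A product of two coset elements falls back into \<open>S\<close>. Here, and
      only here, the equation for \<open>c * c\<close> enters.\<close>
    have both: "\<tau> (t \<otimes> s) (t \<otimes> z) * \<chi>' ((t \<otimes> s) \<otimes> (t \<otimes> z)) = \<chi>' (t \<otimes> s) * \<chi>' (t \<otimes> z)"
      if sz: "s \<in> S" "z \<in> S" for s z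
    proof -
      have 1: "\<tau> (t \<otimes> s) (t \<otimes> z) * \<tau> t s * \<tau> t z = \<tau> t t * \<tau> s z * \<tau> (t \<otimes> t) (s \<otimes> z)"
        using tau_2 sz t by auto
      have 2: "\<tau> s z * \<chi> (s \<otimes> z) = \<chi> s * \<chi> z"
        "\<tau> (t \<otimes> t) (s \<otimes> z) * \<chi> ((t \<otimes> t) \<otimes> (s \<otimes> z)) = \<chi> (t \<otimes> t) * \<chi> (s \<otimes> z)"
        using chi sz t by auto
      have nz: "\<tau> t s \<noteq> 0" "\<tau> t z \<noteq> 0" using tau_nz sz t by auto
      have "\<tau> (t \<otimes> s) (t \<otimes> z) * \<chi> ((t \<otimes> t) \<otimes> (s \<otimes> z)) * \<tau> t s * \<tau> t z =
        (\<tau> t t * \<tau> s z) * (\<tau> (t \<otimes> t) (s \<otimes> z) * \<chi> ((t \<otimes> t) \<otimes> (s \<otimes> z)))"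

      proof -
        have "\<tau> (t \<otimes> s) (t \<otimes> z) * \<chi> ((t \<otimes> t) \<otimes> (s \<otimes> z)) * \<tau> t s * \<tau> t z =
          (\<tau> (t \<otimes> s) (t \<otimes> z) * \<tau> t s * \<tau> t z) * \<chi> ((t \<otimes> t) \<otimes> (s \<otimes> z))" by simp
        then show ?thesis unfolding 1 by simp
      qed
      also have "\<dots> = (\<tau> t t * \<chi> (t \<otimes> t)) * (\<tau> s z * \<chi> (s \<otimes> z))" unfolding 2(2) by simp
      also have "\<dots> = (c * c) * (\<chi> s * \<chi> z)" unfolding 2(1) c(1) ..
      finally have "\<tau> (t \<otimes> s) (t \<otimes> z) * \<chi> ((t \<otimes> t) \<otimes> (s \<otimes> z)) = (\<chi> s * c / \<tau> t s) * (\<chi> z * c / \<tau> t z)"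
        using nz by (simp add: field_simps)
      moreover have "\<chi>' ((t \<otimes> s) \<otimes> (t \<otimes> z)) = \<chi> ((t \<otimes> t) \<otimes> (s \<otimes> z))"
        unfolding tt[OF sz] by (rule c1) (use sz t in auto)
      ultimately show ?thesis unfolding c2[OF sz(1)] c2[OF sz(2)] by simp
    qed
    show ?thesis
    proof (cases "x \<in> S")
      case True
      show ?thesis
      proof (cases "y \<in> S")
        case y: True then show ?thesis using True chi c1 by auto
      next
        case False then obtain z where "z \<in> S" "y = t \<otimes> z" using xy unfolding S'_def by auto
        then show ?thesis using mixed True by auto
      qed
    next
      case False then obtain s where s: "s \<in> S" "x = t \<otimes> s" using xy unfolding S'_def by auto
      show ?thesis
      proof (cases "y \<in> S")
        case y: True
        then show ?thesis using mixed[OF y s(1)] s t ST tau_sym[of y "t \<otimes> s"] m_comm[of y "t \<otimes> s"]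
          by (simp add: mult.commute)
      next
        case False then obtain z where "z \<in> S" "y = t \<otimes> z" using xy unfolding S'_def by auto
        then show ?thesis using both s by auto
      qed
    qed
  qed
  have nz: "\<chi>' x \<noteq> 0" if x: "x \<in> S'" for x
  proof (cases "x \<in> S")
    case True then show ?thesis using c1[OF True] chi(1)[OF True True] by simp
  next
    case False
    then obtain z where "z \<in> S" "x = t \<otimes> z" using x unfolding S'_def by auto
    then show ?thesis using c2[of z] chi(1)[of z z] tau_nz[OF t(1) ST[of z]] c(2) by simp
  qed
  have "split_on S' \<chi>'" using sub mul nz by (auto simp: split_on_def)
  moreover have "t \<in> S'" unfolding S'_def using t by (auto intro!: image_eqI[of _ _ \<one>])
  moreover have "\<chi>' t = c" using c2[of \<one>] t tau_one[of t] tau_sym[of t \<one>] chi_one by simp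
  moreover have "S \<subseteq> S'" unfolding S'_def by simp
  ultimately show ?thesis using c1 by (intro exI[of _ S'] exI[of _ \<chi>']) simp
qed

lemma split_on_one: "split_on S \<chi> \<Longrightarrow> \<one> \<in> S \<and> \<chi> \<one> = 1"
proof -
  assume S: "split_on S \<chi>"
  then have "\<one> \<in> S" by (auto simp: split_on_def subgroup.one_closed)
  moreover from this have "\<tau> \<one> \<one> * \<chi> (\<one> \<otimes> \<one>) = \<chi> \<one> * \<chi> \<one>" "\<chi> \<one> \<noteq> 0"
    using S unfolding split_on_def by blast+
  ultimately show ?thesis using tau_one[of \<one>] by simp
qed

text \<open>The hypothesis on \<open>b\<close> puts an involution into every coset of
  \<open>S\<close>: if \<open>t\<close> lies outside \<open>S\<close>, so does
  \<open>t \<otimes> b\<close>, and one of the two is an involution. At an involution the radicand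
  is \<open>\<tau> t t > 0\<close>, because \<open>\<chi> \<one> = 1\<close>. For an elementary
  group \<open>b\<close> is \<open>\<one>\<close>.\<close>

lemma split_on_all:
  assumes "finite (carrier T)"
    and pos: "\<And>t. t \<in> carrier T \<Longrightarrow> t \<otimes> t = \<one> \<Longrightarrow> \<tau> t t > 0"
    and "split_on S \<chi>" "b \<in> S" "\<And>t. t \<in> carrier T \<Longrightarrow> t \<otimes> t = \<one> \<or> (t \<otimes> b) \<otimes> (t \<otimes> b) = \<one>"
  shows "\<exists>\<chi>. split_on (carrier T) \<chi>"
  using assms(3-5)
proof (induction "card (carrier T - S)" arbitrary: S \<chi> rule: less_induct)
  case less
  interpret S: subgroup S T using less by (simp add: split_on_def)
  show ?case
  proof (cases "S = carrier T")
    case True then show ?thesis using less by auto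
  next
    case False
    then obtain t0 where t0: "t0 \<in> carrier T" "t0 \<notin> S" using S.subset by auto
    have "\<exists>t\<in>carrier T. t \<notin> S \<and> t \<otimes> t = \<one>"
    proof (cases "t0 \<otimes> t0 = \<one>")
      case False
      have "t0 \<otimes> b \<notin> S"
      proof
        assume "t0 \<otimes> b \<in> S"
        then have "(t0 \<otimes> b) \<otimes> inv b \<in> S" using less by auto
        then show False using t0 less by (simp add: m_assoc)
      qed
      moreover have "t0 \<otimes> b \<in> carrier T" using t0 less(3) by auto
      ultimately show ?thesis using less(4)[OF t0(1)] False by blast
    qed (use t0 in auto)
    then obtain t where t: "t \<in> carrier T" "t \<notin> S" "t \<otimes> t = \<one>" by blast
    have p: "\<tau> t t > 0" by (rule pos[OF t(1,3)])
    have "\<exists>S' \<chi>'. split_on S' \<chi>' \<and> S \<subseteq> S' \<and> t \<in> S' \<and> (\<forall>s\<in>S. \<chi>' s = \<chi> s) \<and> \<chi>' t = sqrt (\<tau> t t)"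
      by (rule split_on_extend[OF less(2) t(1,2)]) (use p t split_on_one[OF less(2)] in auto)
    then obtain S' \<chi>' where S': "split_on S' \<chi>'" "S \<subseteq> S'" "t \<in> S'" by blast
    have "card (carrier T - S') < card (carrier T - S)"
      by (rule psubset_card_mono) (use assms(1) S' t in auto)
    then show ?thesis using less(1)[OF _ S'(1)] less(3,4) S'(2) by blast
  qed
qed

text \<open>Over the reals the only obstruction is the sign of a radicand. At involutions it is
  positive by assumption. At an element \<open>b\<close> with square \<open>f\<close> the radicand
  is \<open>\<tau> b b * \<chi> f\<close>, which can be made positive through the sign of
  \<open>\<chi> f\<close>. One such \<open>b\<close> is enough, since any other element of order
  four becomes an involution when multiplied by \<open>b\<close>.\<close>

lemma coboundary:
  assumes fin: "finite (carrier T)"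
    and pos: "\<And>t. t \<in> carrier T \<Longrightarrow> t \<otimes> t = \<one> \<Longrightarrow> \<tau> t t > 0"
    and f: "f \<in> carrier T" "f \<noteq> \<one>" "f \<otimes> f = \<one>"
    and sq: "\<And>t. t \<in> carrier T \<Longrightarrow> t \<otimes> t = \<one> \<or> t \<otimes> t = f"
  obtains \<chi> where "\<And>t. t \<in> carrier T \<Longrightarrow> \<chi> t \<noteq> 0"
    "\<And>s t. s \<in> carrier T \<Longrightarrow> t \<in> carrier T \<Longrightarrow> \<tau> s t * \<chi> (s \<otimes> t) = \<chi> s * \<chi> t"
proof -
  have S0: "split_on {\<one>} (\<lambda>_. 1)" unfolding split_on_def using triv_subgroup tau_one[of \<one>] by auto
  have "\<exists>\<chi>. split_on (carrier T) \<chi>"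
  proof (cases "\<forall>t\<in>carrier T. t \<otimes> t = \<one>")
    case True
    then show ?thesis by (intro split_on_all[OF fin pos S0, of \<one>]) auto
  next
    case False
    then obtain b where b: "b \<in> carrier T" "b \<otimes> b = f" using sq by blast
    \<comment> \<open>The value intended for \<open>\<chi> f\<close>. Only its square
      \<open>\<tau> f f\<close> is prescribed, and the sign is chosen to make
      \<open>\<tau> b b * c\<close> positive.\<close>
    define c where "c = sgn (\<tau> b b) * sqrt (\<tau> f f)"
    have ff: "\<tau> f f > 0" using pos f by auto
    have bb: "\<tau> b b \<noteq> 0" using tau_nz b by auto
    have "\<exists>S' \<chi>'. split_on S' \<chi>' \<and> {\<one>} \<subseteq> S' \<and> f \<in> S' \<and> (\<forall>s\<in>{\<one>}. \<chi>' s = 1) \<and> \<chi>' f = c"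
      by (rule split_on_extend[OF S0 f(1)]) (use f ff bb in \<open>auto simp: c_def sgn_if\<close>)
    then obtain S1 \<chi>1 where S1: "split_on S1 \<chi>1" "f \<in> S1" "\<chi>1 f = c" by blast
    have p: "\<tau> b b * c > 0" unfolding c_def using ff bb by (auto simp: sgn_if mult_less_0_iff)
    obtain S2 \<chi>2 where S2: "split_on S2 \<chi>2" "b \<in> S2"
    proof (cases "b \<in> S1")
      case False
      have "\<exists>S' \<chi>'. split_on S' \<chi>' \<and> S1 \<subseteq> S' \<and> b \<in> S' \<and> (\<forall>s\<in>S1. \<chi>' s = \<chi>1 s) \<and> \<chi>' b = sqrt (\<tau> b b * c)"
        by (rule split_on_extend[OF S1(1) b(1) False]) (use b S1 p in auto)
      then show ?thesis using that by blast
    qed (use S1 that in blast)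
    have "t \<otimes> t = \<one> \<or> (t \<otimes> b) \<otimes> (t \<otimes> b) = \<one>" if t: "t \<in> carrier T" for t
    proof -
      have "(t \<otimes> b) \<otimes> (t \<otimes> b) = (t \<otimes> t) \<otimes> (b \<otimes> b)" using t b(1) by (simp add: m_ac)
      then show ?thesis using sq[OF t] b(2) f(3) by auto
    qed
    then show ?thesis by (intro split_on_all[OF fin pos S2]) auto
  qed
  then show thesis using that by (auto simp: split_on_def)
qed

end

text \<open>A presentation of \<open>D\<close> as a twisted group algebra of \<open>T\<close>, with
  2-cocycle \<open>\<sigma>\<close> normalised by the choice of the unit as basis vector at the
  neutral element.\<close>

definition gbasis :: "('g, 'c) monoid_scheme \<Rightarrow> (real, 'd) module \<Rightarrow> ('g \<Rightarrow> 'd) \<Rightarrow> ('g \<Rightarrow> 'g \<Rightarrow> real) \<Rightarrow> bool" where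
  "gbasis T D X \<sigma> \<longleftrightarrow> ualg D \<and> comm_group T \<and> ualg.fbasis D (carrier T) X \<and> X \<one>\<^bsub>T\<^esub> = \<one>\<^bsub>D\<^esub> \<and>
     (\<forall>s\<in>carrier T. \<forall>t\<in>carrier T. \<sigma> s t \<noteq> 0 \<and> X s \<otimes>\<^bsub>D\<^esub> X t = \<sigma> s t \<odot>\<^bsub>D\<^esub> X (s \<otimes>\<^bsub>T\<^esub> t))"

lemma gbasisD:
  fixes D (structure)
  assumes "gbasis T D X \<sigma>"
  shows "ualg D" "comm_group T" "ualg.fbasis D (carrier T) X" "X \<one>\<^bsub>T\<^esub> = \<one>"
    "\<And>s t. s \<in> carrier T \<Longrightarrow> t \<in> carrier T \<Longrightarrow> \<sigma> s t \<noteq> 0"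
    "\<And>s t. s \<in> carrier T \<Longrightarrow> t \<in> carrier T \<Longrightarrow> X s \<otimes> X t = \<sigma> s t \<odot> X (s \<otimes>\<^bsub>T\<^esub> t)"
    "finite (carrier T)" "\<And>t. t \<in> carrier T \<Longrightarrow> X t \<in> carrier D" "\<And>t. t \<in> carrier T \<Longrightarrow> X t \<noteq> \<zero>"
proof -
  show 1: "ualg D" "comm_group T" "ualg.fbasis D (carrier T) X" "X \<one>\<^bsub>T\<^esub> = \<one>"
    "\<And>s t. s \<in> carrier T \<Longrightarrow> t \<in> carrier T \<Longrightarrow> \<sigma> s t \<noteq> 0"
    "\<And>s t. s \<in> carrier T \<Longrightarrow> t \<in> carrier T \<Longrightarrow> X s \<otimes> X t = \<sigma> s t \<odot> X (s \<otimes>\<^bsub>T\<^esub> t)"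
    using assms by (auto simp: gbasis_def)
  interpret ualg D by fact
  show 2: "finite (carrier T)" "\<And>t. t \<in> carrier T \<Longrightarrow> X t \<in> carrier D"
    using 1(3) by (auto simp: fbasis_def)
  show "\<And>t. t \<in> carrier T \<Longrightarrow> X t \<noteq> \<zero>"
    using 1(3) indep_nonzero[OF 2(1)] unfolding fbasis_def by blast
qed

text \<open>The cocycle identity is associativity of \<open>D\<close>, read on three basis vectors;
  scalars may be compared because basis vectors are nonzero.\<close>

lemma gbasis_sigma:
  fixes T (structure)
  assumes "gbasis T D X \<sigma>"
  shows "\<And>t. t \<in> carrier T \<Longrightarrow> \<sigma> \<one> t = 1" "\<And>t. t \<in> carrier T \<Longrightarrow> \<sigma> t \<one> = 1"
    "\<And>s t u. s \<in> carrier T \<Longrightarrow> t \<in> carrier T \<Longrightarrow> u \<in> carrier T \<Longrightarrow>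
      \<sigma> s t * \<sigma> (s \<otimes> t) u = \<sigma> s (t \<otimes> u) * \<sigma> t u"
proof -
  note g = gbasisD[OF assms]
  interpret D: ualg D by fact
  interpret T: comm_group T by fact
  show "\<sigma> \<one> t = 1" if "t \<in> carrier T" for t
    using g(6)[of "\<one>" t] g(4,8,9) that D.sm_cancel[of "X t" "\<sigma> \<one> t" 1] by simp
  show "\<sigma> t \<one> = 1" if "t \<in> carrier T" for t
    using g(6)[of t "\<one>"] g(4,8,9) that D.sm_cancel[of "X t" "\<sigma> t \<one>" 1] by simp
  fix s t u assume c: "s \<in> carrier T" "t \<in> carrier T" "u \<in> carrier T"
  have "(X s \<otimes>\<^bsub>D\<^esub> X t) \<otimes>\<^bsub>D\<^esub> X u = (\<sigma> s t * \<sigma> (s \<otimes> t) u) \<odot>\<^bsub>D\<^esub> X (s \<otimes> t \<otimes> u)"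
    using g(6,8) c by simp
  moreover have "X s \<otimes>\<^bsub>D\<^esub> (X t \<otimes>\<^bsub>D\<^esub> X u) = (\<sigma> s (t \<otimes> u) * \<sigma> t u) \<odot>\<^bsub>D\<^esub> X (s \<otimes> t \<otimes> u)"
    using g(6,8) c by (simp add: T.m_assoc mult.commute)
  moreover have "(X s \<otimes>\<^bsub>D\<^esub> X t) \<otimes>\<^bsub>D\<^esub> X u = X s \<otimes>\<^bsub>D\<^esub> (X t \<otimes>\<^bsub>D\<^esub> X u)" using g(8) c D.m_assoc by auto
  ultimately show "\<sigma> s t * \<sigma> (s \<otimes> t) u = \<sigma> s (t \<otimes> u) * \<sigma> t u"
    using D.sm_cancel[of "X (s \<otimes> t \<otimes> u)"] g(8,9) c by auto
qed

text \<open>Assumption \<open>comm\<close> says exactly that the quotient \<open>\<tau>\<close> of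
  the two cocycles is symmetric, and \<open>pos\<close> that it is positive on the diagonal at
  involutions. The splitting \<open>\<chi>\<close> is then the rescaling of
  \<open>X' (\<alpha> t)\<close> that turns the structure constants \<open>\<sigma>'\<close> into
  \<open>\<sigma>\<close>.\<close>

lemma graded_iso:
  fixes T (structure)
  assumes A: "gbasis T D X \<sigma>" and B: "gbasis T' D' X' \<sigma>'" and al: "\<alpha> \<in> iso T T'"
    and comm: "\<And>s t. s \<in> carrier T \<Longrightarrow> t \<in> carrier T \<Longrightarrow>
      \<sigma> s t * \<sigma>' (\<alpha> t) (\<alpha> s) = \<sigma> t s * \<sigma>' (\<alpha> s) (\<alpha> t)"
    and pos: "\<And>t. t \<in> carrier T \<Longrightarrow> t \<otimes> t = \<one> \<Longrightarrow> \<sigma> t t * \<sigma>' (\<alpha> t) (\<alpha> t) > 0"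
    and f: "f \<in> carrier T" "f \<noteq> \<one>" "f \<otimes> f = \<one>"
    and sq: "\<And>t. t \<in> carrier T \<Longrightarrow> t \<otimes> t = \<one> \<or> t \<otimes> t = f"
  obtains \<phi> where "\<phi> \<in> alg_iso D D'" "\<And>t. t \<in> carrier T \<Longrightarrow> \<exists>c. c \<noteq> 0 \<and> \<phi> (X t) = c \<odot>\<^bsub>D'\<^esub> X' (\<alpha> t)"
proof -
  note g = gbasisD[OF A] and g' = gbasisD[OF B]
  interpret D: ualg D by (rule g)
  interpret D': ualg D' by (rule g')
  interpret T: comm_group T by (rule g)
  interpret T': comm_group T' by (rule g')
  have ah: "\<alpha> t \<in> carrier T'" "\<alpha> (s \<otimes> t) = \<alpha> s \<otimes>\<^bsub>T'\<^esub> \<alpha> t" if "s \<in> carrier T" "t \<in> carrier T" for s t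
    using al that by (auto simp: iso_def hom_def)
  have bij: "bij_betw \<alpha> (carrier T) (carrier T')" using al by (auto simp: iso_def)
  have a1: "\<alpha> \<one> = \<one>\<^bsub>T'\<^esub>" using ah[of "\<one>" "\<one>"] by simp
  define \<tau> where "\<tau> s t = \<sigma> s t / \<sigma>' (\<alpha> s) (\<alpha> t)" for s t
  have co: "cocycle T \<tau>"
  proof (unfold_locales, goal_cases)
    case (1 s t) then show ?case unfolding \<tau>_def using g(5) g'(5) ah by auto
  next
    case (2 t) then show ?case unfolding \<tau>_def using gbasis_sigma(1)[OF A] gbasis_sigma(1)[OF B] ah(1) a1 by simp
  next
    case (3 s t)
    then show ?case unfolding \<tau>_def using comm[of s t] g'(5)[of "\<alpha> s" "\<alpha> t"] g'(5)[of "\<alpha> t" "\<alpha> s"] ah(1)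
      by (simp add: field_simps)
  next
    case (4 s t u)
    have 1: "\<sigma> s t * \<sigma> (s \<otimes> t) u = \<sigma> s (t \<otimes> u) * \<sigma> t u"
      using gbasis_sigma(3)[OF A] 4 by auto
    have 2: "\<sigma>' (\<alpha> s) (\<alpha> t) * \<sigma>' (\<alpha> s \<otimes>\<^bsub>T'\<^esub> \<alpha> t) (\<alpha> u) = \<sigma>' (\<alpha> s) (\<alpha> t \<otimes>\<^bsub>T'\<^esub> \<alpha> u) * \<sigma>' (\<alpha> t) (\<alpha> u)"
      using gbasis_sigma(3)[OF B] 4 ah by auto
    have "\<tau> s t * \<tau> (s \<otimes> t) u = (\<sigma> s t * \<sigma> (s \<otimes> t) u) / (\<sigma>' (\<alpha> s) (\<alpha> t) * \<sigma>' (\<alpha> s \<otimes>\<^bsub>T'\<^esub> \<alpha> t) (\<alpha> u))"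
      using 4 ah by (simp add: \<tau>_def)
    also have "\<dots> = \<tau> s (t \<otimes> u) * \<tau> t u"
      unfolding 1 2 using 4 ah by (simp add: \<tau>_def)
    finally show ?case .
  qed
  interpret cocycle T \<tau> by (rule co)
  have tpos: "\<tau> t t > 0" if t: "t \<in> carrier T" "t \<otimes> t = \<one>" for t
    using pos[OF t] unfolding \<tau>_def by (auto simp: zero_less_divide_iff zero_less_mult_iff)
  obtain \<chi> where chi: "\<And>t. t \<in> carrier T \<Longrightarrow> \<chi> t \<noteq> 0"
    "\<And>s t. s \<in> carrier T \<Longrightarrow> t \<in> carrier T \<Longrightarrow> \<tau> s t * \<chi> (s \<otimes> t) = \<chi> s * \<chi> t"
    by (rule coboundary[OF g(7) tpos f sq]) blast+
  have fb: "D'.fbasis (carrier T) (\<lambda>t. \<chi> t \<odot>\<^bsub>D'\<^esub> (X' \<circ> \<alpha>) t)"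
    by (rule D'.fbasis_scale[OF D'.fbasis_reindex[OF bij g'(3)] chi(1)])
  have "\<exists>\<phi>\<in>alg_iso D D'. \<forall>t\<in>carrier T. \<phi> (X t) = \<chi> t \<odot>\<^bsub>D'\<^esub> (X' \<circ> \<alpha>) t"
  proof (rule alg_iso_from_bases[OF g(1) g'(1) g(3) fb])
    fix s t assume st: "s \<in> carrier T" "t \<in> carrier T"
    have e: "\<chi> s * \<chi> t * \<sigma>' (\<alpha> s) (\<alpha> t) = \<sigma> s t * \<chi> (s \<otimes> t)"
      using chi(2)[OF st] g'(5)[of "\<alpha> s" "\<alpha> t"] ah st unfolding \<tau>_def by (simp add: field_simps)
    have "(\<chi> s \<odot>\<^bsub>D'\<^esub> X' (\<alpha> s)) \<otimes>\<^bsub>D'\<^esub> (\<chi> t \<odot>\<^bsub>D'\<^esub> X' (\<alpha> t)) =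
      (\<chi> s * \<chi> t * \<sigma>' (\<alpha> s) (\<alpha> t)) \<odot>\<^bsub>D'\<^esub> X' (\<alpha> s \<otimes>\<^bsub>T'\<^esub> \<alpha> t)"
      using g'(6,8) ah(1) st by (simp add: mult_ac)
    also have "\<dots> = \<sigma> s t \<odot>\<^bsub>D'\<^esub> (\<chi> (s \<otimes> t) \<odot>\<^bsub>D'\<^esub> X' (\<alpha> (s \<otimes> t)))"
      unfolding e using ah st g'(8) by simp
    finally show "\<exists>k\<in>carrier T. \<exists>r. X s \<otimes>\<^bsub>D\<^esub> X t = r \<odot>\<^bsub>D\<^esub> X k \<and>
      (\<chi> s \<odot>\<^bsub>D'\<^esub> (X' \<circ> \<alpha>) s) \<otimes>\<^bsub>D'\<^esub> (\<chi> t \<odot>\<^bsub>D'\<^esub> (X' \<circ> \<alpha>) t) = r \<odot>\<^bsub>D'\<^esub> (\<chi> k \<odot>\<^bsub>D'\<^esub> (X' \<circ> \<alpha>) k)"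
      using g(6)[OF st] st T.m_closed by (auto intro!: bexI[of _ "s \<otimes> t"])
  qed
  then obtain \<phi> where phi: "\<phi> \<in> alg_iso D D'" "\<And>t. t \<in> carrier T \<Longrightarrow> \<phi> (X t) = \<chi> t \<odot>\<^bsub>D'\<^esub> (X' \<circ> \<alpha>) t" by blast
  have "\<exists>c. c \<noteq> 0 \<and> \<phi> (X t) = c \<odot>\<^bsub>D'\<^esub> X' (\<alpha> t)" if "t \<in> carrier T" for t
    using phi(2)[OF that] chi(1)[OF that] by (intro exI[of _ "\<chi> t"]) simp
  with phi(1) show thesis by (rule that)
qed

section \<open>Division gradings with one-dimensional components\<close>

text \<open>Left translation by an element of \<open>T\<close> is injective on the finite set
  \<open>T\<close>, hence onto; this produces first the unit and then the inverse.\<close>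

lemma (in group) finite_mult_closed_subgroup:
  assumes "finite T" "T \<subseteq> carrier G" "T \<noteq> {}" "\<And>s t. s \<in> T \<Longrightarrow> t \<in> T \<Longrightarrow> s \<otimes> t \<in> T"
  shows "subgroup T G"
proof (rule subgroupI)
  fix h assume h: "h \<in> T"
  have hG: "h \<in> carrier G" using assms(2) h by blast
  have "inj_on (\<lambda>x. h \<otimes> x) T" using assms(2) hG by (auto simp: inj_on_def subset_iff)
  then have surj: "(\<lambda>x. h \<otimes> x) ` T = T"
    using assms(1,4) h by (intro card_subset_eq) (auto simp: card_image)
  then have "h \<in> (\<lambda>x. h \<otimes> x) ` T" using h by simp
  then obtain e where e: "e \<in> T" "h \<otimes> e = h" by auto
  have "e \<in> carrier G" using assms(2) e by blast
  then have "e = \<one>" using e(2) hG by (metis l_cancel_one)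
  then have "\<one> \<in> (\<lambda>x. h \<otimes> x) ` T" using e(1) surj by simp
  then obtain y where y: "y \<in> T" "h \<otimes> y = \<one>" by auto
  have "y \<in> carrier G" using assms(2) y by blast
  then have "inv h = y" using y(2) hG by (metis inv_comm inv_equality)
  then show "inv h \<in> T" using y by simp
qed (use assms in auto)

context ualg begin

lemma dim1_generator:
  assumes V: "subspace (class_ring :: real ring) W A" and d: "has_real_dim A W 1"
  obtains x where "x \<in> W" "x \<noteq> \<zero>" "W = {r \<odot> x | r. True}"
proof -
  interpret W: vectorspace "class_ring :: real ring" "A\<lparr>carrier := W\<rparr>"
    by (rule V.subspace_is_vs[OF V])
  obtain B where B: "finite B" "W.basis B" using W.finite_basis_exists d unfolding has_real_dim_def by auto
  have "card B = 1" using W.dim_basis[OF B] d unfolding has_real_dim_def by simp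
  then obtain x where x: "B = {x}" by (rule card_1_singletonE)
  have xW: "x \<in> W" using B x by (auto simp: W.basis_def)
  have "x \<noteq> \<zero>"
  proof
    assume "x = \<zero>"
    have "(UNIV :: real set) \<noteq> {0}" using UNIV_I[of "1::real"] by (metis singletonD zero_neq_one)
    then show False using W.zero_nin_lin_indpt[of B] B x \<open>x = \<zero>\<close> by (auto simp: W.basis_def)
  qed
  moreover have "W = real_span (A\<lparr>carrier := W\<rparr>) {x}" using B x by (auto simp: W.basis_def)
  moreover have "real_span (A\<lparr>carrier := W\<rparr>) {x} = real_span A {x}"
    by (rule V.span_li_not_depend(1)) (use xW V in \<open>auto simp: V.is_module\<close>)
  ultimately show thesis using that[of x] xW span_single[of x] subspaceD(1)[OF V] by auto
qed

lemma dim1_span: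
  assumes "x \<in> carrier A" "x \<noteq> \<zero>" "W = {r \<odot> x | r. True}"
  shows "subspace (class_ring :: real ring) W A" "has_real_dim A W 1"
proof -
  have W: "W = real_span A {x}" using span_single[OF assms(1)] assms(3) by simp
  show V: "subspace class_ring W A" unfolding W by (rule span_subspace) (use assms in auto)
  interpret W: vectorspace "class_ring :: real ring" "A\<lparr>carrier := W\<rparr>"
    by (rule V.subspace_is_vs[OF V])
  have xW: "x \<in> W" unfolding assms(3) using assms(1) by (auto intro!: exI[of _ 1])
  have s: "real_span (A\<lparr>carrier := W\<rparr>) {x} = W"
    using V.span_li_not_depend(1)[of "{x}" W] xW V W by (auto simp: V.is_module)
  have "W.dim = 1" by (rule W.dim1I[of x]) (use s assms xW in auto)
  moreover have "W.fin_dim" unfolding W.fin_dim_def using s xW by (intro exI[of _ "{x}"]) auto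
  ultimately show "has_real_dim A W 1" unfolding has_real_dim_def by simp
qed

lemma lc_mono_neutral:
  assumes "finite T" "S \<subseteq> T" "X \<in> T \<rightarrow> carrier A" "\<And>t. t \<in> T - S \<Longrightarrow> c t = 0"
  shows "lc T X c = lc S X c"
  unfolding lc_def
proof (rule add.finprod_mono_neutral_cong_left[symmetric])
  show "\<And>i. i \<in> T - S \<Longrightarrow> c i \<odot> X i = \<zero>" using assms by (auto simp: Pi_iff)
qed (use assms in \<open>auto simp: Pi_iff\<close>)

end

lemma gradingD:
  fixes D (structure)
  assumes "grading G D \<Gamma>"
  shows "\<And>g. g \<in> carrier G \<Longrightarrow> subspace class_ring (\<Gamma> g) D"
    and "\<And>x. x \<in> carrier D \<Longrightarrow> \<exists>S f. finite S \<and> S \<subseteq> carrier G \<and> (\<forall>g\<in>S. f g \<in> \<Gamma> g) \<and> x = finsum D f S"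
    and "\<And>S f g. finite S \<Longrightarrow> S \<subseteq> carrier G \<Longrightarrow> (\<And>g. g \<in> S \<Longrightarrow> f g \<in> \<Gamma> g) \<Longrightarrow>
      finsum D f S = \<zero> \<Longrightarrow> g \<in> S \<Longrightarrow> f g = \<zero>"
    and "\<And>g h x y. g \<in> carrier G \<Longrightarrow> h \<in> carrier G \<Longrightarrow> x \<in> \<Gamma> g \<Longrightarrow> y \<in> \<Gamma> h \<Longrightarrow>
      x \<otimes> y \<in> \<Gamma> (g \<otimes>\<^bsub>G\<^esub> h)"
proof -
  note g = assms[unfolded grading_def]
  show "\<And>g. g \<in> carrier G \<Longrightarrow> subspace class_ring (\<Gamma> g) D"
    by (rule g[THEN conjunct1, THEN bspec])
  show "\<And>x. x \<in> carrier D \<Longrightarrow> \<exists>S f. finite S \<and> S \<subseteq> carrier G \<and> (\<forall>g\<in>S. f g \<in> \<Gamma> g) \<and> x = finsum D f S"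
    by (rule g[THEN conjunct2, THEN conjunct1, THEN bspec])
  show "f g = \<zero>" if "finite S" "S \<subseteq> carrier G" "\<And>g. g \<in> S \<Longrightarrow> f g \<in> \<Gamma> g"
    "finsum D f S = \<zero>" "g \<in> S" for S f g
    by (rule g[THEN conjunct2, THEN conjunct2, THEN conjunct1, THEN spec, THEN spec, THEN mp, THEN bspec])
      (use that in auto)
  show "x \<otimes> y \<in> \<Gamma> (g \<otimes>\<^bsub>G\<^esub> h)" if "g \<in> carrier G" "h \<in> carrier G" "x \<in> \<Gamma> g" "y \<in> \<Gamma> h" for g h x y
    by (rule g[THEN conjunct2, THEN conjunct2, THEN conjunct2, THEN bspec, THEN bspec, THEN bspec, THEN bspec])
      (use that in auto)
qed

text \<open>The inverse lies on the line of the inverse degree. The scalars of the left and the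
  right inverse are a priori different and are identified by uniqueness of inverses.\<close>

lemma gbasis_Units:
  fixes D (structure)
  assumes "gbasis T D X \<sigma>" "t \<in> carrier T"
  shows "X t \<in> Units D"
proof -
  note g = gbasisD[OF assms(1)]
  interpret D: ualg D by (rule g)
  interpret T: comm_group T by (rule g)
  define h where "h = inv\<^bsub>T\<^esub> t"
  have h: "h \<in> carrier T" "t \<otimes>\<^bsub>T\<^esub> h = \<one>\<^bsub>T\<^esub>" "h \<otimes>\<^bsub>T\<^esub> t = \<one>\<^bsub>T\<^esub>" using assms(2) by (auto simp: h_def)
  define y where "y = (1 / \<sigma> t h) \<odot> X h"
  define z where "z = (1 / \<sigma> h t) \<odot> X h"
  have x: "X t \<in> carrier D" "X h \<in> carrier D" using g(8) assms(2) h by auto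
  have y: "y \<in> carrier D" "X t \<otimes> y = \<one>"
    unfolding y_def using x g(5)[of t h] g(6)[of t h] g(4) assms(2) h by auto
  have z: "z \<in> carrier D" "z \<otimes> X t = \<one>"
    unfolding z_def using x g(5)[of h t] g(6)[of h t] g(4) assms(2) h by auto
  have "y = z" using D.inv_unique[OF z(2) y(2) x(1) z(1) y(1)] by simp
  then show ?thesis unfolding Units_def using x y z by auto
qed

text \<open>The way back from a twisted group algebra of a subgroup to a division grading by the
  whole group, whose components outside the subgroup are zero.\<close>

lemma gbasis_grading:
  fixes G :: "('g, 'c) monoid_scheme" and D :: "(real, 'd) module" (structure)
  assumes G: "comm_group G" and T: "subgroup T G" and g: "gbasis (G\<lparr>carrier := T\<rparr>) D X \<sigma>"
    and GT: "\<And>t. t \<in> T \<Longrightarrow> \<Gamma> t = {r \<odot> X t | r. True}"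
    and GN: "\<And>t. t \<in> carrier G \<Longrightarrow> t \<notin> T \<Longrightarrow> \<Gamma> t = {\<zero>}"
  shows "\<Gamma> \<in> division_gradings_dim1 G D" "grading_support G D \<Gamma> = T"
proof -
  note gD = gbasisD[OF g]
  interpret D: ualg D by (rule gD)
  interpret G: comm_group G by (rule G)
  interpret T: subgroup T G by (rule T)
  have X: "X t \<in> carrier D" "X t \<noteq> \<zero>" if "t \<in> T" for t using gD(8,9) that by auto
  have XT: "X \<in> T \<rightarrow> carrier D" using X by auto
  have finT: "finite T" using gD(7) by simp
  have ind: "D.indep T X" using gD(3) by (simp add: D.fbasis_def)
  have mult: "X s \<otimes> X t = \<sigma> s t \<odot> X (s \<otimes>\<^bsub>G\<^esub> t)" "\<sigma> s t \<noteq> 0" if "s \<in> T" "t \<in> T" for s t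
    using gD(5,6) that by auto
  show supp: "grading_support G D \<Gamma> = T"
  proof -
    have "\<Gamma> t \<noteq> {\<zero>}" if "t \<in> T" for t
    proof -
      have "X t \<in> \<Gamma> t" unfolding GT[OF that] using X[OF that] by (auto intro!: exI[of _ 1])
      then show ?thesis using X[OF that] by auto
    qed
    then show ?thesis unfolding grading_support_def using GN T.subset by auto
  qed
  have sub: "subspace (class_ring :: real ring) (\<Gamma> t) D" if "t \<in> carrier G" for t
  proof (cases "t \<in> T")
    case True then show ?thesis using D.dim1_span(1)[OF X[OF True] GT[OF True]] by simp
  next
    case False then show ?thesis unfolding GN[OF that False] by (intro D.subspaceI) auto
  qed
  have "grading G D \<Gamma>"
    unfolding grading_def
  proof (intro conjI ballI allI impI)
    fix x assume "x \<in> carrier D"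
    then obtain c where c: "x = D.lc T X c" using gD(3) by (auto simp: D.fbasis_def)
    show "\<exists>S f. finite S \<and> S \<subseteq> carrier G \<and> (\<forall>g\<in>S. f g \<in> \<Gamma> g) \<and> x = finsum D f S"
      by (rule exI[of _ T], rule exI[of _ "\<lambda>t. c t \<odot> X t"])
        (use c finT T.subset GT in \<open>auto simp: D.lc_def\<close>)
  next
    fix S f t assume a: "finite S \<and> S \<subseteq> carrier G \<and> (\<forall>g\<in>S. f g \<in> \<Gamma> g) \<and> finsum D f S = \<zero>" and t: "t \<in> S"
    have "\<forall>g\<in>S \<inter> T. \<exists>c. f g = c \<odot> X g" using a GT by auto
    then obtain c where c: "\<And>g. g \<in> S \<inter> T \<Longrightarrow> f g = c g \<odot> X g" by metis
    have f0: "f g = \<zero>" if "g \<in> S - T" for g using a GN that by auto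
    have fD: "f \<in> S \<rightarrow> carrier D"
    proof
      fix g assume g: "g \<in> S"
      then show "f g \<in> carrier D" using a D.subspaceD(1)[OF sub[of g]] by blast
    qed
    have "\<zero> = finsum D f S" using a by simp
    also have "\<dots> = finsum D (\<lambda>g. c g \<odot> X g) (S \<inter> T)"
      by (rule D.add.finprod_mono_neutral_cong_left[symmetric]) (use a c f0 fD X in auto)
    \<comment> \<open>Extending the coefficients by zero makes this a combination over all of
      \<open>T\<close>, the index set for which independence is known.\<close>
    also have "\<dots> = D.lc (S \<inter> T) X (\<lambda>g. if g \<in> S then c g else 0)"
      unfolding D.lc_def by (rule D.finsum_cong') (use X in auto)
    also have "\<dots> = D.lc T X (\<lambda>g. if g \<in> S then c g else 0)"
      by (rule D.lc_mono_neutral[symmetric]) (use finT XT in auto)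
    finally have "D.lc T X (\<lambda>g. if g \<in> S then c g else 0) = \<zero>" by (rule sym)
    from ind[unfolded D.indep_def, THEN spec, THEN mp, OF this]
    have z: "\<forall>g\<in>T. (if g \<in> S then c g else 0) = 0" .
    show "f t = \<zero>"
    proof (cases "t \<in> T")
      case True
      then have "c t = 0" using z t by auto
      then show ?thesis using c[of t] t True X by simp
    qed (use f0 t in auto)
  next
    fix g h x y assume gh: "g \<in> carrier G" "h \<in> carrier G" "x \<in> \<Gamma> g" "y \<in> \<Gamma> h"
    have xy: "x \<in> carrier D" "y \<in> carrier D" using gh D.subspaceD(1)[OF sub[of g]] D.subspaceD(1)[OF sub[of h]] by blast+
    have z: "\<zero> \<in> \<Gamma> (g \<otimes>\<^bsub>G\<^esub> h)" using D.subspaceD(2)[OF sub[of "g \<otimes>\<^bsub>G\<^esub> h"]] gh by simp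
    show "x \<otimes> y \<in> \<Gamma> (g \<otimes>\<^bsub>G\<^esub> h)"
    proof (cases "g \<in> T \<and> h \<in> T")
      case True
      then obtain r s where "x = r \<odot> X g" "y = s \<odot> X h" using gh GT by auto
      then have "x \<otimes> y = (r * s * \<sigma> g h) \<odot> X (g \<otimes>\<^bsub>G\<^esub> h)" using True X mult by (simp add: mult_ac)
      then show ?thesis using True GT by auto
    next
      case False
      then have "x = \<zero> \<or> y = \<zero>" using GN gh by auto
      then show ?thesis using z xy by auto
    qed
  qed (rule sub)
  moreover have "x \<in> Units D" if gx: "g \<in> carrier G" "x \<in> \<Gamma> g" "x \<noteq> \<zero>" for g x
  proof -
    have gT: "g \<in> T" using GN gx by auto
    then obtain r where r: "x = r \<odot> X g" using gx GT by auto
    have r0: "r \<noteq> 0" using r gx X[OF gT] by auto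
    obtain u where u: "u \<in> carrier D" "X g \<otimes> u = \<one>" "u \<otimes> X g = \<one>"
      using gbasis_Units[OF g, of g] gT unfolding Units_def by auto
    have "x \<in> carrier D" "(1 / r) \<odot> u \<in> carrier D" "((1 / r) \<odot> u) \<otimes> x = \<one>" "x \<otimes> ((1 / r) \<odot> u) = \<one>"
      unfolding r using X[OF gT] u r0 by simp_all
    then show ?thesis unfolding Units_def by blast
  qed
  moreover have "has_real_dim D (\<Gamma> t) 1" if "t \<in> T" for t
    using D.dim1_span(2)[OF X[OF that] GT[OF that]] by simp
  ultimately show "\<Gamma> \<in> division_gradings_dim1 G D"
    unfolding division_gradings_dim1_def division_grading_def components_of_dim_def
    by (simp add: supp del: One_nat_def)
qed

text \<open>Directness of the decomposition makes generators of different degrees independent, so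
  finite dimension bounds the support. Products of units are nonzero, so the support is closed under
  multiplication, and being finite and nonempty it is a subgroup.\<close>

lemma grading_gbasis:
  fixes G :: "('g, 'c) monoid_scheme" and D :: "(real, 'd) module" (structure)
  assumes G: "comm_group G" and D: "ualg D" and Gam: "\<Gamma> \<in> division_gradings_dim1 G D"
    and ne: "\<one> \<noteq> \<zero>" and fin: "ualg.fbasis D J Y"
    and T_def: "T = grading_support G D \<Gamma>"
  obtains X \<sigma> where "subgroup T G" "gbasis (G\<lparr>carrier := T\<rparr>) D X \<sigma>"
    "\<And>t. t \<in> T \<Longrightarrow> \<Gamma> t = {r \<odot> X t | r. True}"
    "\<And>t. t \<in> carrier G \<Longrightarrow> t \<notin> T \<Longrightarrow> \<Gamma> t = {\<zero>}"
proof -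
  interpret D: ualg D by (rule D)
  interpret G: comm_group G by (rule G)
  have gr: "grading G D \<Gamma>" "\<And>g x. g \<in> carrier G \<Longrightarrow> x \<in> \<Gamma> g \<Longrightarrow> x \<noteq> \<zero> \<Longrightarrow> x \<in> Units D"
    "\<And>t. t \<in> T \<Longrightarrow> has_real_dim D (\<Gamma> t) 1"
    using Gam unfolding division_gradings_dim1_def division_grading_def components_of_dim_def T_def by auto
  note gr_parts = gradingD[OF gr(1)]
  note sub = gr_parts(1) and gen = gr_parts(2) and ind = gr_parts(3) and mul = gr_parts(4)
  have TG: "T \<subseteq> carrier G" and TN: "\<And>t. t \<in> carrier G \<Longrightarrow> t \<notin> T \<Longrightarrow> \<Gamma> t = {\<zero>}"
    unfolding T_def grading_support_def by auto
  have "\<exists>x. x \<in> \<Gamma> t \<and> x \<noteq> \<zero> \<and> \<Gamma> t = {r \<odot> x | r. True}" if t: "t \<in> T" for t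
    by (rule D.dim1_generator[OF sub gr(3)]) (use t TG in auto)
  then obtain X0 where X0: "\<And>t. t \<in> T \<Longrightarrow> X0 t \<in> \<Gamma> t" "\<And>t. t \<in> T \<Longrightarrow> X0 t \<noteq> \<zero>"
    "\<And>t. t \<in> T \<Longrightarrow> \<Gamma> t = {r \<odot> X0 t | r. True}" by metis
  have X0c: "X0 t \<in> carrier D" if "t \<in> T" for t using X0(1)[OF that] D.subspaceD(1)[OF sub[of t]] TG that by blast
  have X0U: "X0 t \<in> Units D" if "t \<in> T" for t using gr(2) X0 TG that by blast
  have indF: "D.indep F X0" if F: "finite F" "F \<subseteq> T" for F
    unfolding D.indep_def
  proof (intro allI impI ballI)
    fix c t assume c: "D.lc F X0 c = \<zero>" and t: "t \<in> F"
    have mem: "c g \<odot> X0 g \<in> \<Gamma> g" if "g \<in> F" for g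
      using X0(3)[of g] F(2) that by blast
    have "c t \<odot> X0 t = \<zero>"
      by (rule ind[OF F(1), of "\<lambda>t. c t \<odot> X0 t"]) (use c t F TG mem in \<open>auto simp: D.lc_def\<close>)
    then show "c t = 0" using D.sm_eq_0[OF X0c[of t]] X0(2)[of t] t F by auto
  qed
  have finT: "finite T"
  proof (rule ccontr)
    assume "infinite T"
    then obtain F where F: "F \<subseteq> T" "finite F" "card F = card J + 1" by (metis infinite_arbitrarily_large)
    then have "card F \<le> card J" using D.fbasis_indep_card[OF fin F(2) _ indF] X0c by auto
    then show False using F by simp
  qed
  have mX: "X0 s \<otimes> X0 t \<in> \<Gamma> (s \<otimes>\<^bsub>G\<^esub> t)" "X0 s \<otimes> X0 t \<noteq> \<zero>" "s \<otimes>\<^bsub>G\<^esub> t \<in> T" if st: "s \<in> T" "t \<in> T" for s t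
  proof -
    show 1: "X0 s \<otimes> X0 t \<in> \<Gamma> (s \<otimes>\<^bsub>G\<^esub> t)" by (rule mul) (use st TG X0 in auto)
    have "X0 s \<otimes> X0 t \<in> Units D" using X0U st by auto
    moreover have "\<zero> \<notin> Units D" using ne by (auto simp: Units_def)
    ultimately show 2: "X0 s \<otimes> X0 t \<noteq> \<zero>" by auto
    show "s \<otimes>\<^bsub>G\<^esub> t \<in> T" using TN[of "s \<otimes>\<^bsub>G\<^esub> t"] 1 2 st TG by auto
  qed
  have Tne: "T \<noteq> {}"
  proof
    assume T0: "T = {}"
    obtain S f where S: "finite S" "S \<subseteq> carrier G" "\<forall>g\<in>S. f g \<in> \<Gamma> g" "\<one> = finsum D f S" using gen[of "\<one>"] by auto
    have "finsum D f S = \<zero>" by (rule D.add.finprod_one_eqI) (use S TN T0 in auto)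
    then show False using S ne by simp
  qed
  have subT: "subgroup T G" by (rule G.finite_mult_closed_subgroup) (use finT TG Tne mX in auto)
  interpret T: subgroup T G by (rule subT)
  \<comment> \<open>The neutral component is a line closed under multiplication. Its generator is a
    unit with \<open>x x = r x\<close>, hence \<open>x = r 1\<close>; so the unit of the algebra is
    homogeneous of neutral degree.\<close>
  have one: "\<one> \<in> \<Gamma> \<one>\<^bsub>G\<^esub>"
  proof -
    let ?x = "X0 \<one>\<^bsub>G\<^esub>"
    have x: "?x \<in> carrier D" "?x \<in> Units D" using X0c X0U by auto
    have "?x \<otimes> ?x \<in> \<Gamma> \<one>\<^bsub>G\<^esub>" using mX(1)[of "\<one>\<^bsub>G\<^esub>" "\<one>\<^bsub>G\<^esub>"] by simp
    then obtain r where r: "?x \<otimes> ?x = r \<odot> ?x" using X0(3) by auto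
    have "r \<odot> ?x = (r \<odot> \<one>) \<otimes> ?x" using x by simp
    then have "?x \<otimes> ?x = (r \<odot> \<one>) \<otimes> ?x" using r by simp
    then have e: "?x = r \<odot> \<one>" using D.Units_inv_closed[OF x(2)] D.Units_r_inv[OF x(2)] D.m_assoc[of ?x ?x "inv ?x"]
        D.m_assoc[of "r \<odot> \<one>" ?x "inv ?x"] x(1) by simp
    then have "r \<noteq> 0" using X0(2)[of "\<one>\<^bsub>G\<^esub>"] by auto
    then have "\<one> = (1/r) \<odot> ?x" by (subst e) simp
    then show ?thesis using X0(3)[of "\<one>\<^bsub>G\<^esub>"] by auto
  qed
  define X where "X t = (if t = \<one>\<^bsub>G\<^esub> then \<one> else X0 t)" for t
  have Xs: "\<exists>r. r \<noteq> 0 \<and> X t = r \<odot> X0 t" if t: "t \<in> T" for t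
  proof (cases "t = \<one>\<^bsub>G\<^esub>")
    case True
    then obtain r where r: "\<one> = r \<odot> X0 t" using one X0(3) t by auto
    then have "r \<noteq> 0" using ne X0c t by auto
    then show ?thesis using True r by (auto simp: X_def)
  next
    case False then show ?thesis using X0c t by (auto simp: X_def intro!: exI[of _ 1])
  qed
  then obtain c where c: "\<And>t. t \<in> T \<Longrightarrow> c t \<noteq> 0" "\<And>t. t \<in> T \<Longrightarrow> X t = c t \<odot> X0 t" by metis
  have fb0: "D.fbasis T X0"
    unfolding D.fbasis_def
  proof (intro conjI ballI finT)
    show "X0 \<in> T \<rightarrow> carrier D" using X0c by auto
    show "D.indep T X0" by (rule indF) (use finT in auto)
    fix a assume "a \<in> carrier D"
    then obtain S f where S: "finite S" "S \<subseteq> carrier G" "\<And>g. g \<in> S \<Longrightarrow> f g \<in> \<Gamma> g" "a = finsum D f S"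
      using gen[of a] by blast
    have "\<forall>g\<in>S \<inter> T. \<exists>d. f g = d \<odot> X0 g" using S(3) X0(3) by blast
    then obtain d where d: "\<And>g. g \<in> S \<inter> T \<Longrightarrow> f g = d g \<odot> X0 g" by metis
    have fD: "f \<in> S \<rightarrow> carrier D"
    proof
      fix g assume g: "g \<in> S"
      then show "f g \<in> carrier D" using S(2,3) D.subspaceD(1)[OF sub[of g]] by blast
    qed
    have f0: "f g = \<zero>" if "g \<in> S - T" for g
      using S(2) S(3)[of g] TN[of g] that by auto
    have "a = finsum D (\<lambda>g. d g \<odot> X0 g) (S \<inter> T)" unfolding S(4)
      by (rule D.add.finprod_mono_neutral_cong_left[symmetric]) (use S(1) d f0 fD X0c in auto)
    also have "\<dots> = D.lc (S \<inter> T) X0 (\<lambda>g. if g \<in> S then d g else 0)"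
      unfolding D.lc_def by (rule D.finsum_cong') (use X0c in auto)
    also have "\<dots> = D.lc T X0 (\<lambda>g. if g \<in> S then d g else 0)"
      by (rule D.lc_mono_neutral[symmetric]) (use finT X0c in auto)
    finally show "\<exists>c. a = D.lc T X0 c" by blast
  qed
  have fbX: "D.fbasis T X"
  proof -
    have "D.fbasis T (\<lambda>t. c t \<odot> X0 t)" by (rule D.fbasis_scale[OF fb0 c(1)])
    moreover have "D.lc T (\<lambda>t. c t \<odot> X0 t) e = D.lc T X e" for e
      unfolding D.lc_def by (rule D.finsum_cong') (use c X0c in auto)
    ultimately show ?thesis using c(2) X0c unfolding D.fbasis_def D.indep_def by auto
  qed
  have GX: "\<Gamma> t = {r \<odot> X t | r. True}" if t: "t \<in> T" for t
  proof -
    have "r \<odot> X0 t = (r / c t) \<odot> X t" for r using c X0c t by simp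
    moreover have "r \<odot> X t = (r * c t) \<odot> X0 t" for r using c X0c t by simp
    ultimately show ?thesis unfolding X0(3)[OF t] by blast
  qed
  have Xc: "X t \<in> carrier D" if "t \<in> T" for t using c(2) X0c that by auto
  have "\<exists>q. q \<noteq> 0 \<and> X s \<otimes> X t = q \<odot> X (s \<otimes>\<^bsub>G\<^esub> t)" if st: "s \<in> T" "t \<in> T" for s t
  proof -
    have e: "X s \<otimes> X t = (c s * c t) \<odot> (X0 s \<otimes> X0 t)" using c X0c st by (simp add: mult.commute)
    obtain q where q: "X0 s \<otimes> X0 t = q \<odot> X (s \<otimes>\<^bsub>G\<^esub> t)" using GX[OF mX(3)[OF st]] mX(1)[OF st] by auto
    have "q \<noteq> 0" using q mX(2,3)[OF st] Xc by auto
    then show ?thesis using e q c(1) st Xc mX(3) by (intro exI[of _ "c s * c t * q"]) auto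
  qed
  then have "\<forall>s t. \<exists>q. s \<in> T \<longrightarrow> t \<in> T \<longrightarrow> q \<noteq> 0 \<and> X s \<otimes> X t = q \<odot> X (s \<otimes>\<^bsub>G\<^esub> t)"
    by blast
  then obtain \<sigma> where s: "\<And>s t. s \<in> T \<Longrightarrow> t \<in> T \<Longrightarrow> \<sigma> s t \<noteq> 0 \<and> X s \<otimes> X t = \<sigma> s t \<odot> X (s \<otimes>\<^bsub>G\<^esub> t)"
    unfolding choice_iff by blast
  interpret TG: group "G\<lparr>carrier := T\<rparr>" using subgroup.subgroup_is_group[OF subT] G.is_group by blast
  have "comm_group (G\<lparr>carrier := T\<rparr>)" by (rule TG.group_comm_groupI) (use TG G.m_comm in auto)
  then have "gbasis (G\<lparr>carrier := T\<rparr>) D X \<sigma>"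
    unfolding gbasis_def using D fbX s by (auto simp: X_def)
  then show thesis using that subT GX TN by blast
qed

section \<open>Complex matrix algebras as real algebras\<close>

lemma alg_isoD:
  fixes A (structure)
  assumes "\<phi> \<in> alg_iso A B"
  shows "bij_betw \<phi> (carrier A) (carrier B)" "\<And>x. x \<in> carrier A \<Longrightarrow> \<phi> x \<in> carrier B"
    "\<And>x y. x \<in> carrier A \<Longrightarrow> y \<in> carrier A \<Longrightarrow> \<phi> (x \<otimes> y) = \<phi> x \<otimes>\<^bsub>B\<^esub> \<phi> y"
    "\<And>x y. x \<in> carrier A \<Longrightarrow> y \<in> carrier A \<Longrightarrow> \<phi> (x \<oplus> y) = \<phi> x \<oplus>\<^bsub>B\<^esub> \<phi> y"
    "\<phi> \<one> = \<one>\<^bsub>B\<^esub>" "\<And>r x. x \<in> carrier A \<Longrightarrow> \<phi> (r \<odot> x) = r \<odot>\<^bsub>B\<^esub> \<phi> x"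
  using assms unfolding alg_iso_def ring_iso_def Ring.ring_hom_def by auto

lemma alg_isoI:
  fixes A (structure)
  assumes "bij_betw \<phi> (carrier A) (carrier B)"
    "\<And>x y. x \<in> carrier A \<Longrightarrow> y \<in> carrier A \<Longrightarrow> \<phi> (x \<otimes> y) = \<phi> x \<otimes>\<^bsub>B\<^esub> \<phi> y"
    "\<And>x y. x \<in> carrier A \<Longrightarrow> y \<in> carrier A \<Longrightarrow> \<phi> (x \<oplus> y) = \<phi> x \<oplus>\<^bsub>B\<^esub> \<phi> y"
    "\<phi> \<one> = \<one>\<^bsub>B\<^esub>" "\<And>r x. x \<in> carrier A \<Longrightarrow> \<phi> (r \<odot> x) = r \<odot>\<^bsub>B\<^esub> \<phi> x"
  shows "\<phi> \<in> alg_iso A B"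
  using assms unfolding alg_iso_def ring_iso_def Ring.ring_hom_def bij_betw_def by auto

lemma alg_iso_comp: "\<phi> \<in> alg_iso A B \<Longrightarrow> \<psi> \<in> alg_iso B C \<Longrightarrow> \<psi> \<circ> \<phi> \<in> alg_iso A C"
  by (rule alg_isoI) (auto dest: alg_isoD intro: bij_betw_trans simp: alg_isoD(2-6))

lemma alg_iso_inv:
  fixes A (structure)
  assumes "\<phi> \<in> alg_iso A B" "ualg A"
  shows "inv_into (carrier A) \<phi> \<in> alg_iso B A"
proof (rule alg_isoI)
  interpret A: ualg A by fact
  note p = alg_isoD[OF assms(1)]
  let ?\<psi> = "inv_into (carrier A) \<phi>"
  show "bij_betw ?\<psi> (carrier B) (carrier A)" by (rule bij_betw_inv_into[OF p(1)])
  have i: "\<phi> (?\<psi> x) = x" "?\<psi> x \<in> carrier A" if "x \<in> carrier B" for x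
    using that p(1) by (auto simp: bij_betw_def f_inv_into_f inv_into_into)
  have j: "?\<psi> (\<phi> x) = x" if "x \<in> carrier A" for x
    using that p(1) by (simp add: bij_betw_def)
  show "?\<psi> (x \<otimes>\<^bsub>B\<^esub> y) = ?\<psi> x \<otimes> ?\<psi> y" if "x \<in> carrier B" "y \<in> carrier B" for x y
    using j[of "?\<psi> x \<otimes> ?\<psi> y"] p(3)[of "?\<psi> x" "?\<psi> y"] i that by simp
  show "?\<psi> (x \<oplus>\<^bsub>B\<^esub> y) = ?\<psi> x \<oplus> ?\<psi> y" if "x \<in> carrier B" "y \<in> carrier B" for x y
    using j[of "?\<psi> x \<oplus> ?\<psi> y"] p(4)[of "?\<psi> x" "?\<psi> y"] i that by simp
  show "?\<psi> \<one>\<^bsub>B\<^esub> = \<one>" using j[of "\<one>"] p(5) by simp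
  show "?\<psi> (r \<odot>\<^bsub>B\<^esub> x) = r \<odot> ?\<psi> x" if "x \<in> carrier B" for r x
    using j[of "r \<odot> ?\<psi> x"] p(6)[of "?\<psi> x" r] i that by simp
qed

lemma alg_iso_zero: "\<phi> \<in> alg_iso A B \<Longrightarrow> ualg A \<Longrightarrow> ualg B \<Longrightarrow> \<phi> \<zero>\<^bsub>A\<^esub> = \<zero>\<^bsub>B\<^esub>"
proof -
  assume a: "\<phi> \<in> alg_iso A B" "ualg A" "ualg B"
  interpret A: ualg A by fact
  interpret B: ualg B by fact
  show ?thesis using alg_isoD(2)[OF a(1), of "\<zero>\<^bsub>A\<^esub>"] alg_isoD(6)[OF a(1), of "\<zero>\<^bsub>A\<^esub>" 0] by simp
qed

text \<open>Stated for arbitrary linear maps, because it is also applied to the quotient map onto a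
  tensor product and to the linear extension of a map on tuples, neither of which is assumed to be
  bijective.\<close>

lemma linear_lc:
  fixes A (structure)
  assumes "ualg A" "ualg B" "X \<in> I \<rightarrow> carrier A"
    and clo: "\<And>x. x \<in> carrier A \<Longrightarrow> \<phi> x \<in> carrier B"
    and add: "\<And>x y. x \<in> carrier A \<Longrightarrow> y \<in> carrier A \<Longrightarrow> \<phi> (x \<oplus> y) = \<phi> x \<oplus>\<^bsub>B\<^esub> \<phi> y"
    and smult: "\<And>r x. x \<in> carrier A \<Longrightarrow> \<phi> (r \<odot> x) = r \<odot>\<^bsub>B\<^esub> \<phi> x"
  shows "\<phi> (ualg.lc A I X c) = ualg.lc B I (\<phi> \<circ> X) c"
proof -
  interpret A: ualg A by fact
  interpret B: ualg B by fact
  have z: "\<phi> \<zero> = \<zero>\<^bsub>B\<^esub>" using smult[of "\<zero>" 0] clo[of "\<zero>"] by simp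
  show ?thesis using assms(3)
  proof (induction I rule: infinite_finite_induct)
    case (infinite I) then show ?case by (simp add: A.lc_def B.lc_def A.finsum_infinite B.finsum_infinite z)
  next
    case empty then show ?case by (simp add: A.lc_def B.lc_def z)
  next
    case (insert i I)
    have X: "X i \<in> carrier A" "X \<in> I \<rightarrow> carrier A" using insert by auto
    have "A.lc (insert i I) X c = c i \<odot> X i \<oplus> A.lc I X c"
      unfolding A.lc_def by (rule A.finsum_insert) (use insert X in \<open>auto simp: Pi_iff\<close>)
    moreover have "B.lc (insert i I) (\<phi> \<circ> X) c = c i \<odot>\<^bsub>B\<^esub> \<phi> (X i) \<oplus>\<^bsub>B\<^esub> B.lc I (\<phi> \<circ> X) c"
      unfolding B.lc_def
      by (subst B.finsum_insert) (use insert X clo in \<open>auto simp: Pi_iff\<close>)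
    ultimately show ?case using insert(3)[OF X(2)] X(1) add[of "c i \<odot> X i" "A.lc I X c"]
        smult[of "X i" "c i"] A.lc_closed[OF X(2), of c] by (simp add: comp_def)
  qed
qed

lemma alg_iso_lc:
  assumes "\<phi> \<in> alg_iso A B" "ualg A" "ualg B" "X \<in> I \<rightarrow> carrier A"
  shows "\<phi> (ualg.lc A I X c) = ualg.lc B I (\<phi> \<circ> X) c"
  by (rule linear_lc[OF assms(2-4)]) (use alg_isoD[OF assms(1)] in auto)

lemma fbasis_alg_iso:
  assumes "\<phi> \<in> alg_iso A B" "ualg A" "ualg B" "ualg.fbasis A I X"
  shows "ualg.fbasis B I (\<phi> \<circ> X)"
proof -
  interpret A: ualg A by fact
  interpret B: ualg B by fact
  note p = alg_isoD[OF assms(1)] alg_iso_zero[OF assms(1-3)]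
  have X: "finite I" "X \<in> I \<rightarrow> carrier A" "\<And>a. a \<in> carrier A \<Longrightarrow> \<exists>c. a = A.lc I X c" "A.indep I X"
    using assms(4) by (auto simp: A.fbasis_def)
  show ?thesis unfolding B.fbasis_def B.indep_def
  proof (intro conjI ballI allI impI X(1))
    show "\<phi> \<circ> X \<in> I \<rightarrow> carrier B" using p(2) X(2) by (auto simp: Pi_iff)
    fix b assume "b \<in> carrier B"
    then obtain a where a: "a \<in> carrier A" "b = \<phi> a" using p(1) by (auto simp: bij_betw_def)
    then obtain c where "a = A.lc I X c" using X(3) by blast
    then have "b = B.lc I (\<phi> \<circ> X) c" using alg_iso_lc[OF assms(1-3) X(2), of c] a(2) by simp
    then show "\<exists>c. b = B.lc I (\<phi> \<circ> X) c" by blast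
  next
    fix c i assume c: "B.lc I (\<phi> \<circ> X) c = \<zero>\<^bsub>B\<^esub>" and i: "i \<in> I"
    have e: "\<phi> (A.lc I X c) = \<phi> \<zero>\<^bsub>A\<^esub>" using alg_iso_lc[OF assms(1-3) X(2), of c] c p by simp
    have "inj_on \<phi> (carrier A)" using p(1) by (simp add: bij_betw_def)
    then have "A.lc I X c = \<zero>\<^bsub>A\<^esub>" using e A.lc_closed[OF X(2)] A.zero_closed by (rule inj_onD)
    then show "c i = 0" using X(4) i by (auto simp: A.indep_def)
  qed
qed

lemma matrix_algebra_simps [simp]:
  "carrier (matrix_algebra n) = carrier_mat n n" "\<one>\<^bsub>matrix_algebra n\<^esub> = 1\<^sub>m n"
  "\<zero>\<^bsub>matrix_algebra n\<^esub> = 0\<^sub>m n n" "x \<otimes>\<^bsub>matrix_algebra n\<^esub> y = x * y" "x \<oplus>\<^bsub>matrix_algebra n\<^esub> y = x + y"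
  "r \<odot>\<^bsub>matrix_algebra n\<^esub> x = of_real r \<cdot>\<^sub>m x"
  by (auto simp: matrix_algebra_def)

lemma ring_matrix_algebra: "ring (matrix_algebra n :: (real, 'a::{comm_ring_1, real_algebra_1} mat) module)"
proof (rule ringI)
  let ?M = "matrix_algebra n :: (real, 'a mat) module"
  show "abelian_group ?M"
  proof (rule abelian_groupI)
    fix x assume "x \<in> carrier ?M"
    then show "\<exists>y\<in>carrier ?M. y \<oplus>\<^bsub>?M\<^esub> x = \<zero>\<^bsub>?M\<^esub>" by (intro bexI[of _ "- x"]) auto
  next
    fix x y assume "x \<in> carrier ?M" "y \<in> carrier ?M"
    then show "x \<oplus>\<^bsub>?M\<^esub> y = y \<oplus>\<^bsub>?M\<^esub> x" using comm_add_mat[of x n n y] by simp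
  qed auto
  show "Group.monoid ?M"
  proof (rule Group.monoidI)
    fix x y z assume "x \<in> carrier ?M" "y \<in> carrier ?M" "z \<in> carrier ?M"
    then show "x \<otimes>\<^bsub>?M\<^esub> y \<otimes>\<^bsub>?M\<^esub> z = x \<otimes>\<^bsub>?M\<^esub> (y \<otimes>\<^bsub>?M\<^esub> z)" using assoc_mult_mat[of x n n y n z n] by simp
  qed auto
next
  fix x y z :: "'a mat"
  assume "x \<in> carrier (matrix_algebra n)" "y \<in> carrier (matrix_algebra n)" "z \<in> carrier (matrix_algebra n)"
  then show "(x \<oplus>\<^bsub>matrix_algebra n\<^esub> y) \<otimes>\<^bsub>matrix_algebra n\<^esub> z =
      x \<otimes>\<^bsub>matrix_algebra n\<^esub> z \<oplus>\<^bsub>matrix_algebra n\<^esub> y \<otimes>\<^bsub>matrix_algebra n\<^esub> z"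
    "z \<otimes>\<^bsub>matrix_algebra n\<^esub> (x \<oplus>\<^bsub>matrix_algebra n\<^esub> y) =
      z \<otimes>\<^bsub>matrix_algebra n\<^esub> x \<oplus>\<^bsub>matrix_algebra n\<^esub> z \<otimes>\<^bsub>matrix_algebra n\<^esub> y"
    using add_mult_distrib_mat[of x n n y z n] mult_add_distrib_mat[of z n n x n y] by simp_all
qed

lemma ualg_matrix_algebra: "ualg (matrix_algebra n :: (real, 'a::{comm_ring_1, real_algebra_1} mat) module)"
  unfolding unital_real_algebra_ualg[symmetric]
proof (rule unital_real_algebraI[OF ring_matrix_algebra])
  fix r s :: real and x y :: "'a mat"
  assume x: "x \<in> carrier (matrix_algebra n)"
  show "r \<odot>\<^bsub>matrix_algebra n\<^esub> x \<in> carrier (matrix_algebra n)" using x by simp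
  show "(r + s) \<odot>\<^bsub>matrix_algebra n\<^esub> x = r \<odot>\<^bsub>matrix_algebra n\<^esub> x \<oplus>\<^bsub>matrix_algebra n\<^esub> s \<odot>\<^bsub>matrix_algebra n\<^esub> x"
    using x by (simp add: add_smult_distrib_right_mat)
  show "(r * s) \<odot>\<^bsub>matrix_algebra n\<^esub> x = r \<odot>\<^bsub>matrix_algebra n\<^esub> (s \<odot>\<^bsub>matrix_algebra n\<^esub> x)"
    using x by (auto intro!: eq_matI simp: mult.assoc)
  show "1 \<odot>\<^bsub>matrix_algebra n\<^esub> x = x" using x by (auto intro!: eq_matI)
  assume y: "y \<in> carrier (matrix_algebra n)"
  show "r \<odot>\<^bsub>matrix_algebra n\<^esub> (x \<oplus>\<^bsub>matrix_algebra n\<^esub> y) = r \<odot>\<^bsub>matrix_algebra n\<^esub> x \<oplus>\<^bsub>matrix_algebra n\<^esub> r \<odot>\<^bsub>matrix_algebra n\<^esub> y"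
    using x y by (simp add: add_smult_distrib_left_mat)
  show "(r \<odot>\<^bsub>matrix_algebra n\<^esub> x) \<otimes>\<^bsub>matrix_algebra n\<^esub> y = r \<odot>\<^bsub>matrix_algebra n\<^esub> (x \<otimes>\<^bsub>matrix_algebra n\<^esub> y)"
    using x y by (simp add: mult_smult_assoc_mat)
  show "x \<otimes>\<^bsub>matrix_algebra n\<^esub> (r \<odot>\<^bsub>matrix_algebra n\<^esub> y) = r \<odot>\<^bsub>matrix_algebra n\<^esub> (x \<otimes>\<^bsub>matrix_algebra n\<^esub> y)"
    using x y by (simp add: mult_smult_distrib)
qed

lemma lc_matrix_index:
  fixes X :: "'i \<Rightarrow> 'a::{comm_ring_1, real_algebra_1} mat"
  assumes "finite I" "X \<in> I \<rightarrow> carrier_mat n n" "a < n" "b < n"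
  shows "ualg.lc (matrix_algebra n) I X c $$ (a, b) = (\<Sum>i\<in>I. of_real (c i) * X i $$ (a, b))"
proof -
  interpret M: ualg "matrix_algebra n :: (real, 'a mat) module" by (rule ualg_matrix_algebra)
  show ?thesis using assms
  proof (induction I rule: finite_induct)
    case (insert i I)
    have X: "X i \<in> carrier_mat n n" "X \<in> I \<rightarrow> carrier_mat n n" using insert by auto
    have "M.lc (insert i I) X c = of_real (c i) \<cdot>\<^sub>m X i + M.lc I X c"
      unfolding M.lc_def
      by (subst M.finsum_insert) (use insert X in \<open>auto simp: Pi_iff\<close>)
    moreover have "M.lc I X c \<in> carrier_mat n n" using M.lc_closed[of X I c] X by simp
    ultimately show ?case using insert(1,2) insert(3)[OF X(2)] assms(3,4) X by auto
  qed (simp add: M.lc_def)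
qed

text \<open>The matrix units and their multiples by \<open>\<i>\<close>, a basis over the reals; the
  truth value selects the factor \<open>\<i>\<close>.\<close>

definition unit_mat :: "nat \<Rightarrow> nat \<times> nat \<times> bool \<Rightarrow> complex mat" where
  "unit_mat n = (\<lambda>(i, j, u). mat n n (\<lambda>(a, b). if a = i \<and> b = j then (if u then \<i> else 1) else 0))"

abbreviation cmat_algebra :: "nat \<Rightarrow> (real, complex mat) module" where
  "cmat_algebra \<equiv> matrix_algebra"

lemma fbasis_matrix_algebra:
  "ualg.fbasis (matrix_algebra n) ({..<n} \<times> {..<n} \<times> UNIV) (unit_mat n)"
proof -
  interpret M: ualg "cmat_algebra n" by (rule ualg_matrix_algebra)
  let ?I = "{..<n} \<times> {..<n} \<times> (UNIV :: bool set)"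
  have u: "unit_mat n \<in> ?I \<rightarrow> carrier_mat n n" by (auto simp: unit_mat_def)
  have idx: "M.lc ?I (unit_mat n) c $$ (a, b) = Complex (c (a, b, False)) (c (a, b, True))"
    if ab: "a < n" "b < n" for c a b
  proof -
    have "M.lc ?I (unit_mat n) c $$ (a, b) = (\<Sum>i\<in>?I. of_real (c i) * unit_mat n i $$ (a, b))"
      by (rule lc_matrix_index) (use u ab in auto)
    also have "\<dots> = (\<Sum>i\<in>{(a, b, False), (a, b, True)}. of_real (c i) * unit_mat n i $$ (a, b))"
      by (rule sum.mono_neutral_right) (use ab in \<open>auto simp: unit_mat_def\<close>)
    also have "\<dots> = Complex (c (a, b, False)) (c (a, b, True))"
      using ab by (simp add: unit_mat_def complex_eq_iff)
    finally show ?thesis .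
  qed
  show ?thesis unfolding M.fbasis_def M.indep_def
  proof (intro conjI ballI allI impI)
    show "unit_mat n \<in> ?I \<rightarrow> carrier (matrix_algebra n)" using u by simp
    fix x :: "complex mat" assume x: "x \<in> carrier (matrix_algebra n)"
    define c where "c = (\<lambda>(a, b, u). if u then Im (x $$ (a, b)) else Re (x $$ (a, b)))"
    have "M.lc ?I (unit_mat n) c \<in> carrier_mat n n" using M.lc_closed[of "unit_mat n" ?I c] u by simp
    then have "x = M.lc ?I (unit_mat n) c"
      using x idx[of _ _ c] by (intro eq_matI) (auto simp: c_def)
    then show "\<exists>c. x = M.lc ?I (unit_mat n) c" by blast
  next
    fix c k assume c: "M.lc ?I (unit_mat n) c = \<zero>\<^bsub>matrix_algebra n\<^esub>" and k: "k \<in> ?I"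
    obtain a b u where k': "k = (a, b, u)" using prod_cases3 by blast
    then have "Complex (c (a, b, False)) (c (a, b, True)) = 0" using idx[of a b c] c k by simp
    then show "c k = 0" unfolding k' by (cases u) (auto simp: complex_eq_iff)
  qed auto
qed

text \<open>Tested against the matrix units: off-diagonal units make the diagonal entries equal,
  diagonal units kill the entries off the diagonal.\<close>

lemma commuting_scalar:
  fixes z :: "complex mat"
  assumes z: "z \<in> carrier_mat n n" and c: "\<And>x. x \<in> carrier_mat n n \<Longrightarrow> x * z = z * x"
  obtains k where "z = k \<cdot>\<^sub>m 1\<^sub>m n"
proof -
  have e: "(unit_mat n (i, j, False) * z) $$ (a, b) = (if a = i then z $$ (j, b) else 0)"
    "(z * unit_mat n (i, j, False)) $$ (a, b) = (if b = j then z $$ (a, i) else 0)"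
    if "i < n" "j < n" "a < n" "b < n" for i j a b
    using that z by (auto simp: unit_mat_def scalar_prod_def if_distrib[of "\<lambda>x. x * _"]
        if_distrib[of "\<lambda>x. _ * x"] sum.delta cong: if_cong)
  have comm: "(unit_mat n (i, j, False) * z) $$ (a, b) = (z * unit_mat n (i, j, False)) $$ (a, b)" for i j a b
    using c[of "unit_mat n (i, j, False)"] by (simp add: unit_mat_def)
  have diag: "z $$ (j, j) = z $$ (i, i)" if "i < n" "j < n" for i j
    using comm[of i j i j] e[of i j i j] that by simp
  have off: "z $$ (j, b) = 0" if "j < n" "b < n" "b \<noteq> j" for j b
    using comm[of j j j b] e[of j j j b] that by simp
  \<comment> \<open>For \<open>n = 0\<close> the entry on the right is unspecified, which is
    harmless because no entries are compared.\<close>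
  have "z = z $$ (0, 0) \<cdot>\<^sub>m 1\<^sub>m n"
  proof (rule eq_matI)
    fix a b assume "a < dim_row (z $$ (0, 0) \<cdot>\<^sub>m 1\<^sub>m n)" "b < dim_col (z $$ (0, 0) \<cdot>\<^sub>m 1\<^sub>m n)"
    then show "z $$ (a, b) = (z $$ (0, 0) \<cdot>\<^sub>m 1\<^sub>m n) $$ (a, b)"
      using diag[of 0 a] off[of a b] by (cases "a = b") simp_all
  qed (use z in auto)
  then show thesis using that by blast
qed

text \<open>What the analysis of the radical uses of the matrix algebra is its centre: a copy of the
  complex numbers, with \<open>J\<close> the preimage of the scalar matrix
  \<open>\<i>\<close>.\<close>

lemma center_matrix_algebra:
  fixes D :: "(real, 'd) module" (structure)
  assumes D: "ualg D" and iso: "isomorphic_algebras D (cmat_algebra n)"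
  obtains J where "J \<in> carrier D" "\<And>x. x \<in> carrier D \<Longrightarrow> x \<otimes> J = J \<otimes> x"
    "J \<otimes> J = (-1) \<odot> \<one>"
    "\<And>z. z \<in> carrier D \<Longrightarrow> (\<And>x. x \<in> carrier D \<Longrightarrow> x \<otimes> z = z \<otimes> x) \<Longrightarrow>
      \<exists>a b. z = a \<odot> \<one> \<oplus> b \<odot> J"
proof -
  interpret D: ualg D by (rule D)
  let ?M = "cmat_algebra n"
  interpret M: ualg ?M by (rule ualg_matrix_algebra)
  obtain \<phi> where phi: "\<phi> \<in> alg_iso D ?M" using iso by (auto simp: isomorphic_algebras_def)
  let ?\<psi> = "inv_into (carrier D) \<phi>"
  have psi: "?\<psi> \<in> alg_iso ?M D" by (rule alg_iso_inv[OF phi D])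
  note p = alg_isoD[OF phi] and q = alg_isoD[OF psi]
  have qp: "?\<psi> (\<phi> x) = x" if "x \<in> carrier D" for x using that p(1) by (simp add: bij_betw_def)
  have pq: "\<phi> (?\<psi> x) = x" if "x \<in> carrier_mat n n" for x
    using that p(1) by (auto simp: bij_betw_def f_inv_into_f)
  define K where "K = \<i> \<cdot>\<^sub>m (1\<^sub>m n :: complex mat)"
  have K: "K \<in> carrier_mat n n" by (simp add: K_def)
  have KK: "K * K = of_real (-1) \<cdot>\<^sub>m 1\<^sub>m n"
    unfolding K_def by (auto intro!: eq_matI simp: mult_smult_assoc_mat[of _ n n] mult_smult_distrib[of _ n n])
  have Kc: "x * K = K * x" if "x \<in> carrier_mat n n" for x
    unfolding K_def using that mult_smult_assoc_mat[of "1\<^sub>m n" n n x n \<i>] mult_smult_distrib[of x n n "1\<^sub>m n" n \<i>] by simp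
  show thesis
  proof (rule that[of "?\<psi> K"])
    show "?\<psi> K \<in> carrier D" using q(2)[of K] K by simp
    show "x \<otimes> ?\<psi> K = ?\<psi> K \<otimes> x" if "x \<in> carrier D" for x
      using q(3)[of "\<phi> x" K] q(3)[of K "\<phi> x"] Kc[of "\<phi> x"] p(2)[OF that] qp[OF that] K by simp
    show "?\<psi> K \<otimes> ?\<psi> K = (-1) \<odot> \<one>"
      using q(3)[of K K] q(6)[of "1\<^sub>m n" "-1"] q(5) KK K by simp
    fix z assume z: "z \<in> carrier D" and zc: "\<And>x. x \<in> carrier D \<Longrightarrow> x \<otimes> z = z \<otimes> x"
    have "x * \<phi> z = \<phi> z * x" if x: "x \<in> carrier_mat n n" for x
      using p(3)[of "?\<psi> x" z] p(3)[of z "?\<psi> x"] zc[of "?\<psi> x"] pq[OF x] q(2)[of x] x z by simp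
    then obtain k where k: "\<phi> z = k \<cdot>\<^sub>m 1\<^sub>m n" using commuting_scalar[of "\<phi> z" n] p(2)[OF z] by auto
    have "\<phi> z = of_real (Re k) \<cdot>\<^sub>m 1\<^sub>m n + of_real (Im k) \<cdot>\<^sub>m K"
      unfolding k K_def by (rule eq_matI) (auto simp: complex_eq_iff)
    also have "\<dots> = Re k \<odot>\<^bsub>?M\<^esub> \<one>\<^bsub>?M\<^esub> \<oplus>\<^bsub>?M\<^esub> Im k \<odot>\<^bsub>?M\<^esub> K" by simp
    finally have "z = ?\<psi> (Re k \<odot>\<^bsub>?M\<^esub> \<one>\<^bsub>?M\<^esub> \<oplus>\<^bsub>?M\<^esub> Im k \<odot>\<^bsub>?M\<^esub> K)" using qp[OF z] by metis
    also have "\<dots> = Re k \<odot> \<one> \<oplus> Im k \<odot> ?\<psi> K"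
      using q(4)[of "Re k \<odot>\<^bsub>?M\<^esub> \<one>\<^bsub>?M\<^esub>" "Im k \<odot>\<^bsub>?M\<^esub> K"] q(6)[of "1\<^sub>m n" "Re k"] q(6)[of K "Im k"] q(5) K by simp
    finally show "\<exists>a b. z = a \<odot> \<one> \<oplus> b \<odot> ?\<psi> K" by blast
  qed
qed

lemma fbasis_isomorphic_matrix_algebra:
  assumes "ualg D" "isomorphic_algebras D (cmat_algebra n)"
  obtains Y :: "nat \<times> nat \<times> bool \<Rightarrow> _" where "ualg.fbasis D ({..<n} \<times> {..<n} \<times> UNIV) Y"
proof -
  obtain \<phi> where phi: "\<phi> \<in> alg_iso D (cmat_algebra n)"
    using assms(2) by (auto simp: isomorphic_algebras_def)
  show thesis
    by (rule that, rule fbasis_alg_iso[OF alg_iso_inv[OF phi assms(1)] ualg_matrix_algebra assms(1) fbasis_matrix_algebra])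
qed

lemma isomorphic_matrix_algebra_nontrivial:
  fixes D (structure)
  assumes "ualg D" "isomorphic_algebras D (cmat_algebra n)" "n \<ge> 1"
  shows "\<one> \<noteq> \<zero>"
proof
  assume e: "\<one> = \<zero>"
  obtain \<phi> where phi: "\<phi> \<in> alg_iso D (cmat_algebra n)"
    using assms(2) by (auto simp: isomorphic_algebras_def)
  have "(1\<^sub>m n :: complex mat) = 0\<^sub>m n n"
    using alg_isoD(5)[OF phi] alg_iso_zero[OF phi assms(1) ualg_matrix_algebra] e by simp
  then have "(1\<^sub>m n :: complex mat) $$ (0, 0) = 0\<^sub>m n n $$ (0, 0)" by simp
  then show False using assms(3) by simp
qed

section \<open>Commutation factors, signs of squares and the centre of a twisted group
  algebra\<close>

definition comm_factor :: "('g \<Rightarrow> 'g \<Rightarrow> real) \<Rightarrow> 'g \<Rightarrow> 'g \<Rightarrow> real" where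
  "comm_factor \<sigma> s t = \<sigma> s t / \<sigma> t s"

text \<open>At an involution \<open>t\<close> the square of \<open>X t\<close> is the real scalar
  \<open>\<sigma> t t\<close>, and rescaling \<open>X t\<close> changes it by a positive factor. At
  other degrees the square is a multiple of another basis vector, whose own sign is a matter of
  choice.\<close>

definition square_sign :: "('g \<Rightarrow> 'g \<Rightarrow> real) \<Rightarrow> 'g \<Rightarrow> real" where
  "square_sign \<sigma> t = sgn (\<sigma> t t)"

lemma gbasis_comm:
  assumes "gbasis T D X \<sigma>" "s \<in> carrier T" "t \<in> carrier T"
  shows "X s \<otimes>\<^bsub>D\<^esub> X t = comm_factor \<sigma> s t \<odot>\<^bsub>D\<^esub> (X t \<otimes>\<^bsub>D\<^esub> X s)"
proof -
  note g = gbasisD[OF assms(1)]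
  interpret D: ualg D by (rule g)
  interpret T: comm_group T by (rule g)
  show ?thesis using g(5)[of t s] g(6) g(8)[of "s \<otimes>\<^bsub>T\<^esub> t"] assms(2,3) T.m_comm[of s t] by (simp add: comm_factor_def)
qed

text \<open>Conceptually, conjugation by \<open>X w\<close> is an automorphism that scales each
  \<open>X u\<close> by the commutation factor. The proof eliminates the unwanted coefficients from
  three instances of the cocycle identity.\<close>

lemma comm_factor_mult:
  fixes T (structure)
  assumes "gbasis T D X \<sigma>" "u \<in> carrier T" "v \<in> carrier T" "w \<in> carrier T"
  shows "comm_factor \<sigma> (u \<otimes> v) w = comm_factor \<sigma> u w * comm_factor \<sigma> v w"
proof -
  note g = gbasisD[OF assms(1)] and c = gbasis_sigma(3)[OF assms(1)]
  interpret T: comm_group T by (rule g)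
  have nz: "\<sigma> u v \<noteq> 0" "\<sigma> w u \<noteq> 0" "\<sigma> w v \<noteq> 0" "\<sigma> w (u \<otimes> v) \<noteq> 0" using g(5) assms by auto
  have 1: "\<sigma> u v * \<sigma> (u \<otimes> v) w = \<sigma> u (v \<otimes> w) * \<sigma> v w" using c assms by auto
  have 2: "\<sigma> w u * \<sigma> (u \<otimes> w) v = \<sigma> w (u \<otimes> v) * \<sigma> u v" using c[of w u v] assms by (simp add: T.m_comm)
  have 3: "\<sigma> u w * \<sigma> (u \<otimes> w) v = \<sigma> u (v \<otimes> w) * \<sigma> w v" using c[of u w v] assms by (simp add: T.m_comm)
  have arith: "b / h = (p / d) * (c / q)"
    if "a * b = k * c" "d * e = h * a" "p * e = k * q" "a \<noteq> 0" "d \<noteq> 0" "q \<noteq> 0" "h \<noteq> 0"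
    for a b c d e h k p q :: real
  proof -
    have e: "e = h * a / d" using that by (simp add: field_simps)
    then have "e \<noteq> 0" using that by simp
    have k: "k = p * e / q" using that by (simp add: field_simps)
    have "b = k * c / a" using that by (simp add: field_simps)
    then show ?thesis unfolding k e using that by (simp add: field_simps)
  qed
  show ?thesis unfolding comm_factor_def by (rule arith[OF 1 2 3]) (use nz in auto)
qed

lemma gbasis_right_cancel:
  fixes D (structure)
  assumes g: "gbasis T D X \<sigma>" and u: "u \<in> carrier T" and y: "y \<in> carrier D" "X u \<otimes> y = \<zero>"
  shows "y = \<zero>"
proof -
  note g' = gbasisD[OF g]
  interpret D: ualg D by (rule g')
  interpret T: comm_group T by (rule g')
  let ?v = "inv\<^bsub>T\<^esub> u"
  have "X ?v \<otimes> (X u \<otimes> y) = \<sigma> ?v u \<odot> y"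
    using g'(4,6,8) u y(1) by (simp add: D.m_assoc[symmetric])
  then have "\<sigma> ?v u \<odot> y = \<zero>" using y g'(8) u by simp
  then show ?thesis using D.sm_eq_0[OF y(1), of "\<sigma> ?v u"] g'(5)[of ?v u] u by simp
qed

text \<open>Passing \<open>X u\<close> through a combination multiplies each coefficient by a
  commutation factor. For a central element the coefficients before and after must agree, which
  restricts its support.\<close>

lemma lc_mult_basis:
  fixes D (structure)
  assumes g: "gbasis T D X \<sigma>" and u: "u \<in> carrier T"
  shows "ualg.lc D (carrier T) X c \<otimes> X u =
    X u \<otimes> ualg.lc D (carrier T) X (\<lambda>t. c t * comm_factor \<sigma> t u)"
proof -
  note g' = gbasisD[OF g]
  interpret D: ualg D by (rule g')
  have X: "X \<in> carrier T \<rightarrow> carrier D" using g'(8) by auto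
  have "D.lc (carrier T) X c \<otimes> X u = finsum D (\<lambda>t. (c t \<odot> X t) \<otimes> X u) (carrier T)"
    unfolding D.lc_def by (rule D.finsum_ldistr) (use g'(7,8) u in auto)
  also have "\<dots> = finsum D (\<lambda>t. X u \<otimes> ((c t * comm_factor \<sigma> t u) \<odot> X t)) (carrier T)"
    by (rule D.finsum_cong') (use g'(8) u gbasis_comm[OF g _ u] in auto)
  also have "\<dots> = X u \<otimes> D.lc (carrier T) X (\<lambda>t. c t * comm_factor \<sigma> t u)"
    unfolding D.lc_def by (rule D.finsum_rdistr[symmetric]) (use g'(7,8) u in auto)
  finally show ?thesis .
qed

text \<open>The centre is compared with the basis in both directions. Expanding \<open>J\<close> in
  the basis shows that some nontrivial radical element exists; expressing a central
  \<open>X t\<close> through 1 and \<open>J\<close> shows that there is only one.\<close>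

lemma qdata_gbasis:
  fixes D (structure)
  assumes g: "gbasis T D X \<sigma>" and ne: "\<one> \<noteq> \<zero>"
    and J: "J \<in> carrier D" "\<And>x. x \<in> carrier D \<Longrightarrow> x \<otimes> J = J \<otimes> x"
    "J \<otimes> J = (-1) \<odot> \<one>"
    and center: "\<And>z. z \<in> carrier D \<Longrightarrow> (\<And>x. x \<in> carrier D \<Longrightarrow> x \<otimes> z = z \<otimes> x) \<Longrightarrow>
      \<exists>a b. z = a \<odot> \<one> \<oplus> b \<odot> J"
  obtains f where "qdata T (comm_factor \<sigma>) (square_sign \<sigma>) f"
proof -
  note g' = gbasisD[OF g]
  interpret D: ualg D by (rule g')
  interpret T: comm_group T by (rule g')
  let ?\<beta> = "comm_factor \<sigma>"
  have X: "X \<in> carrier T \<rightarrow> carrier D" using g'(8) by auto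
  have fb: "D.fbasis (carrier T) X" by (rule g')
  have ind: "D.indep (carrier T) X" using fb by (simp add: D.fbasis_def)
  have bm: "?\<beta> (u \<otimes>\<^bsub>T\<^esub> v) w = ?\<beta> u w * ?\<beta> v w" if "u \<in> carrier T" "v \<in> carrier T" "w \<in> carrier T" for u v w
    using comm_factor_mult[OF g that] .
  have bone: "?\<beta> \<one>\<^bsub>T\<^esub> w = 1" if "w \<in> carrier T" for w
    using gbasis_sigma(1,2)[OF g that] by (simp add: comm_factor_def)
  \<comment> \<open>A homomorphism from a finite group to the nonzero reals takes values 1 and -1.
    Finiteness enters through the coincidence of two powers of \<open>u\<close>.\<close>
  have bval: "?\<beta> u v = 1 \<or> ?\<beta> u v = -1" if uv: "u \<in> carrier T" "v \<in> carrier T" for u v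
  proof -
    have p: "?\<beta> (u [^]\<^bsub>T\<^esub> (k::nat)) v = ?\<beta> u v ^ k" for k
      by (induction k) (use uv bone bm in auto)
    have "\<not> inj (\<lambda>k::nat. u [^]\<^bsub>T\<^esub> k)"
    proof
      assume "inj (\<lambda>k::nat. u [^]\<^bsub>T\<^esub> k)"
      then have "infinite (range (\<lambda>k::nat. u [^]\<^bsub>T\<^esub> k))" by (rule range_inj_infinite)
      moreover have "range (\<lambda>k::nat. u [^]\<^bsub>T\<^esub> k) \<subseteq> carrier T" using uv(1) by auto
      ultimately show False using g'(7) finite_subset by blast
    qed
    then obtain i j :: nat where ij: "i < j" "u [^]\<^bsub>T\<^esub> i = u [^]\<^bsub>T\<^esub> j"
      unfolding inj_def by (metis linorder_neqE_nat)
    have nz: "?\<beta> u v \<noteq> 0" using g'(5) uv by (simp add: comm_factor_def)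
    have "?\<beta> u v ^ i * ?\<beta> u v ^ (j - i) = ?\<beta> u v ^ i"
      using p[of i] p[of j] ij by (simp add: power_add[symmetric])
    then have "?\<beta> u v ^ (j - i) = 1" using nz by simp
    then have "\<bar>?\<beta> u v\<bar> = 1"
      using power_eq_imp_eq_base[of "\<bar>?\<beta> u v\<bar>" "j - i" 1] ij(1) by (simp add: power_abs[symmetric])
    then show ?thesis by linarith
  qed
  have binv: "?\<beta> u v * ?\<beta> v u = 1" if "u \<in> carrier T" "v \<in> carrier T" for u v
    using g'(5) that by (simp add: comm_factor_def)
  have bsym: "?\<beta> u v = ?\<beta> v u" if uv: "u \<in> carrier T" "v \<in> carrier T" for u v
    using binv[OF uv] bval[OF uv] by auto
  have balt: "?\<beta> u u = 1" if "u \<in> carrier T" for u using g'(5) that by (simp add: comm_factor_def)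
  define R where "R = {t \<in> carrier T. \<forall>u\<in>carrier T. ?\<beta> u t = 1}"
  have R1: "\<one>\<^bsub>T\<^esub> \<in> R" unfolding R_def using bsym bone by auto
  have cent: "x \<otimes> X t = X t \<otimes> x" if t: "t \<in> R" and x: "x \<in> carrier D" for t x
    using fb x
  proof (induction rule: D.fbasis_induct)
    have Xt: "X t \<in> carrier D" using t g'(8) by (auto simp: R_def)
    case zero then show ?case using Xt by simp
    case (add x y) then show ?case using Xt by (simp add: D.l_distr D.r_distr)
    case (smult r x) then show ?case using Xt by simp
  next
    case (basis u)
    have "?\<beta> u t = 1" "t \<in> carrier T" using t basis by (auto simp: R_def)
    then show ?case using gbasis_comm[OF g basis, of t] g'(8) basis by simp
  qed
  obtain c where c: "J = D.lc (carrier T) X c" using fb J(1) by (auto simp: D.fbasis_def)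
  \<comment> \<open>\<open>J\<close> commutes with \<open>X u\<close>, so
    \<open>c t = c t * ?\<beta> t u\<close> for each \<open>u\<close>; outside the radical some
    factor differs from 1.\<close>
  have cR: "c t = 0" if t: "t \<in> carrier T" "t \<notin> R" for t
  proof -
    obtain u where u: "u \<in> carrier T" "?\<beta> u t \<noteq> 1" using t by (auto simp: R_def)
    let ?d = "\<lambda>t. c t * ?\<beta> t u"
    have "X u \<otimes> D.lc (carrier T) X c = X u \<otimes> D.lc (carrier T) X ?d"
      using J(2)[of "X u"] lc_mult_basis[OF g u(1), of c] g'(8)[OF u(1)] c by simp
    then have "X u \<otimes> (D.lc (carrier T) X c \<ominus> D.lc (carrier T) X ?d) = \<zero>"
      using g'(8)[OF u(1)] D.lc_closed[OF X] by (simp add: a_minus_def D.r_distr D.r_minus D.r_neg)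
    then have "X u \<otimes> D.lc (carrier T) X (\<lambda>t. c t - ?d t) = \<zero>" unfolding D.lc_minus[OF X] .
    then have "D.lc (carrier T) X (\<lambda>t. c t - ?d t) = \<zero>"
      using gbasis_right_cancel[OF g u(1)] D.lc_closed[OF X] by blast
    then have "c t - ?d t = 0" using ind t(1) unfolding D.indep_def by blast
    then show "c t = 0" using u bsym[OF t(1) u(1)] by simp
  qed
  have Jns: "J \<noteq> r \<odot> \<one>" for r
  proof
    assume "J = r \<odot> \<one>"
    then have "(r * r) \<odot> \<one> = (-1) \<odot> \<one>" using J(3) by simp
    then have "r * r = -1" using D.sm_cancel[OF D.one_closed ne] by blast
    then show False using zero_le_square[of r] by linarith
  qed
  \<comment> \<open>Otherwise \<open>J\<close> would be a real multiple of 1, and no real number has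
    square -1.\<close>
  have supp: "\<exists>t\<in>R. t \<noteq> \<one>\<^bsub>T\<^esub>"
  proof (rule ccontr)
    assume a: "\<not> (\<exists>t\<in>R. t \<noteq> \<one>\<^bsub>T\<^esub>)"
    have "J = D.lc (carrier T) X (\<lambda>t. if t = \<one>\<^bsub>T\<^esub> then c \<one>\<^bsub>T\<^esub> else 0)"
      unfolding c by (rule D.lc_cong[OF X]) (use a cR in auto)
    then show False using D.lc_single[OF g'(7) T.one_closed X] g'(4) Jns by metis
  qed
  \<comment> \<open>Since \<open>X t\<close> is central it has the form \<open>a 1 + b J\<close>.
    Comparing coordinates at \<open>t\<close> gives \<open>b * c t = 1\<close>, and comparing the
    others shows that \<open>J\<close> has no coordinates besides \<open>\<one>\<close> and
    \<open>t\<close>. Two different nontrivial radical elements would contradict each other.\<close>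
  have key: "\<exists>a b. X t = a \<odot> \<one> \<oplus> b \<odot> J \<and> b \<noteq> 0 \<and> c t \<noteq> 0 \<and>
      (\<forall>s\<in>carrier T. s \<noteq> \<one>\<^bsub>T\<^esub> \<longrightarrow> s \<noteq> t \<longrightarrow> c s = 0)" if t: "t \<in> R" "t \<noteq> \<one>\<^bsub>T\<^esub>" for t
  proof -
    have tT: "t \<in> carrier T" using t by (auto simp: R_def)
    obtain a b where ab: "X t = a \<odot> \<one> \<oplus> b \<odot> J"
      using center[OF g'(8)[OF tT]] cent[OF t(1)] by blast
    let ?e = "\<lambda>t s. if s = t then 1 else 0 :: real"
    have "D.lc (carrier T) X (?e t) = D.lc (carrier T) X (\<lambda>s. a * ?e \<one>\<^bsub>T\<^esub> s + b * c s)"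
      using ab c D.lc_single[OF g'(7) tT X, of 1] D.lc_single[OF g'(7) T.one_closed X, of 1] g'(4) g'(8)[OF tT]
      by (simp add: D.lc_add[OF X] D.lc_smult[OF X])
    then have e: "?e t s = a * ?e \<one>\<^bsub>T\<^esub> s + b * c s" if "s \<in> carrier T" for s
      using D.indep_eq[OF X ind _ that] by blast
    have bc: "b * c t = 1" using e[OF tT] t(2) by simp
    have "c s = 0" if "s \<in> carrier T" "s \<noteq> \<one>\<^bsub>T\<^esub>" "s \<noteq> t" for s
      using e[OF that(1)] that bc by auto
    then show ?thesis using ab bc by (intro exI[of _ a] exI[of _ b]) auto
  qed
  obtain f where f: "f \<in> R" "f \<noteq> \<one>\<^bsub>T\<^esub>" using supp by blast
  have fT: "f \<in> carrier T" using f by (auto simp: R_def)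
  have RR: "R = {\<one>\<^bsub>T\<^esub>, f}"
  proof -
    have "t = \<one>\<^bsub>T\<^esub> \<or> t = f" if t: "t \<in> R" for t
    proof (rule ccontr)
      assume n: "\<not> ?thesis"
      then have "c t \<noteq> 0" using key[OF t] by blast
      moreover have "t \<in> carrier T" using t by (auto simp: R_def)
      ultimately show False using key[OF f] n by blast
    qed
    then show ?thesis using R1 f by auto
  qed
  have sq: "t \<otimes>\<^bsub>T\<^esub> t = \<one>\<^bsub>T\<^esub> \<or> t \<otimes>\<^bsub>T\<^esub> t = f" if t: "t \<in> carrier T" for t
  proof -
    have "?\<beta> u (t \<otimes>\<^bsub>T\<^esub> t) = 1" if u: "u \<in> carrier T" for u
      using bsym[OF u, of "t \<otimes>\<^bsub>T\<^esub> t"] bm[OF t t u] bval[OF t u] t by auto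
    then have "t \<otimes>\<^bsub>T\<^esub> t \<in> R" using t by (auto simp: R_def)
    then show ?thesis using RR by auto
  qed
  have ff: "f \<otimes>\<^bsub>T\<^esub> f = \<one>\<^bsub>T\<^esub>" using sq[OF fT] f(2) fT by auto
  \<comment> \<open>The square of \<open>X f = a 1 + b J\<close> is real because \<open>f\<close> is
    an involution. Its \<open>J\<close>-part \<open>2 a b\<close> must therefore vanish, and as
    \<open>b\<close> is nonzero the square is \<open>- b^2\<close>.\<close>
  have sig_f: "\<sigma> f f < 0"
  proof -
    obtain a b where ab: "X f = a \<odot> \<one> \<oplus> b \<odot> J" "b \<noteq> 0" using key[OF f] by blast
    have "X f \<otimes> X f = (a * a) \<odot> \<one> \<oplus> (a * b) \<odot> J \<oplus> ((b * a) \<odot> J \<oplus> (b * b) \<odot> (J \<otimes> J))"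
      unfolding ab(1) using J(1) by (simp add: D.l_distr D.r_distr D.sm_add_r mult.commute)
    also have "\<dots> = (a * a - b * b) \<odot> \<one> \<oplus> (2 * a * b) \<odot> J"
    proof -
      have "(a * a - b * b) \<odot> \<one> = (a * a) \<odot> \<one> \<oplus> (b * b) \<odot> ((-1) \<odot> \<one>)"
        using D.sm_add_l[of "\<one>" "a * a" "- (b * b)"] by simp
      moreover have "(2 * a * b) \<odot> J = (a * b) \<odot> J \<oplus> (b * a) \<odot> J"
      proof -
        have "2 * a * b = a * b + b * a" by simp
        then show ?thesis using D.sm_add_l[OF J(1), of "a * b" "b * a"] by (simp only:)
      qed
      ultimately show ?thesis unfolding J(3) using J(1) by (simp add: D.a_ac)
    qed
    finally have e: "\<sigma> f f \<odot> \<one> = (a * a - b * b) \<odot> \<one> \<oplus> (2 * a * b) \<odot> J"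
      using g'(6)[OF fT fT] ff g'(4) by simp
    have a0: "a = 0"
    proof (rule ccontr)
      assume a: "a \<noteq> 0"
      have "(2 * a * b) \<odot> J = (\<sigma> f f - (a * a - b * b)) \<odot> \<one>"
      proof -
        have "(\<sigma> f f - (a * a - b * b)) \<odot> \<one> = \<sigma> f f \<odot> \<one> \<oplus> (- (a * a - b * b)) \<odot> \<one>"
          using D.sm_add_l[OF D.one_closed, of "\<sigma> f f" "- (a * a - b * b)"]
          by (simp only: diff_conv_add_uminus[of "\<sigma> f f" "a * a - b * b"])
        also have "\<dots> = \<sigma> f f \<odot> \<one> \<ominus> (a * a - b * b) \<odot> \<one>"
          by (simp only: D.sm_minus D.one_closed a_minus_def)
        also have "\<dots> = (2 * a * b) \<odot> J"
          unfolding e using J(1) by (simp add: a_minus_def D.a_ac D.r_neg1 D.r_neg D.r_neg2)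
        finally show ?thesis by simp
      qed
      then have "(1 / (2 * a * b)) \<odot> ((2 * a * b) \<odot> J) = (1 / (2 * a * b)) \<odot> ((\<sigma> f f - (a * a - b * b)) \<odot> \<one>)"
        by simp
      then have "J = ((\<sigma> f f - (a * a - b * b)) / (2 * a * b)) \<odot> \<one>"
        using a ab(2) J(1) by simp
      then show False using Jns by blast
    qed
    have "\<sigma> f f \<odot> \<one> = (- (b * b)) \<odot> \<one>" using e a0 J(1) by simp
    then have "\<sigma> f f = - (b * b)" by (rule D.sm_cancel[OF D.one_closed ne])
    then show ?thesis using ab(2) by (metis neg_less_0_iff_less not_real_square_gt_zero)
  qed
  \<comment> \<open>The square of \<open>X s X t\<close> is computed twice: directly, with the
    positive factor \<open>(\<sigma> s t)^2\<close>, and after exchanging the two middle factors at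
    the cost of a commutation factor. Taking signs removes the positive factor.\<close>
  have mum: "square_sign \<sigma> (s \<otimes>\<^bsub>T\<^esub> t) = square_sign \<sigma> s * square_sign \<sigma> t * ?\<beta> s t"
    if st: "s \<in> carrier T" "t \<in> carrier T" "s \<otimes>\<^bsub>T\<^esub> s = \<one>\<^bsub>T\<^esub>" "t \<otimes>\<^bsub>T\<^esub> t = \<one>\<^bsub>T\<^esub>" for s t
  proof -
    have Xst: "X s \<in> carrier D" "X t \<in> carrier D" "X (s \<otimes>\<^bsub>T\<^esub> t) \<in> carrier D" using g'(8) st by auto
    have st2: "(s \<otimes>\<^bsub>T\<^esub> t) \<otimes>\<^bsub>T\<^esub> (s \<otimes>\<^bsub>T\<^esub> t) = \<one>\<^bsub>T\<^esub>"
    proof -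
      have "(s \<otimes>\<^bsub>T\<^esub> t) \<otimes>\<^bsub>T\<^esub> (s \<otimes>\<^bsub>T\<^esub> t) = (s \<otimes>\<^bsub>T\<^esub> s) \<otimes>\<^bsub>T\<^esub> (t \<otimes>\<^bsub>T\<^esub> t)" using st(1,2) by (simp add: T.m_ac)
      then show ?thesis using st(3,4) by simp
    qed
    have "(X s \<otimes> X t) \<otimes> (X s \<otimes> X t) = (\<sigma> s t * \<sigma> s t * \<sigma> (s \<otimes>\<^bsub>T\<^esub> t) (s \<otimes>\<^bsub>T\<^esub> t)) \<odot> \<one>"
      using g'(6)[OF st(1,2)] g'(6)[of "s \<otimes>\<^bsub>T\<^esub> t" "s \<otimes>\<^bsub>T\<^esub> t"] st(1,2) st2 g'(4) Xst by (simp add: mult.assoc)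
    moreover have "(X s \<otimes> X t) \<otimes> (X s \<otimes> X t) = (?\<beta> t s * \<sigma> s s * \<sigma> t t) \<odot> \<one>"
    proof -
      have "(X s \<otimes> X t) \<otimes> (X s \<otimes> X t) = X s \<otimes> (X t \<otimes> X s) \<otimes> X t"
        using Xst by (simp add: D.m_assoc)
      also have "\<dots> = ?\<beta> t s \<odot> ((X s \<otimes> X s) \<otimes> (X t \<otimes> X t))"
        unfolding gbasis_comm[OF g st(2,1)] using Xst by (simp add: D.m_assoc)
      also have "\<dots> = (?\<beta> t s * \<sigma> s s * \<sigma> t t) \<odot> \<one>"
        using g'(6)[OF st(1,1)] g'(6)[OF st(2,2)] st g'(4) by (simp add: mult_ac)
      finally show ?thesis .
    qed
    ultimately have "\<sigma> s t * \<sigma> s t * \<sigma> (s \<otimes>\<^bsub>T\<^esub> t) (s \<otimes>\<^bsub>T\<^esub> t) = ?\<beta> t s * \<sigma> s s * \<sigma> t t"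
      using D.sm_cancel[OF D.one_closed ne] by metis
    then have "sgn (\<sigma> s t * \<sigma> s t * \<sigma> (s \<otimes>\<^bsub>T\<^esub> t) (s \<otimes>\<^bsub>T\<^esub> t)) = sgn (?\<beta> t s * \<sigma> s s * \<sigma> t t)" by simp
    moreover have "sgn (\<sigma> s t) * sgn (\<sigma> s t) = 1" using g'(5)[OF st(1,2)] by (simp add: sgn_if)
    moreover have "sgn (?\<beta> t s) = ?\<beta> s t" using bval[OF st(1,2)] bsym[OF st(1,2)] by auto
    ultimately show ?thesis unfolding square_sign_def by (simp add: sgn_mult mult_ac)
  qed
  have "qdata T ?\<beta> (square_sign \<sigma>) f"
  proof (rule qdata.intro[OF g'(2)], rule qdata_axioms.intro, goal_cases)
    case (8 t) then show ?case using RR unfolding R_def by blast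
  next
    case (10 t) then show ?case using g'(5)[of t t] by (auto simp: square_sign_def sgn_if)
  qed (use g'(7) bval bm bsym balt fT f(2) sq mum sig_f in \<open>auto simp: square_sign_def\<close>)
  then show thesis by (rule that)
qed

section \<open>The structure of the support\<close>

lemma carrier_Z2_pow: "carrier (Z2_pow k) = ({..<k} \<rightarrow>\<^sub>E {0, 1})"
proof -
  have "{0..<2::int} = {0, 1}" by auto
  then show ?thesis by (simp add: Z2_pow_def carrier_integer_mod_group)
qed

lemma one_Z2_pow [simp]: "\<one>\<^bsub>Z2_pow k\<^esub> = (\<lambda>i\<in>{..<k}. 0)"
  and mult_Z2_pow: "x \<otimes>\<^bsub>Z2_pow k\<^esub> y = (\<lambda>i\<in>{..<k}. (x i + y i) mod 2)"
  by (simp_all add: Z2_pow_def)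

lemma group_Z2_pow [simp]: "Group.group (Z2_pow k)"
  unfolding Z2_pow_def by (rule product_group) simp

lemma card_Z2_pow: "card (carrier (Z2_pow k)) = 2 ^ k"
  by (simp add: carrier_Z2_pow card_PiE numeral_2_eq_2)

lemma Z2_pow_square: "x \<in> carrier (Z2_pow k) \<Longrightarrow> x \<otimes>\<^bsub>Z2_pow k\<^esub> x = \<one>\<^bsub>Z2_pow k\<^esub>"
  by (auto simp: carrier_Z2_pow mult_Z2_pow PiE_iff intro!: restrict_ext)

text \<open>The two invariants through which abstract isomorphism types are used: whether the
  exponent divides two, which separates the two kinds of support, and the order, which fixes the
  parameter.\<close>

lemma iso_square:
  fixes T (structure)
  assumes "T \<cong> K" "Group.group T" "Group.group K"
  shows "(\<forall>t\<in>carrier T. t \<otimes> t = \<one>) \<longleftrightarrow> (\<forall>t\<in>carrier K. t \<otimes>\<^bsub>K\<^esub> t = \<one>\<^bsub>K\<^esub>)"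
    and "card (carrier T) = card (carrier K)"
proof -
  obtain h where h: "h \<in> iso T K" using assms(1) by (auto simp: is_iso_def)
  then have hh: "h \<in> hom T K" and b: "bij_betw h (carrier T) (carrier K)" by (auto simp: iso_def)
  interpret T: Group.group T by fact
  interpret K: Group.group K by fact
  interpret group_hom T K h using hh by unfold_locales
  show "card (carrier T) = card (carrier K)" using b by (rule bij_betw_same_card)
  have e: "h t \<otimes>\<^bsub>K\<^esub> h t = \<one>\<^bsub>K\<^esub> \<longleftrightarrow> t \<otimes> t = \<one>" if t: "t \<in> carrier T" for t
  proof -
    have "h t \<otimes>\<^bsub>K\<^esub> h t = h (t \<otimes> t)" "\<one>\<^bsub>K\<^esub> = h \<one>" using t by auto
    moreover have "h (t \<otimes> t) = h \<one> \<longleftrightarrow> t \<otimes> t = \<one>"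
      using b t by (intro inj_on_eq_iff) (auto simp: bij_betw_def)
    ultimately show ?thesis by simp
  qed
  have "carrier K = h ` carrier T" using b by (simp add: bij_betw_def)
  then show "(\<forall>t\<in>carrier T. t \<otimes> t = \<one>) \<longleftrightarrow> (\<forall>t\<in>carrier K. t \<otimes>\<^bsub>K\<^esub> t = \<one>\<^bsub>K\<^esub>)" using e by auto
qed

lemma Z4_carrier: "carrier Z4 = {0, 1, 2, 3}"
  by (auto simp: carrier_integer_mod_group)

lemma Z2_pow_Z4_not_square: "\<not> (\<forall>t\<in>carrier (Z2_pow_Z4 k). t \<otimes>\<^bsub>Z2_pow_Z4 k\<^esub> t = \<one>\<^bsub>Z2_pow_Z4 k\<^esub>)"
proof -
  have "(\<one>\<^bsub>Z2_pow k\<^esub>, 1) \<in> carrier (Z2_pow_Z4 k)"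
    unfolding Z2_pow_Z4_def using Group.group.is_monoid[OF group_Z2_pow, THEN Group.monoid.one_closed, of k]
    by (simp add: DirProd_def Z4_carrier)
  moreover have "(\<one>\<^bsub>Z2_pow k\<^esub>, 1) \<otimes>\<^bsub>Z2_pow_Z4 k\<^esub> (\<one>\<^bsub>Z2_pow k\<^esub>, 1) \<noteq> \<one>\<^bsub>Z2_pow_Z4 k\<^esub>"
    unfolding Z2_pow_Z4_def by (simp add: DirProd_def)
  ultimately show ?thesis by blast
qed

lemma card_Z2_pow_Z4: "card (carrier (Z2_pow_Z4 k)) = 2 ^ k * 4"
  unfolding Z2_pow_Z4_def by (simp add: DirProd_def card_cartesian_product card_Z2_pow Z4_carrier)

lemma group_Z2_pow_Z4: "Group.group (Z2_pow_Z4 k)"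
  unfolding Z2_pow_Z4_def by (rule DirProd_group) auto

text \<open>An involution \<open>t\<close> outside the image becomes the image of one new
  coordinate. Injectivity holds because a collision would write \<open>t\<close> as a quotient of
  two values of \<open>h\<close>. The last clause preserves the restriction to \<open>K\<close>; its
  trailing factor \<open>\<one>\<close> is there because \<open>y\<close> ranges over the whole
  type, where \<open>h\<close> need not take values in the carrier.\<close>

lemma extend_Z2_pow_hom:
  fixes T :: "('g, 'c) monoid_scheme" (structure) and K :: "('k, 'e) monoid_scheme"
  assumes T: "comm_group T" and K: "Group.group K"
    and h: "h \<in> hom (Z2_pow k \<times>\<times> K) T" "inj_on h (carrier (Z2_pow k \<times>\<times> K))"
    and t: "t \<in> carrier T" "t \<otimes> t = \<one>" "t \<notin> h ` carrier (Z2_pow k \<times>\<times> K)"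
  shows "\<exists>h'\<in>hom (Z2_pow (Suc k) \<times>\<times> K) T. inj_on h' (carrier (Z2_pow (Suc k) \<times>\<times> K)) \<and>
    (\<forall>y. h' (\<one>\<^bsub>Z2_pow (Suc k)\<^esub>, y) = h (\<one>\<^bsub>Z2_pow k\<^esub>, y) \<otimes> \<one>)"
proof -
  interpret T: comm_group T by fact
  interpret K: Group.group K by fact
  let ?Z = "Z2_pow k \<times>\<times> K"
  interpret Z: Group.group ?Z by (rule DirProd_group) (auto simp: K)
  interpret h: group_hom ?Z T h using h by unfold_locales
  define \<tau> where "\<tau> i = (if i = (1::int) then t else \<one>)" for i
  define r where "r = (\<lambda>(x, y). (restrict (x :: nat \<Rightarrow> int) {..<k}, y :: 'k))"
  define h' where "h' = (\<lambda>z. h (r z) \<otimes> \<tau> (fst z k))"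
  have tau: "\<tau> i \<in> carrier T" "\<tau> i \<otimes> \<tau> i = \<one>" for i using t by (auto simp: \<tau>_def)
  have tau_add: "\<tau> ((i + j) mod 2) = \<tau> i \<otimes> \<tau> j" if "i \<in> {0, 1}" "j \<in> {0, 1}" for i j
    using that t by (auto simp: \<tau>_def)
  have rc: "r z \<in> carrier ?Z" "fst z k \<in> {0, 1}" if "z \<in> carrier (Z2_pow (Suc k) \<times>\<times> K)" for z
  proof -
    obtain x y where xy: "z = (x, y)" by fastforce
    have x: "x \<in> ({..<Suc k} \<rightarrow>\<^sub>E {0, 1})" and y: "y \<in> carrier K"
      using that unfolding xy by (auto simp: carrier_Z2_pow)
    have "restrict x {..<k} \<in> ({..<k} \<rightarrow>\<^sub>E {0, 1})"
      unfolding restrict_PiE_iff by (intro ballI PiE_mem[OF x]) simp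
    then show "r z \<in> carrier ?Z" using y by (simp add: xy r_def carrier_Z2_pow)
    show "fst z k \<in> {0, 1}" using PiE_mem[OF x, of k] by (simp add: xy)
  qed
  have rm: "r (z \<otimes>\<^bsub>Z2_pow (Suc k) \<times>\<times> K\<^esub> w) = r z \<otimes>\<^bsub>?Z\<^esub> r w"
    "fst (z \<otimes>\<^bsub>Z2_pow (Suc k) \<times>\<times> K\<^esub> w) k = (fst z k + fst w k) mod 2" for z w
  proof -
    obtain x y x' y' where xy: "z = (x, y)" "w = (x', y')" by fastforce
    have "restrict (\<lambda>i\<in>{..<Suc k}. (x i + x' i) mod 2) {..<k} =
      (\<lambda>i\<in>{..<k}. (restrict x {..<k} i + restrict x' {..<k} i) mod 2)"
      by (rule ext) simp
    then show "r (z \<otimes>\<^bsub>Z2_pow (Suc k) \<times>\<times> K\<^esub> w) = r z \<otimes>\<^bsub>?Z\<^esub> r w"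
      unfolding xy r_def mult_DirProd prod.case mult_Z2_pow by simp
    show "fst (z \<otimes>\<^bsub>Z2_pow (Suc k) \<times>\<times> K\<^esub> w) k = (fst z k + fst w k) mod 2"
      unfolding xy mult_DirProd mult_Z2_pow by simp
  qed
  have hc: "h a \<in> carrier T" if "a \<in> carrier ?Z" for a using that by (rule h.hom_closed)
  have "h' \<in> hom (Z2_pow (Suc k) \<times>\<times> K) T"
  proof (rule homI)
    show "h' z \<in> carrier T" if "z \<in> carrier (Z2_pow (Suc k) \<times>\<times> K)" for z
      unfolding h'_def using rc[OF that] tau hc by simp
    fix z w assume zw: "z \<in> carrier (Z2_pow (Suc k) \<times>\<times> K)" "w \<in> carrier (Z2_pow (Suc k) \<times>\<times> K)"
    have "h (r z \<otimes>\<^bsub>?Z\<^esub> r w) = h (r z) \<otimes> h (r w)" by (rule h.hom_mult) (use rc zw in auto)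
    then show "h' (z \<otimes>\<^bsub>Z2_pow (Suc k) \<times>\<times> K\<^esub> w) = h' z \<otimes> h' w"
      unfolding h'_def rm tau_add[OF rc(2)[OF zw(1)] rc(2)[OF zw(2)]]
      using tau hc[OF rc(1)[OF zw(1)]] hc[OF rc(1)[OF zw(2)]] by (simp add: T.m_ac)
  qed
  moreover have "inj_on h' (carrier (Z2_pow (Suc k) \<times>\<times> K))"
  proof (rule inj_onI)
    fix z w assume zw: "z \<in> carrier (Z2_pow (Suc k) \<times>\<times> K)" "w \<in> carrier (Z2_pow (Suc k) \<times>\<times> K)"
      and e: "h' z = h' w"
    note c = rc(1)[OF zw(1)] rc(1)[OF zw(2)]
    have s: "fst z k = fst w k"
    proof (rule ccontr)
      assume "fst z k \<noteq> fst w k"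
      then have "\<tau> (fst z k) = t \<and> \<tau> (fst w k) = \<one> \<or> \<tau> (fst z k) = \<one> \<and> \<tau> (fst w k) = t"
        using rc(2)[OF zw(1)] rc(2)[OF zw(2)] by (auto simp: \<tau>_def)
      then have "h (r z) \<otimes> t = h (r w) \<or> h (r w) \<otimes> t = h (r z)"
        using e hc[OF c(1)] hc[OF c(2)] unfolding h'_def by auto
      then have "\<exists>a b. a \<in> carrier ?Z \<and> b \<in> carrier ?Z \<and> h a \<otimes> t = h b"
        using c by blast
      then obtain a b where ab: "a \<in> carrier ?Z" "b \<in> carrier ?Z" "h a \<otimes> t = h b" by blast
      have "t = inv (h a) \<otimes> h b" unfolding ab(3)[symmetric] using hc[OF ab(1)] t(1)
        by (simp add: T.m_assoc[symmetric])
      also have "\<dots> = h (inv\<^bsub>?Z\<^esub> a \<otimes>\<^bsub>?Z\<^esub> b)"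
        unfolding h.hom_mult[OF Z.inv_closed[OF ab(1)] ab(2)] h.hom_inv[OF ab(1)] ..
      finally show False using t(3) ab Z.inv_closed Z.m_closed by blast
    qed
    have "h (r z) = h (r w)"
      using e hc[OF c(1)] hc[OF c(2)] tau(1)[of "fst w k"] unfolding h'_def s by simp
    then have rr: "r z = r w" using h(2) c by (auto dest: inj_onD)
    obtain x y x' y' where xy: "z = (x, y)" "w = (x', y')" by fastforce
    have "x i = x' i" for i
    proof (cases "i < k")
      case True
      have "restrict x {..<k} = restrict x' {..<k}" using rr xy by (simp add: r_def)
      then show ?thesis using True by (metis lessThan_iff restrict_apply')
    next
      case False
      show ?thesis
      proof (cases "i = k")
        case True then show ?thesis using s xy by simp
      next
        case False
        then have i: "i \<notin> {..<Suc k}" using \<open>\<not> i < k\<close> by auto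
        have x: "x \<in> ({..<Suc k} \<rightarrow>\<^sub>E {0, 1})" "x' \<in> ({..<Suc k} \<rightarrow>\<^sub>E {0, 1})"
          using zw xy by (auto simp: carrier_Z2_pow)
        show ?thesis using PiE_arb[OF x(1) i] PiE_arb[OF x(2) i] by simp
      qed
    qed
    then have "x = x'" by (rule ext)
    moreover have "y = y'" using rr unfolding xy r_def by simp
    ultimately show "z = w" using xy by simp
  qed
  moreover have "h' (\<one>\<^bsub>Z2_pow (Suc k)\<^esub>, y) = h (\<one>\<^bsub>Z2_pow k\<^esub>, y) \<otimes> \<one>" for y
  proof -
    have "restrict (\<lambda>i\<in>{..<Suc k}. 0) {..<k} = (\<lambda>i\<in>{..<k}. 0 :: int)" by (auto simp: fun_eq_iff)
    then show ?thesis by (simp add: h'_def r_def \<tau>_def)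
  qed
  ultimately show ?thesis by blast
qed

text \<open>Take the largest power of the two-element group that embeds together with
  \<open>K\<close> in a way extending \<open>h0\<close>. If the image were proper, some
  \<open>t\<close> outside it could be turned into an involution \<open>t \<otimes> h0 y\<close>,
  still outside, and the embedding could be extended. Both kinds of support follow, from trivial and
  from cyclic \<open>K\<close>.\<close>

lemma split_off_Z2_pow:
  fixes T (structure)
  assumes T: "comm_group T" and fin: "finite (carrier T)" and K: "Group.group K"
    and h0: "h0 \<in> hom K T" "inj_on h0 (carrier K)"
    and sq: "\<And>t. t \<in> carrier T \<Longrightarrow> \<exists>y\<in>carrier K. (t \<otimes> h0 y) \<otimes> (t \<otimes> h0 y) = \<one>"
  shows "\<exists>k. (Z2_pow k \<times>\<times> K) \<cong> T"
proof -
  interpret T: comm_group T by fact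
  interpret K: Group.group K by fact
  interpret h0: group_hom K T h0 using h0 by unfold_locales
  let ?P = "\<lambda>k. \<exists>h\<in>hom (Z2_pow k \<times>\<times> K) T. inj_on h (carrier (Z2_pow k \<times>\<times> K)) \<and>
    (\<forall>y\<in>carrier K. h (\<one>\<^bsub>Z2_pow k\<^esub>, y) = h0 y)"
  have P0: "?P 0"
  proof -
    have "(\<lambda>(x, y). h0 y) \<in> hom (Z2_pow 0 \<times>\<times> K) T" by (auto simp: hom_def)
    moreover have "inj_on (\<lambda>(x, y). h0 y) (carrier (Z2_pow 0 \<times>\<times> K))"
      using h0(2) by (auto simp: inj_on_def carrier_Z2_pow)
    ultimately show ?thesis by (intro bexI[of _ "\<lambda>(x, y). h0 y"]) auto
  qed
  have bound: "k \<le> card (carrier T)" if k: "?P k" for k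
  proof -
    obtain h where h: "h \<in> hom (Z2_pow k \<times>\<times> K) T" "inj_on h (carrier (Z2_pow k \<times>\<times> K))" using k by blast
    have "k < 2 ^ k" by (rule less_exp)
    also have "2 ^ k = card (carrier (Z2_pow k))" by (simp add: card_Z2_pow)
    also have "\<dots> = card ((\<lambda>x. h (x, \<one>\<^bsub>K\<^esub>)) ` carrier (Z2_pow k))"
      by (rule card_image[symmetric]) (use inj_onD[OF h(2)] in \<open>fastforce intro!: inj_onI\<close>)
    also have "\<dots> \<le> card (carrier T)"
      by (rule card_mono[OF fin]) (use h(1) in \<open>auto simp: hom_def Pi_iff\<close>)
    finally show ?thesis by simp
  qed
  \<comment> \<open>The maximum exists because an embedding forces \<open>2 ^ k\<close> to be at
    most the order of \<open>T\<close>.\<close>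
  define k where "k = (GREATEST k. ?P k)"
  have Pk: "?P k" unfolding k_def by (rule GreatestI_nat[of ?P, OF P0]) (use bound in blast)
  have nP: "\<not> ?P (Suc k)"
  proof
    assume "?P (Suc k)"
    then have "Suc k \<le> k" unfolding k_def by (rule Greatest_le_nat) (use bound in blast)
    then show False by simp
  qed
  obtain h where h: "h \<in> hom (Z2_pow k \<times>\<times> K) T" "inj_on h (carrier (Z2_pow k \<times>\<times> K))"
    "\<forall>y\<in>carrier K. h (\<one>\<^bsub>Z2_pow k\<^esub>, y) = h0 y" using Pk by blast
  let ?Z = "Z2_pow k \<times>\<times> K"
  interpret Z: Group.group ?Z by (rule DirProd_group) (auto simp: K)
  interpret h: group_hom ?Z T h using h by unfold_locales
  have "h ` carrier ?Z = carrier T"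
  proof (rule ccontr)
    assume "h ` carrier ?Z \<noteq> carrier T"
    then obtain t where t: "t \<in> carrier T" "t \<notin> h ` carrier ?Z" using h.hom_closed by blast
    obtain y where y: "y \<in> carrier K" "(t \<otimes> h0 y) \<otimes> (t \<otimes> h0 y) = \<one>" using sq[OF t(1)] by blast
    have yc: "(\<one>\<^bsub>Z2_pow k\<^esub>, y) \<in> carrier ?Z"
      using y(1) Group.group.is_monoid[OF group_Z2_pow, THEN Group.monoid.one_closed, of k] by simp
    have "t \<otimes> h0 y \<notin> h ` carrier ?Z"
    proof
      assume "t \<otimes> h0 y \<in> h ` carrier ?Z"
      then obtain a where a: "a \<in> carrier ?Z" "h a = t \<otimes> h0 y" by force
      have "h (a \<otimes>\<^bsub>?Z\<^esub> inv\<^bsub>?Z\<^esub> (\<one>\<^bsub>Z2_pow k\<^esub>, y)) = t \<otimes> h0 y \<otimes> inv (h0 y)"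
        using a yc h(3) y(1) h.hom_mult[OF a(1) Z.inv_closed[OF yc]] h.hom_inv[OF yc] by simp
      also have "\<dots> = t" using t(1) y(1) by (simp add: T.m_assoc)
      finally show False using t(2) a(1) Z.m_closed[OF a(1) Z.inv_closed[OF yc]] by blast
    qed
    moreover have "t \<otimes> h0 y \<in> carrier T" using t(1) y(1) by simp
    ultimately obtain h' where h': "h' \<in> hom (Z2_pow (Suc k) \<times>\<times> K) T"
      "inj_on h' (carrier (Z2_pow (Suc k) \<times>\<times> K))"
      "\<And>y. h' (\<one>\<^bsub>Z2_pow (Suc k)\<^esub>, y) = h (\<one>\<^bsub>Z2_pow k\<^esub>, y) \<otimes> \<one>"
      using extend_Z2_pow_hom[OF T K h(1,2) _ y(2)] by blast
    have "h' (\<one>\<^bsub>Z2_pow (Suc k)\<^esub>, z) = h0 z" if "z \<in> carrier K" for z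
      using h'(3)[of z] h(3) that by simp
    then have "?P (Suc k)" using h'(1,2) by blast
    then show False using nP by blast
  qed
  then have "h \<in> iso ?Z T" using h by (auto simp: iso_def bij_betw_def)
  then show ?thesis by (auto simp: is_iso_def)
qed

lemma elementary_group_iso:
  assumes T: "comm_group T" and fin: "finite (carrier T)"
    and sq: "\<And>t. t \<in> carrier T \<Longrightarrow> t \<otimes>\<^bsub>T\<^esub> t = \<one>\<^bsub>T\<^esub>"
  obtains k where "T \<cong> Z2_pow k"
proof -
  interpret T: comm_group T by fact
  \<comment> \<open>The trivial group plays the role of \<open>K\<close>: every element is already
    an involution or neutral, so no correction is required.\<close>
  let ?K = "integer_mod_group 1"
  have K: "carrier ?K = {0}" by (auto simp: carrier_integer_mod_group)
  have "\<exists>k. (Z2_pow k \<times>\<times> ?K) \<cong> T"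
    by (rule split_off_Z2_pow[OF T fin, of _ "\<lambda>_. \<one>\<^bsub>T\<^esub>"]) (use K sq in \<open>auto simp: hom_def\<close>)
  then obtain k where k: "(Z2_pow k \<times>\<times> ?K) \<cong> T" by blast
  have "fst \<in> iso (Z2_pow k \<times>\<times> ?K) (Z2_pow k)"
    unfolding iso_def hom_def bij_betw_def using K by (force simp: inj_on_def DirProd_def)
  then have "(Z2_pow k \<times>\<times> ?K) \<cong> Z2_pow k" by (auto simp: is_iso_def)
  moreover have "T \<cong> (Z2_pow k \<times>\<times> ?K)"
    by (rule Group.group.iso_sym[OF _ k]) (rule DirProd_group; simp)
  ultimately show thesis using that iso_trans by blast
qed

lemma order_four_group_iso:
  fixes T (structure)
  assumes T: "comm_group T" and fin: "finite (carrier T)"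
    and b: "b \<in> carrier T" "b \<otimes> b = f" "f \<noteq> \<one>" "f \<otimes> f = \<one>"
    and sq: "\<And>t. t \<in> carrier T \<Longrightarrow> t \<otimes> t = \<one> \<or> t \<otimes> t = f"
  obtains k where "T \<cong> Z2_pow_Z4 k"
proof -
  interpret T: comm_group T by fact
  have fc: "f \<in> carrier T" using b by auto
  have bb: "b \<otimes> b = f" "b \<otimes> f = f \<otimes> b" "f \<otimes> b \<otimes> b = \<one>"
    "b \<otimes> (f \<otimes> b) = \<one>" "f \<otimes> (f \<otimes> b) = b" "f \<otimes> b \<otimes> f = b"
    "f \<otimes> b \<otimes> (f \<otimes> b) = f"
  proof -
    have ffb: "f \<otimes> (f \<otimes> x) = x" if "x \<in> carrier T" for x
      using b(4) fc that by (simp add: T.m_assoc[symmetric])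
    show "b \<otimes> b = f" by (rule b)
    show "b \<otimes> f = f \<otimes> b" using T.m_comm b fc by blast
    show 1: "f \<otimes> b \<otimes> b = \<one>" using b fc by (simp add: T.m_assoc)
    show "b \<otimes> (f \<otimes> b) = \<one>" using 1 T.m_comm b fc by auto
    show "f \<otimes> (f \<otimes> b) = b" using ffb b by auto
    then show "f \<otimes> b \<otimes> f = b" using T.m_comm[of "f \<otimes> b" f] b fc by simp
    have "f \<otimes> b \<otimes> (f \<otimes> b) = (f \<otimes> f) \<otimes> (b \<otimes> b)" using b(1) fc by (simp add: T.m_ac)
    then show "f \<otimes> b \<otimes> (f \<otimes> b) = f" using b fc by simp
  qed
  \<comment> \<open>The powers of \<open>b\<close>, spelled out with \<open>b^2 = f\<close> and
    \<open>b^3 = f \<otimes> b\<close>.\<close>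
  define h0 where "h0 i = (if i = (0::int) then \<one> else if i = 1 then b else if i = 2 then f else f \<otimes> b)" for i
  have bne: "b \<noteq> \<one>" "b \<noteq> f" "f \<otimes> b \<noteq> \<one>" "f \<otimes> b \<noteq> b" "f \<otimes> b \<noteq> f"
    using b fc T.r_cancel_one[of b f] T.l_cancel_one[of f b] bb(3) by auto
  have "\<exists>k. (Z2_pow k \<times>\<times> Z4) \<cong> T"
  proof (rule split_off_Z2_pow[OF T fin, of _ h0])
    show "h0 \<in> hom Z4 T"
      unfolding hom_def Z4_carrier using b(1) fc bb b(4) by (auto simp: h0_def)
    show "inj_on h0 (carrier Z4)"
      unfolding inj_on_def Z4_carrier using bne b(3) by (auto simp: h0_def)
    fix t assume t: "t \<in> carrier T"
    show "\<exists>y\<in>carrier Z4. (t \<otimes> h0 y) \<otimes> (t \<otimes> h0 y) = \<one>"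
    proof (cases "t \<otimes> t = \<one>")
      case True then show ?thesis unfolding Z4_carrier using t by (auto simp: h0_def)
    next
      case False
      \<comment> \<open>Both squares equal \<open>f\<close>, so multiplication by \<open>b\<close>
        turns an element of order four into an involution.\<close>
      have "(t \<otimes> b) \<otimes> (t \<otimes> b) = (t \<otimes> t) \<otimes> (b \<otimes> b)" using b(1) t by (simp add: T.m_ac)
      then have "(t \<otimes> b) \<otimes> (t \<otimes> b) = \<one>" using sq[OF t] False b by simp
      then show ?thesis unfolding Z4_carrier by (intro bexI[of _ 1]) (auto simp: h0_def)
    qed
  qed simp
  then obtain k where k: "Z2_pow_Z4 k \<cong> T" unfolding Z2_pow_Z4_def by blast
  show thesis by (rule that, rule Group.group.iso_sym[OF group_Z2_pow_Z4 k])
qed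

lemma square_power_of_two:
  fixes n :: nat
  assumes "n * n = 2 ^ k"
  obtains m where "n = 2 ^ m" "k = 2 * m"
proof -
  have "n dvd 2 ^ k" using assms by (metis dvd_triv_left)
  then obtain m where m: "n = 2 ^ m" using divides_primepow_nat[of 2 n k] two_is_prime_nat by auto
  then have "(2::nat) ^ (2 * m) = 2 ^ k" using assms by (simp add: power_add mult_2)
  then have "k = 2 * m" by simp
  then show thesis using m that by blast
qed

text \<open>Only the order remains to be compared: \<open>2 n^2\<close> is \<open>2^k\<close> in the
  elementary case and \<open>4 * 2^k\<close> otherwise. A square that is a power of two has even
  exponent, so \<open>k\<close> is \<open>2m + 1\<close> or \<open>2m - 1\<close>, and in the second
  case \<open>k + 1 = 2m\<close> forces \<open>m \<ge> 1\<close>.\<close>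

lemma (in qdata) group_structure:
  assumes "card (carrier T) = 2 * (n * n)"
  shows "\<exists>m. n = 2 ^ m \<and> (T \<cong> Z2_pow (2 * m + 1) \<or> m \<ge> 1 \<and> T \<cong> Z2_pow_Z4 (2 * m - 1))"
proof (cases "\<forall>t\<in>carrier T. t \<otimes> t = \<one>")
  case True
  obtain k where k: "T \<cong> Z2_pow k" using elementary_group_iso[OF comm_group_axioms fin] True by blast
  have "card (carrier T) = 2 ^ k" using iso_square(2)[OF k is_group group_Z2_pow] by (simp add: card_Z2_pow)
  then have e: "2 * (n * n) = 2 ^ k" using assms by simp
  moreover have "k \<noteq> 0" using e by (cases "k = 0") auto
  ultimately have "n * n = 2 ^ (k - 1)" by (cases k) auto
  then obtain m where m: "n = 2 ^ m" "k - 1 = 2 * m" by (rule square_power_of_two)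
  then have "k = 2 * m + 1" using \<open>k \<noteq> 0\<close> by simp
  then show ?thesis using m k by blast
next
  case False
  then obtain b where b: "b \<in> carrier T" "b \<otimes> b = f" using square by blast
  obtain k where k: "T \<cong> Z2_pow_Z4 k"
    using order_four_group_iso[OF comm_group_axioms fin b f_ne f_square] square by blast
  have "card (carrier T) = 2 ^ k * 4" using iso_square(2)[OF k is_group group_Z2_pow_Z4] by (simp add: card_Z2_pow_Z4)
  then have "n * n = 2 ^ (k + 1)" using assms by simp
  then obtain m where m: "n = 2 ^ m" "k + 1 = 2 * m" by (rule square_power_of_two)
  then have "k = 2 * m - 1" "m \<ge> 1" by auto
  then show ?thesis using m k by blast
qed

section \<open>Monoid algebras\<close>

lemma monoid_algebra_simps [simp]:
  "\<one>\<^bsub>monoid_algebra M\<^esub> = delta \<one>\<^bsub>M\<^esub>" "\<zero>\<^bsub>monoid_algebra M\<^esub> = (\<lambda>w. 0)"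
  "p \<oplus>\<^bsub>monoid_algebra M\<^esub> q = (\<lambda>w. p w + q w)" "r \<odot>\<^bsub>monoid_algebra M\<^esub> p = (\<lambda>w. r * p w)"
  by (simp_all add: monoid_algebra_def delta_def fun_eq_iff)

lemma monoid_algebra_carrier:
  "p \<in> carrier (monoid_algebra M) \<longleftrightarrow> finite {u. p u \<noteq> 0} \<and> {u. p u \<noteq> 0} \<subseteq> carrier M"
  by (simp add: monoid_algebra_def)

text \<open>The product is defined by sums over the exact supports. Admitting larger finite index
  sets allows several products to be summed over one common set.\<close>

lemma monoid_algebra_mult:
  fixes M (structure)
  assumes "finite U" "{u. p u \<noteq> 0} \<subseteq> U" "finite V" "{v. q v \<noteq> 0} \<subseteq> V"
  shows "(p \<otimes>\<^bsub>monoid_algebra M\<^esub> q) w = (\<Sum>u\<in>U. \<Sum>v\<in>V. if u \<otimes> v = w then p u * q v else 0)"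
proof -
  have "(p \<otimes>\<^bsub>monoid_algebra M\<^esub> q) w =
    (\<Sum>u\<in>{u. p u \<noteq> 0}. \<Sum>v\<in>{v. q v \<noteq> 0}. if u \<otimes> v = w then p u * q v else 0)"
    by (simp add: monoid_algebra_def)
  also have "\<dots> = (\<Sum>u\<in>{u. p u \<noteq> 0}. \<Sum>v\<in>V. if u \<otimes> v = w then p u * q v else 0)"
    by (intro sum.cong refl sum.mono_neutral_left) (use assms in auto)
  also have "\<dots> = (\<Sum>u\<in>U. \<Sum>v\<in>V. if u \<otimes> v = w then p u * q v else 0)"
    by (intro sum.mono_neutral_left) (use assms in \<open>auto intro!: sum.neutral\<close>)
  finally show ?thesis .
qed

lemma delta_mult:
  "delta u \<otimes>\<^bsub>monoid_algebra M\<^esub> delta v = delta (u \<otimes>\<^bsub>M\<^esub> v)"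
proof
  fix w
  have "(delta u \<otimes>\<^bsub>monoid_algebra M\<^esub> delta v) w =
    (\<Sum>u'\<in>{u}. \<Sum>v'\<in>{v}. if u' \<otimes>\<^bsub>M\<^esub> v' = w then delta u u' * delta v v' else 0)"
    by (rule monoid_algebra_mult) (auto simp: delta_def)
  then show "(delta u \<otimes>\<^bsub>monoid_algebra M\<^esub> delta v) w = delta (u \<otimes>\<^bsub>M\<^esub> v) w" by (auto simp: delta_def)
qed

lemma delta_closed: "u \<in> carrier M \<Longrightarrow> delta u \<in> carrier (monoid_algebra M)"
  by (auto simp: monoid_algebra_carrier delta_def)

lemma monoid_algebra_mult_closed:
  fixes M (structure)
  assumes M: "Group.monoid M" and pq: "p \<in> carrier (monoid_algebra M)" "q \<in> carrier (monoid_algebra M)"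
  shows "p \<otimes>\<^bsub>monoid_algebra M\<^esub> q \<in> carrier (monoid_algebra M)"
    and "{w. (p \<otimes>\<^bsub>monoid_algebra M\<^esub> q) w \<noteq> 0} \<subseteq> (\<lambda>(u, v). u \<otimes> v) ` ({u. p u \<noteq> 0} \<times> {v. q v \<noteq> 0})"
proof -
  let ?U = "{u. p u \<noteq> 0}" and ?V = "{v. q v \<noteq> 0}"
  have fin: "finite ?U" "finite ?V" "?U \<subseteq> carrier M" "?V \<subseteq> carrier M" using pq by (auto simp: monoid_algebra_carrier)
  show sub: "{w. (p \<otimes>\<^bsub>monoid_algebra M\<^esub> q) w \<noteq> 0} \<subseteq> (\<lambda>(u, v). u \<otimes> v) ` (?U \<times> ?V)"
  proof
    fix w assume "w \<in> {w. (p \<otimes>\<^bsub>monoid_algebra M\<^esub> q) w \<noteq> 0}"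
    then have "(\<Sum>u\<in>?U. \<Sum>v\<in>?V. if u \<otimes> v = w then p u * q v else 0) \<noteq> 0"
      using monoid_algebra_mult[OF fin(1) order_refl fin(2) order_refl, of M w] by simp
    then obtain u where "u \<in> ?U" "(\<Sum>v\<in>?V. if u \<otimes> v = w then p u * q v else 0) \<noteq> 0"
      by (rule sum.not_neutral_contains_not_neutral)
    moreover from this(2) obtain v where "v \<in> ?V" "(if u \<otimes> v = w then p u * q v else 0) \<noteq> 0"
      by (rule sum.not_neutral_contains_not_neutral)
    ultimately show "w \<in> (\<lambda>(u, v). u \<otimes> v) ` (?U \<times> ?V)"
      by (intro image_eqI[of _ _ "(u, v)"]) (auto split: if_splits)
  qed
  have "(\<lambda>(u, v). u \<otimes> v) ` (?U \<times> ?V) \<subseteq> carrier M"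
    using fin Group.monoid.m_closed[OF M] by auto
  then show "p \<otimes>\<^bsub>monoid_algebra M\<^esub> q \<in> carrier (monoid_algebra M)"
    unfolding monoid_algebra_carrier using sub fin by (meson finite_SigmaI finite_imageI finite_subset order_trans)
qed

text \<open>Both bracketings become the sum of \<open>p u * q v * r z\<close> over the triples with
  product \<open>w\<close>. The inner product is summed over the set of all products of support
  elements, which contains its support and on which each pair hits exactly one point.\<close>

lemma monoid_algebra_mult_assoc:
  fixes M (structure)
  assumes M: "Group.monoid M" and pqr: "p \<in> carrier (monoid_algebra M)" "q \<in> carrier (monoid_algebra M)"
    "r \<in> carrier (monoid_algebra M)"
  shows "(p \<otimes>\<^bsub>monoid_algebra M\<^esub> q) \<otimes>\<^bsub>monoid_algebra M\<^esub> r = p \<otimes>\<^bsub>monoid_algebra M\<^esub> (q \<otimes>\<^bsub>monoid_algebra M\<^esub> r)"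
proof
  fix w
  let ?U = "{u. p u \<noteq> 0}" and ?V = "{v. q v \<noteq> 0}" and ?R = "{v. r v \<noteq> 0}"
  have fin: "finite ?U" "finite ?V" "finite ?R" "?U \<subseteq> carrier M" "?V \<subseteq> carrier M" "?R \<subseteq> carrier M"
    using pqr by (auto simp: monoid_algebra_carrier)
  let ?X = "(\<lambda>(u, v). u \<otimes> v) ` (?U \<times> ?V)" and ?Y = "(\<lambda>(u, v). u \<otimes> v) ` (?V \<times> ?R)"
  have finX: "finite ?X" "finite ?Y" using fin by auto
  have "((p \<otimes>\<^bsub>monoid_algebra M\<^esub> q) \<otimes>\<^bsub>monoid_algebra M\<^esub> r) w =
    (\<Sum>x\<in>?X. \<Sum>z\<in>?R. if x \<otimes> z = w then (p \<otimes>\<^bsub>monoid_algebra M\<^esub> q) x * r z else 0)"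
    by (rule monoid_algebra_mult[OF finX(1) monoid_algebra_mult_closed(2)[OF M pqr(1,2)] fin(3) order_refl])
  also have "\<dots> = (\<Sum>x\<in>?X. \<Sum>z\<in>?R. \<Sum>u\<in>?U. \<Sum>v\<in>?V.
      if x = u \<otimes> v then if x \<otimes> z = w then p u * q v * r z else 0 else 0)"
    by (intro sum.cong refl)
      (auto simp: monoid_algebra_mult[OF fin(1) order_refl fin(2) order_refl] sum_distrib_right intro!: sum.cong sum.neutral)
  also have "\<dots> = (\<Sum>z\<in>?R. \<Sum>u\<in>?U. \<Sum>v\<in>?V. \<Sum>x\<in>?X.
      if x = u \<otimes> v then if x \<otimes> z = w then p u * q v * r z else 0 else 0)"
    by (subst sum.swap, rule sum.cong[OF refl], subst sum.swap, rule sum.cong[OF refl], rule sum.swap)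
  also have "\<dots> = (\<Sum>z\<in>?R. \<Sum>u\<in>?U. \<Sum>v\<in>?V. if u \<otimes> v \<otimes> z = w then p u * q v * r z else 0)"
  proof (intro sum.cong refl)
    fix z u v assume "u \<in> ?U" "v \<in> ?V"
    then have "u \<otimes> v \<in> ?X" by force
    then show "(\<Sum>x\<in>?X. if x = u \<otimes> v then if x \<otimes> z = w then p u * q v * r z else 0 else 0) =
      (if u \<otimes> v \<otimes> z = w then p u * q v * r z else 0)"
      using finX(1) by (simp add: sum.delta)
  qed
  also have "\<dots> = (\<Sum>u\<in>?U. \<Sum>v\<in>?V. \<Sum>z\<in>?R. if u \<otimes> v \<otimes> z = w then p u * q v * r z else 0)"
    by (subst sum.swap, rule sum.cong[OF refl], rule sum.swap)
  finally have L: "((p \<otimes>\<^bsub>monoid_algebra M\<^esub> q) \<otimes>\<^bsub>monoid_algebra M\<^esub> r) w = \<dots>" .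
  have "(p \<otimes>\<^bsub>monoid_algebra M\<^esub> (q \<otimes>\<^bsub>monoid_algebra M\<^esub> r)) w =
    (\<Sum>u\<in>?U. \<Sum>y\<in>?Y. if u \<otimes> y = w then p u * (q \<otimes>\<^bsub>monoid_algebra M\<^esub> r) y else 0)"
    by (rule monoid_algebra_mult[OF fin(1) order_refl finX(2) monoid_algebra_mult_closed(2)[OF M pqr(2,3)]])
  also have "\<dots> = (\<Sum>u\<in>?U. \<Sum>y\<in>?Y. \<Sum>v\<in>?V. \<Sum>z\<in>?R.
      if y = v \<otimes> z then if u \<otimes> y = w then p u * q v * r z else 0 else 0)"
    by (intro sum.cong refl)
      (auto simp: monoid_algebra_mult[OF fin(2) order_refl fin(3) order_refl] sum_distrib_left mult.assoc intro!: sum.cong sum.neutral)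
  also have "\<dots> = (\<Sum>u\<in>?U. \<Sum>v\<in>?V. \<Sum>z\<in>?R. \<Sum>y\<in>?Y.
      if y = v \<otimes> z then if u \<otimes> y = w then p u * q v * r z else 0 else 0)"
    by (rule sum.cong[OF refl], subst sum.swap, rule sum.cong[OF refl], rule sum.swap)
  also have "\<dots> = (\<Sum>u\<in>?U. \<Sum>v\<in>?V. \<Sum>z\<in>?R. if u \<otimes> v \<otimes> z = w then p u * q v * r z else 0)"
  proof (intro sum.cong refl)
    fix z u v assume a: "u \<in> ?U" "v \<in> ?V" "z \<in> ?R"
    then have "v \<otimes> z \<in> ?Y" by force
    moreover have "u \<otimes> (v \<otimes> z) = u \<otimes> v \<otimes> z"
    proof -
      have "u \<in> carrier M" "v \<in> carrier M" "z \<in> carrier M" using a fin by blast+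
      then show ?thesis by (rule Group.monoid.m_assoc[OF M, symmetric])
    qed
    ultimately show "(\<Sum>y\<in>?Y. if y = v \<otimes> z then if u \<otimes> y = w then p u * q v * r z else 0 else 0) =
      (if u \<otimes> v \<otimes> z = w then p u * q v * r z else 0)"
      using finX(2) by (simp add: sum.delta)
  qed
  finally show "((p \<otimes>\<^bsub>monoid_algebra M\<^esub> q) \<otimes>\<^bsub>monoid_algebra M\<^esub> r) w =
      (p \<otimes>\<^bsub>monoid_algebra M\<^esub> (q \<otimes>\<^bsub>monoid_algebra M\<^esub> r)) w" using L by simp
qed

lemma ualg_monoid_algebra:
  fixes M (structure)
  assumes M: "Group.monoid M"
  shows "ualg (monoid_algebra M)"
proof -
  interpret M: Group.monoid M by fact
  let ?A = "monoid_algebra M"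
  have fin: "finite {u. p u \<noteq> 0}" "\<And>u. p u \<noteq> 0 \<Longrightarrow> u \<in> carrier M" if "p \<in> carrier ?A" for p
    using that by (auto simp: monoid_algebra_carrier)
  have add: "(\<lambda>w. p w + q w) \<in> carrier ?A" if "p \<in> carrier ?A" "q \<in> carrier ?A" for p q
  proof -
    have "{u. p u + q u \<noteq> 0} \<subseteq> {u. p u \<noteq> 0} \<union> {u. q u \<noteq> 0}" by auto
    then show ?thesis using fin[OF that(1)] fin[OF that(2)] finite_subset unfolding monoid_algebra_carrier by fastforce
  qed
  have smult: "(\<lambda>w. r * p w) \<in> carrier ?A" if "p \<in> carrier ?A" for p r
  proof -
    have "{u. r * p u \<noteq> 0} \<subseteq> {u. p u \<noteq> 0}" by auto
    then show ?thesis using fin[OF that] finite_subset unfolding monoid_algebra_carrier by fastforce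
  qed
  have m: "(p \<otimes>\<^bsub>?A\<^esub> q) w = (\<Sum>u\<in>U. \<Sum>v\<in>V. if u \<otimes> v = w then p u * q v else 0)"
    if "finite U" "finite V" "{u. p u \<noteq> 0} \<subseteq> U" "{v. q v \<noteq> 0} \<subseteq> V" for p q U V w
    by (rule monoid_algebra_mult) (use that in auto)
  have ring: "ring ?A"
  proof (rule ringI)
    show "abelian_group ?A"
    proof (rule abelian_groupI)
      fix p assume "p \<in> carrier ?A"
      then show "\<exists>y\<in>carrier ?A. y \<oplus>\<^bsub>?A\<^esub> p = \<zero>\<^bsub>?A\<^esub>" using smult[of p "-1"] by (intro bexI[of _ "\<lambda>w. (-1) * p w"]) auto
    qed (use add in \<open>auto simp: monoid_algebra_carrier add_ac\<close>)
    show "Group.monoid ?A"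
    proof (rule Group.monoidI)
      fix p assume p: "p \<in> carrier ?A"
      show "\<one>\<^bsub>?A\<^esub> \<otimes>\<^bsub>?A\<^esub> p = p"
      proof
        fix w
        have "(\<one>\<^bsub>?A\<^esub> \<otimes>\<^bsub>?A\<^esub> p) w = (\<Sum>u\<in>{\<one>}. \<Sum>v\<in>{v. p v \<noteq> 0}. if u \<otimes> v = w then \<one>\<^bsub>?A\<^esub> u * p v else 0)"
          by (rule m) (use fin[OF p] in \<open>auto simp: delta_def\<close>)
        also have "\<dots> = (\<Sum>v\<in>{v. p v \<noteq> 0}. if v = w then p v else 0)"
          using fin[OF p] by (auto simp: delta_def intro!: sum.cong)
        also have "\<dots> = p w" using fin(1)[OF p] by (auto simp: sum.delta)
        finally show "(\<one>\<^bsub>?A\<^esub> \<otimes>\<^bsub>?A\<^esub> p) w = p w" .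
      qed
      show "p \<otimes>\<^bsub>?A\<^esub> \<one>\<^bsub>?A\<^esub> = p"
      proof
        fix w
        have "(p \<otimes>\<^bsub>?A\<^esub> \<one>\<^bsub>?A\<^esub>) w = (\<Sum>u\<in>{v. p v \<noteq> 0}. \<Sum>v\<in>{\<one>}. if u \<otimes> v = w then p u * \<one>\<^bsub>?A\<^esub> v else 0)"
          by (rule m) (use fin[OF p] in \<open>auto simp: delta_def\<close>)
        also have "\<dots> = (\<Sum>v\<in>{v. p v \<noteq> 0}. if v = w then p v else 0)"
          using fin[OF p] by (auto simp: delta_def intro!: sum.cong)
        also have "\<dots> = p w" using fin(1)[OF p] by (auto simp: sum.delta)
        finally show "(p \<otimes>\<^bsub>?A\<^esub> \<one>\<^bsub>?A\<^esub>) w = p w" .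
      qed
    qed (use monoid_algebra_mult_closed(1)[OF M] monoid_algebra_mult_assoc[OF M] delta_closed[OF M.one_closed] in auto)
    fix p q r assume p: "p \<in> carrier ?A" and q: "q \<in> carrier ?A" and r: "r \<in> carrier ?A"
    let ?U = "{u. p u \<noteq> 0} \<union> {u. q u \<noteq> 0}" and ?V = "{u. r u \<noteq> 0}"
    have f: "finite ?U" "finite ?V" using fin p q r by auto
    show "(p \<oplus>\<^bsub>?A\<^esub> q) \<otimes>\<^bsub>?A\<^esub> r = p \<otimes>\<^bsub>?A\<^esub> r \<oplus>\<^bsub>?A\<^esub> q \<otimes>\<^bsub>?A\<^esub> r"
    proof
      fix w
      have "((p \<oplus>\<^bsub>?A\<^esub> q) \<otimes>\<^bsub>?A\<^esub> r) w = (\<Sum>u\<in>?U. \<Sum>v\<in>?V. if u \<otimes> v = w then (p \<oplus>\<^bsub>?A\<^esub> q) u * r v else 0)"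
        "(p \<otimes>\<^bsub>?A\<^esub> r) w = (\<Sum>u\<in>?U. \<Sum>v\<in>?V. if u \<otimes> v = w then p u * r v else 0)"
        "(q \<otimes>\<^bsub>?A\<^esub> r) w = (\<Sum>u\<in>?U. \<Sum>v\<in>?V. if u \<otimes> v = w then q u * r v else 0)"
        by (rule m[OF f], auto)+
      then show "((p \<oplus>\<^bsub>?A\<^esub> q) \<otimes>\<^bsub>?A\<^esub> r) w = (p \<otimes>\<^bsub>?A\<^esub> r \<oplus>\<^bsub>?A\<^esub> q \<otimes>\<^bsub>?A\<^esub> r) w"
        by (simp add: sum.distrib[symmetric] distrib_right if_distrib cong: if_cong)
    qed
    show "r \<otimes>\<^bsub>?A\<^esub> (p \<oplus>\<^bsub>?A\<^esub> q) = r \<otimes>\<^bsub>?A\<^esub> p \<oplus>\<^bsub>?A\<^esub> r \<otimes>\<^bsub>?A\<^esub> q"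
    proof
      fix w
      have "(r \<otimes>\<^bsub>?A\<^esub> (p \<oplus>\<^bsub>?A\<^esub> q)) w = (\<Sum>u\<in>?V. \<Sum>v\<in>?U. if u \<otimes> v = w then r u * (p \<oplus>\<^bsub>?A\<^esub> q) v else 0)"
        "(r \<otimes>\<^bsub>?A\<^esub> p) w = (\<Sum>u\<in>?V. \<Sum>v\<in>?U. if u \<otimes> v = w then r u * p v else 0)"
        "(r \<otimes>\<^bsub>?A\<^esub> q) w = (\<Sum>u\<in>?V. \<Sum>v\<in>?U. if u \<otimes> v = w then r u * q v else 0)"
        by (rule m[OF f(2,1)], auto)+
      then show "(r \<otimes>\<^bsub>?A\<^esub> (p \<oplus>\<^bsub>?A\<^esub> q)) w = (r \<otimes>\<^bsub>?A\<^esub> p \<oplus>\<^bsub>?A\<^esub> r \<otimes>\<^bsub>?A\<^esub> q) w"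
        by (simp add: sum.distrib[symmetric] distrib_left if_distrib cong: if_cong)
    qed
  qed
  show ?thesis unfolding unital_real_algebra_ualg[symmetric]
  proof (rule unital_real_algebraI[OF ring])
    fix r s :: real and p q assume p: "p \<in> carrier ?A"
    show "r \<odot>\<^bsub>?A\<^esub> p \<in> carrier ?A" using smult[OF p] by simp
    assume q: "q \<in> carrier ?A"
    let ?U = "{u. p u \<noteq> 0}" and ?V = "{u. q u \<noteq> 0}"
    have f: "finite ?U" "finite ?V" using fin p q by auto
    have e: "((r \<odot>\<^bsub>?A\<^esub> p) \<otimes>\<^bsub>?A\<^esub> q) w = (\<Sum>u\<in>?U. \<Sum>v\<in>?V. if u \<otimes> v = w then (r \<odot>\<^bsub>?A\<^esub> p) u * q v else 0)"
      "(p \<otimes>\<^bsub>?A\<^esub> (r \<odot>\<^bsub>?A\<^esub> q)) w = (\<Sum>u\<in>?U. \<Sum>v\<in>?V. if u \<otimes> v = w then p u * (r \<odot>\<^bsub>?A\<^esub> q) v else 0)"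
      "(p \<otimes>\<^bsub>?A\<^esub> q) w = (\<Sum>u\<in>?U. \<Sum>v\<in>?V. if u \<otimes> v = w then p u * q v else 0)" for w
      by (rule m[OF f]; auto)+
    show "(r \<odot>\<^bsub>?A\<^esub> p) \<otimes>\<^bsub>?A\<^esub> q = r \<odot>\<^bsub>?A\<^esub> (p \<otimes>\<^bsub>?A\<^esub> q)"
    proof
      fix w
      show "((r \<odot>\<^bsub>?A\<^esub> p) \<otimes>\<^bsub>?A\<^esub> q) w = (r \<odot>\<^bsub>?A\<^esub> (p \<otimes>\<^bsub>?A\<^esub> q)) w"
      proof -
        have "(r \<odot>\<^bsub>?A\<^esub> (p \<otimes>\<^bsub>?A\<^esub> q)) w = r * (p \<otimes>\<^bsub>?A\<^esub> q) w" by simp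
        then show ?thesis unfolding e(1) e(3) sum_distrib_left by (auto intro!: sum.cong)
      qed
    qed
    show "p \<otimes>\<^bsub>?A\<^esub> (r \<odot>\<^bsub>?A\<^esub> q) = r \<odot>\<^bsub>?A\<^esub> (p \<otimes>\<^bsub>?A\<^esub> q)"
    proof
      fix w
      show "(p \<otimes>\<^bsub>?A\<^esub> (r \<odot>\<^bsub>?A\<^esub> q)) w = (r \<odot>\<^bsub>?A\<^esub> (p \<otimes>\<^bsub>?A\<^esub> q)) w"
      proof -
        have "(r \<odot>\<^bsub>?A\<^esub> (p \<otimes>\<^bsub>?A\<^esub> q)) w = r * (p \<otimes>\<^bsub>?A\<^esub> q) w" by simp
        then show ?thesis unfolding e(2) e(3) sum_distrib_left by (auto intro!: sum.cong)
      qed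
    qed
  qed (auto simp: algebra_simps)
qed

lemma monoid_algebra_induct [consumes 2, case_names zero add]:
  assumes "Group.monoid M" "p \<in> carrier (monoid_algebra M)" "P (\<lambda>w. 0)"
    "\<And>p u r. p \<in> carrier (monoid_algebra M) \<Longrightarrow> u \<in> carrier M \<Longrightarrow> P p \<Longrightarrow>
      P (p \<oplus>\<^bsub>monoid_algebra M\<^esub> r \<odot>\<^bsub>monoid_algebra M\<^esub> delta u)"
  shows "P p"
proof -
  have "finite U \<Longrightarrow> p \<in> carrier (monoid_algebra M) \<Longrightarrow> {u. p u \<noteq> 0} = U \<Longrightarrow> P p" for U p
  proof (induction U arbitrary: p rule: finite_induct)
    case empty
    then have "p = (\<lambda>w. 0)" by (auto simp: fun_eq_iff)
    then show ?case using assms by simp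
  next
    case (insert u U)
    have "{v. (p(u := 0)) v \<noteq> 0} = U" using insert by auto
    moreover have c: "p(u := 0) \<in> carrier (monoid_algebra M)"
      unfolding monoid_algebra_carrier calculation using insert by (auto simp: monoid_algebra_carrier)
    ultimately have "P (p(u := 0))" using insert(3) by blast
    then have "P (p(u := 0) \<oplus>\<^bsub>monoid_algebra M\<^esub> p u \<odot>\<^bsub>monoid_algebra M\<^esub> delta u)"
      by (rule assms(4)[OF c, rotated]) (use insert in \<open>auto simp: monoid_algebra_carrier\<close>)
    moreover have "p(u := 0) \<oplus>\<^bsub>monoid_algebra M\<^esub> p u \<odot>\<^bsub>monoid_algebra M\<^esub> delta u = p"
      by (auto simp: fun_eq_iff delta_def)
    ultimately show ?case by simp
  qed
  then show ?thesis using assms(2) by (auto simp: monoid_algebra_carrier)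
qed

definition lin_ext :: "(real, 'b) module \<Rightarrow> ('m \<Rightarrow> 'b) \<Rightarrow> ('m \<Rightarrow> real) \<Rightarrow> 'b" where
  "lin_ext B \<phi> p = ualg.lc B {u. p u \<noteq> 0} \<phi> p"

lemma lin_ext:
  fixes M :: "('m, 'c) monoid_scheme" and B :: "(real, 'b) module" (structure)
  assumes M: "Group.monoid M" and B: "ualg B" and phi': "\<phi> \<in> carrier M \<rightarrow> carrier B"
  shows "\<And>p. p \<in> carrier (monoid_algebra M) \<Longrightarrow> lin_ext B \<phi> p \<in> carrier B"
    and "\<And>p q. p \<in> carrier (monoid_algebra M) \<Longrightarrow> q \<in> carrier (monoid_algebra M) \<Longrightarrow>
      lin_ext B \<phi> (p \<oplus>\<^bsub>monoid_algebra M\<^esub> q) = lin_ext B \<phi> p \<oplus> lin_ext B \<phi> q"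
    and "\<And>p r. p \<in> carrier (monoid_algebra M) \<Longrightarrow>
      lin_ext B \<phi> (r \<odot>\<^bsub>monoid_algebra M\<^esub> p) = r \<odot> lin_ext B \<phi> p"
    and "\<And>u. u \<in> carrier M \<Longrightarrow> lin_ext B \<phi> (delta u) = \<phi> u"
proof -
  interpret B: ualg B by fact
  have phi: "\<phi> u \<in> carrier B" if "u \<in> carrier M" for u using phi' that by (rule funcset_mem)
  have e: "lin_ext B \<phi> p = B.lc U \<phi> p" if "finite U" "U \<subseteq> carrier M" "{u. p u \<noteq> 0} \<subseteq> U" for U p
    unfolding lin_ext_def by (rule B.lc_mono_neutral[symmetric]) (use that phi in auto)
  have fin: "finite {u. p u \<noteq> 0}" "{u. p u \<noteq> 0} \<subseteq> carrier M" if "p \<in> carrier (monoid_algebra M)" for p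
    using that by (auto simp: monoid_algebra_carrier)
  show "lin_ext B \<phi> p \<in> carrier B" if "p \<in> carrier (monoid_algebra M)" for p
    unfolding lin_ext_def using fin[OF that] phi by (intro B.lc_closed) auto
  show "lin_ext B \<phi> (p \<oplus>\<^bsub>monoid_algebra M\<^esub> q) = lin_ext B \<phi> p \<oplus> lin_ext B \<phi> q"
    if pq: "p \<in> carrier (monoid_algebra M)" "q \<in> carrier (monoid_algebra M)" for p q
  proof -
    let ?U = "{u. p u \<noteq> 0} \<union> {u. q u \<noteq> 0}"
    have U: "finite ?U" "?U \<subseteq> carrier M" using fin pq by auto
    have "lin_ext B \<phi> p = B.lc ?U \<phi> p" "lin_ext B \<phi> q = B.lc ?U \<phi> q" using e[OF U] by auto
    moreover have "lin_ext B \<phi> (p \<oplus>\<^bsub>monoid_algebra M\<^esub> q) = B.lc ?U \<phi> (\<lambda>w. p w + q w)"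
    proof -
      have "{u. p u + q u \<noteq> 0} \<subseteq> ?U" by auto
      then show ?thesis using e[OF U, of "\<lambda>w. p w + q w"] by simp
    qed
    moreover have "B.lc ?U \<phi> (\<lambda>w. p w + q w) = B.lc ?U \<phi> p \<oplus> B.lc ?U \<phi> q"
      by (rule B.lc_add) (use U phi in auto)
    ultimately show ?thesis by simp
  qed
  show "lin_ext B \<phi> (r \<odot>\<^bsub>monoid_algebra M\<^esub> p) = r \<odot> lin_ext B \<phi> p"
    if p: "p \<in> carrier (monoid_algebra M)" for p r
  proof -
    let ?U = "{u. p u \<noteq> 0}"
    have U: "finite ?U" "?U \<subseteq> carrier M" using fin p by auto
    have "lin_ext B \<phi> p = B.lc ?U \<phi> p" using e[OF U] by auto
    moreover have "lin_ext B \<phi> (r \<odot>\<^bsub>monoid_algebra M\<^esub> p) = B.lc ?U \<phi> (\<lambda>w. r * p w)"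
      using e[OF U, of "\<lambda>w. r * p w"] by auto
    moreover have "B.lc ?U \<phi> (\<lambda>w. r * p w) = r \<odot> B.lc ?U \<phi> p"
      by (rule B.lc_smult) (use U phi in auto)
    ultimately show ?thesis by simp
  qed
  show "lin_ext B \<phi> (delta u) = \<phi> u" if u: "u \<in> carrier M" for u
  proof -
    have "lin_ext B \<phi> (delta u) = B.lc {u} \<phi> (delta u)" by (rule e) (use u in \<open>auto simp: delta_def\<close>)
    also have "\<dots> = B.lc {u} \<phi> (\<lambda>v. if v = u then 1 else 0)" by (rule B.lc_cong) (use phi u in \<open>auto simp: delta_def\<close>)
    also have "\<dots> = \<phi> u" using B.lc_single[of "{u}" u \<phi> 1] phi u by auto
    finally show ?thesis .
  qed
qed

text \<open>Both sides are bilinear, so \<open>q\<close> and then \<open>p\<close> are built up from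
  point masses, on which \<open>mult\<close> applies.\<close>

lemma lin_ext_mult:
  fixes B (structure)
  assumes M: "Group.monoid M" and B: "ualg B" and phi': "\<phi> \<in> carrier M \<rightarrow> carrier B"
    and mult: "\<And>u v. u \<in> carrier M \<Longrightarrow> v \<in> carrier M \<Longrightarrow> \<phi> (u \<otimes>\<^bsub>M\<^esub> v) = \<phi> u \<otimes> \<phi> v"
    and p: "p \<in> carrier (monoid_algebra M)" and q: "q \<in> carrier (monoid_algebra M)"
  shows "lin_ext B \<phi> (p \<otimes>\<^bsub>monoid_algebra M\<^esub> q) = lin_ext B \<phi> p \<otimes> lin_ext B \<phi> q"
proof -
  interpret B: ualg B by fact
  interpret M: Group.monoid M by fact
  let ?A = "monoid_algebra M"
  interpret A: ualg ?A by (rule ualg_monoid_algebra[OF M])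
  have phi: "\<phi> u \<in> carrier B" if "u \<in> carrier M" for u using phi' that by (rule funcset_mem)
  note l = lin_ext[OF M B phi']
  have z: "lin_ext B \<phi> \<zero>\<^bsub>?A\<^esub> = \<zero>"
    using l(3)[OF A.zero_closed, of 0] l(1)[OF A.zero_closed] by simp
  have 1: "lin_ext B \<phi> (delta u \<otimes>\<^bsub>?A\<^esub> q) = \<phi> u \<otimes> lin_ext B \<phi> q" if u: "u \<in> carrier M" for u
    using M q
  proof (induction rule: monoid_algebra_induct)
    case zero
    have "delta u \<otimes>\<^bsub>?A\<^esub> \<zero>\<^bsub>?A\<^esub> = \<zero>\<^bsub>?A\<^esub>" using A.r_null[OF delta_closed[OF u]] .
    then show ?case using z phi[OF u] by simp
  next
    case (add q v r)
    note d = delta_closed[OF u] delta_closed[OF add(2)]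
    have e: "delta u \<otimes>\<^bsub>?A\<^esub> (q \<oplus>\<^bsub>?A\<^esub> r \<odot>\<^bsub>?A\<^esub> delta v) = delta u \<otimes>\<^bsub>?A\<^esub> q \<oplus>\<^bsub>?A\<^esub> r \<odot>\<^bsub>?A\<^esub> delta (u \<otimes>\<^bsub>M\<^esub> v)"
      using A.r_distr[of q "r \<odot>\<^bsub>?A\<^esub> delta v" "delta u"] A.sm_mult_r[of "delta u" "delta v" r] add(1) d
        A.sm_closed[of "delta v" r] by (simp add: delta_mult del: monoid_algebra_simps)
    have "lin_ext B \<phi> (delta u \<otimes>\<^bsub>?A\<^esub> (q \<oplus>\<^bsub>?A\<^esub> r \<odot>\<^bsub>?A\<^esub> delta v)) =
        lin_ext B \<phi> (delta u \<otimes>\<^bsub>?A\<^esub> q) \<oplus> r \<odot> \<phi> (u \<otimes>\<^bsub>M\<^esub> v)"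
      unfolding e using l(2)[OF A.m_closed[OF d(1) add(1)] A.sm_closed[OF delta_closed[OF M.m_closed[OF u add(2)]]], of r]
        l(3)[OF delta_closed[OF M.m_closed[OF u add(2)]], of r] l(4)[OF M.m_closed[OF u add(2)]]
      by (simp del: monoid_algebra_simps)
    moreover have "lin_ext B \<phi> (q \<oplus>\<^bsub>?A\<^esub> r \<odot>\<^bsub>?A\<^esub> delta v) = lin_ext B \<phi> q \<oplus> r \<odot> \<phi> v"
      using l(2)[OF add(1) A.sm_closed[OF d(2)], of r] l(3)[OF d(2), of r] l(4)[OF add(2)]
      by (simp del: monoid_algebra_simps)
    ultimately show ?case using add(3) mult[OF u add(2)] phi[OF u] phi[OF add(2)] l(1)[OF add(1)]
      by (simp add: B.r_distr del: monoid_algebra_simps)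
  qed
  show ?thesis using M p
  proof (induction rule: monoid_algebra_induct)
    case zero
    have "\<zero>\<^bsub>?A\<^esub> \<otimes>\<^bsub>?A\<^esub> q = \<zero>\<^bsub>?A\<^esub>" using A.l_null[OF q] .
    then show ?case using z l(1)[OF q] by simp
  next
    case (add p u r)
    note d = delta_closed[OF add(2)]
    have e: "(p \<oplus>\<^bsub>?A\<^esub> r \<odot>\<^bsub>?A\<^esub> delta u) \<otimes>\<^bsub>?A\<^esub> q = p \<otimes>\<^bsub>?A\<^esub> q \<oplus>\<^bsub>?A\<^esub> r \<odot>\<^bsub>?A\<^esub> (delta u \<otimes>\<^bsub>?A\<^esub> q)"
      using A.l_distr[of p "r \<odot>\<^bsub>?A\<^esub> delta u" q] A.sm_mult_l[of "delta u" q r] add(1) d q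
        A.sm_closed[of "delta u" r] by (simp del: monoid_algebra_simps)
    have "lin_ext B \<phi> ((p \<oplus>\<^bsub>?A\<^esub> r \<odot>\<^bsub>?A\<^esub> delta u) \<otimes>\<^bsub>?A\<^esub> q) =
        lin_ext B \<phi> (p \<otimes>\<^bsub>?A\<^esub> q) \<oplus> r \<odot> (\<phi> u \<otimes> lin_ext B \<phi> q)"
      unfolding e using l(2)[OF A.m_closed[OF add(1) q] A.sm_closed[OF A.m_closed[OF d q]], of r]
        l(3)[OF A.m_closed[OF d q], of r] 1[OF add(2)] by (simp del: monoid_algebra_simps)
    moreover have "lin_ext B \<phi> (p \<oplus>\<^bsub>?A\<^esub> r \<odot>\<^bsub>?A\<^esub> delta u) = lin_ext B \<phi> p \<oplus> r \<odot> \<phi> u"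
      using l(2)[OF add(1) A.sm_closed[OF d], of r] l(3)[OF d, of r] l(4)[OF add(2)]
      by (simp del: monoid_algebra_simps)
    ultimately show ?case using add(3) phi[OF add(2)] l(1)[OF add(1)] l(1)[OF q]
      by (simp add: B.l_distr del: monoid_algebra_simps)
  qed
qed

section \<open>Tensor products\<close>

text \<open>The scalar action on cosets is defined as a union over all representatives; the issue is
  that this union is a single coset.\<close>

lemma quotient_algebra:
  fixes A :: "(real, 'd) module" (structure)
  assumes A: "ualg A" and J: "ideal J A"
  defines "Q \<equiv> quotient_algebra A J"
  shows "ualg Q"
    and "\<And>x. x \<in> carrier A \<Longrightarrow> J +> x \<in> carrier Q"
    and "\<And>X. X \<in> carrier Q \<Longrightarrow> \<exists>x\<in>carrier A. X = J +> x"
    and "\<And>x y. x \<in> carrier A \<Longrightarrow> y \<in> carrier A \<Longrightarrow> (J +> x) \<oplus>\<^bsub>Q\<^esub> (J +> y) = J +> (x \<oplus> y)"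
    and "\<And>x y. x \<in> carrier A \<Longrightarrow> y \<in> carrier A \<Longrightarrow> (J +> x) \<otimes>\<^bsub>Q\<^esub> (J +> y) = J +> (x \<otimes> y)"
    and "\<And>r x. x \<in> carrier A \<Longrightarrow> r \<odot>\<^bsub>Q\<^esub> (J +> x) = J +> (r \<odot> x)"
    and "\<one>\<^bsub>Q\<^esub> = J +> \<one>"
    and "\<And>x. x \<in> carrier A \<Longrightarrow> J +> x = \<zero>\<^bsub>Q\<^esub> \<longleftrightarrow> x \<in> J"
proof -
  interpret A: ualg A by fact
  interpret J: ideal J A by fact
  have sel: "carrier Q = carrier (A Quot J)" "mult Q = mult (A Quot J)" "one Q = one (A Quot J)"
      "zero Q = zero (A Quot J)" "add Q = add (A Quot J)"
    by (simp_all add: Q_def quotient_algebra_def)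
  interpret R: ring "A Quot J" by (rule J.quotient_is_ring)
  have JA: "j \<in> carrier A" if "j \<in> J" for j using that J.a_subset by blast
  show cl: "\<And>x. x \<in> carrier A \<Longrightarrow> J +> x \<in> carrier Q"
    unfolding sel by (auto simp: FactRing_def A_RCOSETS_def')
  show ex: "\<And>X. X \<in> carrier Q \<Longrightarrow> \<exists>x\<in>carrier A. X = J +> x"
    unfolding sel by (auto simp: FactRing_def A_RCOSETS_def')
  show ad: "\<And>x y. x \<in> carrier A \<Longrightarrow> y \<in> carrier A \<Longrightarrow> (J +> x) \<oplus>\<^bsub>Q\<^esub> (J +> y) = J +> (x \<oplus> y)"
    unfolding sel by (simp add: FactRing_def J.a_rcos_sum)
  show mu: "\<And>x y. x \<in> carrier A \<Longrightarrow> y \<in> carrier A \<Longrightarrow> (J +> x) \<otimes>\<^bsub>Q\<^esub> (J +> y) = J +> (x \<otimes> y)"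
    unfolding sel by (simp add: FactRing_def J.rcoset_mult_add)
  show one: "\<one>\<^bsub>Q\<^esub> = J +> \<one>" unfolding sel by (simp add: FactRing_def)
  have zero: "\<zero>\<^bsub>Q\<^esub> = J" unfolding sel by (simp add: FactRing_def)
  show "\<And>x. x \<in> carrier A \<Longrightarrow> J +> x = \<zero>\<^bsub>Q\<^esub> \<longleftrightarrow> x \<in> J"
    unfolding zero using J.a_rcos_const J.a_rcos_self by blast
  show sm: "r \<odot>\<^bsub>Q\<^esub> (J +> x) = J +> (r \<odot> x)" if x: "x \<in> carrier A" for r x
  proof -
    \<comment> \<open>A ring ideal is stable under scalars, since \<open>r j = (r 1) j\<close>.
      Hence every representative contributes the same coset.\<close>
    have "J +> (r \<odot> y) = J +> (r \<odot> x)" if y: "y \<in> J +> x" for y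
    proof -
      obtain j where j: "j \<in> J" "y = j \<oplus> x" using y by (auto simp: a_r_coset_def')
      have "r \<odot> j = (r \<odot> \<one>) \<otimes> j" using JA[OF j(1)] by simp
      then have rj: "r \<odot> j \<in> J" using J.I_l_closed[OF j(1), of "r \<odot> \<one>"] by simp
      have "r \<odot> y = r \<odot> j \<oplus> r \<odot> x" using j JA x by (simp add: A.sm_add_r)
      then have "r \<odot> y \<in> J +> (r \<odot> x)" using rj by (auto simp: a_r_coset_def')
      then show ?thesis using J.a_repr_independence'[of "r \<odot> y" "r \<odot> x"] x by simp
    qed
    moreover have "x \<in> J +> x" by (rule J.a_rcos_self[OF x])
    ultimately have "(\<Union>y\<in>J +> x. J +> (r \<odot> y)) = J +> (r \<odot> x)" by blast
    then show ?thesis by (simp add: Q_def quotient_algebra_def)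
  qed
  have ring: "ring Q"
  proof (rule ringI)
    show "abelian_group Q"
      by (rule abelian_groupI) (use R.a_assoc R.a_comm R.l_neg R.a_inv_closed in \<open>auto simp: sel\<close>)
    show "Group.monoid Q" by (rule Group.monoidI) (use R.m_assoc in \<open>auto simp: sel\<close>)
  qed (use R.l_distr R.r_distr in \<open>auto simp: sel\<close>)
  show "ualg Q" unfolding unital_real_algebra_ualg[symmetric]
  proof (rule unital_real_algebraI[OF ring])
    fix r s X assume "X \<in> carrier Q"
    then obtain x where x: "x \<in> carrier A" "X = J +> x" using ex by blast
    show "r \<odot>\<^bsub>Q\<^esub> X \<in> carrier Q" unfolding x sm[OF x(1)] by (rule cl) (use x in auto)
    show "(r + s) \<odot>\<^bsub>Q\<^esub> X = r \<odot>\<^bsub>Q\<^esub> X \<oplus>\<^bsub>Q\<^esub> s \<odot>\<^bsub>Q\<^esub> X" unfolding x using x(1) by (simp add: sm ad A.sm_add_l)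
    show "(r * s) \<odot>\<^bsub>Q\<^esub> X = r \<odot>\<^bsub>Q\<^esub> (s \<odot>\<^bsub>Q\<^esub> X)" unfolding x using x(1) by (simp add: sm)
    show "1 \<odot>\<^bsub>Q\<^esub> X = X" unfolding x using x(1) by (simp add: sm)
    fix Y assume "Y \<in> carrier Q"
    then obtain y where y: "y \<in> carrier A" "Y = J +> y" using ex by blast
    show "r \<odot>\<^bsub>Q\<^esub> (X \<oplus>\<^bsub>Q\<^esub> Y) = r \<odot>\<^bsub>Q\<^esub> X \<oplus>\<^bsub>Q\<^esub> r \<odot>\<^bsub>Q\<^esub> Y"
      unfolding x y using x(1) y(1) by (simp add: sm ad A.sm_add_r)
    show "(r \<odot>\<^bsub>Q\<^esub> X) \<otimes>\<^bsub>Q\<^esub> Y = r \<odot>\<^bsub>Q\<^esub> (X \<otimes>\<^bsub>Q\<^esub> Y)" "X \<otimes>\<^bsub>Q\<^esub> (r \<odot>\<^bsub>Q\<^esub> Y) = r \<odot>\<^bsub>Q\<^esub> (X \<otimes>\<^bsub>Q\<^esub> Y)"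
      unfolding x y using x(1) y(1) by (simp_all add: sm mu)
  qed
qed

locale tensor =
  fixes I :: "'i set" and A :: "'i \<Rightarrow> (real, 'a) module" and B :: "(real, 'b) module"
  assumes finI: "finite I" and ualgA: "\<And>i. i \<in> I \<Longrightarrow> ualg (A i)" and ualgB: "ualg B"
begin

abbreviation M where "M \<equiv> tuple_monoid I A B"
abbreviation TA where "TA \<equiv> tensor_algebra I A B"
abbreviation pt where "pt \<equiv> pure_tensor I A B"

lemma M_simps [simp]: "carrier M = (\<Pi>\<^sub>E i\<in>I. carrier (A i)) \<times> carrier B"
  "(x, y) \<otimes>\<^bsub>M\<^esub> (x', y') = ((\<lambda>i\<in>I. x i \<otimes>\<^bsub>A i\<^esub> x' i), y \<otimes>\<^bsub>B\<^esub> y')"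
  "\<one>\<^bsub>M\<^esub> = ((\<lambda>i\<in>I. \<one>\<^bsub>A i\<^esub>), \<one>\<^bsub>B\<^esub>)"
  by (simp_all add: tuple_monoid_def)

lemma ringA: "i \<in> I \<Longrightarrow> ring (A i)" using ualgA by (simp add: ualg_def)

lemma monoidM: "Group.monoid M"
proof -
  interpret B: ualg B by (rule ualgB)
  have mA: "Group.monoid (A i)" if "i \<in> I" for i using ringA[OF that] by (simp add: ring_def)
  show ?thesis
  proof (rule Group.monoidI)
    fix u v w assume "u \<in> carrier M" "v \<in> carrier M" "w \<in> carrier M"
    then obtain x y x' y' x'' y'' where u: "u = (x, y)" "v = (x', y')" "w = (x'', y'')"
      and c: "x \<in> (\<Pi>\<^sub>E i\<in>I. carrier (A i))" "x' \<in> (\<Pi>\<^sub>E i\<in>I. carrier (A i))" "x'' \<in> (\<Pi>\<^sub>E i\<in>I. carrier (A i))"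
      "y \<in> carrier B" "y' \<in> carrier B" "y'' \<in> carrier B" by auto
    have c': "x i \<in> carrier (A i)" "x' i \<in> carrier (A i)" "x'' i \<in> carrier (A i)" if "i \<in> I" for i
      using PiE_mem[OF c(1) that] PiE_mem[OF c(2) that] PiE_mem[OF c(3) that] by auto
    show "u \<otimes>\<^bsub>M\<^esub> v \<in> carrier M" unfolding u using c c' Group.monoid.m_closed[OF mA] by auto
    show "u \<otimes>\<^bsub>M\<^esub> v \<otimes>\<^bsub>M\<^esub> w = u \<otimes>\<^bsub>M\<^esub> (v \<otimes>\<^bsub>M\<^esub> w)" unfolding u
      using c(4-6) c' Group.monoid.m_assoc[OF mA] by (auto simp: B.m_assoc intro!: restrict_ext)
    have "(\<lambda>i\<in>I. (\<lambda>i\<in>I. \<one>\<^bsub>A i\<^esub>) i \<otimes>\<^bsub>A i\<^esub> x i) = x"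
      by (rule PiE_ext[OF _ c(1)]) (use c' Group.monoid.l_one[OF mA] in auto)
    then show "\<one>\<^bsub>M\<^esub> \<otimes>\<^bsub>M\<^esub> u = u" unfolding u using c by simp
    have "(\<lambda>i\<in>I. x i \<otimes>\<^bsub>A i\<^esub> (\<lambda>i\<in>I. \<one>\<^bsub>A i\<^esub>) i) = x"
      by (rule PiE_ext[OF _ c(1)]) (use c' Group.monoid.r_one[OF mA] in auto)
    then show "u \<otimes>\<^bsub>M\<^esub> \<one>\<^bsub>M\<^esub> = u" unfolding u using c by simp
  next
    show "\<one>\<^bsub>M\<^esub> \<in> carrier M" using Group.monoid.one_closed[OF mA] by auto
  qed
qed

sublocale MA: ualg "monoid_algebra M" by (rule ualg_monoid_algebra[OF monoidM])

lemma upd_closed: "x \<in> (\<Pi>\<^sub>E i\<in>I. carrier (A i)) \<Longrightarrow> i \<in> I \<Longrightarrow> a \<in> carrier (A i) \<Longrightarrow>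
  x(i := a) \<in> (\<Pi>\<^sub>E i\<in>I. carrier (A i))"
  by (auto simp: PiE_iff extensional_def)

definition multilinear :: "(('i \<Rightarrow> 'a) \<times> 'b \<Rightarrow> 'c) \<Rightarrow> (real, 'c) module \<Rightarrow> bool" where
  "multilinear \<phi> C \<longleftrightarrow>
    (\<forall>x\<in>(\<Pi>\<^sub>E i\<in>I. carrier (A i)). \<forall>i\<in>I. \<forall>a\<in>carrier (A i). \<forall>a'\<in>carrier (A i). \<forall>y\<in>carrier B.
       \<phi> (x(i := a \<oplus>\<^bsub>A i\<^esub> a'), y) = \<phi> (x(i := a), y) \<oplus>\<^bsub>C\<^esub> \<phi> (x(i := a'), y)) \<and>
    (\<forall>x\<in>(\<Pi>\<^sub>E i\<in>I. carrier (A i)). \<forall>i\<in>I. \<forall>a\<in>carrier (A i). \<forall>r. \<forall>y\<in>carrier B.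
       \<phi> (x(i := r \<odot>\<^bsub>A i\<^esub> a), y) = r \<odot>\<^bsub>C\<^esub> \<phi> (x(i := a), y)) \<and>
    (\<forall>x\<in>(\<Pi>\<^sub>E i\<in>I. carrier (A i)). \<forall>y\<in>carrier B. \<forall>y'\<in>carrier B.
       \<phi> (x, y \<oplus>\<^bsub>B\<^esub> y') = \<phi> (x, y) \<oplus>\<^bsub>C\<^esub> \<phi> (x, y')) \<and>
    (\<forall>x\<in>(\<Pi>\<^sub>E i\<in>I. carrier (A i)). \<forall>r. \<forall>y\<in>carrier B. \<phi> (x, r \<odot>\<^bsub>B\<^esub> y) = r \<odot>\<^bsub>C\<^esub> \<phi> (x, y))"

text \<open>Written with the module operations, the relations become accessible to the closure rules
  and to the linearity of the quotient map.\<close>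

lemma rel_simps:
  "(\<lambda>w. delta u w - delta v w - delta v' w) =
    delta u \<oplus>\<^bsub>monoid_algebra M\<^esub> ((-1) \<odot>\<^bsub>monoid_algebra M\<^esub> delta v \<oplus>\<^bsub>monoid_algebra M\<^esub> (-1) \<odot>\<^bsub>monoid_algebra M\<^esub> delta v')"
  "(\<lambda>w. delta u w - r * delta v w) = delta u \<oplus>\<^bsub>monoid_algebra M\<^esub> (- r) \<odot>\<^bsub>monoid_algebra M\<^esub> delta v"
  by (auto simp: fun_eq_iff)

lemma carrier_op:
  assumes "i \<in> I" "a \<in> carrier (A i)"
  shows "a' \<in> carrier (A i) \<Longrightarrow> a \<oplus>\<^bsub>A i\<^esub> a' \<in> carrier (A i)" "r \<odot>\<^bsub>A i\<^esub> a \<in> carrier (A i)"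
proof -
  interpret ualg "A i" by (rule ualgA[OF assms(1)])
  show "a' \<in> carrier (A i) \<Longrightarrow> a \<oplus>\<^bsub>A i\<^esub> a' \<in> carrier (A i)" "r \<odot>\<^bsub>A i\<^esub> a \<in> carrier (A i)"
    using assms(2) by auto
qed

lemma relations_closed: "multilinear_relations I A B \<subseteq> carrier (monoid_algebra M)"
proof -
  have add_rel: "(\<lambda>w. delta u w - delta v w - delta v' w) \<in> carrier (monoid_algebra M)"
    if "u \<in> carrier M" "v \<in> carrier M" "v' \<in> carrier M" for u v v'
    unfolding rel_simps(1) by (intro MA.a_closed MA.sm_closed delta_closed that)
  have smult_rel: "(\<lambda>w. delta u w - r * delta v w) \<in> carrier (monoid_algebra M)"
    if "u \<in> carrier M" "v \<in> carrier M" for u v r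
    unfolding rel_simps(2) by (intro MA.a_closed MA.sm_closed delta_closed that)
  interpret B: ualg B by (rule ualgB)
  show ?thesis
  proof
    fix \<rho> assume "\<rho> \<in> multilinear_relations I A B"
    then show "\<rho> \<in> carrier (monoid_algebra M)" unfolding multilinear_relations_def
    proof (elim UnE CollectE exE conjE, goal_cases)
      case (1 x i a a' y)
      show ?case unfolding 1(1) by (rule add_rel) (use 1 upd_closed carrier_op in \<open>simp_all del: fun_upd_apply\<close>)
    next
      case (2 x i a r y)
      show ?case unfolding 2(1) by (rule smult_rel) (use 2 upd_closed carrier_op in \<open>simp_all del: fun_upd_apply\<close>)
    next
      case (3 x y y')
      show ?case unfolding 3(1) by (rule add_rel) (use 3 in simp_all)
    next
      case (4 x r y)
      show ?case unfolding 4(1) by (rule smult_rel) (use 4 in simp_all)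
    qed
  qed
qed

lemma ideal_tensor: "ideal (tensor_ideal I A B) (monoid_algebra M)"
  unfolding tensor_ideal_def by (rule MA.genideal_ideal[OF relations_closed])

lemmas quot = quotient_algebra[OF MA.ualg_axioms ideal_tensor, folded tensor_algebra_def]

lemma relations_ideal: "\<rho> \<in> multilinear_relations I A B \<Longrightarrow> \<rho> \<in> tensor_ideal I A B"
  using MA.genideal_self[OF relations_closed] unfolding tensor_ideal_def by blast

lemma pt_closed: "u \<in> carrier M \<Longrightarrow> pt u \<in> carrier TA"
  unfolding pure_tensor_def by (rule quot(2)[OF delta_closed])

lemma pt_mult: "u \<in> carrier M \<Longrightarrow> v \<in> carrier M \<Longrightarrow> pt u \<otimes>\<^bsub>TA\<^esub> pt v = pt (u \<otimes>\<^bsub>M\<^esub> v)"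
  unfolding pure_tensor_def using quot(5)[OF delta_closed delta_closed, of u v] delta_mult[of M u v] by simp

lemma pt_one: "pt \<one>\<^bsub>M\<^esub> = \<one>\<^bsub>TA\<^esub>"
  unfolding pure_tensor_def quot(7) by simp

sublocale TA: ualg TA by (rule quot(1))

lemma pt_add_relation:
  assumes "u \<in> carrier M" "v \<in> carrier M" "v' \<in> carrier M"
    "(\<lambda>w. delta u w - delta v w - delta v' w) \<in> tensor_ideal I A B"
  shows "pt u = pt v \<oplus>\<^bsub>TA\<^esub> pt v'"
proof -
  let ?\<pi> = "\<lambda>p. tensor_ideal I A B +>\<^bsub>monoid_algebra M\<^esub> p"
  let ?A = "monoid_algebra M"
  note d = delta_closed[OF assms(1)] delta_closed[OF assms(2)] delta_closed[OF assms(3)]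
  note s = MA.sm_closed[OF d(2), of "-1"] MA.sm_closed[OF d(3), of "-1"]
  have "?\<pi> (delta u \<oplus>\<^bsub>?A\<^esub> ((-1) \<odot>\<^bsub>?A\<^esub> delta v \<oplus>\<^bsub>?A\<^esub> (-1) \<odot>\<^bsub>?A\<^esub> delta v')) = \<zero>\<^bsub>TA\<^esub>"
    using assms(4) quot(8)[OF MA.a_closed[OF d(1) MA.a_closed[OF s]]] unfolding rel_simps(1) by blast
  then have "pt u \<oplus>\<^bsub>TA\<^esub> ((-1) \<odot>\<^bsub>TA\<^esub> pt v \<oplus>\<^bsub>TA\<^esub> (-1) \<odot>\<^bsub>TA\<^esub> pt v') = \<zero>\<^bsub>TA\<^esub>"
    unfolding pure_tensor_def quot(6)[OF d(2)] quot(6)[OF d(3)] quot(4)[OF s] quot(4)[OF d(1) MA.a_closed[OF s]] .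
  then have "pt u \<oplus>\<^bsub>TA\<^esub> (\<ominus>\<^bsub>TA\<^esub> (pt v \<oplus>\<^bsub>TA\<^esub> pt v')) = \<zero>\<^bsub>TA\<^esub>"
    using pt_closed[OF assms(2)] pt_closed[OF assms(3)] by (simp add: TA.sm_minus TA.minus_add)
  then show ?thesis using TA.minus_equality[of "pt u" "\<ominus>\<^bsub>TA\<^esub> (pt v \<oplus>\<^bsub>TA\<^esub> pt v')"]
      pt_closed[OF assms(1)] pt_closed[OF assms(2)] pt_closed[OF assms(3)] by simp
qed

lemma pt_smult_relation:
  assumes "u \<in> carrier M" "v \<in> carrier M" "(\<lambda>w. delta u w - r * delta v w) \<in> tensor_ideal I A B"
  shows "pt u = r \<odot>\<^bsub>TA\<^esub> pt v"
proof -
  let ?\<pi> = "\<lambda>p. tensor_ideal I A B +>\<^bsub>monoid_algebra M\<^esub> p"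
  let ?A = "monoid_algebra M"
  note d = delta_closed[OF assms(1)] delta_closed[OF assms(2)]
  note s = MA.sm_closed[OF d(2), of "-r"]
  have "?\<pi> (delta u \<oplus>\<^bsub>?A\<^esub> (- r) \<odot>\<^bsub>?A\<^esub> delta v) = \<zero>\<^bsub>TA\<^esub>"
    using assms(3) quot(8)[OF MA.a_closed[OF d(1) s]] unfolding rel_simps(2) by blast
  then have "pt u \<oplus>\<^bsub>TA\<^esub> (- r) \<odot>\<^bsub>TA\<^esub> pt v = \<zero>\<^bsub>TA\<^esub>"
    unfolding pure_tensor_def quot(6)[OF d(2)] quot(4)[OF d(1) s] .
  then have "pt u \<oplus>\<^bsub>TA\<^esub> (\<ominus>\<^bsub>TA\<^esub> (r \<odot>\<^bsub>TA\<^esub> pt v)) = \<zero>\<^bsub>TA\<^esub>"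
    using pt_closed[OF assms(2)] by (simp add: TA.sm_minus)
  then show ?thesis using TA.minus_equality[of "pt u" "\<ominus>\<^bsub>TA\<^esub> (r \<odot>\<^bsub>TA\<^esub> pt v)"]
      pt_closed[OF assms(1)] pt_closed[OF assms(2)] by simp
qed

lemma pt_add:
  assumes "x \<in> (\<Pi>\<^sub>E i\<in>I. carrier (A i))" "i \<in> I" "a \<in> carrier (A i)" "a' \<in> carrier (A i)" "y \<in> carrier B"
  shows "pt (x(i := a \<oplus>\<^bsub>A i\<^esub> a'), y) = pt (x(i := a), y) \<oplus>\<^bsub>TA\<^esub> pt (x(i := a'), y)"
proof (rule pt_add_relation)
  show "(\<lambda>w. delta (x(i := a \<oplus>\<^bsub>A i\<^esub> a'), y) w - delta (x(i := a), y) w - delta (x(i := a'), y) w) \<in> tensor_ideal I A B"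
    by (rule relations_ideal, unfold multilinear_relations_def) (use assms in blast)
qed (use assms upd_closed carrier_op in auto)

lemma pt_smult:
  assumes "x \<in> (\<Pi>\<^sub>E i\<in>I. carrier (A i))" "i \<in> I" "a \<in> carrier (A i)" "y \<in> carrier B"
  shows "pt (x(i := r \<odot>\<^bsub>A i\<^esub> a), y) = r \<odot>\<^bsub>TA\<^esub> pt (x(i := a), y)"
proof (rule pt_smult_relation)
  show "(\<lambda>w. delta (x(i := r \<odot>\<^bsub>A i\<^esub> a), y) w - r * delta (x(i := a), y) w) \<in> tensor_ideal I A B"
    by (rule relations_ideal, unfold multilinear_relations_def) (use assms in blast)
qed (use assms upd_closed carrier_op in auto)

lemma pt_add_last:
  assumes "x \<in> (\<Pi>\<^sub>E i\<in>I. carrier (A i))" "y \<in> carrier B" "y' \<in> carrier B"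
  shows "pt (x, y \<oplus>\<^bsub>B\<^esub> y') = pt (x, y) \<oplus>\<^bsub>TA\<^esub> pt (x, y')"
proof (rule pt_add_relation)
  interpret B: ualg B by (rule ualgB)
  show "(\<lambda>w. delta (x, y \<oplus>\<^bsub>B\<^esub> y') w - delta (x, y) w - delta (x, y') w) \<in> tensor_ideal I A B"
    by (rule relations_ideal, unfold multilinear_relations_def) (use assms in blast)
  show "(x, y \<oplus>\<^bsub>B\<^esub> y') \<in> carrier M" using assms by simp
qed (use assms in auto)

lemma pt_smult_last:
  assumes "x \<in> (\<Pi>\<^sub>E i\<in>I. carrier (A i))" "y \<in> carrier B"
  shows "pt (x, r \<odot>\<^bsub>B\<^esub> y) = r \<odot>\<^bsub>TA\<^esub> pt (x, y)"
proof (rule pt_smult_relation)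
  interpret B: ualg B by (rule ualgB)
  show "(\<lambda>w. delta (x, r \<odot>\<^bsub>B\<^esub> y) w - r * delta (x, y) w) \<in> tensor_ideal I A B"
    by (rule relations_ideal, unfold multilinear_relations_def) (use assms in blast)
  show "(x, r \<odot>\<^bsub>B\<^esub> y) \<in> carrier M" using assms by simp
qed (use assms in auto)

text \<open>The generating sets are enlarged to their spans one slot at a time. \<open>F\<close>
  collects the slots already enlarged, and the last factor is treated in the base case. With all
  other entries fixed, the entries of one slot that lead into \<open>W\<close> form a
  subspace.\<close>

lemma pure_tensor_in_subspace:
  assumes W: "subspace (class_ring :: real ring) W TA"
    and V: "\<And>i. i \<in> I \<Longrightarrow> V i \<subseteq> carrier (A i)" "V' \<subseteq> carrier B"
    and gen: "\<And>x y. x \<in> (\<Pi>\<^sub>E i\<in>I. V i) \<Longrightarrow> y \<in> V' \<Longrightarrow> pt (x, y) \<in> W"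
    and x: "x \<in> (\<Pi>\<^sub>E i\<in>I. real_span (A i) (V i))" and y: "y \<in> real_span B V'"
  shows "pt (x, y) \<in> W"
proof -
  interpret B: ualg B by (rule ualgB)
  note Wp = TA.subspaceD[OF W]
  have sV: "V i \<subseteq> real_span (A i) (V i)" "real_span (A i) (V i) \<subseteq> carrier (A i)" if "i \<in> I" for i
  proof -
    interpret A: ualg "A i" by (rule ualgA[OF that])
    show "V i \<subseteq> real_span (A i) (V i)" by (rule A.V.in_own_span[OF V(1)[OF that]])
    show "real_span (A i) (V i) \<subseteq> carrier (A i)" by (rule A.V.span_is_subset2[OF V(1)[OF that]])
  qed
  have sV': "real_span B V' \<subseteq> carrier B" by (rule B.V.span_is_subset2[OF V(2)])
  have "finite F \<Longrightarrow> F \<subseteq> I \<Longrightarrow> x \<in> (\<Pi>\<^sub>E i\<in>I. if i \<in> F then real_span (A i) (V i) else V i) \<Longrightarrow>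
      pt (x, y) \<in> W" for F x
  proof (induction F arbitrary: x rule: finite_induct)
    case empty
    then have xV: "x \<in> (\<Pi>\<^sub>E i\<in>I. V i)" by simp
    have xc: "x \<in> (\<Pi>\<^sub>E i\<in>I. carrier (A i))"
      by (rule subsetD[OF PiE_mono xV]) (use V in auto)
    let ?S = "{y \<in> carrier B. pt (x, y) \<in> W}"
    have "real_span B V' \<subseteq> ?S"
    proof (rule B.span_least)
      show "V' \<subseteq> ?S" using gen[OF xV] V(2) by blast
      have z: "pt (x, \<zero>\<^bsub>B\<^esub>) \<in> W"
        using pt_smult_last[OF xc, of "\<zero>\<^bsub>B\<^esub>" 0] pt_closed[of "(x, \<zero>\<^bsub>B\<^esub>)"] xc Wp(2) by simp
      show "subspace class_ring ?S B"
        by (rule B.subspaceI) (use z pt_add_last[OF xc] pt_smult_last[OF xc] Wp in auto)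
    qed
    then show ?case using y by blast
  next
    case (insert j F)
    have j: "j \<in> I" using insert by simp
    interpret Aj: ualg "A j" by (rule ualgA[OF j])
    have xc: "x \<in> (\<Pi>\<^sub>E i\<in>I. carrier (A i))"
      by (rule subsetD[OF PiE_mono insert(5)]) (use sV V in auto)
    have yB: "y \<in> carrier B" using y sV' by blast
    let ?S = "{a \<in> carrier (A j). pt (x(j := a), y) \<in> W}"
    have "real_span (A j) (V j) \<subseteq> ?S"
    proof (rule Aj.span_least)
      have "pt (x(j := a), y) \<in> W" if a: "a \<in> V j" for a
      proof (rule insert(3))
        show "x(j := a) \<in> (\<Pi>\<^sub>E i\<in>I. if i \<in> F then real_span (A i) (V i) else V i)"
        proof (rule PiE_I)
          fix i assume i: "i \<in> I"
          show "(x(j := a)) i \<in> (if i \<in> F then real_span (A i) (V i) else V i)"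
          proof (cases "i = j")
            case True then show ?thesis using a insert(2) by simp
          next
            case False then show ?thesis using PiE_mem[OF insert(5) i] by simp
          qed
        next
          fix i assume i: "i \<notin> I"
          then have "i \<noteq> j" using j by auto
          then show "(x(j := a)) i = undefined" using PiE_arb[OF insert(5) i] by simp
        qed
      qed (use insert in auto)
      then show "V j \<subseteq> ?S" using V(1)[OF j] by blast
      have z: "pt (x(j := \<zero>\<^bsub>A j\<^esub>), y) \<in> W"
        using pt_smult[OF xc j Aj.zero_closed yB, of 0] pt_closed[of "(x(j := \<zero>\<^bsub>A j\<^esub>), y)"]
          upd_closed[OF xc j Aj.zero_closed] yB Wp(2) by simp
      show "subspace class_ring ?S (A j)"
        by (rule Aj.subspaceI) (use z pt_add[OF xc j _ _ yB] pt_smult[OF xc j _ yB] Wp in auto)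
    qed
    moreover have "x j \<in> real_span (A j) (V j)" using PiE_mem[OF insert(5) j] by simp
    ultimately have "pt (x(j := x j), y) \<in> W" by blast
    then show ?case by simp
  qed
  from this[OF finI order_refl] show ?thesis using x by (simp cong: PiE_cong)
qed

text \<open>Every coset has a finitely supported representative, hence is a combination of cosets of
  point masses, which are the pure tensors.\<close>

lemma subspace_whole:
  assumes W: "subspace (class_ring :: real ring) W TA" and pt: "\<And>u. u \<in> carrier M \<Longrightarrow> pt u \<in> W"
  shows "carrier TA \<subseteq> W"
proof
  note Wp = TA.subspaceD[OF W]
  fix X assume "X \<in> carrier TA"
  then obtain p where p: "p \<in> carrier (monoid_algebra M)" "X = tensor_ideal I A B +>\<^bsub>monoid_algebra M\<^esub> p"
    using quot(3) by blast
  have "tensor_ideal I A B +>\<^bsub>monoid_algebra M\<^esub> p \<in> W" using monoidM p(1)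
  proof (induction rule: monoid_algebra_induct)
    case zero
    have "tensor_ideal I A B +>\<^bsub>monoid_algebra M\<^esub> \<zero>\<^bsub>monoid_algebra M\<^esub> = \<zero>\<^bsub>TA\<^esub>"
      using quot(8)[OF MA.zero_closed] additive_subgroup.zero_closed[OF ideal.axioms(1)[OF ideal_tensor]] by blast
    then show ?case using Wp(2) by simp
  next
    case (add p u r)
    note d = delta_closed[OF add(2)]
    have "tensor_ideal I A B +>\<^bsub>monoid_algebra M\<^esub> (p \<oplus>\<^bsub>monoid_algebra M\<^esub> r \<odot>\<^bsub>monoid_algebra M\<^esub> delta u) =
      (tensor_ideal I A B +>\<^bsub>monoid_algebra M\<^esub> p) \<oplus>\<^bsub>TA\<^esub> r \<odot>\<^bsub>TA\<^esub> pt u"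
      unfolding pure_tensor_def quot(6)[OF d] quot(4)[OF add(1) MA.sm_closed[OF d]] ..
    then show ?case using Wp(3)[OF add(3) Wp(4)[OF pt[OF add(2)]]] by simp
  qed
  then show "X \<in> W" using p by simp
qed

text \<open>A linear relation between pure tensors is inherited by the images of the tuples.
  Multilinearity puts the defining relations into the kernel of the linear extension of
  \<open>\<phi>\<close>. Since the tensor ideal is the ring ideal they generate, the kernel must be
  an ideal too, and that is where multiplicativity of \<open>\<phi>\<close> comes in.\<close>

lemma lift_zero:
  fixes C :: "(real, 'c) module"
  assumes C: "ualg C" and clo: "\<phi> \<in> carrier M \<rightarrow> carrier C"
    and mult: "\<And>u v. u \<in> carrier M \<Longrightarrow> v \<in> carrier M \<Longrightarrow> \<phi> (u \<otimes>\<^bsub>M\<^esub> v) = \<phi> u \<otimes>\<^bsub>C\<^esub> \<phi> v"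
    and lin: "multilinear \<phi> C"
    and u: "U \<in> K \<rightarrow> carrier M" and z: "TA.lc K (pt \<circ> U) c = \<zero>\<^bsub>TA\<^esub>"
  shows "ualg.lc C K (\<phi> \<circ> U) c = \<zero>\<^bsub>C\<^esub>"
proof -
  interpret C: ualg C by (rule C)
  let ?A = "monoid_algebra M"
  let ?L = "lin_ext C \<phi>"
  note L = lin_ext[OF monoidM C clo]
  note Lm = lin_ext_mult[OF monoidM C clo mult]
  have Lz: "?L \<zero>\<^bsub>?A\<^esub> = \<zero>\<^bsub>C\<^esub>" using L(3)[OF MA.zero_closed, of 0] L(1)[OF MA.zero_closed] by simp
  define N where "N = {p \<in> carrier ?A. ?L p = \<zero>\<^bsub>C\<^esub>}"
  have N: "ideal N ?A"
  proof (rule idealI[OF MA.ring_axioms])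
    show "subgroup N (add_monoid ?A)"
    proof (rule MA.add.subgroupI)
      show "N \<subseteq> carrier ?A" by (auto simp: N_def)
      show "N \<noteq> {}" using Lz MA.zero_closed unfolding N_def by blast
      show "\<ominus>\<^bsub>?A\<^esub> p \<in> N" if "p \<in> N" for p
        using that MA.sm_minus[of p 1] L(3)[of p "-1"] MA.sm_one[of p] MA.a_inv_closed[of p] unfolding N_def by (simp del: monoid_algebra_simps)
      show "p \<oplus>\<^bsub>?A\<^esub> q \<in> N" if "p \<in> N" "q \<in> N" for p q
        using that L(2)[of p q] MA.a_closed[of p q] unfolding N_def by (simp del: monoid_algebra_simps)
    qed
    show "x \<otimes>\<^bsub>?A\<^esub> p \<in> N" "p \<otimes>\<^bsub>?A\<^esub> x \<in> N" if "p \<in> N" "x \<in> carrier ?A" for p x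
      using that Lm[of x p] Lm[of p x] L(1)[of x] unfolding N_def by auto
  qed
  have add_rel: "(\<lambda>w. delta u w - delta v w - delta v' w) \<in> N"
    if c: "u \<in> carrier M" "v \<in> carrier M" "v' \<in> carrier M" and e: "\<phi> u = \<phi> v \<oplus>\<^bsub>C\<^esub> \<phi> v'" for u v v'
  proof -
    note d = delta_closed[OF c(1)] delta_closed[OF c(2)] delta_closed[OF c(3)]
    note s = MA.sm_closed[OF d(2), of "-1"] MA.sm_closed[OF d(3), of "-1"]
    have p: "\<phi> u \<in> carrier C" "\<phi> v \<in> carrier C" "\<phi> v' \<in> carrier C" using clo c by blast+
    have "?L (delta u \<oplus>\<^bsub>?A\<^esub> ((-1) \<odot>\<^bsub>?A\<^esub> delta v \<oplus>\<^bsub>?A\<^esub> (-1) \<odot>\<^bsub>?A\<^esub> delta v')) =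
      \<phi> u \<oplus>\<^bsub>C\<^esub> ((-1) \<odot>\<^bsub>C\<^esub> \<phi> v \<oplus>\<^bsub>C\<^esub> (-1) \<odot>\<^bsub>C\<^esub> \<phi> v')"
      using L(2)[OF d(1) MA.a_closed[OF s]] L(2)[OF s] L(3)[OF d(2), of "-1"] L(3)[OF d(3), of "-1"]
        L(4)[OF c(1)] L(4)[OF c(2)] L(4)[OF c(3)] by (simp del: monoid_algebra_simps)
    also have "\<dots> = \<zero>\<^bsub>C\<^esub>"
    proof -
      have "(-1) \<odot>\<^bsub>C\<^esub> \<phi> v \<oplus>\<^bsub>C\<^esub> (-1) \<odot>\<^bsub>C\<^esub> \<phi> v' = \<ominus>\<^bsub>C\<^esub> (\<phi> v \<oplus>\<^bsub>C\<^esub> \<phi> v')"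
        using p by (simp add: C.sm_minus C.minus_add)
      then show ?thesis using e p by (simp add: C.r_neg)
    qed
    finally show ?thesis unfolding rel_simps(1) N_def using MA.a_closed[OF d(1) MA.a_closed[OF s]] by blast
  qed
  have smult_rel: "(\<lambda>w. delta u w - r * delta v w) \<in> N"
    if c: "u \<in> carrier M" "v \<in> carrier M" and e: "\<phi> u = r \<odot>\<^bsub>C\<^esub> \<phi> v" for u v r
  proof -
    note d = delta_closed[OF c(1)] delta_closed[OF c(2)]
    note s = MA.sm_closed[OF d(2), of "-r"]
    have p: "\<phi> u \<in> carrier C" "\<phi> v \<in> carrier C" using clo c by blast+
    have "?L (delta u \<oplus>\<^bsub>?A\<^esub> (-r) \<odot>\<^bsub>?A\<^esub> delta v) = \<phi> u \<oplus>\<^bsub>C\<^esub> (-r) \<odot>\<^bsub>C\<^esub> \<phi> v"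
      using L(2)[OF d(1) s] L(3)[OF d(2), of "-r"] L(4)[OF c(1)] L(4)[OF c(2)] by (simp del: monoid_algebra_simps)
    also have "\<dots> = \<zero>\<^bsub>C\<^esub>" using e p by (simp add: C.sm_minus C.r_neg)
    finally show ?thesis unfolding rel_simps(2) N_def using MA.a_closed[OF d(1) s] by blast
  qed
  interpret B: ualg B by (rule ualgB)
  have "multilinear_relations I A B \<subseteq> N"
  proof
    fix \<rho> assume "\<rho> \<in> multilinear_relations I A B"
    then show "\<rho> \<in> N" unfolding multilinear_relations_def
    proof (elim UnE CollectE exE conjE, goal_cases)
      case (1 x i a a' y)
      show ?case unfolding 1(1)
        by (rule add_rel)
          (use 1 lin upd_closed carrier_op in \<open>simp_all add: multilinear_def del: fun_upd_apply\<close>)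
    next
      case (2 x i a r y)
      show ?case unfolding 2(1)
        by (rule smult_rel)
          (use 2 lin upd_closed carrier_op in \<open>simp_all add: multilinear_def del: fun_upd_apply\<close>)
    next
      case (3 x y y')
      show ?case unfolding 3(1)
        by (rule add_rel)
          (use 3 lin in \<open>auto simp: multilinear_def\<close>)
    next
      case (4 x r y)
      show ?case unfolding 4(1)
        by (rule smult_rel)
          (use 4 lin in \<open>auto simp: multilinear_def\<close>)
    qed
  qed
  then have JN: "tensor_ideal I A B \<subseteq> N" unfolding tensor_ideal_def by (rule MA.genideal_minimal[OF N])
  let ?\<pi> = "\<lambda>p. tensor_ideal I A B +>\<^bsub>?A\<^esub> p"
  have dU: "delta \<circ> U \<in> K \<rightarrow> carrier ?A"
    by (intro funcsetI, unfold comp_def, rule delta_closed, rule funcset_mem[OF u])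
  have "?\<pi> (MA.lc K (delta \<circ> U) c) = TA.lc K (?\<pi> \<circ> (delta \<circ> U)) c"
    by (rule linear_lc[OF MA.ualg_axioms TA.ualg_axioms dU]) (use quot(2,4,6) in auto)
  also have "?\<pi> \<circ> (delta \<circ> U) = pt \<circ> U" by (auto simp: pure_tensor_def)
  finally have "?\<pi> (MA.lc K (delta \<circ> U) c) = \<zero>\<^bsub>TA\<^esub>" using z by (simp only:)
  then have "MA.lc K (delta \<circ> U) c \<in> tensor_ideal I A B"
    using quot(8)[OF MA.lc_closed[OF dU]] by blast
  then have "?L (MA.lc K (delta \<circ> U) c) = \<zero>\<^bsub>C\<^esub>" using JN by (auto simp: N_def)
  moreover have "?L (MA.lc K (delta \<circ> U) c) = C.lc K (?L \<circ> (delta \<circ> U)) c"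
    by (rule linear_lc[OF MA.ualg_axioms C dU]) (erule L(1) | erule (1) L(2) | erule L(3))+
  moreover have "C.lc K (?L \<circ> (delta \<circ> U)) c = C.lc K (\<phi> \<circ> U) c"
    unfolding C.lc_def by (rule C.finsum_cong') (use u clo L(4) in \<open>auto simp: Pi_iff\<close>)
  ultimately show ?thesis by simp
qed

end

lemma comm_group_product:
  assumes "\<And>i. i \<in> I \<Longrightarrow> comm_group (H i)" "comm_group H'"
  shows "comm_group (product_group I H \<times>\<times> H')"
proof -
  have g: "Group.group (product_group I H)"
    by (rule product_group) (use assms in \<open>auto simp: comm_group_def\<close>)
  interpret P: Group.group "product_group I H \<times>\<times> H'"
    by (rule DirProd_group[OF g]) (use assms in \<open>simp add: comm_group_def\<close>)
  show ?thesis
  proof (rule P.group_comm_groupI)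
    fix u v assume "u \<in> carrier (product_group I H \<times>\<times> H')" "v \<in> carrier (product_group I H \<times>\<times> H')"
    then obtain x y x' y' where u: "u = (x, y)" "v = (x', y')"
      and c: "x \<in> (\<Pi>\<^sub>E i\<in>I. carrier (H i))" "x' \<in> (\<Pi>\<^sub>E i\<in>I. carrier (H i))" "y \<in> carrier H'" "y' \<in> carrier H'"
      by auto
    have "(\<lambda>i\<in>I. x i \<otimes>\<^bsub>H i\<^esub> x' i) = (\<lambda>i\<in>I. x' i \<otimes>\<^bsub>H i\<^esub> x i)"
    proof (rule restrict_ext)
      fix i assume i: "i \<in> I"
      show "x i \<otimes>\<^bsub>H i\<^esub> x' i = x' i \<otimes>\<^bsub>H i\<^esub> x i"
        using comm_groupE(4)[OF assms(1)[OF i]] PiE_mem[OF c(1) i] PiE_mem[OF c(2) i] by blast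
    qed
    moreover have "y \<otimes>\<^bsub>H'\<^esub> y' = y' \<otimes>\<^bsub>H'\<^esub> y" using comm_groupE(4)[OF assms(2)] c by blast
    ultimately show "u \<otimes>\<^bsub>product_group I H \<times>\<times> H'\<^esub> v = v \<otimes>\<^bsub>product_group I H \<times>\<times> H'\<^esub> u"
      unfolding u by simp
  qed
qed

locale graded_tensor = tensor I A B
  for I :: "'i set" and A :: "'i \<Rightarrow> (real, 'a) module" and B :: "(real, 'b) module" +
  fixes H :: "'i \<Rightarrow> ('g, 'c) monoid_scheme" and H' :: "('h, 'e) monoid_scheme"
    and b :: "'i \<Rightarrow> 'g \<Rightarrow> 'a" and b' :: "'h \<Rightarrow> 'b" and s :: "'i \<Rightarrow> 'g \<Rightarrow> 'g \<Rightarrow> real" and s' :: "'h \<Rightarrow> 'h \<Rightarrow> real"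
  assumes gA: "\<And>i. i \<in> I \<Longrightarrow> gbasis (H i) (A i) (b i) (s i)" and gB: "gbasis H' B b' s'"
begin

definition PG where "PG = product_group I H \<times>\<times> H'"

text \<open>The tuple whose pure tensor will be the basis vector of degree
  \<open>(g, h)\<close>.\<close>

definition U :: "('i \<Rightarrow> 'g) \<times> 'h \<Rightarrow> ('i \<Rightarrow> 'a) \<times> 'b" where
  "U = (\<lambda>(g, h). (\<lambda>i\<in>I. b i (g i), b' h))"

lemma carrier_PG: "carrier PG = (\<Pi>\<^sub>E i\<in>I. carrier (H i)) \<times> carrier H'" by (simp add: PG_def)

lemma comm_group_PG: "comm_group PG"
  unfolding PG_def by (rule comm_group_product) (use gbasisD(2) gA gB in blast)+

lemma finite_PG: "finite (carrier PG)"
  unfolding carrier_PG using gbasisD(7)[OF gA] gbasisD(7)[OF gB] finI by (auto intro!: finite_PiE)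

lemma U_closed: "k \<in> carrier PG \<Longrightarrow> U k \<in> carrier M"
  unfolding carrier_PG U_def using gbasisD(8)[OF gA] gbasisD(8)[OF gB] by (auto simp: PiE_iff)

lemma ptU_closed: "k \<in> carrier PG \<Longrightarrow> pt (U k) \<in> carrier TA"
  by (rule pt_closed[OF U_closed])

text \<open>Entries taken from the lines of basis vectors give a pure tensor on the line of the
  basis tensor. Products of basis tensors and the components of the product grading are both handled
  this way, without tracking the scalars of the individual slots.\<close>

lemma pt_line:
  assumes k: "(g, h) \<in> carrier PG" and x: "x \<in> (\<Pi>\<^sub>E i\<in>I. real_span (A i) {b i (g i)})" "y \<in> real_span B {b' h}"
  shows "\<exists>r. pt (x, y) = r \<odot>\<^bsub>TA\<^esub> pt (U (g, h))"
proof -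
  have c: "b i (g i) \<in> carrier (A i)" if "i \<in> I" for i
    using k gbasisD(8)[OF gA[OF that]] that unfolding carrier_PG by auto
  have c': "b' h \<in> carrier B" using k gbasisD(8)[OF gB] unfolding carrier_PG by auto
  let ?W = "real_span TA {pt (U (g, h))}"
  note uc = ptU_closed[OF k]
  have W: "subspace (class_ring :: real ring) ?W TA" by (rule TA.span_subspace) (use uc in simp)
  have "pt (x, y) \<in> ?W"
  proof (rule pure_tensor_in_subspace[OF W _ _ _ x])
    fix x y assume "x \<in> (\<Pi>\<^sub>E i\<in>I. {b i (g i)})" "y \<in> {b' h}"
    then have "(x, y) = U (g, h)" unfolding U_def by (auto simp: PiE_iff extensional_def)
    then have "pt (x, y) = pt (U (g, h))" by simp
    also have "\<dots> \<in> ?W" unfolding TA.span_single[OF uc] using TA.sm_one[OF uc] by (metis (mono_tags, lifting) mem_Collect_eq)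
    finally show "pt (x, y) \<in> ?W" .
  qed (use c c' in auto)
  then show ?thesis unfolding TA.span_single[OF uc] by auto
qed

lemma ptU_mult:
  assumes "k \<in> carrier PG" "l \<in> carrier PG"
  shows "\<exists>r. pt (U k) \<otimes>\<^bsub>TA\<^esub> pt (U l) = r \<odot>\<^bsub>TA\<^esub> pt (U (k \<otimes>\<^bsub>PG\<^esub> l))"
proof -
  obtain g h g' h' where kl: "k = (g, h)" "l = (g', h')" by fastforce
  have c: "g i \<in> carrier (H i)" "g' i \<in> carrier (H i)" if "i \<in> I" for i using assms that unfolding kl carrier_PG by auto
  have c': "h \<in> carrier H'" "h' \<in> carrier H'" using assms unfolding kl carrier_PG by auto
  interpret PG: comm_group PG by (rule comm_group_PG)
  have "pt (U k) \<otimes>\<^bsub>TA\<^esub> pt (U l) = pt (U k \<otimes>\<^bsub>M\<^esub> U l)" by (rule pt_mult) (use U_closed assms in auto)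
  also have "U k \<otimes>\<^bsub>M\<^esub> U l = ((\<lambda>i\<in>I. b i (g i) \<otimes>\<^bsub>A i\<^esub> b i (g' i)), b' h \<otimes>\<^bsub>B\<^esub> b' h')"
    unfolding kl U_def by (auto intro!: restrict_ext)
  finally have e: "pt (U k) \<otimes>\<^bsub>TA\<^esub> pt (U l) = pt \<dots>" .
  have kl': "k \<otimes>\<^bsub>PG\<^esub> l = (\<lambda>i\<in>I. g i \<otimes>\<^bsub>H i\<^esub> g' i, h \<otimes>\<^bsub>H'\<^esub> h')" unfolding kl PG_def by simp
  show ?thesis unfolding e kl'
  proof (rule pt_line)
    show "(\<lambda>i\<in>I. g i \<otimes>\<^bsub>H i\<^esub> g' i, h \<otimes>\<^bsub>H'\<^esub> h') \<in> carrier PG" using PG.m_closed[OF assms] unfolding kl' .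
    show "(\<lambda>i\<in>I. b i (g i) \<otimes>\<^bsub>A i\<^esub> b i (g' i)) \<in> (\<Pi>\<^sub>E i\<in>I. real_span (A i) {b i ((\<lambda>i\<in>I. g i \<otimes>\<^bsub>H i\<^esub> g' i) i)})"
    proof (rule PiE_I)
      fix i assume i: "i \<in> I"
      interpret Ai: ualg "A i" by (rule ualgA[OF i])
      note gi = gbasisD[OF gA[OF i]]
      interpret Hi: comm_group "H i" by (rule gi)
      have "b i (g i \<otimes>\<^bsub>H i\<^esub> g' i) \<in> carrier (A i)" using gi(8) c[OF i] by simp
      then show "(\<lambda>i\<in>I. b i (g i) \<otimes>\<^bsub>A i\<^esub> b i (g' i)) i \<in> real_span (A i) {b i ((\<lambda>i\<in>I. g i \<otimes>\<^bsub>H i\<^esub> g' i) i)}"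
        using i gi(6)[OF c[OF i]] by (auto simp: Ai.span_single)
    qed auto
    interpret B: ualg B by (rule ualgB)
    note gi = gbasisD[OF gB]
    interpret H': comm_group H' by (rule gi)
    have "b' (h \<otimes>\<^bsub>H'\<^esub> h') \<in> carrier B" using gi(8) c' by simp
    then show "b' h \<otimes>\<^bsub>B\<^esub> b' h' \<in> real_span B {b' (h \<otimes>\<^bsub>H'\<^esub> h')}"
      using gi(6)[OF c'] by (auto simp: B.span_single)
  qed
qed

lemma ptU_one: "pt (U \<one>\<^bsub>PG\<^esub>) = \<one>\<^bsub>TA\<^esub>"
proof -
  have "U \<one>\<^bsub>PG\<^esub> = \<one>\<^bsub>M\<^esub>"
    unfolding U_def PG_def using gbasisD(4)[OF gA] gbasisD(4)[OF gB] by (auto intro!: restrict_ext)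
  then show ?thesis using pt_one by simp
qed

text \<open>The inverse is taken slot by slot. Once the tensor product is known to be a nonzero
  ring, this shows that the scalars of \<open>ptU_mult\<close> do not vanish.\<close>

lemma ptU_unit: "k \<in> carrier PG \<Longrightarrow> pt (U k) \<in> Units TA"
proof -
  assume k: "k \<in> carrier PG"
  obtain g h where gh: "k = (g, h)" by fastforce
  have c: "g i \<in> carrier (H i)" if "i \<in> I" for i using k that unfolding gh carrier_PG by auto
  have c': "h \<in> carrier H'" using k unfolding gh carrier_PG by auto
  have "\<forall>i\<in>I. \<exists>x. x \<in> carrier (A i) \<and> x \<otimes>\<^bsub>A i\<^esub> b i (g i) = \<one>\<^bsub>A i\<^esub> \<and> b i (g i) \<otimes>\<^bsub>A i\<^esub> x = \<one>\<^bsub>A i\<^esub>"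
    using gbasis_Units[OF gA c] unfolding Units_def by blast
  then obtain x where x: "\<And>i. i \<in> I \<Longrightarrow> x i \<in> carrier (A i)" "\<And>i. i \<in> I \<Longrightarrow> x i \<otimes>\<^bsub>A i\<^esub> b i (g i) = \<one>\<^bsub>A i\<^esub>"
    "\<And>i. i \<in> I \<Longrightarrow> b i (g i) \<otimes>\<^bsub>A i\<^esub> x i = \<one>\<^bsub>A i\<^esub>" by metis
  obtain y where y: "y \<in> carrier B" "y \<otimes>\<^bsub>B\<^esub> b' h = \<one>\<^bsub>B\<^esub>" "b' h \<otimes>\<^bsub>B\<^esub> y = \<one>\<^bsub>B\<^esub>"
    using gbasis_Units[OF gB c'] unfolding Units_def by blast
  let ?v = "(\<lambda>i\<in>I. x i, y)"
  have v: "?v \<in> carrier M" using x y by auto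
  have "U k \<otimes>\<^bsub>M\<^esub> ?v = \<one>\<^bsub>M\<^esub>" "?v \<otimes>\<^bsub>M\<^esub> U k = \<one>\<^bsub>M\<^esub>"
    unfolding gh U_def using x y by (auto intro!: restrict_ext)
  then have "pt (U k) \<otimes>\<^bsub>TA\<^esub> pt ?v = \<one>\<^bsub>TA\<^esub>" "pt ?v \<otimes>\<^bsub>TA\<^esub> pt (U k) = \<one>\<^bsub>TA\<^esub>"
    unfolding pt_mult[OF U_closed[OF k] v] pt_mult[OF v U_closed[OF k]] pt_one[symmetric] by simp_all
  then show ?thesis unfolding Units_def using ptU_closed[OF k] pt_closed[OF v] by blast
qed

lemma product_grading_eq:
  assumes k: "(g, h) \<in> carrier PG"
    and Ga: "\<And>i g. i \<in> I \<Longrightarrow> g \<in> carrier (H i) \<Longrightarrow> \<Gamma> i g = real_span (A i) {b i g}"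
    and Gb: "\<And>h. h \<in> carrier H' \<Longrightarrow> \<Gamma>' h = real_span B {b' h}"
  shows "product_grading I A B \<Gamma> \<Gamma>' (g, h) = {r \<odot>\<^bsub>TA\<^esub> pt (U (g, h)) | r. True}"
proof -
  have c: "g i \<in> carrier (H i)" if "i \<in> I" for i using k that unfolding carrier_PG by auto
  have c': "h \<in> carrier H'" using k unfolding carrier_PG by auto
  note uc = ptU_closed[OF k]
  let ?L = "{r \<odot>\<^bsub>TA\<^esub> pt (U (g, h)) | r. True}"
  let ?S = "{pt (x, y) | x y. x \<in> (\<Pi>\<^sub>E i\<in>I. \<Gamma> i (g i)) \<and> y \<in> \<Gamma>' h}"
  have L: "?L = real_span TA {pt (U (g, h))}" using TA.span_single[OF uc] by simp
  have Lsub: "subspace (class_ring :: real ring) ?L TA" unfolding L by (rule TA.span_subspace) (use uc in simp)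
  have SL: "?S \<subseteq> ?L"
  proof
    fix z assume "z \<in> ?S"
    then obtain x y where z: "z = pt (x, y)" and x: "x \<in> (\<Pi>\<^sub>E i\<in>I. \<Gamma> i (g i))" and y: "y \<in> \<Gamma>' h" by auto
    have "x \<in> (\<Pi>\<^sub>E i\<in>I. real_span (A i) {b i (g i)})" using x Ga c by (simp cong: PiE_cong)
    then show "z \<in> ?L" using pt_line[OF k _ y[unfolded Gb[OF c']]] unfolding z by blast
  qed
  have "U (g, h) \<in> {(x, y) | x y. x \<in> (\<Pi>\<^sub>E i\<in>I. \<Gamma> i (g i)) \<and> y \<in> \<Gamma>' h}"
  proof -
    have "b i (g i) \<in> \<Gamma> i (g i)" if i: "i \<in> I" for i
    proof -
      interpret Ai: ualg "A i" by (rule ualgA[OF i])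
      show ?thesis unfolding Ga[OF i c[OF i]]
        using Ai.V.in_own_span[of "{b i (g i)}"] gbasisD(8)[OF gA[OF i] c[OF i]] by simp
    qed
    moreover have "b' h \<in> \<Gamma>' h"
    proof -
      interpret B: ualg B by (rule ualgB)
      show ?thesis unfolding Gb[OF c'] using B.V.in_own_span[of "{b' h}"] gbasisD(8)[OF gB c'] by simp
    qed
    ultimately show ?thesis unfolding U_def by auto
  qed
  then obtain x y where xy: "U (g, h) = (x, y)" "x \<in> (\<Pi>\<^sub>E i\<in>I. \<Gamma> i (g i))" "y \<in> \<Gamma>' h" by blast
  have uS: "{pt (U (g, h))} \<subseteq> ?S" unfolding xy(1) using xy(2,3) by blast
  have Sc: "?S \<subseteq> carrier TA" using SL TA.subspaceD(1)[OF Lsub] by (rule order_trans)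
  have "real_span TA ?S \<subseteq> ?L" by (rule TA.span_least[OF SL Lsub])
  moreover have "?L \<subseteq> real_span TA ?S" unfolding L by (rule TA.V.span_is_monotone[OF uS])
  ultimately show ?thesis unfolding product_grading_def by auto
qed

text \<open>The pure tensors of basis elements span by multilinearity; they are independent because a
  multilinear map sends them to a basis of \<open>C\<close>.\<close>

lemma tensor_gbasis:
  fixes C :: "(real, 'z) module"
  assumes C: "ualg C" and ne: "\<one>\<^bsub>C\<^esub> \<noteq> \<zero>\<^bsub>C\<^esub>" and clo: "\<phi> \<in> carrier M \<rightarrow> carrier C"
    and mult: "\<And>u v. u \<in> carrier M \<Longrightarrow> v \<in> carrier M \<Longrightarrow> \<phi> (u \<otimes>\<^bsub>M\<^esub> v) = \<phi> u \<otimes>\<^bsub>C\<^esub> \<phi> v"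
    and lin: "multilinear \<phi> C" and fb: "ualg.fbasis C (carrier PG) (\<phi> \<circ> U)"
  shows "isomorphic_algebras TA C" and "\<exists>\<sigma>. gbasis PG TA (pt \<circ> U) \<sigma>"
proof -
  interpret C: ualg C by (rule C)
  interpret PG: comm_group PG by (rule comm_group_PG)
  have ptU: "pt \<circ> U \<in> carrier PG \<rightarrow> carrier TA" using ptU_closed by auto
  have fbT: "TA.fbasis (carrier PG) (pt \<circ> U)"
    unfolding TA.fbasis_def
  proof (intro conjI finite_PG ptU)
    let ?W = "{TA.lc (carrier PG) (pt \<circ> U) c | c. True}"
    have W: "subspace (class_ring :: real ring) ?W TA"
    proof (rule TA.subspaceI)
      show "?W \<subseteq> carrier TA" using TA.lc_closed[OF ptU] by blast
      show "\<zero>\<^bsub>TA\<^esub> \<in> ?W" using TA.lc_zero[OF ptU] by (intro CollectI exI[of _ "\<lambda>_. 0"]) simp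
      show "x \<oplus>\<^bsub>TA\<^esub> y \<in> ?W" if xy: "x \<in> ?W" "y \<in> ?W" for x y
      proof -
        obtain c d where "x = TA.lc (carrier PG) (pt \<circ> U) c" "y = TA.lc (carrier PG) (pt \<circ> U) d" using xy by blast
        then have "x \<oplus>\<^bsub>TA\<^esub> y = TA.lc (carrier PG) (pt \<circ> U) (\<lambda>i. c i + d i)" using TA.lc_add[OF ptU] by simp
        then show ?thesis by blast
      qed
      show "r \<odot>\<^bsub>TA\<^esub> x \<in> ?W" if x: "x \<in> ?W" for r x
      proof -
        obtain c where "x = TA.lc (carrier PG) (pt \<circ> U) c" using x by blast
        then have "r \<odot>\<^bsub>TA\<^esub> x = TA.lc (carrier PG) (pt \<circ> U) (\<lambda>i. r * c i)" using TA.lc_smult[OF ptU] by simp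
        then show ?thesis by blast
      qed
    qed
    have "carrier TA \<subseteq> ?W"
    proof (rule subspace_whole[OF W])
      fix u assume u: "u \<in> carrier M"
      obtain x y where xy: "u = (x, y)" by fastforce
      interpret B: ualg B by (rule ualgB)
      have spA: "real_span (A i) (b i ` carrier (H i)) = carrier (A i)" if i: "i \<in> I" for i
      proof -
        interpret Ai: ualg "A i" by (rule ualgA[OF i])
        show ?thesis using Ai.fbasis_basis[OF gbasisD(3)[OF gA[OF i]]] by (simp add: Ai.V.basis_def)
      qed
      have spB: "real_span B (b' ` carrier H') = carrier B"
        using B.fbasis_basis[OF gbasisD(3)[OF gB]] by (simp add: B.V.basis_def)
      show "pt u \<in> ?W" unfolding xy
      proof (rule pure_tensor_in_subspace[OF W])
        show "x \<in> (\<Pi>\<^sub>E i\<in>I. real_span (A i) (b i ` carrier (H i)))" using u spA unfolding xy by (simp cong: PiE_cong)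
        show "y \<in> real_span B (b' ` carrier H')" using u spB unfolding xy by simp
        show "b i ` carrier (H i) \<subseteq> carrier (A i)" if "i \<in> I" for i using gbasisD(8)[OF gA[OF that]] by blast
        show "b' ` carrier H' \<subseteq> carrier B" using gbasisD(8)[OF gB] by blast
        fix x y assume x: "x \<in> (\<Pi>\<^sub>E i\<in>I. b i ` carrier (H i))" and y: "y \<in> b' ` carrier H'"
        have "\<forall>i\<in>I. \<exists>g. g \<in> carrier (H i) \<and> x i = b i g" using x by (auto simp: PiE_iff)
        then obtain g where g: "\<And>i. i \<in> I \<Longrightarrow> g i \<in> carrier (H i)" "\<And>i. i \<in> I \<Longrightarrow> x i = b i (g i)" by metis
        obtain h where h: "h \<in> carrier H'" "y = b' h" using y by blast
        have k: "(\<lambda>i\<in>I. g i, h) \<in> carrier PG" unfolding carrier_PG using g h by auto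
        have "(\<lambda>i\<in>I. b i ((\<lambda>i\<in>I. g i) i)) = x"
        proof
          fix i show "(\<lambda>i\<in>I. b i ((\<lambda>i\<in>I. g i) i)) i = x i" using g(2)[of i] PiE_arb[OF x, of i] by (cases "i \<in> I") auto
        qed
        then have "(x, y) = U (\<lambda>i\<in>I. g i, h)" unfolding U_def h(2) by simp
        then have "pt (x, y) = 1 \<odot>\<^bsub>TA\<^esub> (pt \<circ> U) (\<lambda>i\<in>I. g i, h)" using ptU_closed[OF k] by simp
        also have "\<dots> = TA.lc (carrier PG) (pt \<circ> U) (\<lambda>j. if j = (\<lambda>i\<in>I. g i, h) then 1 else 0)"
          by (rule TA.lc_single[OF finite_PG k ptU, symmetric])
        finally show "pt (x, y) \<in> ?W" by blast
      qed
    qed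
    then show "\<forall>a\<in>carrier TA. \<exists>c. a = TA.lc (carrier PG) (pt \<circ> U) c" by blast
    show "TA.indep (carrier PG) (pt \<circ> U)" unfolding TA.indep_def
    proof (intro allI impI)
      fix c assume z: "TA.lc (carrier PG) (pt \<circ> U) c = \<zero>\<^bsub>TA\<^esub>"
      have "C.lc (carrier PG) (\<phi> \<circ> U) c = \<zero>\<^bsub>C\<^esub>"
        by (rule lift_zero[OF C clo mult lin _ z]) (use U_closed in auto)
      then show "\<forall>i\<in>carrier PG. c i = 0" using fb unfolding C.fbasis_def C.indep_def by blast
    qed
  qed
  have phiU: "\<phi> \<circ> U \<in> carrier PG \<rightarrow> carrier C" using fb by (auto simp: C.fbasis_def)
  \<comment> \<open>\<open>lift_zero\<close> for a relation between two pure tensors, indexed by the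
    truth values. It carries the structure constants from the tensor product over to
    \<open>C\<close>.\<close>
  have transfer: "\<phi> u = r \<odot>\<^bsub>C\<^esub> \<phi> v" if uv: "u \<in> carrier M" "v \<in> carrier M" "pt u = r \<odot>\<^bsub>TA\<^esub> pt v" for u v r
  proof -
    let ?V = "\<lambda>j::bool. if j then u else v"
    let ?c = "\<lambda>j::bool. if j then 1 else - r"
    have p: "pt u \<in> carrier TA" "pt v \<in> carrier TA" using pt_closed uv by auto
    have q: "\<phi> u \<in> carrier C" "\<phi> v \<in> carrier C" using clo uv by blast+
    have "TA.lc {True, False} (pt \<circ> ?V) ?c = pt u \<oplus>\<^bsub>TA\<^esub> (- r) \<odot>\<^bsub>TA\<^esub> pt v"
      unfolding TA.lc_def using p by (subst TA.finsum_insert; simp)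
    also have "\<dots> = \<zero>\<^bsub>TA\<^esub>" using uv(3) p by (simp add: TA.sm_minus TA.r_neg)
    finally have z: "TA.lc {True, False} (pt \<circ> ?V) ?c = \<zero>\<^bsub>TA\<^esub>" .
    have "C.lc {True, False} (\<phi> \<circ> ?V) ?c = \<zero>\<^bsub>C\<^esub>"
      by (rule lift_zero[OF C clo mult lin _ z]) (use uv in auto)
    moreover have "C.lc {True, False} (\<phi> \<circ> ?V) ?c = \<phi> u \<oplus>\<^bsub>C\<^esub> (- r) \<odot>\<^bsub>C\<^esub> \<phi> v"
      unfolding C.lc_def using q by (subst C.finsum_insert; simp)
    ultimately have "\<phi> u \<oplus>\<^bsub>C\<^esub> (\<ominus>\<^bsub>C\<^esub> (r \<odot>\<^bsub>C\<^esub> \<phi> v)) = \<zero>\<^bsub>C\<^esub>" using q by (simp add: C.sm_minus)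
    then show ?thesis using C.minus_equality[of "\<phi> u" "\<ominus>\<^bsub>C\<^esub> (r \<odot>\<^bsub>C\<^esub> \<phi> v)"] q by simp
  qed
  have "\<exists>\<psi>\<in>alg_iso TA C. \<forall>i\<in>carrier PG. \<psi> ((pt \<circ> U) i) = (\<phi> \<circ> U) i"
  proof (rule alg_iso_from_bases[OF TA.ualg_axioms C fbT fb])
    fix k l assume kl: "k \<in> carrier PG" "l \<in> carrier PG"
    obtain r where r: "pt (U k) \<otimes>\<^bsub>TA\<^esub> pt (U l) = r \<odot>\<^bsub>TA\<^esub> pt (U (k \<otimes>\<^bsub>PG\<^esub> l))" using ptU_mult[OF kl] by blast
    have m: "U k \<otimes>\<^bsub>M\<^esub> U l \<in> carrier M" by (rule Group.monoid.m_closed[OF monoidM U_closed[OF kl(1)] U_closed[OF kl(2)]])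
    have "pt (U k \<otimes>\<^bsub>M\<^esub> U l) = r \<odot>\<^bsub>TA\<^esub> pt (U (k \<otimes>\<^bsub>PG\<^esub> l))"
      using pt_mult[OF U_closed[OF kl(1)] U_closed[OF kl(2)]] r by simp
    then have "\<phi> (U k \<otimes>\<^bsub>M\<^esub> U l) = r \<odot>\<^bsub>C\<^esub> \<phi> (U (k \<otimes>\<^bsub>PG\<^esub> l))"
      by (rule transfer[OF m U_closed[OF PG.m_closed[OF kl]]])
    then have "\<phi> (U k) \<otimes>\<^bsub>C\<^esub> \<phi> (U l) = r \<odot>\<^bsub>C\<^esub> \<phi> (U (k \<otimes>\<^bsub>PG\<^esub> l))"
      using mult[OF U_closed[OF kl(1)] U_closed[OF kl(2)]] by simp
    then show "\<exists>j\<in>carrier PG. \<exists>r. (pt \<circ> U) k \<otimes>\<^bsub>TA\<^esub> (pt \<circ> U) l = r \<odot>\<^bsub>TA\<^esub> (pt \<circ> U) j \<and>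
        (\<phi> \<circ> U) k \<otimes>\<^bsub>C\<^esub> (\<phi> \<circ> U) l = r \<odot>\<^bsub>C\<^esub> (\<phi> \<circ> U) j"
      using r PG.m_closed[OF kl] by auto
  qed
  then obtain \<psi> where psi: "\<psi> \<in> alg_iso TA C" by blast
  then show "isomorphic_algebras TA C" by (auto simp: isomorphic_algebras_def)
  \<comment> \<open>The isomorphism with \<open>C\<close> excludes the zero ring, so units are
    nonzero and so are the structure constants.\<close>
  have neT: "\<one>\<^bsub>TA\<^esub> \<noteq> \<zero>\<^bsub>TA\<^esub>"
    using alg_isoD(5)[OF psi] alg_iso_zero[OF psi TA.ualg_axioms C] ne by auto
  have "\<exists>r. r \<noteq> 0 \<and> pt (U k) \<otimes>\<^bsub>TA\<^esub> pt (U l) = r \<odot>\<^bsub>TA\<^esub> pt (U (k \<otimes>\<^bsub>PG\<^esub> l))"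
    if kl: "k \<in> carrier PG" "l \<in> carrier PG" for k l
  proof -
    obtain r where r: "pt (U k) \<otimes>\<^bsub>TA\<^esub> pt (U l) = r \<odot>\<^bsub>TA\<^esub> pt (U (k \<otimes>\<^bsub>PG\<^esub> l))" using ptU_mult[OF kl] by blast
    have "pt (U k) \<otimes>\<^bsub>TA\<^esub> pt (U l) \<in> Units TA" using ptU_unit kl by simp
    moreover have "\<zero>\<^bsub>TA\<^esub> \<notin> Units TA" using neT by (auto simp: Units_def)
    ultimately have "r \<noteq> 0" using r ptU_closed[OF PG.m_closed[OF kl]] by auto
    then show ?thesis using r by blast
  qed
  then have "\<forall>k l. \<exists>r. k \<in> carrier PG \<longrightarrow> l \<in> carrier PG \<longrightarrow>
      r \<noteq> 0 \<and> pt (U k) \<otimes>\<^bsub>TA\<^esub> pt (U l) = r \<odot>\<^bsub>TA\<^esub> pt (U (k \<otimes>\<^bsub>PG\<^esub> l))" by blast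
  then obtain \<sigma> where "\<And>k l. k \<in> carrier PG \<Longrightarrow> l \<in> carrier PG \<Longrightarrow>
      \<sigma> k l \<noteq> 0 \<and> pt (U k) \<otimes>\<^bsub>TA\<^esub> pt (U l) = \<sigma> k l \<odot>\<^bsub>TA\<^esub> pt (U (k \<otimes>\<^bsub>PG\<^esub> l))"
    unfolding choice_iff by blast
  then have "gbasis PG TA (pt \<circ> U) \<sigma>"
    unfolding gbasis_def using TA.ualg_axioms comm_group_PG fbT ptU_one by simp
  then show "\<exists>\<sigma>. gbasis PG TA (pt \<circ> U) \<sigma>" by blast
qed

end

section \<open>The graded factors of the representatives\<close>

definition m2 :: "'a \<Rightarrow> 'a \<Rightarrow> 'a \<Rightarrow> 'a \<Rightarrow> 'a mat" where
  "m2 a b c d = mat_of_rows_list 2 [[a, b], [c, d]]"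

lemma m2_carrier [simp]: "m2 a b c d \<in> carrier_mat 2 2"
  and m2_dim [simp]: "dim_row (m2 a b c d) = 2" "dim_col (m2 a b c d) = 2"
  by (auto simp: m2_def mat_of_rows_list_def)

lemma m2_index [simp]: "m2 a b c d $$ (0, 0) = a" "m2 a b c d $$ (0, Suc 0) = b"
  "m2 a b c d $$ (Suc 0, 0) = c" "m2 a b c d $$ (Suc 0, Suc 0) = d"
  by (auto simp: m2_def mat_of_rows_list_def)

lemma eq_m2I:
  assumes "A \<in> carrier_mat 2 2" "A $$ (0, 0) = a" "A $$ (0, Suc 0) = b" "A $$ (Suc 0, 0) = c" "A $$ (Suc 0, Suc 0) = d"
  shows "A = m2 a b c d"
proof (rule eq_matI)
  fix i j assume "i < dim_row (m2 a b c d)" "j < dim_col (m2 a b c d)"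
  then have "i = 0 \<or> i = Suc 0" "j = 0 \<or> j = Suc 0" by auto
  then show "A $$ (i, j) = m2 a b c d $$ (i, j)" using assms by auto
qed (use assms in auto)

lemma m2_eq_iff [simp]: "m2 a b c d = m2 a' b' c' d' \<longleftrightarrow> a = a' \<and> b = b' \<and> c = c' \<and> d = d'"
  by (metis m2_index)

lemma m2_mult [simp]: "m2 a b c d * m2 a' b' c' d' =
  m2 (a * a' + b * c') (a * b' + b * d') (c * a' + d * c') (c * b' + d * d' :: 'a :: comm_ring_1)"
  by (rule eq_m2I) (auto simp: scalar_prod_def numeral_2_eq_2)

lemma m2_add [simp]: "m2 a b c d + m2 a' b' c' d' = m2 (a + a') (b + b') (c + c') (d + d' :: 'a :: comm_ring_1)"
  and m2_smult [simp]: "r \<cdot>\<^sub>m m2 a b c d = m2 (r * a) (r * b) (r * c) (r * d)"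
  by (rule eq_m2I; auto)+

lemma m2_one: "1\<^sub>m 2 = m2 1 0 0 (1 :: 'a :: comm_ring_1)"
  and m2_zero: "0\<^sub>m 2 2 = m2 0 0 0 (0 :: 'a :: comm_ring_1)"
  by (rule eq_m2I; auto)+

lemma m2_cases:
  assumes "A \<in> carrier_mat 2 2" obtains a b c d where "A = m2 a b c d"
  using eq_m2I[OF assms refl refl refl refl] by blast

lemma gbasisI:
  fixes D (structure)
  assumes "ualg D" "comm_group T" "ualg.fbasis D (carrier T) X" "X \<one>\<^bsub>T\<^esub> = \<one>"
    "\<And>s t. s \<in> carrier T \<Longrightarrow> t \<in> carrier T \<Longrightarrow> \<exists>r. r \<noteq> 0 \<and> X s \<otimes> X t = r \<odot> X (s \<otimes>\<^bsub>T\<^esub> t)"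
  shows "\<exists>\<sigma>. gbasis T D X \<sigma>"
proof -
  have "\<forall>s t. \<exists>r. s \<in> carrier T \<longrightarrow> t \<in> carrier T \<longrightarrow> r \<noteq> 0 \<and> X s \<otimes> X t = r \<odot> X (s \<otimes>\<^bsub>T\<^esub> t)"
    using assms(5) by blast
  then obtain \<sigma> where "\<And>s t. s \<in> carrier T \<Longrightarrow> t \<in> carrier T \<Longrightarrow> \<sigma> s t \<noteq> 0 \<and> X s \<otimes> X t = \<sigma> s t \<odot> X (s \<otimes>\<^bsub>T\<^esub> t)"
    unfolding choice_iff by blast
  then show ?thesis unfolding gbasis_def using assms(1-4) by blast
qed

lemma (in ualg) fbasis_cong:
  assumes "fbasis I X" "\<And>i. i \<in> I \<Longrightarrow> X i = Y i"
  shows "fbasis I Y"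
proof -
  have X: "X \<in> I \<rightarrow> carrier A" using assms by (simp add: fbasis_def)
  then have Y: "Y \<in> I \<rightarrow> carrier A" using assms(2) by (auto simp: Pi_iff)
  have "lc I X c = lc I Y c" for c
    unfolding lc_def by (rule finsum_cong') (use Y assms(2) in \<open>auto simp: Pi_iff\<close>)
  then show ?thesis using assms(1) Y unfolding fbasis_def indep_def by simp
qed

lemma Z2_carrier: "carrier Z2 = {0, 1}"
  by (auto simp: carrier_integer_mod_group)

abbreviation K4 :: "(int \<times> int) monoid" where "K4 \<equiv> Z2 \<times>\<times> Z2"

lemma K4_carrier: "carrier K4 = {(0, 0), (0, 1), (1, 0), (1, 1)}"
  by (auto simp: Z2_carrier)

lemma comm_group_DirProd:
  assumes "comm_group G" "comm_group H" shows "comm_group (G \<times>\<times> H)"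
proof -
  interpret G: comm_group G by fact
  interpret H: comm_group H by fact
  interpret Group.group "G \<times>\<times> H" by (rule DirProd_group) (auto simp: G.is_group H.is_group)
  show ?thesis by (rule group_comm_groupI) (auto simp: G.m_comm H.m_comm)
qed

text \<open>Up to complex scalars, the identity and the Pauli matrices, in the real form that spans
  the lines of \<open>M2R_grading\<close>.\<close>

definition pauli :: "int \<times> int \<Rightarrow> real mat" where
  "pauli g = mat_of_rows_list 2
     (if g = (0, 0) then [[1, 0], [0, 1]]
      else if g = (1, 0) then [[0, 1], [1, 0]]
      else if g = (0, 1) then [[-1, 0], [0, 1]]
      else [[0, -1], [1, 0]])"

lemma pauli_simps: "pauli (0, 0) = m2 1 0 0 1" "pauli (1, 0) = m2 0 1 1 0"
  "pauli (0, 1) = m2 (-1) 0 0 1" "pauli (1, 1) = m2 0 (-1) 1 0"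
  by (simp_all add: pauli_def m2_def)

lemma M2R_grading_eq: "M2R_grading g = real_span M2R {pauli g}"
  by (simp add: M2R_grading_def pauli_def)

lemma lc_matrix2:
  fixes X :: "'i \<Rightarrow> 'a::{comm_ring_1, real_algebra_1} mat"
  assumes "finite I" "X \<in> I \<rightarrow> carrier_mat 2 2"
  shows "ualg.lc (matrix_algebra 2) I X c = m2 (\<Sum>i\<in>I. of_real (c i) * X i $$ (0, 0))
    (\<Sum>i\<in>I. of_real (c i) * X i $$ (0, Suc 0)) (\<Sum>i\<in>I. of_real (c i) * X i $$ (Suc 0, 0))
    (\<Sum>i\<in>I. of_real (c i) * X i $$ (Suc 0, Suc 0))"
proof (rule eq_m2I)
  interpret M: ualg "matrix_algebra 2 :: (real, 'a mat) module" by (rule ualg_matrix_algebra)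
  show "M.lc I X c \<in> carrier_mat 2 2" using M.lc_closed[of X I c] assms by simp
qed (rule lc_matrix_index[OF assms]; simp)+

lemma gbasis_pauli: "\<exists>s. gbasis K4 M2R pauli s"
proof (rule gbasisI)
  show "ualg M2R" by (rule ualg_matrix_algebra)
  interpret M: ualg M2R by (rule ualg_matrix_algebra)
  show "comm_group K4" by (rule comm_group_DirProd) auto
  have c: "pauli \<in> carrier K4 \<rightarrow> carrier_mat 2 2" unfolding K4_carrier by (auto simp: pauli_simps)
  have l: "M.lc (carrier K4) pauli c = m2 (c (0, 0) - c (0, 1)) (c (1, 0) - c (1, 1)) (c (1, 0) + c (1, 1)) (c (0, 0) + c (0, 1))" for c :: "int \<times> int \<Rightarrow> real"
  proof -
    have "finite (carrier K4)" unfolding K4_carrier by simp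
    from lc_matrix2[OF this c, of c] show ?thesis unfolding K4_carrier by (simp add: pauli_simps)
  qed
  show "M.fbasis (carrier K4) pauli" unfolding M.fbasis_def M.indep_def l
  proof (intro conjI ballI allI impI)
    show "finite (carrier K4)" unfolding K4_carrier by simp
    show "pauli \<in> carrier K4 \<rightarrow> carrier M2R" using c by simp
    fix a :: "real mat" assume "a \<in> carrier M2R"
    then obtain p q r s where a: "a = m2 p q r s" by (auto elim: m2_cases)
    \<comment> \<open>Half sums and half differences of the entries invert the linear system
      displayed in \<open>l\<close>.\<close>
    define c where "c g = (if g = (0, 0) then (p + s) / 2 else if g = (0, 1) then (s - p) / 2
      else if g = (1, 0) then (q + r) / 2 else (r - q) / 2)" for g :: "int \<times> int"
    show "\<exists>c :: int \<times> int \<Rightarrow> real. a = m2 (c (0, 0) - c (0, 1)) (c (1, 0) - c (1, 1)) (c (1, 0) + c (1, 1)) (c (0, 0) + c (0, 1))"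
      by (rule exI[of _ c]) (simp add: a c_def field_simps)
  next
    fix c :: "int \<times> int \<Rightarrow> real" and i assume "m2 (c (0, 0) - c (0, 1)) (c (1, 0) - c (1, 1)) (c (1, 0) + c (1, 1)) (c (0, 0) + c (0, 1)) = \<zero>\<^bsub>M2R\<^esub>"
      and "i \<in> carrier K4"
    then show "c i = (0::real)" unfolding K4_carrier by (auto simp: m2_zero)
  qed
  show "pauli \<one>\<^bsub>K4\<^esub> = \<one>\<^bsub>M2R\<^esub>" by (simp add: pauli_simps m2_one)
  fix s t assume "s \<in> carrier K4" "t \<in> carrier K4"
  then have "pauli s * pauli t = 1 \<cdot>\<^sub>m pauli (s \<otimes>\<^bsub>K4\<^esub> t) \<or> pauli s * pauli t = (-1) \<cdot>\<^sub>m pauli (s \<otimes>\<^bsub>K4\<^esub> t)"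
    unfolding K4_carrier by (auto simp: pauli_simps)
  then show "\<exists>r. r \<noteq> 0 \<and> pauli s \<otimes>\<^bsub>M2R\<^esub> pauli t = r \<odot>\<^bsub>M2R\<^esub> pauli (s \<otimes>\<^bsub>K4\<^esub> t)"
    by (elim disjE) (rule exI[of _ 1], simp, rule exI[of _ "-1"], simp)
qed

lemma complex_algebra_simps [simp]: "carrier complex_algebra = UNIV" "\<one>\<^bsub>complex_algebra\<^esub> = 1"
  "\<zero>\<^bsub>complex_algebra\<^esub> = 0" "x \<otimes>\<^bsub>complex_algebra\<^esub> y = x * y" "x \<oplus>\<^bsub>complex_algebra\<^esub> y = x + y"
  "r \<odot>\<^bsub>complex_algebra\<^esub> x = of_real r * x"
  by (simp_all add: complex_algebra_def)

lemma ualg_complex: "ualg complex_algebra"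
proof -
  have "ring complex_algebra"
  proof (rule ringI)
    show "abelian_group complex_algebra"
    proof (rule abelian_groupI)
      fix x show "\<exists>y\<in>carrier complex_algebra. y \<oplus>\<^bsub>complex_algebra\<^esub> x = \<zero>\<^bsub>complex_algebra\<^esub>"
        by (intro bexI[of _ "-x"]) auto
    qed auto
    show "Group.monoid complex_algebra" by (rule Group.monoidI) auto
  qed (auto simp: algebra_simps)
  then show ?thesis unfolding unital_real_algebra_ualg[symmetric]
    by (rule unital_real_algebraI) (auto simp: algebra_simps)
qed

definition c_unit :: "int \<Rightarrow> complex" where "c_unit k = (if k = 0 then 1 else \<i>)"

lemma C_grading_eq: "C_grading k = real_span complex_algebra {c_unit k}"
  by (simp add: C_grading_def c_unit_def)

lemma gbasis_complex: "\<exists>s. gbasis Z2 complex_algebra c_unit s"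
proof (rule gbasisI)
  show "ualg complex_algebra" by (rule ualg_complex)
  interpret M: ualg complex_algebra by (rule ualg_complex)
  show "comm_group Z2" by simp
  have l: "M.lc (carrier Z2) c_unit c = Complex (c 0) (c 1)" for c
    unfolding M.lc_def Z2_carrier by (subst M.finsum_insert) (auto simp: c_unit_def complex_eq_iff)
  show "M.fbasis (carrier Z2) c_unit" unfolding M.fbasis_def M.indep_def l
  proof (intro conjI ballI allI impI)
    fix a :: complex
    show "\<exists>c :: int \<Rightarrow> real. a = Complex (c 0) (c 1)"
      by (rule exI[of _ "\<lambda>k. if k = 0 then Re a else Im a"]) simp
  next
    fix c :: "int \<Rightarrow> real" and i assume "Complex (c 0) (c 1) = \<zero>\<^bsub>complex_algebra\<^esub>" "i \<in> carrier Z2"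
    then show "c i = 0" unfolding Z2_carrier by (auto simp: complex_eq_iff)
  qed (auto simp: Z2_carrier)
  show "c_unit \<one>\<^bsub>Z2\<^esub> = \<one>\<^bsub>complex_algebra\<^esub>" by (simp add: c_unit_def)
  fix s t assume "s \<in> carrier Z2" "t \<in> carrier Z2"
  then have "c_unit s * c_unit t = of_real 1 * c_unit (s \<otimes>\<^bsub>Z2\<^esub> t) \<or> c_unit s * c_unit t = of_real (-1) * c_unit (s \<otimes>\<^bsub>Z2\<^esub> t)"
    unfolding Z2_carrier by (auto simp: c_unit_def)
  then show "\<exists>r. r \<noteq> 0 \<and> c_unit s \<otimes>\<^bsub>complex_algebra\<^esub> c_unit t = r \<odot>\<^bsub>complex_algebra\<^esub> c_unit (s \<otimes>\<^bsub>Z2\<^esub> t)"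
    by (elim disjE) (rule exI[of _ 1], simp, rule exI[of _ "-1"], simp)
qed

abbreviation Z2Z4 :: "(int \<times> int) monoid" where "Z2Z4 \<equiv> Z2 \<times>\<times> Z4"

lemma Z2Z4_carrier: "carrier Z2Z4 = {(0, 0), (0, 1), (0, 2), (0, 3), (1, 0), (1, 1), (1, 2), (1, 3)}"
  by (auto simp: Z2_carrier Z4_carrier)

definition m2c :: "int \<times> int \<Rightarrow> complex mat" where
  "m2c g = mat_of_rows_list 2
     (if g = (0, 0) then [[1, 0], [0, 1]]
      else if g = (0, 1) then [[omega, 0], [0, - omega]]
      else if g = (0, 2) then [[\<i>, 0], [0, \<i>]]
      else if g = (0, 3) then [[omega ^ 3, 0], [0, - (omega ^ 3)]]
      else if g = (1, 0) then [[0, 1], [1, 0]]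
      else if g = (1, 1) then [[0, - omega], [omega, 0]]
      else if g = (1, 2) then [[0, \<i>], [\<i>, 0]]
      else [[0, - (omega ^ 3)], [omega ^ 3, 0]])"

lemma M2C_grading_eq: "M2C_grading g = real_span M2C {m2c g}"
  by (simp add: M2C_grading_def m2c_def)

lemma omega_eq: "omega = Complex (sqrt 2 / 2) (sqrt 2 / 2)"
proof -
  have "omega = cis (pi / 4)" by (simp add: omega_def cis_conv_exp)
  then show ?thesis by (simp add: complex_eq_iff cos_45 sin_45)
qed

lemma omega_sq: "omega * omega = \<i>"
proof -
  have "sqrt 2 * sqrt 2 = (2::real)" by simp
  then show ?thesis by (simp add: omega_eq complex_eq_iff field_simps)
qed

text \<open>The cube of \<open>omega\<close>; since \<open>omega\<close> squares to
  \<open>\<i>\<close>, the set of multiples by 1 and -1 of 1, \<open>omega\<close>,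
  \<open>\<i>\<close> and \<open>omega3\<close> is closed under products.\<close>

definition omega3 :: complex where "omega3 = \<i> * omega"

lemma omega_cube: "omega ^ 3 = omega3"
  by (simp add: omega3_def power3_eq_cube omega_sq)

lemma omega_mult: "omega * omega = \<i>" "omega * omega3 = -1" "omega3 * omega = -1" "omega3 * omega3 = - \<i>"
  "\<i> * omega = omega3" "omega * \<i> = omega3" "\<i> * omega3 = - omega" "omega3 * \<i> = - omega"
proof -
  show 1: "omega * omega = \<i>" by (rule omega_sq)
  have "omega * omega3 = \<i> * (omega * omega)" by (simp add: omega3_def)
  then show "omega * omega3 = -1" "omega3 * omega = -1" unfolding 1 by (simp_all add: mult.commute)
  have "omega3 * omega3 = \<i> * \<i> * (omega * omega)" unfolding omega3_def by (simp only: mult_ac)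
  then show "omega3 * omega3 = - \<i>" unfolding 1 by simp
qed (simp_all add: omega3_def mult.commute)

lemma m2c_simps: "m2c (0, 0) = m2 1 0 0 1" "m2c (0, 1) = m2 omega 0 0 (- omega)"
  "m2c (0, 2) = m2 \<i> 0 0 \<i>" "m2c (0, 3) = m2 omega3 0 0 (- omega3)"
  "m2c (1, 0) = m2 0 1 1 0" "m2c (1, 1) = m2 0 (- omega) omega 0"
  "m2c (1, 2) = m2 0 \<i> \<i> 0" "m2c (1, 3) = m2 0 (- omega3) omega3 0"
  by (simp_all add: m2c_def m2_def omega_cube)

text \<open>Diagonal and off-diagonal entries decouple. In each case the two entries are real
  combinations of 1, \<open>omega\<close>, \<open>\<i>\<close>, \<open>omega3\<close> that differ
  only in the sign of the odd powers of \<open>omega\<close>. Their half sum yields the even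
  coefficients and their half difference the odd ones.\<close>

lemma gbasis_m2c: "\<exists>s. gbasis Z2Z4 M2C m2c s"
proof (rule gbasisI)
  show "ualg M2C" by (rule ualg_matrix_algebra)
  interpret M: ualg M2C by (rule ualg_matrix_algebra)
  show "comm_group Z2Z4" by (rule comm_group_DirProd) auto
  have c: "m2c \<in> carrier Z2Z4 \<rightarrow> carrier_mat 2 2" unfolding Z2Z4_carrier by (auto simp: m2c_simps)
  define ev where "ev p q r s = of_real p + of_real q * omega + of_real r * \<i> + of_real s * omega3" for p q r s :: real
  have l: "M.lc (carrier Z2Z4) m2c c = m2 (ev (c (0, 0)) (c (0, 1)) (c (0, 2)) (c (0, 3)))
      (ev (c (1, 0)) (- c (1, 1)) (c (1, 2)) (- c (1, 3))) (ev (c (1, 0)) (c (1, 1)) (c (1, 2)) (c (1, 3)))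
      (ev (c (0, 0)) (- c (0, 1)) (c (0, 2)) (- c (0, 3)))" for c :: "int \<times> int \<Rightarrow> real"
  proof -
    have "finite (carrier Z2Z4)" unfolding Z2Z4_carrier by simp
    from lc_matrix2[OF this c, of c] show ?thesis unfolding Z2Z4_carrier by (simp add: m2c_simps ev_def add.assoc)
  qed
  have s2: "sqrt 2 \<noteq> (0::real)" by simp
  have ev_re: "Re (ev p q r s) = p + (q - s) * (sqrt 2 / 2)" and ev_im: "Im (ev p q r s) = r + (q + s) * (sqrt 2 / 2)" for p q r s
    by (simp_all add: ev_def omega3_def omega_eq left_diff_distrib distrib_right)
  have solve: "\<exists>p q r s. a = ev p q r s \<and> d = ev p (- q) r (- s)" for a d
  proof -
    \<comment> \<open>The half difference of \<open>a\<close> and \<open>d\<close> must be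
      \<open>q omega + s omega3\<close>, with real part \<open>(q - s) / sqrt 2\<close> and
      imaginary part \<open>(q + s) / sqrt 2\<close>. So \<open>?u\<close> and \<open>?v\<close> are
      the required values of \<open>q - s\<close> and \<open>q + s\<close>.\<close>
    let ?u = "(Re a - Re d) / 2 * sqrt 2" and ?v = "(Im a - Im d) / 2 * sqrt 2"
    let ?q = "(?u + ?v) / 2" and ?s = "(?v - ?u) / 2"
    have sq: "x * sqrt 2 * (sqrt 2 / 2) = x" for x :: real by (simp add: mult.assoc)
    have e: "?q - ?s = ?u" "?q + ?s = ?v" by argo+
    have 1: "(?q - ?s) * (sqrt 2 / 2) = (Re a - Re d) / 2" "(?q + ?s) * (sqrt 2 / 2) = (Im a - Im d) / 2"
      unfolding e by (rule sq)+
    have "- ?q - - ?s = - ?u" "- ?q + - ?s = - ?v" by argo+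
    then have 2: "(- ?q - - ?s) * (sqrt 2 / 2) = - ((Re a - Re d) / 2)" "(- ?q + - ?s) * (sqrt 2 / 2) = - ((Im a - Im d) / 2)"
      by (simp_all only: minus_mult_left[symmetric] sq)
    have "a = ev ((Re a + Re d) / 2) ?q ((Im a + Im d) / 2) ?s"
      unfolding complex_eq_iff ev_re ev_im 1 by (simp add: field_simps)
    moreover have "d = ev ((Re a + Re d) / 2) (- ?q) ((Im a + Im d) / 2) (- ?s)"
      unfolding complex_eq_iff ev_re ev_im 2 by (simp add: field_simps)
    ultimately show ?thesis by blast
  qed
  have zero: "p = 0 \<and> q = 0 \<and> r = 0 \<and> s = 0" if "ev p q r s = 0" "ev p (- q) r (- s) = 0" for p q r s
  proof -
    have "p + (q - s) * (sqrt 2 / 2) = 0" "r + (q + s) * (sqrt 2 / 2) = 0"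
      "p + (- q - - s) * (sqrt 2 / 2) = 0" "r + (- q + - s) * (sqrt 2 / 2) = 0"
      using that unfolding complex_eq_iff ev_re ev_im by simp_all
    moreover have "(- q - - s) * k = - ((q - s) * k)" "(- q + - s) * k = - ((q + s) * k)" for k
      by (simp_all add: algebra_simps)
    note this[of "sqrt 2 / 2"]
    ultimately have "p = 0" "r = 0" "(q - s) * (sqrt 2 / 2) = 0" "(q + s) * (sqrt 2 / 2) = 0"
      by linarith+
    then show ?thesis using s2 by simp
  qed
  show "M.fbasis (carrier Z2Z4) m2c" unfolding M.fbasis_def M.indep_def l
  proof (intro conjI ballI allI impI)
    show "finite (carrier Z2Z4)" unfolding Z2Z4_carrier by simp
    show "m2c \<in> carrier Z2Z4 \<rightarrow> carrier M2C" using c by simp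
    fix a :: "complex mat" assume "a \<in> carrier M2C"
    then obtain a1 a2 a3 a4 where a: "a = m2 a1 a2 a3 a4" by (auto elim: m2_cases)
    obtain p q r s where 1: "a1 = ev p q r s" "a4 = ev p (- q) r (- s)" using solve by blast
    obtain p' q' r' s' where 2: "a3 = ev p' q' r' s'" "a2 = ev p' (- q') r' (- s')" using solve by blast
    show "\<exists>c :: int \<times> int \<Rightarrow> real. a = m2 (ev (c (0, 0)) (c (0, 1)) (c (0, 2)) (c (0, 3)))
      (ev (c (1, 0)) (- c (1, 1)) (c (1, 2)) (- c (1, 3))) (ev (c (1, 0)) (c (1, 1)) (c (1, 2)) (c (1, 3)))
      (ev (c (0, 0)) (- c (0, 1)) (c (0, 2)) (- c (0, 3)))"
      by (rule exI[of _ "\<lambda>g :: int \<times> int. if g = (0, 0) then p else if g = (0, 1) then q else if g = (0, 2) then r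
        else if g = (0, 3) then s else if g = (1, 0) then p' else if g = (1, 1) then q' else if g = (1, 2) then r' else s'"])
        (simp add: a 1 2)
  next
    fix c :: "int \<times> int \<Rightarrow> real" and i
    assume a: "m2 (ev (c (0, 0)) (c (0, 1)) (c (0, 2)) (c (0, 3)))
      (ev (c (1, 0)) (- c (1, 1)) (c (1, 2)) (- c (1, 3))) (ev (c (1, 0)) (c (1, 1)) (c (1, 2)) (c (1, 3)))
      (ev (c (0, 0)) (- c (0, 1)) (c (0, 2)) (- c (0, 3))) = \<zero>\<^bsub>M2C\<^esub>" and i: "i \<in> carrier Z2Z4"
    have "c (0, 0) = 0 \<and> c (0, 1) = 0 \<and> c (0, 2) = 0 \<and> c (0, 3) = 0"
      by (rule zero) (use a in \<open>simp_all add: m2_zero\<close>)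
    moreover have "c (1, 0) = 0 \<and> c (1, 1) = 0 \<and> c (1, 2) = 0 \<and> c (1, 3) = 0"
      by (rule zero) (use a in \<open>simp_all add: m2_zero\<close>)
    ultimately show "c i = 0" using i unfolding Z2Z4_carrier by auto
  qed
  show "m2c \<one>\<^bsub>Z2Z4\<^esub> = \<one>\<^bsub>M2C\<^esub>" by (simp add: m2c_simps m2_one)
  fix s t assume "s \<in> carrier Z2Z4" "t \<in> carrier Z2Z4"
  then have "m2c s * m2c t = 1 \<cdot>\<^sub>m m2c (s \<otimes>\<^bsub>Z2Z4\<^esub> t) \<or> m2c s * m2c t = (-1) \<cdot>\<^sub>m m2c (s \<otimes>\<^bsub>Z2Z4\<^esub> t)"
    unfolding Z2Z4_carrier by (elim insertE emptyE; simp add: m2c_simps omega_mult)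
  then show "\<exists>r. r \<noteq> 0 \<and> m2c s \<otimes>\<^bsub>M2C\<^esub> m2c t = r \<odot>\<^bsub>M2C\<^esub> m2c (s \<otimes>\<^bsub>Z2Z4\<^esub> t)"
    by (elim disjE) (rule exI[of _ 1], simp, rule exI[of _ "-1"], simp)
qed

section \<open>Iterated Kronecker products with real matrices of size two\<close>

definition kron2 :: "real mat \<Rightarrow> complex mat \<Rightarrow> complex mat" where
  "kron2 A X = four_block_mat (of_real (A $$ (0, 0)) \<cdot>\<^sub>m X) (of_real (A $$ (0, Suc 0)) \<cdot>\<^sub>m X)
     (of_real (A $$ (Suc 0, 0)) \<cdot>\<^sub>m X) (of_real (A $$ (Suc 0, Suc 0)) \<cdot>\<^sub>m X)"

lemma kron2_m2: "kron2 (m2 a b c d) X = four_block_mat (of_real a \<cdot>\<^sub>m X) (of_real b \<cdot>\<^sub>m X)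
     (of_real c \<cdot>\<^sub>m X) (of_real d \<cdot>\<^sub>m X)"
  by (simp add: kron2_def)

lemma kron2_carrier [simp]: "X \<in> carrier_mat N N \<Longrightarrow> kron2 A X \<in> carrier_mat (N + N) (N + N)"
  by (simp add: kron2_def)

lemma kron2_mult:
  assumes A: "A \<in> carrier_mat 2 2" "A' \<in> carrier_mat 2 2" and X: "X \<in> carrier_mat N N" "X' \<in> carrier_mat N N"
  shows "kron2 (A * A') (X * X') = kron2 A X * kron2 A' X'"
proof -
  obtain a b c d where a: "A = m2 a b c d" using A by (elim m2_cases)
  obtain a' b' c' d' where a': "A' = m2 a' b' c' d'" using A by (elim m2_cases)
  have e: "(p \<cdot>\<^sub>m X) * (p' \<cdot>\<^sub>m X') + (q \<cdot>\<^sub>m X) * (q' \<cdot>\<^sub>m X') = (p * p' + q * q') \<cdot>\<^sub>m (X * X')" for p p' q q'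
  proof -
    have "(r \<cdot>\<^sub>m X) * (r' \<cdot>\<^sub>m X') = (r * r') \<cdot>\<^sub>m (X * X')" for r r'
      using X mult_smult_assoc_mat[of X N N "r' \<cdot>\<^sub>m X'" N r] mult_smult_distrib[of X N N X' N r']
      by (auto intro!: eq_matI)
    then show ?thesis using X by (simp add: add_smult_distrib_right_mat[of _ N N])
  qed
  show ?thesis unfolding a a' m2_mult kron2_m2
    by (subst mult_four_block_mat[of _ N N _ N _ N _ _ N _ N]) (use X in \<open>simp_all add: e\<close>)
qed

lemma kron2_add_l:
  assumes A: "A \<in> carrier_mat 2 2" "A' \<in> carrier_mat 2 2" and X: "X \<in> carrier_mat N N"
  shows "kron2 (A + A') X = kron2 A X + kron2 A' X"
  unfolding kron2_def using A X
  by (subst add_four_block_mat[of _ N N _ N _ N]) (auto simp: add_smult_distrib_right_mat)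

lemma kron2_smult_l:
  assumes A: "A \<in> carrier_mat 2 2" and X: "X \<in> carrier_mat N N"
  shows "kron2 (r \<cdot>\<^sub>m A) X = of_real r \<cdot>\<^sub>m kron2 A X"
  unfolding kron2_def using A X
  by (subst smult_four_block_mat[of _ N N _ N _ N]) (auto intro!: cong_four_block_mat eq_matI)

lemma kron2_add_r:
  assumes X: "X \<in> carrier_mat N N" "X' \<in> carrier_mat N N"
  shows "kron2 A (X + X') = kron2 A X + kron2 A X'"
  unfolding kron2_def using X
  by (subst add_four_block_mat[of _ N N _ N _ N]) (auto simp: add_smult_distrib_left_mat)

lemma kron2_smult_r:
  assumes X: "X \<in> carrier_mat N N"
  shows "kron2 A (z \<cdot>\<^sub>m X) = z \<cdot>\<^sub>m kron2 A X"
  unfolding kron2_def using X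
  by (subst smult_four_block_mat[of _ N N _ N _ N]) (auto intro!: cong_four_block_mat eq_matI)

text \<open>\<open>y\<close> sits innermost and \<open>x 0, ..., x (k - 1)\<close> are wrapped
  around it one after the other, so every step doubles the size and \<open>y\<close> of size
  \<open>d\<close> leads to size \<open>2 ^ k * d\<close>.\<close>

fun kron :: "nat \<Rightarrow> (nat \<Rightarrow> real mat) \<Rightarrow> complex mat \<Rightarrow> complex mat" where
  "kron 0 x y = y"
| "kron (Suc k) x y = kron2 (x k) (kron k x y)"

lemma kron_carrier [simp]: "y \<in> carrier_mat d d \<Longrightarrow> kron k x y \<in> carrier_mat (2 ^ k * d) (2 ^ k * d)"
proof (induction k)
  case (Suc k)
  have "2 ^ Suc k * d = 2 ^ k * d + 2 ^ k * d" by simp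
  then show ?case using kron2_carrier[OF Suc(1)[OF Suc(2)], of "x k"] by (simp only: kron.simps)
qed simp

lemma kron_cong: "(\<And>i. i < k \<Longrightarrow> x i = x' i) \<Longrightarrow> kron k x y = kron k x' y"
  by (induction k) auto

lemma kron_mult:
  assumes "\<And>i. i < k \<Longrightarrow> x i \<in> carrier_mat 2 2" "\<And>i. i < k \<Longrightarrow> x' i \<in> carrier_mat 2 2"
    and y: "y \<in> carrier_mat d d" "y' \<in> carrier_mat d d"
  shows "kron k (\<lambda>i. x i * x' i) (y * y') = kron k x y * kron k x' y'"
  using assms(1,2)
proof (induction k)
  case (Suc k)
  have "kron k (\<lambda>i. x i * x' i) (y * y') = kron k x y * kron k x' y'" using Suc by auto
  then show ?case using kron2_mult[of "x k" "x' k", OF _ _ kron_carrier[OF y(1)] kron_carrier[OF y(2)]] Suc(2,3) by simp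
qed simp

lemma kron_add:
  assumes i: "i < k" and a: "a \<in> carrier_mat 2 2" "a' \<in> carrier_mat 2 2" and y: "y \<in> carrier_mat d d"
  shows "kron k (x(i := a + a')) y = kron k (x(i := a)) y + kron k (x(i := a')) y"
  using i
proof (induction k)
  case (Suc k)
  show ?case
  proof (cases "i = k")
    case True
    have "kron (Suc k) (x(i := b)) y = kron2 b (kron k x y)" for b
      using True kron_cong[of k "x(i := b)" x y] by simp
    then show ?thesis using kron2_add_l[OF a kron_carrier[OF y]] by (simp only:)
  next
    case False
    have "kron (Suc k) (x(i := b)) y = kron2 (x k) (kron k (x(i := b)) y)" for b
      using False by simp
    moreover have "kron k (x(i := a + a')) y = kron k (x(i := a)) y + kron k (x(i := a')) y"
      by (rule Suc.IH) (use Suc.prems False in simp)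
    ultimately show ?thesis using kron2_add_r[OF kron_carrier[OF y] kron_carrier[OF y]] by (simp only:)
  qed
qed simp

lemma kron_smult:
  assumes i: "i < k" and a: "a \<in> carrier_mat 2 2" and y: "y \<in> carrier_mat d d"
  shows "kron k (x(i := r \<cdot>\<^sub>m a)) y = of_real r \<cdot>\<^sub>m kron k (x(i := a)) y"
  using i
proof (induction k)
  case (Suc k)
  show ?case
  proof (cases "i = k")
    case True
    have "kron (Suc k) (x(i := b)) y = kron2 b (kron k x y)" for b
      using True kron_cong[of k "x(i := b)" x y] by simp
    then show ?thesis using kron2_smult_l[OF a kron_carrier[OF y]] by (simp only:)
  next
    case False
    have "kron (Suc k) (x(i := b)) y = kron2 (x k) (kron k (x(i := b)) y)" for b
      using False by simp
    moreover have "kron k (x(i := r \<cdot>\<^sub>m a)) y = of_real r \<cdot>\<^sub>m kron k (x(i := a)) y"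
      by (rule Suc.IH) (use Suc.prems False in simp)
    ultimately show ?thesis using kron2_smult_r[OF kron_carrier[OF y]] by (simp only:)
  qed
qed simp

lemma kron_add_last:
  assumes y: "y \<in> carrier_mat d d" "y' \<in> carrier_mat d d"
  shows "kron k x (y + y') = kron k x y + kron k x y'"
proof (induction k)
  case (Suc k)
  then show ?case using kron2_add_r[OF kron_carrier[OF y(1)] kron_carrier[OF y(2)]] by simp
qed simp

lemma kron_smult_last:
  assumes y: "y \<in> carrier_mat d d"
  shows "kron k x (z \<cdot>\<^sub>m y) = z \<cdot>\<^sub>m kron k x y"
proof (induction k)
  case (Suc k)
  then show ?case using kron2_smult_r[OF kron_carrier[OF y]] by simp
qed simp

text \<open>Each of the four blocks of a combination is a combination of the \<open>X j\<close>,
  with coefficients that are sums and differences as for \<open>pauli\<close> alone. Cutting a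
  matrix into blocks and expanding each block therefore reduces the claim to an invertible system
  for every \<open>j\<close>.\<close>

lemma fbasis_kron2:
  assumes fb: "ualg.fbasis (cmat_algebra N) J X"
  shows "ualg.fbasis (cmat_algebra (N + N)) (carrier K4 \<times> J)
    (\<lambda>(g, j). kron2 (pauli g) (X j))"
proof -
  interpret M: ualg "cmat_algebra N" by (rule ualg_matrix_algebra)
  interpret M2: ualg "cmat_algebra (N + N)" by (rule ualg_matrix_algebra)
  let ?Z = "\<lambda>(g, j). kron2 (pauli g) (X j)"
  have X: "finite J" "X \<in> J \<rightarrow> carrier_mat N N" "M.indep J X" using fb by (auto simp: M.fbasis_def)
  have X': "X \<in> J \<rightarrow> carrier (matrix_algebra N)" using X by simp
  have ex: "\<exists>c. a = M.lc J X c" if "a \<in> carrier_mat N N" for a using fb that by (auto simp: M.fbasis_def)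
  have Xj: "X j \<in> carrier_mat N N" if "j \<in> J" for j using X(2) that by blast
  have finK: "finite (carrier K4 \<times> J)" using X(1) unfolding K4_carrier by simp
  have Z: "?Z \<in> carrier K4 \<times> J \<rightarrow> carrier_mat (N + N) (N + N)" using Xj by auto
  have Z': "?Z \<in> carrier K4 \<times> J \<rightarrow> carrier (matrix_algebra (N + N))" using Z by simp
  have lN: "M.lc J X c \<in> carrier_mat N N" for c using M.lc_closed[OF X', of c] by simp
  have key: "M2.lc (carrier K4 \<times> J) ?Z c = four_block_mat
      (M.lc J X (\<lambda>j. c ((0, 0), j) - c ((0, 1), j))) (M.lc J X (\<lambda>j. c ((1, 0), j) - c ((1, 1), j)))
      (M.lc J X (\<lambda>j. c ((1, 0), j) + c ((1, 1), j))) (M.lc J X (\<lambda>j. c ((0, 0), j) + c ((0, 1), j)))" (is "?L = ?R") for c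
  proof (rule eq_matI)
    have Lc: "?L \<in> carrier_mat (N + N) (N + N)" using M2.lc_closed[OF Z', of c] by simp
    have Rc: "?R \<in> carrier_mat (N + N) (N + N)" by (rule four_block_carrier_mat[OF lN lN])
    show "dim_row ?L = dim_row ?R" "dim_col ?L = dim_col ?R" using Lc Rc by (simp_all only: carrier_matD)
    fix a b assume "a < dim_row ?R" "b < dim_col ?R"
    then have ab: "a < N + N" "b < N + N" using Rc by (simp_all only: carrier_matD)
    have "?L $$ (a, b) = (\<Sum>i\<in>carrier K4 \<times> J. of_real (c i) * ?Z i $$ (a, b))"
      by (rule lc_matrix_index[OF finK Z ab])
    also have "\<dots> = (\<Sum>g\<in>carrier K4. \<Sum>j\<in>J. of_real (c (g, j)) * kron2 (pauli g) (X j) $$ (a, b))"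
      by (subst sum.cartesian_product) (simp add: case_prod_unfold)
    also have "\<dots> = (\<Sum>j\<in>J. of_real (c ((0, 0), j)) * kron2 (pauli (0, 0)) (X j) $$ (a, b)
       + of_real (c ((0, 1), j)) * kron2 (pauli (0, 1)) (X j) $$ (a, b)
       + of_real (c ((1, 0), j)) * kron2 (pauli (1, 0)) (X j) $$ (a, b)
       + of_real (c ((1, 1), j)) * kron2 (pauli (1, 1)) (X j) $$ (a, b))"
      unfolding K4_carrier by (simp add: sum.distrib)
    also have "\<dots> = ?R $$ (a, b)"
    proof -
      have lc: "M.lc J X d $$ (a', b') = (\<Sum>j\<in>J. of_real (d j) * X j $$ (a', b'))" if "a' < N" "b' < N" for d a' b'
        by (rule lc_matrix_index[OF X(1,2) that])
      have d: "dim_row (M.lc J X d) = N" "dim_col (M.lc J X d) = N" for d using lN by auto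
      have dX: "dim_row (X j) = N" "dim_col (X j) = N" if "j \<in> J" for j using Xj[OF that] by auto
      show ?thesis
        using ab by (cases "a < N"; cases "b < N")
          (auto simp: d dX lc pauli_simps kron2_m2 algebra_simps intro!: sum.cong)
    qed
    finally show "?L $$ (a, b) = ?R $$ (a, b)" .
  qed
  \<comment> \<open>A block matrix determines its blocks, so the vanishing of the whole is the
    vanishing of four combinations in the smaller algebra.\<close>
  have fbm_eq: "A = A' \<and> B = B' \<and> C = C' \<and> E = E'"
    if "four_block_mat A B C E = four_block_mat A' B' C' E'"
      "A \<in> carrier_mat N N" "B \<in> carrier_mat N N" "C \<in> carrier_mat N N" "E \<in> carrier_mat N N"
      "A' \<in> carrier_mat N N" "B' \<in> carrier_mat N N" "C' \<in> carrier_mat N N" "E' \<in> carrier_mat N N"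
    for A B C E A' B' C' E' :: "complex mat"
  proof -
    have e: "four_block_mat A B C E $$ ab = four_block_mat A' B' C' E' $$ ab" for ab using that(1) by simp
    note c = that(2-9)
    note d = carrier_matD[OF c(1)] carrier_matD[OF c(4)] carrier_matD[OF c(5)] carrier_matD[OF c(8)]
    have "A $$ (a, b) = A' $$ (a, b) \<and> B $$ (a, b) = B' $$ (a, b) \<and> C $$ (a, b) = C' $$ (a, b) \<and> E $$ (a, b) = E' $$ (a, b)"
      if "a < N" "b < N" for a b
      using e[of "(a, b)"] e[of "(a, N + b)"] e[of "(N + a, b)"] e[of "(N + a, N + b)"] that
      by (simp add: d)
    then have i: "A $$ (a, b) = A' $$ (a, b)" "B $$ (a, b) = B' $$ (a, b)" "C $$ (a, b) = C' $$ (a, b)" "E $$ (a, b) = E' $$ (a, b)"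
      if "a < N" "b < N" for a b using that by blast+
    have m: "P = P'" if "P \<in> carrier_mat N N" "P' \<in> carrier_mat N N" "\<And>a b. a < N \<Longrightarrow> b < N \<Longrightarrow> P $$ (a, b) = P' $$ (a, b)"
      for P P' :: "complex mat" using that by (intro eq_matI) auto
    show ?thesis using m[OF c(1) c(5) i(1)] m[OF c(2) c(6) i(2)] m[OF c(3) c(7) i(3)] m[OF c(4) c(8) i(4)] by blast
  qed
  show ?thesis unfolding M2.fbasis_def M2.indep_def
  proof (intro conjI finK Z' ballI allI impI)
    fix a :: "complex mat" assume "a \<in> carrier (matrix_algebra (N + N))"
    then have a: "a \<in> carrier_mat (N + N) (N + N)" by simp
    obtain P Q R S where s: "split_block a N N = (P, Q, R, S)" by (metis prod_cases4)
    have ac: "a = four_block_mat P Q R S" "P \<in> carrier_mat N N" "Q \<in> carrier_mat N N" "R \<in> carrier_mat N N" "S \<in> carrier_mat N N"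
      using split_block[OF s, of N N] a by auto
    obtain p q r t where e: "P = M.lc J X p" "Q = M.lc J X q" "R = M.lc J X r" "S = M.lc J X t"
      using ex ac(2-5) by metis
    \<comment> \<open>The inverse of the system in \<open>key\<close>, solved separately for each
      \<open>j\<close>.\<close>
    define c where "c = (\<lambda>(g :: int \<times> int, j). if g = (0, 0) then (p j + t j) / 2 else if g = (0, 1) then (t j - p j) / 2
      else if g = (1, 0) then (q j + r j) / 2 else (r j - q j) / 2)"
    have "(\<lambda>j. c ((0, 0), j) - c ((0, 1), j)) = p" "(\<lambda>j. c ((1, 0), j) - c ((1, 1), j)) = q"
      "(\<lambda>j. c ((1, 0), j) + c ((1, 1), j)) = r" "(\<lambda>j. c ((0, 0), j) + c ((0, 1), j)) = t"
      by (auto simp: c_def fun_eq_iff field_simps)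
    then have "a = M2.lc (carrier K4 \<times> J) ?Z c" unfolding key ac(1) e by simp
    then show "\<exists>c. a = M2.lc (carrier K4 \<times> J) ?Z c" by blast
  next
    fix c i assume c: "M2.lc (carrier K4 \<times> J) ?Z c = \<zero>\<^bsub>matrix_algebra (N + N)\<^esub>" and i: "i \<in> carrier K4 \<times> J"
    obtain g j where gj: "i = (g, j)" "g \<in> carrier K4" "j \<in> J" using i by blast
    have "four_block_mat (M.lc J X (\<lambda>j. c ((0, 0), j) - c ((0, 1), j))) (M.lc J X (\<lambda>j. c ((1, 0), j) - c ((1, 1), j)))
      (M.lc J X (\<lambda>j. c ((1, 0), j) + c ((1, 1), j))) (M.lc J X (\<lambda>j. c ((0, 0), j) + c ((0, 1), j))) =
      four_block_mat (0\<^sub>m N N) (0\<^sub>m N N) (0\<^sub>m N N) (0\<^sub>m N N)"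
      using c unfolding key by simp
    from fbm_eq[OF this] have z: "M.lc J X (\<lambda>j. c ((0, 0), j) - c ((0, 1), j)) = \<zero>\<^bsub>matrix_algebra N\<^esub>"
      "M.lc J X (\<lambda>j. c ((1, 0), j) - c ((1, 1), j)) = \<zero>\<^bsub>matrix_algebra N\<^esub>"
      "M.lc J X (\<lambda>j. c ((1, 0), j) + c ((1, 1), j)) = \<zero>\<^bsub>matrix_algebra N\<^esub>"
      "M.lc J X (\<lambda>j. c ((0, 0), j) + c ((0, 1), j)) = \<zero>\<^bsub>matrix_algebra N\<^esub>"
      using lN by auto
    have "c ((0, 0), j) - c ((0, 1), j) = 0" "c ((1, 0), j) - c ((1, 1), j) = 0"
      "c ((1, 0), j) + c ((1, 1), j) = 0" "c ((0, 0), j) + c ((0, 1), j) = 0"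
      using z X(3) gj(3) unfolding M.indep_def by blast+
    then have "c ((0, 0), j) = 0" "c ((0, 1), j) = 0" "c ((1, 0), j) = 0" "c ((1, 1), j) = 0" by linarith+
    then show "c i = 0" using gj unfolding K4_carrier by auto
  qed
qed

text \<open>Splits off the last coordinate, which is the factor that the recursion of
  \<open>kron\<close> places outermost.\<close>

lemma bij_PiE_Suc:
  "bij_betw (\<lambda>(g, h). (g k, (restrict g {..<k}, h))) ((\<Pi>\<^sub>E i\<in>{..<Suc k}. S) \<times> H) (S \<times> ((\<Pi>\<^sub>E i\<in>{..<k}. S) \<times> H))"
proof (rule bij_betw_byWitness[where f' = "\<lambda>(s, (g, h)). (g(k := s), h)"])
  have r: "(restrict g {..<k})(k := g k) = g" if g: "g \<in> (\<Pi>\<^sub>E i\<in>{..<Suc k}. S)" for g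
  proof
    fix i show "((restrict g {..<k})(k := g k)) i = g i"
      using PiE_arb[OF g, of i] by (cases "i = k"; cases "i < k") auto
  qed
  then show "\<forall>a\<in>(\<Pi>\<^sub>E i\<in>{..<Suc k}. S) \<times> H.
      (case case a of (g, h) \<Rightarrow> (g k, restrict g {..<k}, h) of (s, g, h) \<Rightarrow> (g(k := s), h)) = a" by auto
  have r': "restrict (g(k := s)) {..<k} = g" if g: "g \<in> (\<Pi>\<^sub>E i\<in>{..<k}. S)" for g s
  proof
    fix i show "restrict (g(k := s)) {..<k} i = g i" using PiE_arb[OF g, of i] by (cases "i < k") auto
  qed
  then show "\<forall>a\<in>S \<times> (\<Pi>\<^sub>E i\<in>{..<k}. S) \<times> H.
      (case case a of (s, g, h) \<Rightarrow> (g(k := s), h) of (g, h) \<Rightarrow> (g k, restrict g {..<k}, h)) = a" by auto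
  show "(\<lambda>(g, h). (g k, restrict g {..<k}, h)) ` ((\<Pi>\<^sub>E i\<in>{..<Suc k}. S) \<times> H) \<subseteq> S \<times> (\<Pi>\<^sub>E i\<in>{..<k}. S) \<times> H"
  proof (rule image_subsetI)
    fix a assume "a \<in> (\<Pi>\<^sub>E i\<in>{..<Suc k}. S) \<times> H"
    then obtain g h where a: "a = (g, h)" "g \<in> (\<Pi>\<^sub>E i\<in>{..<Suc k}. S)" "h \<in> H" by blast
    have m: "g i \<in> S" if "i < Suc k" for i using PiE_mem[OF a(2), of i] that by simp
    show "(case a of (g, h) \<Rightarrow> (g k, restrict g {..<k}, h)) \<in> S \<times> (\<Pi>\<^sub>E i\<in>{..<k}. S) \<times> H"
      using a(1,3) m by simp
  qed
  show "(\<lambda>(s, g, h). (g(k := s), h)) ` (S \<times> (\<Pi>\<^sub>E i\<in>{..<k}. S) \<times> H) \<subseteq> (\<Pi>\<^sub>E i\<in>{..<Suc k}. S) \<times> H"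
  proof (rule image_subsetI)
    fix a assume "a \<in> S \<times> (\<Pi>\<^sub>E i\<in>{..<k}. S) \<times> H"
    then obtain s g h where a: "a = (s, (g, h))" "s \<in> S" "g \<in> (\<Pi>\<^sub>E i\<in>{..<k}. S)" "h \<in> H" by blast
    have "g(k := s) \<in> (\<Pi>\<^sub>E i\<in>{..<Suc k}. S)"
    proof (rule PiE_I)
      fix i assume "i \<in> {..<Suc k}"
      then show "(g(k := s)) i \<in> S" using a(2) PiE_mem[OF a(3), of i] by (cases "i = k") auto
    next
      fix i assume "i \<notin> {..<Suc k}"
      then show "(g(k := s)) i = undefined" using PiE_arb[OF a(3), of i] by auto
    qed
    then show "(case a of (s, g, h) \<Rightarrow> (g(k := s), h)) \<in> (\<Pi>\<^sub>E i\<in>{..<Suc k}. S) \<times> H" using a by simp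
  qed
qed

lemma fbasis_kron:
  assumes fb: "ualg.fbasis (cmat_algebra d) H Y"
  shows "ualg.fbasis (cmat_algebra (2 ^ k * d))
    ((\<Pi>\<^sub>E i\<in>{..<k}. carrier K4) \<times> H) (\<lambda>(g, h). kron k (\<lambda>i. pauli (g i)) (Y h))"
proof (induction k)
  case 0
  interpret M: ualg "cmat_algebra d" by (rule ualg_matrix_algebra)
  have e: "(\<Pi>\<^sub>E i\<in>{..<0::nat}. carrier K4) = {\<lambda>_. undefined}"
    unfolding lessThan_0 by (rule PiE_empty_domain)
  have b: "bij_betw snd ((\<Pi>\<^sub>E i\<in>{..<0::nat}. carrier K4) \<times> H) H"
    unfolding e by (rule bij_betwI[where g = "\<lambda>h. (\<lambda>_. undefined, h)"]) auto
  have "M.fbasis ((\<Pi>\<^sub>E i\<in>{..<0}. carrier K4) \<times> H) (\<lambda>(g, h). kron 0 (\<lambda>i. pauli (g i)) (Y h))"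
    by (rule M.fbasis_cong[OF M.fbasis_reindex[OF b fb]]) auto
  then show ?case by simp
next
  case (Suc k)
  let ?N = "2 ^ k * d"
  interpret M: ualg "cmat_algebra (?N + ?N)" by (rule ualg_matrix_algebra)
  let ?Z = "\<lambda>(g, h). kron (Suc k) (\<lambda>i. pauli (g i)) (Y h)"
  have "M.fbasis ((\<Pi>\<^sub>E i\<in>{..<Suc k}. carrier K4) \<times> H) ?Z"
  proof (rule M.fbasis_cong[OF M.fbasis_reindex[OF bij_PiE_Suc fbasis_kron2[OF Suc]]])
    fix a assume "a \<in> (\<Pi>\<^sub>E i\<in>{..<Suc k}. carrier K4) \<times> H"
    obtain g h where a: "a = (g, h)" by fastforce
    have "kron k (\<lambda>i. pauli (restrict g {..<k} i)) (Y h) = kron k (\<lambda>i. pauli (g i)) (Y h)"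
      by (rule kron_cong) simp
    then show "((\<lambda>(g, j). kron2 (pauli g) ((\<lambda>(g, h). kron k (\<lambda>i. pauli (g i)) (Y h)) j)) \<circ>
        (\<lambda>(g, h). (g k, restrict g {..<k}, h))) a = ?Z a"
      unfolding a by simp
  qed
  then show ?case unfolding power_Suc mult_2 distrib_right .
qed

text \<open>The map \<open>(x, y)\<close> to \<open>kron k x (\<psi> y)\<close> is multilinear and
  multiplicative and sends the basis tuples to a basis of complex matrices. Both families of
  representatives are instances: complex numbers with \<open>d = 1\<close>, and two by two complex
  matrices with \<open>d = 2\<close>.\<close>

lemma tensor_representative:
  fixes B :: "(real, 'b) module" and H' :: "('h, 'e) monoid_scheme"
  assumes psi: "\<psi> \<in> alg_iso B (cmat_algebra d)" and d: "d \<ge> 1"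
    and gB: "gbasis H' B b' s'" and gr: "\<And>h. h \<in> carrier H' \<Longrightarrow> \<Gamma>' h = real_span B {b' h}" and sP: "gbasis K4 M2R pauli s"
  shows "isomorphic_algebras (tensor_algebra {..<k} (\<lambda>_. M2R) B) (cmat_algebra (2 ^ k * d))"
    and "\<exists>\<sigma>. gbasis (product_group {..<k} (\<lambda>_. K4) \<times>\<times> H') (tensor_algebra {..<k} (\<lambda>_. M2R) B)
      (\<lambda>(g, h). pure_tensor {..<k} (\<lambda>_. M2R) B (\<lambda>i\<in>{..<k}. pauli (g i), b' h)) \<sigma>"
    and "\<forall>g\<in>(\<Pi>\<^sub>E i\<in>{..<k}. carrier K4). \<forall>h\<in>carrier H'.
      product_grading {..<k} (\<lambda>_. M2R) B (\<lambda>_. M2R_grading) \<Gamma>' (g, h) =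
      {r \<odot>\<^bsub>tensor_algebra {..<k} (\<lambda>_. M2R) B\<^esub> pure_tensor {..<k} (\<lambda>_. M2R) B (\<lambda>i\<in>{..<k}. pauli (g i), b' h) | r. True}"
proof -
  interpret B: ualg B by (rule gbasisD(1)[OF gB])
  interpret T: graded_tensor "{..<k}" "\<lambda>_. M2R" B "\<lambda>_. K4" H' "\<lambda>_. pauli" b' "\<lambda>_. s" s'
    by (intro graded_tensor.intro tensor.intro graded_tensor_axioms.intro finite_lessThan ualg_matrix_algebra
        B.ualg_axioms gB sP)
  let ?N = "2 ^ k * d"
  let ?C = "cmat_algebra ?N"
  define \<phi> where "\<phi> = (\<lambda>(x, y). kron k x (\<psi> y))"
  note p = alg_isoD[OF psi]
  have py: "\<psi> y \<in> carrier_mat d d" if "y \<in> carrier B" for y using p(2)[OF that] by simp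
  have clo: "\<phi> \<in> carrier T.M \<rightarrow> carrier ?C"
    unfolding \<phi>_def using py by auto
  have mult: "\<phi> (u \<otimes>\<^bsub>T.M\<^esub> v) = \<phi> u \<otimes>\<^bsub>?C\<^esub> \<phi> v" if uv: "u \<in> carrier T.M" "v \<in> carrier T.M" for u v
  proof -
    obtain x y x' y' where u: "u = (x, y)" "v = (x', y')" by fastforce
    have c: "x i \<in> carrier_mat 2 2" "x' i \<in> carrier_mat 2 2" if "i < k" for i
      using uv that unfolding u by (auto dest!: PiE_mem[of _ "{..<k}" _ i])
    have y: "y \<in> carrier B" "y' \<in> carrier B" using uv unfolding u by auto
    have "kron k (\<lambda>i\<in>{..<k}. x i * x' i) (\<psi> (y \<otimes>\<^bsub>B\<^esub> y')) = kron k (\<lambda>i. x i * x' i) (\<psi> y * \<psi> y')"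
      unfolding p(3)[OF y] matrix_algebra_simps by (rule kron_cong) simp
    also have "\<dots> = kron k x (\<psi> y) * kron k x' (\<psi> y')" by (rule kron_mult[OF c py[OF y(1)] py[OF y(2)]]) auto
    finally show ?thesis unfolding u \<phi>_def by simp
  qed
  have lin: "T.multilinear \<phi> ?C"
    unfolding T.multilinear_def \<phi>_def prod.case
  proof (intro conjI ballI allI)
    fix x i a a' y assume a: "i \<in> {..<k}" "a \<in> carrier M2R" "a' \<in> carrier M2R" "y \<in> carrier B"
    show "kron k (x(i := a \<oplus>\<^bsub>M2R\<^esub> a')) (\<psi> y) = kron k (x(i := a)) (\<psi> y) \<oplus>\<^bsub>?C\<^esub> kron k (x(i := a')) (\<psi> y)"
      using kron_add[of i k a a' "\<psi> y" d x] a py by simp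
  next
    fix x i a r y assume a: "i \<in> {..<k}" "a \<in> carrier M2R" "y \<in> carrier B"
    show "kron k (x(i := r \<odot>\<^bsub>M2R\<^esub> a)) (\<psi> y) = r \<odot>\<^bsub>?C\<^esub> kron k (x(i := a)) (\<psi> y)"
      using kron_smult[of i k a "\<psi> y" d x r] a py by simp
  next
    fix x y y' assume "y \<in> carrier B" "y' \<in> carrier B"
    then show "kron k x (\<psi> (y \<oplus>\<^bsub>B\<^esub> y')) = kron k x (\<psi> y) \<oplus>\<^bsub>?C\<^esub> kron k x (\<psi> y')"
      using kron_add_last[OF py py] p(4) by simp
  next
    fix x r y assume "y \<in> carrier B"
    then show "kron k x (\<psi> (r \<odot>\<^bsub>B\<^esub> y)) = r \<odot>\<^bsub>?C\<^esub> kron k x (\<psi> y)"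
      using kron_smult_last[OF py] p(6) by simp
  qed
  interpret C: ualg ?C by (rule ualg_matrix_algebra)
  have fbB: "ualg.fbasis (matrix_algebra d) (carrier H') (\<psi> \<circ> b')"
    by (rule fbasis_alg_iso[OF psi B.ualg_axioms ualg_matrix_algebra gbasisD(3)[OF gB]])
  have fb: "C.fbasis (carrier T.PG) (\<phi> \<circ> T.U)"
    unfolding T.carrier_PG
  proof (rule C.fbasis_cong[OF fbasis_kron[OF fbB]])
    fix a assume "a \<in> (\<Pi>\<^sub>E i\<in>{..<k}. carrier K4) \<times> carrier H'"
    obtain g h where a: "a = (g, h)" by fastforce
    have "kron k (\<lambda>i\<in>{..<k}. pauli (g i)) (\<psi> (b' h)) = kron k (\<lambda>i. pauli (g i)) (\<psi> (b' h))" by (rule kron_cong) simp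
    then show "(case a of (g, h) \<Rightarrow> kron k (\<lambda>i. pauli (g i)) ((\<psi> \<circ> b') h)) = (\<phi> \<circ> T.U) a"
      unfolding a by (simp add: \<phi>_def T.U_def)
  qed
  have ne: "\<one>\<^bsub>?C\<^esub> \<noteq> \<zero>\<^bsub>?C\<^esub>"
  proof
    assume "\<one>\<^bsub>?C\<^esub> = \<zero>\<^bsub>?C\<^esub>"
    then have "(1\<^sub>m ?N :: complex mat) $$ (0, 0) = 0\<^sub>m ?N ?N $$ (0, 0)" by simp
    then show False using d by simp
  qed
  show "isomorphic_algebras T.TA ?C"
    by (rule T.tensor_gbasis(1)[OF C.ualg_axioms ne clo mult lin fb])
  have "\<exists>\<sigma>. gbasis T.PG T.TA (T.pt \<circ> T.U) \<sigma>"
    by (rule T.tensor_gbasis(2)[OF C.ualg_axioms ne clo mult lin fb])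
  moreover have "T.pt \<circ> T.U = (\<lambda>(g, h). T.pt (\<lambda>i\<in>{..<k}. pauli (g i), b' h))"
  proof
    fix a show "(T.pt \<circ> T.U) a = (case a of (g, h) \<Rightarrow> T.pt (\<lambda>i\<in>{..<k}. pauli (g i), b' h))"
      unfolding T.U_def comp_def by (rule prod.case_distrib)
  qed
  ultimately show "\<exists>\<sigma>. gbasis (product_group {..<k} (\<lambda>_. K4) \<times>\<times> H') (tensor_algebra {..<k} (\<lambda>_. M2R) B)
      (\<lambda>(g, h). pure_tensor {..<k} (\<lambda>_. M2R) B (\<lambda>i\<in>{..<k}. pauli (g i), b' h)) \<sigma>"
    unfolding T.PG_def by (simp only:)
  show "\<forall>g\<in>(\<Pi>\<^sub>E i\<in>{..<k}. carrier K4). \<forall>h\<in>carrier H'.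
      product_grading {..<k} (\<lambda>_. M2R) B (\<lambda>_. M2R_grading) \<Gamma>' (g, h) =
      {r \<odot>\<^bsub>T.TA\<^esub> T.pt (\<lambda>i\<in>{..<k}. pauli (g i), b' h) | r. True}"
  proof (intro ballI)
    fix g h assume "g \<in> (\<Pi>\<^sub>E i\<in>{..<k}. carrier K4)" "h \<in> carrier H'"
    then have "(g, h) \<in> carrier T.PG" unfolding T.carrier_PG by (rule SigmaI)
    then have "product_grading {..<k} (\<lambda>_. M2R) B (\<lambda>_. M2R_grading) \<Gamma>' (g, h) = {r \<odot>\<^bsub>T.TA\<^esub> T.pt (T.U (g, h)) | r. True}"
      by (rule T.product_grading_eq[OF _ M2R_grading_eq gr])
    then show "product_grading {..<k} (\<lambda>_. M2R) B (\<lambda>_. M2R_grading) \<Gamma>' (g, h) =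
      {r \<odot>\<^bsub>T.TA\<^esub> T.pt (\<lambda>i\<in>{..<k}. pauli (g i), b' h) | r. True}" unfolding T.U_def prod.case .
  qed
qed

section \<open>Classification by commutation factors and signs\<close>

lemma gbasis_cardinality:
  assumes g: "gbasis T D X \<sigma>" and iso: "isomorphic_algebras D (cmat_algebra n)"
  shows "card (carrier T) = 2 * (n * n)"
proof -
  note gD = gbasisD[OF g]
  interpret D: ualg D by (rule gD)
  obtain Y :: "nat \<times> nat \<times> bool \<Rightarrow> _" where "D.fbasis ({..<n} \<times> {..<n} \<times> UNIV) Y"
    using fbasis_isomorphic_matrix_algebra[OF gD(1) iso] by blast
  from D.fbasis_card_eq[OF gD(3) this] show ?thesis by (simp add: card_cartesian_product)
qed

lemma qdata_gbasis_matrix: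
  fixes D (structure)
  assumes g: "gbasis T D X \<sigma>" and iso: "isomorphic_algebras D (cmat_algebra n)"
    and n: "n \<ge> 1"
  obtains f where "qdata T (comm_factor \<sigma>) (square_sign \<sigma>) f"
proof -
  note D = gbasisD(1)[OF g]
  obtain J where J: "J \<in> carrier D" "\<And>x. x \<in> carrier D \<Longrightarrow> x \<otimes> J = J \<otimes> x"
    "J \<otimes> J = (-1) \<odot> \<one>"
    "\<And>z. z \<in> carrier D \<Longrightarrow> (\<And>x. x \<in> carrier D \<Longrightarrow> x \<otimes> z = z \<otimes> x) \<Longrightarrow>
      \<exists>a b. z = a \<odot> \<one> \<oplus> b \<odot> J"
    using center_matrix_algebra[OF D iso] by blast
  show thesis
    by (rule qdata_gbasis[OF g isomorphic_matrix_algebra_nontrivial[OF D iso n] J that])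
qed

lemma qiso_graded_iso:
  fixes T (structure)
  assumes A: "gbasis T D X \<sigma>" and B: "gbasis T' D' X' \<sigma>'"
    and q: "qdata T (comm_factor \<sigma>) (square_sign \<sigma>) f"
    and al: "qiso T (comm_factor \<sigma>) (square_sign \<sigma>) T' (comm_factor \<sigma>') (square_sign \<sigma>') \<alpha>"
  obtains \<phi> where "\<phi> \<in> alg_iso D D'" "\<forall>t\<in>carrier T. \<exists>c. c \<noteq> 0 \<and> \<phi> (X t) = c \<odot>\<^bsub>D'\<^esub> X' (\<alpha> t)"
proof -
  interpret q: qdata T "comm_factor \<sigma>" "square_sign \<sigma>" f by (rule q)
  have a: "\<alpha> \<in> iso T T'"
    and c: "\<And>s t. s \<in> carrier T \<Longrightarrow> t \<in> carrier T \<Longrightarrow> comm_factor \<sigma>' (\<alpha> s) (\<alpha> t) = comm_factor \<sigma> s t"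
    and m: "\<And>t. t \<in> carrier T \<Longrightarrow> t \<otimes> t = \<one> \<Longrightarrow> square_sign \<sigma>' (\<alpha> t) = square_sign \<sigma> t"
    using al unfolding qiso_def by blast+
  have ac: "\<alpha> t \<in> carrier T'" if "t \<in> carrier T" for t using a that by (auto simp: iso_def hom_def)
  have nz: "\<sigma> s t \<noteq> 0" "\<sigma>' (\<alpha> s) (\<alpha> t) \<noteq> 0" if "s \<in> carrier T" "t \<in> carrier T" for s t
    using gbasisD(5)[OF A that] gbasisD(5)[OF B ac[OF that(1)] ac[OF that(2)]] by blast+
  show thesis
  proof (rule graded_iso[OF A B a _ _ q.f_closed q.f_ne q.f_square q.square])
    fix \<phi> assume "\<phi> \<in> alg_iso D D'" "\<And>t. t \<in> carrier T \<Longrightarrow> \<exists>c. c \<noteq> 0 \<and> \<phi> (X t) = c \<odot>\<^bsub>D'\<^esub> X' (\<alpha> t)"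
    then show thesis using that by blast
  next
    fix s t assume st: "s \<in> carrier T" "t \<in> carrier T"
    show "\<sigma> s t * \<sigma>' (\<alpha> t) (\<alpha> s) = \<sigma> t s * \<sigma>' (\<alpha> s) (\<alpha> t)"
      using c[OF st] nz[OF st] nz[OF st(2,1)] unfolding comm_factor_def by (simp add: field_simps)
  next
    fix t assume t: "t \<in> carrier T" "t \<otimes> t = \<one>"
    have "sgn (\<sigma> t t * \<sigma>' (\<alpha> t) (\<alpha> t)) = sgn (\<sigma> t t) * sgn (\<sigma> t t)"
      using m[OF t] by (simp add: sgn_mult square_sign_def)
    also have "\<dots> = 1" using nz(1)[OF t(1,1)] by (simp add: sgn_if)
    finally show "\<sigma> t t * \<sigma>' (\<alpha> t) (\<alpha> t) > 0" by (simp only: sgn_1_pos)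
  qed
qed

lemma image_line:
  fixes D (structure)
  assumes "\<phi> \<in> alg_iso D D'" "ualg D'" "x \<in> carrier D" "y \<in> carrier D'" "c \<noteq> 0" "\<phi> x = c \<odot>\<^bsub>D'\<^esub> y"
  shows "\<phi> ` {r \<odot> x | r. True} = {r \<odot>\<^bsub>D'\<^esub> y | r. True}"
proof -
  interpret D': ualg D' by fact
  have e: "\<phi> (r \<odot> x) = (r * c) \<odot>\<^bsub>D'\<^esub> y" for r
    using alg_isoD(6)[OF assms(1,3)] assms(4,6) by (simp add: D'.sm_assoc)
  show ?thesis
  proof (intro equalityI subsetI)
    fix z assume "z \<in> \<phi> ` {r \<odot> x | r. True}"
    then show "z \<in> {r \<odot>\<^bsub>D'\<^esub> y | r. True}" using e by auto
  next
    fix z assume "z \<in> {r \<odot>\<^bsub>D'\<^esub> y | r. True}"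
    then obtain r where "z = r \<odot>\<^bsub>D'\<^esub> y" by blast
    then have "z = \<phi> ((r / c) \<odot> x)" using e assms(5) by simp
    then show "z \<in> \<phi> ` {r \<odot> x | r. True}" by blast
  qed
qed

text \<open>Degrees are pulled back along \<open>\<alpha>\<close> and elements are pushed forward
  along \<open>\<psi>\<close>; the cocycle is relabelled and otherwise unchanged.\<close>

lemma gbasis_transport:
  fixes T (structure)
  assumes g: "gbasis T' R X' \<sigma>'" and psi: "\<psi> \<in> alg_iso R D" and D: "ualg D"
    and T: "comm_group T" and a: "\<alpha> \<in> iso T T'"
  shows "gbasis T D (\<psi> \<circ> (X' \<circ> \<alpha>)) (\<lambda>s t. \<sigma>' (\<alpha> s) (\<alpha> t))"
proof -
  note gD = gbasisD[OF g] and p = alg_isoD[OF psi]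
  interpret D: ualg D by (rule D)
  interpret R: ualg R by (rule gD)
  interpret T: comm_group T by (rule T)
  interpret T': comm_group T' by (rule gD)
  have ac: "\<alpha> t \<in> carrier T'" "\<alpha> (s \<otimes> t) = \<alpha> s \<otimes>\<^bsub>T'\<^esub> \<alpha> t" if "s \<in> carrier T" "t \<in> carrier T" for s t
    using a that by (auto simp: iso_def hom_def)
  have a1: "\<alpha> \<one> = \<one>\<^bsub>T'\<^esub>" using ac[of "\<one>" "\<one>"] by simp
  have bij: "bij_betw \<alpha> (carrier T) (carrier T')" using a by (simp add: iso_def)
  have "D.fbasis (carrier T) (\<psi> \<circ> (X' \<circ> \<alpha>))"
    by (rule fbasis_alg_iso[OF psi gD(1) D R.fbasis_reindex[OF bij gD(3)]])
  moreover have "(\<psi> \<circ> (X' \<circ> \<alpha>)) s \<otimes>\<^bsub>D\<^esub> (\<psi> \<circ> (X' \<circ> \<alpha>)) t = \<sigma>' (\<alpha> s) (\<alpha> t) \<odot>\<^bsub>D\<^esub> (\<psi> \<circ> (X' \<circ> \<alpha>)) (s \<otimes> t)"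
    if st: "s \<in> carrier T" "t \<in> carrier T" for s t
  proof -
    have c: "\<alpha> s \<in> carrier T'" "\<alpha> t \<in> carrier T'" using ac st by blast+
    have "(\<psi> \<circ> (X' \<circ> \<alpha>)) s \<otimes>\<^bsub>D\<^esub> (\<psi> \<circ> (X' \<circ> \<alpha>)) t = \<psi> (X' (\<alpha> s) \<otimes>\<^bsub>R\<^esub> X' (\<alpha> t))"
      using p(3)[OF gD(8)[OF c(1)] gD(8)[OF c(2)]] by (simp add: comp_def)
    also have "\<dots> = \<sigma>' (\<alpha> s) (\<alpha> t) \<odot>\<^bsub>D\<^esub> \<psi> (X' (\<alpha> s \<otimes>\<^bsub>T'\<^esub> \<alpha> t))"
      unfolding gD(6)[OF c] by (rule p(6)) (use gD(8) c in simp)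
    finally show ?thesis using ac(2)[OF st] by (simp add: comp_def)
  qed
  ultimately show ?thesis
    unfolding gbasis_def using D T a1 gD(4) p(5) gD(5) ac(1) by auto
qed

text \<open>No twisted group algebra is built from prescribed data. One existing presentation of the
  right order and exponent has isomorphic data, and relabelling its degrees along that isomorphism
  yields the prescribed ones.\<close>

lemma qdata_realization:
  fixes T (structure)
  assumes q: "qdata T \<beta> \<mu> f" and g: "gbasis T' R X' \<sigma>'"
    and q': "qdata T' (comm_factor \<sigma>') (square_sign \<sigma>') f'"
    and card: "card (carrier T) = card (carrier T')"
    and el: "(\<forall>t\<in>carrier T. t \<otimes> t = \<one>) \<longleftrightarrow> (\<forall>t\<in>carrier T'. t \<otimes>\<^bsub>T'\<^esub> t = \<one>\<^bsub>T'\<^esub>)"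
    and D: "ualg D" and psi: "\<psi> \<in> alg_iso R D"
  obtains X \<sigma> where "gbasis T D X \<sigma>"
    "\<forall>s\<in>carrier T. \<forall>t\<in>carrier T. comm_factor \<sigma> s t = \<beta> s t"
    "\<forall>t\<in>carrier T. t \<otimes> t = \<one> \<longrightarrow> square_sign \<sigma> t = \<mu> t"
proof -
  interpret q: qdata T \<beta> \<mu> f by (rule q)
  obtain \<alpha> where al: "qiso T \<beta> \<mu> T' (comm_factor \<sigma>') (square_sign \<sigma>') \<alpha>"
    using qiso_exists[OF q q' card el] by blast
  then have a: "\<alpha> \<in> iso T T'" by (simp add: qiso_def)
  show thesis
    by (rule that[OF gbasis_transport[OF g psi D q.comm_group_axioms a]])
      (use al in \<open>simp_all add: qiso_def comm_factor_def square_sign_def\<close>)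
qed

text \<open>Scaling a homogeneous element multiplies its square by a positive number, so the sign
  belongs to the line and not to the generator. With values restricted to 1 and -1, the predicate
  determines \<open>\<mu>\<close> on \<open>S\<close>.\<close>

lemma square_signs_gbasis:
  fixes D (structure)
  assumes g: "gbasis T D X \<sigma>" and S: "S \<subseteq> carrier T" "\<And>t. t \<in> S \<Longrightarrow> t \<otimes>\<^bsub>T\<^esub> t = \<one>\<^bsub>T\<^esub>"
    and Gam: "\<And>t. t \<in> S \<Longrightarrow> \<Gamma> t = {r \<odot> X t | r. True}" and mu: "\<mu> \<in> S \<rightarrow> {1, -1}"
  shows "square_signs D \<Gamma> S \<mu> \<longleftrightarrow> (\<forall>t\<in>S. \<mu> t = square_sign \<sigma> t)"
proof -
  note gD = gbasisD[OF g]
  interpret D: ualg D by (rule gD)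
  have sq: "(r \<odot> X t) \<otimes> (r \<odot> X t) = (r * r * \<sigma> t t) \<odot> \<one>" if tS: "t \<in> S" for r t
  proof -
    have t: "t \<in> carrier T" using S tS by blast
    have "(r \<odot> X t) \<otimes> (r \<odot> X t) = (r * r) \<odot> (X t \<otimes> X t)"
      using gD(8)[OF t] by simp
    then show ?thesis using gD(6)[OF t t] S(2)[OF tS] gD(4) by simp
  qed
  have m: "\<mu> t = 1 \<or> \<mu> t = -1" if tS: "t \<in> S" for t using mu tS by (auto simp: Pi_iff)
  have "(\<forall>x\<in>\<Gamma> t. x \<noteq> \<zero> \<longrightarrow> (\<exists>r>0. x \<otimes> x = (r * \<mu> t) \<odot> \<one>)) \<longleftrightarrow> \<mu> t = square_sign \<sigma> t" (is "?L \<longleftrightarrow> ?R")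
    if tS: "t \<in> S" for t
  proof
    have t: "t \<in> carrier T" using S tS by blast
    note Xt = gD(8,9)[OF t]
    {
      assume L: ?L
      have "X t \<in> \<Gamma> t" unfolding Gam[OF tS] using D.sm_one[OF Xt(1), symmetric] by blast
      then obtain r where r: "r > 0" "X t \<otimes> X t = (r * \<mu> t) \<odot> \<one>" using L Xt(2) by blast
      have one: "\<one> \<noteq> \<zero>"
      proof
        assume "\<one> = \<zero>"
        then show False using D.l_one[OF Xt(1)] D.l_null[OF Xt(1)] Xt(2) by simp
      qed
      have "\<sigma> t t \<odot> \<one> = (r * \<mu> t) \<odot> \<one>" using gD(6)[OF t t] S(2)[OF tS] gD(4) r(2) by simp
      then have "\<sigma> t t = r * \<mu> t" using D.sm_cancel[OF _ one] by simp
      then show ?R using r(1) m[OF tS] by (auto simp: square_sign_def sgn_mult)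
    }
    assume R: ?R
    have ne: "\<sigma> t t \<noteq> 0" by (rule gD(5)[OF t t])
    show ?L
    proof (intro ballI impI)
      fix x assume x: "x \<in> \<Gamma> t" "x \<noteq> \<zero>"
      then obtain r where r: "x = r \<odot> X t" using Gam[OF tS] by blast
      have "r \<noteq> 0" using x r Xt(1) by auto
      then have "r * r * \<bar>\<sigma> t t\<bar> > 0" using ne by (auto simp: zero_less_mult_iff linorder_neq_iff)
      moreover have "r * r * \<bar>\<sigma> t t\<bar> * \<mu> t = r * r * \<sigma> t t" using R by (simp add: square_sign_def abs_mult_sgn mult.assoc)
      ultimately show "\<exists>r>0. x \<otimes> x = (r * \<mu> t) \<odot> \<one>"
        unfolding r sq[OF tS] by (intro exI[of _ "r * r * \<bar>\<sigma> t t\<bar>"] conjI) (simp_all only:)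
    qed
  qed
  then show ?thesis unfolding square_signs_def by blast
qed

lemma commutation_factors_gbasis:
  fixes D (structure)
  assumes g: "gbasis T D X \<sigma>" and Gam: "\<And>t. t \<in> carrier T \<Longrightarrow> \<Gamma> t = {r \<odot> X t | r. True}"
  shows "commutation_factors D \<Gamma> (carrier T) \<beta> \<longleftrightarrow> (\<forall>u\<in>carrier T. \<forall>v\<in>carrier T. \<beta> (u, v) = comm_factor \<sigma> u v)"
proof -
  note gD = gbasisD[OF g]
  interpret D: ualg D by (rule gD)
  interpret T: comm_group T by (rule gD)
  have "(\<forall>x\<in>\<Gamma> u. \<forall>y\<in>\<Gamma> v. x \<otimes> y = \<beta> (u, v) \<odot> (y \<otimes> x)) \<longleftrightarrow> \<beta> (u, v) = comm_factor \<sigma> u v" (is "?L \<longleftrightarrow> ?R")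
    if u: "u \<in> carrier T" and v: "v \<in> carrier T" for u v
  proof
    note X = gD(8)[OF u] gD(8)[OF v]
    {
      assume L: ?L
      have "X t \<in> \<Gamma> t" if "t \<in> carrier T" for t
        unfolding Gam[OF that] using D.sm_one[OF gD(8)[OF that], symmetric] by blast
      then have "X u \<otimes> X v = \<beta> (u, v) \<odot> (X v \<otimes> X u)" using L u v by blast
      then have e: "\<beta> (u, v) \<odot> (X v \<otimes> X u) = comm_factor \<sigma> u v \<odot> (X v \<otimes> X u)"
        using gbasis_comm[OF g u v] by simp
      have "X v \<otimes> X u \<noteq> \<zero>"
      proof
        assume "X v \<otimes> X u = \<zero>"
        then have "\<sigma> v u \<odot> X (v \<otimes>\<^bsub>T\<^esub> u) = 0 \<odot> X (v \<otimes>\<^bsub>T\<^esub> u)"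
          using gD(6)[OF v u] gD(8)[of "v \<otimes>\<^bsub>T\<^esub> u"] u v by simp
        then show False using D.sm_cancel[of "X (v \<otimes>\<^bsub>T\<^esub> u)" "\<sigma> v u" 0] gD(8,9)[of "v \<otimes>\<^bsub>T\<^esub> u"] gD(5)[OF v u] u v by simp
      qed
      then show ?R using D.sm_cancel[OF _ _ e] X by simp
    }
    assume R: ?R
    show ?L
    proof (intro ballI)
      fix x y assume "x \<in> \<Gamma> u" "y \<in> \<Gamma> v"
      then obtain r s where xy: "x = r \<odot> X u" "y = s \<odot> X v" using Gam u v by blast
      have "x \<otimes> y = (r * s) \<odot> (X u \<otimes> X v)" unfolding xy using X by (simp add: mult.commute)
      moreover have "y \<otimes> x = (r * s) \<odot> (X v \<otimes> X u)" unfolding xy using X by (simp add: mult.commute)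
      ultimately show "x \<otimes> y = \<beta> (u, v) \<odot> (y \<otimes> x)"
        using gbasis_comm[OF g u v] R X by (simp add: mult.commute)
    qed
  qed
  then show ?thesis unfolding commutation_factors_def by blast
qed

text \<open>The formal core common to both families: every grading has exactly one datum, every
  datum occurs, and isomorphism means sharing a datum. That isomorphism is an equivalence relation
  on \<open>S\<close> is a consequence, since it coincides with equality of data.\<close>

lemma classification_by_data:
  assumes iso: "\<And>\<Gamma> \<Gamma>'. \<Gamma> \<in> S \<Longrightarrow> \<Gamma>' \<in> S \<Longrightarrow>
      gradings_isomorphic G D \<Gamma> D \<Gamma>' \<longleftrightarrow> (\<exists>q\<in>Q. P \<Gamma> q \<and> P \<Gamma>' q)"
    and ex: "\<And>\<Gamma>. \<Gamma> \<in> S \<Longrightarrow> \<exists>q\<in>Q. P \<Gamma> q"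
    and uniq: "\<And>\<Gamma> q q'. \<Gamma> \<in> S \<Longrightarrow> q \<in> Q \<Longrightarrow> q' \<in> Q \<Longrightarrow> P \<Gamma> q \<Longrightarrow> P \<Gamma> q' \<Longrightarrow> q = q'"
    and surj: "\<And>q. q \<in> Q \<Longrightarrow> \<exists>\<Gamma>\<in>S. P \<Gamma> q"
  shows "\<exists>F. bij_betw F (isomorphism_classes G D S) Q \<and> (\<forall>C\<in>isomorphism_classes G D S. \<forall>\<Gamma>\<in>C. P \<Gamma> (F C))"
proof -
  have "\<forall>\<Gamma>. \<exists>q. \<Gamma> \<in> S \<longrightarrow> q \<in> Q \<and> P \<Gamma> q" using ex by blast
  then obtain d where d: "\<And>\<Gamma>. \<Gamma> \<in> S \<Longrightarrow> d \<Gamma> \<in> Q" "\<And>\<Gamma>. \<Gamma> \<in> S \<Longrightarrow> P \<Gamma> (d \<Gamma>)"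
    unfolding choice_iff by blast
  have i: "gradings_isomorphic G D \<Gamma> D \<Gamma>' \<longleftrightarrow> d \<Gamma> = d \<Gamma>'" if g: "\<Gamma> \<in> S" "\<Gamma>' \<in> S" for \<Gamma> \<Gamma>'
  proof
    assume "gradings_isomorphic G D \<Gamma> D \<Gamma>'"
    then obtain q where "q \<in> Q" "P \<Gamma> q" "P \<Gamma>' q" using iso[OF g] by blast
    then have "q = d \<Gamma>" "q = d \<Gamma>'" using uniq[OF g(1) _ d(1)[OF g(1)] _ d(2)[OF g(1)]] uniq[OF g(2) _ d(1)[OF g(2)] _ d(2)[OF g(2)]] by blast+
    then show "d \<Gamma> = d \<Gamma>'" by simp
  next
    assume "d \<Gamma> = d \<Gamma>'"
    then have "P \<Gamma>' (d \<Gamma>)" using d(2)[OF g(2)] by simp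
    then show "gradings_isomorphic G D \<Gamma> D \<Gamma>'" using iso[OF g] d[OF g(1)] by blast
  qed
  \<comment> \<open>The isomorphism classes are the fibres of the map \<open>d\<close>, so
    \<open>F\<close> may evaluate \<open>d\<close> on any member.\<close>
  have cl: "isomorphism_classes G D S = (\<lambda>\<Gamma>. {\<Gamma>' \<in> S. d \<Gamma>' = d \<Gamma>}) ` S"
  proof -
    let ?r = "{(\<Gamma>, \<Gamma>'). \<Gamma> \<in> S \<and> \<Gamma>' \<in> S \<and> gradings_isomorphic G D \<Gamma> D \<Gamma>'}"
    have "?r `` {\<Gamma>} = {\<Gamma>' \<in> S. d \<Gamma>' = d \<Gamma>}" if "\<Gamma> \<in> S" for \<Gamma>
      unfolding Image_singleton using i[OF that] that by (intro Collect_cong) (simp add: eq_commute conj_commute cong: conj_cong)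
    then show ?thesis unfolding isomorphism_classes_def quotient_def by blast
  qed
  define F where "F C = d (SOME \<Gamma>. \<Gamma> \<in> C)" for C
  have F: "F {\<Gamma>' \<in> S. d \<Gamma>' = d \<Gamma>} = d \<Gamma>" if "\<Gamma> \<in> S" for \<Gamma>
  proof -
    have "\<Gamma> \<in> {\<Gamma>' \<in> S. d \<Gamma>' = d \<Gamma>}" using that by simp
    then have "(SOME \<Gamma>''. \<Gamma>'' \<in> {\<Gamma>' \<in> S. d \<Gamma>' = d \<Gamma>}) \<in> {\<Gamma>' \<in> S. d \<Gamma>' = d \<Gamma>}" by (rule someI[where P = "\<lambda>x. x \<in> {\<Gamma>' \<in> S. d \<Gamma>' = d \<Gamma>}"])
    then show ?thesis unfolding F_def by blast
  qed
  have onto: "q \<in> d ` S" if q: "q \<in> Q" for q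
  proof -
    obtain \<Gamma> where "\<Gamma> \<in> S" "P \<Gamma> q" using surj[OF q] by blast
    then have "q = d \<Gamma>" using uniq[OF _ q d(1) _ d(2)] by blast
    then show ?thesis using \<open>\<Gamma> \<in> S\<close> by (rule image_eqI)
  qed
  have "bij_betw F (isomorphism_classes G D S) Q"
  proof (rule bij_betw_imageI)
    show "inj_on F (isomorphism_classes G D S)" unfolding cl
    proof (rule inj_onI, elim imageE)
      fix C C' \<Gamma> \<Gamma>'
      assume "F C = F C'" "C = {\<Gamma>'' \<in> S. d \<Gamma>'' = d \<Gamma>}" "\<Gamma> \<in> S" "C' = {\<Gamma>'' \<in> S. d \<Gamma>'' = d \<Gamma>'}" "\<Gamma>' \<in> S"
      then show "C = C'" using F by simp
    qed
    have "F ` isomorphism_classes G D S = d ` S" unfolding cl image_image using F by (intro image_cong refl)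
    also have "d ` S = Q" by (intro equalityI subsetI onto image_subsetI d(1))
    finally show "F ` isomorphism_classes G D S = Q" .
  qed
  moreover have "P \<Gamma> (F C)" if C: "C \<in> isomorphism_classes G D S" "\<Gamma> \<in> C" for C \<Gamma>
  proof -
    obtain \<Gamma>0 where 0: "C = {\<Gamma>' \<in> S. d \<Gamma>' = d \<Gamma>0}" "\<Gamma>0 \<in> S" using C(1) unfolding cl by (rule imageE)
    have "\<Gamma> \<in> S" "d \<Gamma> = d \<Gamma>0" using C(2) unfolding 0 by simp_all
    then have "F C = d \<Gamma>" using F[OF 0(2)] unfolding 0 by simp
    then show ?thesis using d(2)[OF \<open>\<Gamma> \<in> S\<close>] by simp
  qed
  ultimately show ?thesis by blast
qed

section \<open>Data read off from a division grading of a matrix algebra\<close>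

locale matrix_algebra_gradings =
  fixes G :: "('g, 'c) monoid_scheme" and D :: "(real, 'd) module" (structure) and n :: nat
  assumes G: "comm_group G" and n: "n \<ge> 1" and D: "ualg D"
    and iso: "isomorphic_algebras D (cmat_algebra n)"
begin

sublocale G: comm_group G by (rule G)
sublocale D: ualg D by (rule D)

abbreviation supp where "supp \<equiv> grading_support G D"
abbreviation sub where "sub T \<equiv> G\<lparr>carrier := T\<rparr>"

lemma grading_basis:
  assumes "\<Gamma> \<in> division_gradings_dim1 G D"
  obtains X \<sigma> f where "subgroup (supp \<Gamma>) G" "gbasis (sub (supp \<Gamma>)) D X \<sigma>"
    "\<forall>t\<in>supp \<Gamma>. \<Gamma> t = {r \<odot> X t | r. True}"
    "\<forall>t\<in>carrier G. t \<notin> supp \<Gamma> \<longrightarrow> \<Gamma> t = {\<zero>}"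
    "qdata (sub (supp \<Gamma>)) (comm_factor \<sigma>) (square_sign \<sigma>) f" "card (supp \<Gamma>) = 2 * (n * n)"
proof -
  obtain Y :: "nat \<times> nat \<times> bool \<Rightarrow> _" where Y: "D.fbasis ({..<n} \<times> {..<n} \<times> UNIV) Y"
    using fbasis_isomorphic_matrix_algebra[OF D iso] by blast
  show thesis
  proof (rule grading_gbasis[OF G D assms isomorphic_matrix_algebra_nontrivial[OF D iso n] Y refl])
    fix X \<sigma>
    assume T: "subgroup (supp \<Gamma>) G" and g: "gbasis (sub (supp \<Gamma>)) D X \<sigma>"
      and l: "\<And>t. t \<in> supp \<Gamma> \<Longrightarrow> \<Gamma> t = {r \<odot> X t | r. True}"
        "\<And>t. t \<in> carrier G \<Longrightarrow> t \<notin> supp \<Gamma> \<Longrightarrow> \<Gamma> t = {\<zero>}"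
    obtain f where "qdata (sub (supp \<Gamma>)) (comm_factor \<sigma>) (square_sign \<sigma>) f"
      by (rule qdata_gbasis_matrix[OF g iso n])
    moreover have "card (supp \<Gamma>) = 2 * (n * n)" using gbasis_cardinality[OF g iso] by simp
    ultimately show thesis using that[OF T g] l by simp
  qed
qed

lemma grading_data:
  assumes Gam: "\<Gamma> \<in> division_gradings_dim1 G D"
  obtains \<beta> \<mu> f where "qdata (sub (supp \<Gamma>)) (\<lambda>u v. \<beta> (u, v)) \<mu> f" "commutation_factors D \<Gamma> (supp \<Gamma>) \<beta>"
    "square_signs D \<Gamma> (two_torsion G (supp \<Gamma>)) \<mu>"
proof -
  obtain X \<sigma> f where b0: "subgroup (supp \<Gamma>) G" "gbasis (sub (supp \<Gamma>)) D X \<sigma>"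
    "\<forall>t\<in>supp \<Gamma>. \<Gamma> t = {r \<odot> X t | r. True}"
    "\<forall>t\<in>carrier G. t \<notin> supp \<Gamma> \<longrightarrow> \<Gamma> t = {\<zero>}"
    "qdata (sub (supp \<Gamma>)) (comm_factor \<sigma>) (square_sign \<sigma>) f" "card (supp \<Gamma>) = 2 * (n * n)"
    by (rule grading_basis[OF Gam])
  note b = b0(2) b0(3)[rule_format] b0(5)
  interpret q: qdata "sub (supp \<Gamma>)" "comm_factor \<sigma>" "square_sign \<sigma>" f by (rule b)
  show thesis
  proof (rule that)
    show "qdata (sub (supp \<Gamma>)) (\<lambda>u v. (\<lambda>(u, v). comm_factor \<sigma> u v) (u, v)) (square_sign \<sigma>) f"
      using b(3) by simp
    show "commutation_factors D \<Gamma> (supp \<Gamma>) (\<lambda>(u, v). comm_factor \<sigma> u v)"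
      using commutation_factors_gbasis[OF b(1), of \<Gamma> "\<lambda>(u, v). comm_factor \<sigma> u v"] b(2) by simp
    have "square_sign \<sigma> \<in> two_torsion G (supp \<Gamma>) \<rightarrow> {1, -1}"
      using q.mu_val by (auto simp: two_torsion_def)
    then show "square_signs D \<Gamma> (two_torsion G (supp \<Gamma>)) (square_sign \<sigma>)"
      using square_signs_gbasis[OF b(1), of "two_torsion G (supp \<Gamma>)" \<Gamma> "square_sign \<sigma>"] b(2)
      by (auto simp: two_torsion_def)
  qed
qed

lemma commutation_factors_unique:
  assumes "\<Gamma> \<in> division_gradings_dim1 G D" "commutation_factors D \<Gamma> (supp \<Gamma>) \<beta>" "commutation_factors D \<Gamma> (supp \<Gamma>) \<beta>'"
    "u \<in> supp \<Gamma>" "v \<in> supp \<Gamma>"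
  shows "\<beta> (u, v) = \<beta>' (u, v)"
proof -
  obtain X \<sigma> f where b0: "subgroup (supp \<Gamma>) G" "gbasis (sub (supp \<Gamma>)) D X \<sigma>"
    "\<forall>t\<in>supp \<Gamma>. \<Gamma> t = {r \<odot> X t | r. True}"
    "\<forall>t\<in>carrier G. t \<notin> supp \<Gamma> \<longrightarrow> \<Gamma> t = {\<zero>}"
    "qdata (sub (supp \<Gamma>)) (comm_factor \<sigma>) (square_sign \<sigma>) f" "card (supp \<Gamma>) = 2 * (n * n)"
    by (rule grading_basis[OF assms(1)])
  note b = b0(2) b0(3)[rule_format]
  show ?thesis using commutation_factors_gbasis[OF b(1), of \<Gamma>] b(2) assms by simp
qed

text \<open>The set \<open>S\<close> is left open: it is the whole support in the elementary case
  and the 2-torsion of the support otherwise.\<close>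

lemma square_signs_unique:
  assumes "\<Gamma> \<in> division_gradings_dim1 G D" "S \<subseteq> two_torsion G (supp \<Gamma>)" "square_signs D \<Gamma> S \<mu>" "square_signs D \<Gamma> S \<mu>'"
    "\<mu> \<in> S \<rightarrow> {1, -1}" "\<mu>' \<in> S \<rightarrow> {1, -1}" "t \<in> S"
  shows "\<mu> t = \<mu>' t"
proof -
  obtain X \<sigma> f where b0: "subgroup (supp \<Gamma>) G" "gbasis (sub (supp \<Gamma>)) D X \<sigma>"
    "\<forall>t\<in>supp \<Gamma>. \<Gamma> t = {r \<odot> X t | r. True}"
    "\<forall>t\<in>carrier G. t \<notin> supp \<Gamma> \<longrightarrow> \<Gamma> t = {\<zero>}"
    "qdata (sub (supp \<Gamma>)) (comm_factor \<sigma>) (square_sign \<sigma>) f" "card (supp \<Gamma>) = 2 * (n * n)"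
    by (rule grading_basis[OF assms(1)])
  note b = b0(2) b0(3)[rule_format]
  have "square_signs D \<Gamma> S \<nu> \<longleftrightarrow> (\<forall>t\<in>S. \<nu> t = square_sign \<sigma> t)" if "\<nu> \<in> S \<rightarrow> {1, -1}" for \<nu>
    by (rule square_signs_gbasis[OF b(1) _ _ _ that]) (use assms(2) b(2) in \<open>auto simp: two_torsion_def\<close>)
  then show ?thesis using assms(3-7) by simp
qed

lemma same_data_isomorphic:
  assumes Gam: "\<Gamma> \<in> division_gradings_dim1 G D" "\<Gamma>' \<in> division_gradings_dim1 G D" and T: "supp \<Gamma> = T" "supp \<Gamma>' = T"
    and beta: "commutation_factors D \<Gamma> T \<beta>" "commutation_factors D \<Gamma>' T \<beta>"
    and mu: "square_signs D \<Gamma> (two_torsion G T) \<mu>" "square_signs D \<Gamma>' (two_torsion G T) \<mu>" "\<mu> \<in> two_torsion G T \<rightarrow> {1, -1}"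
  shows "gradings_isomorphic G D \<Gamma> D \<Gamma>'"
proof -
  obtain X \<sigma> f where b0: "subgroup (T) G" "gbasis (sub (T)) D X \<sigma>"
    "\<forall>t\<in>T. \<Gamma> t = {r \<odot> X t | r. True}"
    "\<forall>t\<in>carrier G. t \<notin> T \<longrightarrow> \<Gamma> t = {\<zero>}"
    "qdata (sub (T)) (comm_factor \<sigma>) (square_sign \<sigma>) f" "card (T) = 2 * (n * n)"
    by (rule grading_basis[OF Gam(1), unfolded T])
  note b = b0(2) b0(3)[rule_format] b0(4)[rule_format] b0(5)
  obtain X' \<sigma>' f' where b'0: "subgroup (T) G" "gbasis (sub (T)) D X' \<sigma>'"
    "\<forall>t\<in>T. \<Gamma>' t = {r \<odot> X' t | r. True}"
    "\<forall>t\<in>carrier G. t \<notin> T \<longrightarrow> \<Gamma>' t = {\<zero>}"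
    "qdata (sub (T)) (comm_factor \<sigma>') (square_sign \<sigma>') f'" "card (T) = 2 * (n * n)"
    by (rule grading_basis[OF Gam(2), unfolded T])
  note b' = b'0(2) b'0(3)[rule_format] b'0(4)[rule_format]
  have t2: "two_torsion G T \<subseteq> carrier (sub T)" "\<And>t. t \<in> two_torsion G T \<Longrightarrow> t \<otimes>\<^bsub>sub T\<^esub> t = \<one>\<^bsub>sub T\<^esub>"
    by (auto simp: two_torsion_def)
  have l: "\<Gamma> t = {r \<odot> X t | r. True}" "\<Gamma>' t = {r \<odot> X' t | r. True}" if "t \<in> two_torsion G T" for t
    using that b(2) b'(2) by (auto simp: two_torsion_def)
  have "comm_factor \<sigma> u v = comm_factor \<sigma>' u v" if "u \<in> T" "v \<in> T" for u v
    using commutation_factors_gbasis[OF b(1), of \<Gamma> \<beta>] commutation_factors_gbasis[OF b'(1), of \<Gamma>' \<beta>] b(2) b'(2) beta that by simp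
  moreover have "square_sign \<sigma> t = square_sign \<sigma>' t" if "t \<in> two_torsion G T" for t
    using square_signs_gbasis[OF b(1) t2 l(1) mu(3)] square_signs_gbasis[OF b'(1) t2 l(2) mu(3)] mu(1,2) that by simp
  \<comment> \<open>Equal data on one and the same support mean that the identity map respects them,
    so the resulting algebra isomorphism preserves every degree.\<close>
  ultimately have "qiso (sub T) (comm_factor \<sigma>) (square_sign \<sigma>) (sub T) (comm_factor \<sigma>') (square_sign \<sigma>') (\<lambda>t. t)"
    unfolding qiso_def by (auto simp: iso_def hom_def bij_betw_def two_torsion_def)
  then obtain \<phi> where phi: "\<phi> \<in> alg_iso D D" "\<forall>t\<in>carrier (sub T). \<exists>c. c \<noteq> 0 \<and> \<phi> (X t) = c \<odot> X' t"
    by (rule qiso_graded_iso[OF b(1) b'(1) b(4)])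
  have "\<phi> ` \<Gamma> g = \<Gamma>' g" if "g \<in> carrier G" for g
  proof (cases "g \<in> T")
    case True
    obtain c where "c \<noteq> 0" "\<phi> (X g) = c \<odot> X' g" using phi(2) True by auto
    then show ?thesis unfolding b(2)[OF True] b'(2)[OF True]
      using image_line[OF phi(1) D] gbasisD(8)[OF b(1)] gbasisD(8)[OF b'(1)] True by simp
  next
    case False
    then show ?thesis using b(3)[OF that] b'(3)[OF that] alg_iso_zero[OF phi(1) D D] by simp
  qed
  then show ?thesis unfolding gradings_isomorphic_def using phi(1) by blast
qed

text \<open>Support, commutation factors and signs are expressed by products of homogeneous
  elements, so an algebra isomorphism matching the components carries them over unchanged.\<close>

lemma isomorphic_same_data:
  assumes i: "gradings_isomorphic G D \<Gamma> D \<Gamma>'" and Gam: "\<Gamma> \<in> division_gradings_dim1 G D"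
  shows "supp \<Gamma>' = supp \<Gamma>"
    and "S \<subseteq> carrier G \<Longrightarrow> commutation_factors D \<Gamma> S \<beta> \<Longrightarrow> commutation_factors D \<Gamma>' S \<beta>"
    and "S \<subseteq> carrier G \<Longrightarrow> square_signs D \<Gamma> S \<mu> \<Longrightarrow> square_signs D \<Gamma>' S \<mu>"
proof -
  obtain \<phi> where phi: "\<phi> \<in> alg_iso D D" "\<And>g. g \<in> carrier G \<Longrightarrow> \<Gamma>' g = \<phi> ` \<Gamma> g"
    using i unfolding gradings_isomorphic_def by blast
  note p = alg_isoD[OF phi(1)] and z = alg_iso_zero[OF phi(1) D D]
  obtain X \<sigma> f where b0: "subgroup (supp \<Gamma>) G" "gbasis (sub (supp \<Gamma>)) D X \<sigma>"
    "\<forall>t\<in>supp \<Gamma>. \<Gamma> t = {r \<odot> X t | r. True}"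
    "\<forall>t\<in>carrier G. t \<notin> supp \<Gamma> \<longrightarrow> \<Gamma> t = {\<zero>}"
    "qdata (sub (supp \<Gamma>)) (comm_factor \<sigma>) (square_sign \<sigma>) f" "card (supp \<Gamma>) = 2 * (n * n)"
    by (rule grading_basis[OF Gam])
  note b = b0(2) b0(3)[rule_format] b0(4)[rule_format]
  have c: "\<Gamma> g \<subseteq> carrier D" if "g \<in> carrier G" for g
    using b(2)[of g] b(3)[OF that] gbasisD(8)[OF b(1), of g] by (cases "g \<in> supp \<Gamma>") auto
  have inj: "inj_on \<phi> (carrier D)" using p(1) by (simp add: bij_betw_def)
  have z': "\<phi> x = \<zero> \<longleftrightarrow> x = \<zero>" if "x \<in> carrier D" for x
    using inj_on_eq_iff[OF inj that D.zero_closed] z by simp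
  have "\<Gamma>' g = {\<zero>} \<longleftrightarrow> \<Gamma> g = {\<zero>}" if g: "g \<in> carrier G" for g
  proof
    assume "\<Gamma>' g = {\<zero>}"
    then have e: "\<phi> ` \<Gamma> g = {\<zero>}" using phi(2)[OF g] by simp
    then have "x = \<zero>" if "x \<in> \<Gamma> g" for x using z' c[OF g] that by blast
    moreover have "\<Gamma> g \<noteq> {}" using e by auto
    ultimately show "\<Gamma> g = {\<zero>}" by blast
  qed (use phi(2)[OF g] z in simp)
  then show "supp \<Gamma>' = supp \<Gamma>" unfolding grading_support_def by (intro Collect_cong conj_cong refl) simp
  show "commutation_factors D \<Gamma>' S \<beta>" if S: "S \<subseteq> carrier G" and cf: "commutation_factors D \<Gamma> S \<beta>"
    unfolding commutation_factors_def
  proof (intro ballI)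
    fix u v x' y' assume uv: "u \<in> S" "v \<in> S" "x' \<in> \<Gamma>' u" "y' \<in> \<Gamma>' v"
    have uv': "u \<in> carrier G" "v \<in> carrier G" using uv(1,2) S by blast+
    obtain x y where xy: "x' = \<phi> x" "y' = \<phi> y" "x \<in> \<Gamma> u" "y \<in> \<Gamma> v"
      using uv(3,4) unfolding phi(2)[OF uv'(1)] phi(2)[OF uv'(2)] by (elim imageE) blast
    have cxy: "x \<in> carrier D" "y \<in> carrier D" using c[OF uv'(1)] c[OF uv'(2)] xy(3,4) by blast+
    have "x \<otimes> y = \<beta> (u, v) \<odot> (y \<otimes> x)" using cf uv(1,2) xy unfolding commutation_factors_def by blast
    then have "\<phi> (x \<otimes> y) = \<beta> (u, v) \<odot> \<phi> (y \<otimes> x)" using p(6) cxy by simp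
    then show "x' \<otimes> y' = \<beta> (u, v) \<odot> (y' \<otimes> x')" using p(3) cxy unfolding xy(1,2) by simp
  qed
  show "square_signs D \<Gamma>' S \<mu>" if S: "S \<subseteq> carrier G" and ss: "square_signs D \<Gamma> S \<mu>"
    unfolding square_signs_def
  proof (intro ballI impI)
    fix t x' assume t: "t \<in> S" "x' \<in> \<Gamma>' t" "x' \<noteq> \<zero>"
    have t': "t \<in> carrier G" using t(1) S by blast
    obtain x where x: "x' = \<phi> x" "x \<in> \<Gamma> t" using t(2) unfolding phi(2)[OF t'] by (rule imageE)
    have cx: "x \<in> carrier D" using c[OF t'] x(2) by blast
    have "x \<noteq> \<zero>" using z t(3) x(1) by auto
    then obtain r where r: "r > 0" "x \<otimes> x = (r * \<mu> t) \<odot> \<one>"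
      using ss t(1) x(2) unfolding square_signs_def by blast
    then have "x' \<otimes> x' = (r * \<mu> t) \<odot> \<one>"
      unfolding x(1) p(3)[OF cx cx, symmetric] r(2) using p(5,6) by simp
    then show "\<exists>r>0. x' \<otimes> x' = (r * \<mu> t) \<odot> \<one>" using r(1) by blast
  qed
qed

text \<open>Here \<open>R\<close> is a twisted group algebra already known to be a matrix algebra,
  later the representative. Its presentation is moved to \<open>D\<close> through the common matrix
  algebra and relabelled to fit the given data.\<close>

lemma grading_of_data:
  assumes T: "subgroup T G" and q: "qdata (sub T) (\<lambda>u v. \<beta> (u, v)) \<mu> f"
    and g: "gbasis T' R X' \<sigma>'" and R: "isomorphic_algebras R (cmat_algebra n)"
    and card: "card T = 2 * (n * n)"
    and el: "(\<forall>t\<in>T. t \<otimes>\<^bsub>G\<^esub> t = \<one>\<^bsub>G\<^esub>) \<longleftrightarrow> (\<forall>t\<in>carrier T'. t \<otimes>\<^bsub>T'\<^esub> t = \<one>\<^bsub>T'\<^esub>)"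
  obtains \<Gamma> where "\<Gamma> \<in> division_gradings_dim1 G D" "supp \<Gamma> = T" "commutation_factors D \<Gamma> T \<beta>"
    "square_signs D \<Gamma> (two_torsion G T) \<mu>"
proof -
  interpret q: qdata "sub T" "\<lambda>u v. \<beta> (u, v)" \<mu> f by (rule q)
  obtain \<phi> \<psi> where "\<phi> \<in> alg_iso R (cmat_algebra n)"
    and psi: "\<psi> \<in> alg_iso D (cmat_algebra n)"
    using R iso by (auto simp: isomorphic_algebras_def)
  then have psi': "inv_into (carrier D) \<psi> \<circ> \<phi> \<in> alg_iso R D" using alg_iso_comp alg_iso_inv[OF psi D] by blast
  obtain f' where q': "qdata T' (comm_factor \<sigma>') (square_sign \<sigma>') f'" by (rule qdata_gbasis_matrix[OF g R n])
  have "card (carrier (sub T)) = card (carrier T')" using card gbasis_cardinality[OF g R] by simp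
  moreover have "(\<forall>t\<in>carrier (sub T). t \<otimes>\<^bsub>sub T\<^esub> t = \<one>\<^bsub>sub T\<^esub>) \<longleftrightarrow> (\<forall>t\<in>carrier T'. t \<otimes>\<^bsub>T'\<^esub> t = \<one>\<^bsub>T'\<^esub>)"
    using el by simp
  ultimately obtain X \<sigma> where "gbasis (sub T) D X \<sigma>"
    "\<forall>s\<in>carrier (sub T). \<forall>t\<in>carrier (sub T). comm_factor \<sigma> s t = \<beta> (s, t)"
    "\<forall>t\<in>carrier (sub T). t \<otimes>\<^bsub>sub T\<^esub> t = \<one>\<^bsub>sub T\<^esub> \<longrightarrow> square_sign \<sigma> t = \<mu> t"
    by (rule qdata_realization[OF q g q' _ _ D psi'])
  then have b: "gbasis (sub T) D X \<sigma>" "\<And>s t. s \<in> T \<Longrightarrow> t \<in> T \<Longrightarrow> comm_factor \<sigma> s t = \<beta> (s, t)"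
    "\<And>t. t \<in> T \<Longrightarrow> t \<otimes>\<^bsub>G\<^esub> t = \<one>\<^bsub>G\<^esub> \<Longrightarrow> square_sign \<sigma> t = \<mu> t" by simp_all
  define \<Gamma> where "\<Gamma> t = (if t \<in> T then {r \<odot> X t | r. True} else {\<zero>})" for t
  have l: "\<Gamma> t = {r \<odot> X t | r. True}" if "t \<in> T" for t using that by (simp add: \<Gamma>_def)
  note gr = gbasis_grading[OF G T b(1) l]
  show thesis
  proof (rule that)
    show "\<Gamma> \<in> division_gradings_dim1 G D" "supp \<Gamma> = T" by (rule gr; simp add: \<Gamma>_def)+
    show "commutation_factors D \<Gamma> T \<beta>"
      using commutation_factors_gbasis[OF b(1), of \<Gamma> \<beta>] l b(2) by simp
    have "\<mu> \<in> two_torsion G T \<rightarrow> {1, -1}" using q.mu_val by (auto simp: two_torsion_def)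
    then show "square_signs D \<Gamma> (two_torsion G T) \<mu>"
      using square_signs_gbasis[OF b(1), of "two_torsion G T" \<Gamma> \<mu>] l b(3) by (auto simp: two_torsion_def)
  qed
qed

end

text \<open>Both supports have order \<open>2 n^2\<close>, so agreement of the exponents is all that
  \<open>qiso_exists\<close> still requires. The bijection of supports obtained is even an
  isomorphism of groups.\<close>

lemma gradings_equivalentI:
  assumes A: "matrix_algebra_gradings G D n" and B: "matrix_algebra_gradings H R n"
    and Gam: "\<Gamma> \<in> division_gradings_dim1 G D" and Gam': "\<Gamma>' \<in> division_gradings_dim1 H R"
    and el: "(\<forall>t\<in>grading_support G D \<Gamma>. t \<otimes>\<^bsub>G\<^esub> t = \<one>\<^bsub>G\<^esub>) \<longleftrightarrow>
      (\<forall>t\<in>grading_support H R \<Gamma>'. t \<otimes>\<^bsub>H\<^esub> t = \<one>\<^bsub>H\<^esub>)"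
  shows "gradings_equivalent G D \<Gamma> H R \<Gamma>'"
proof -
  interpret A: matrix_algebra_gradings G D n by (rule A)
  interpret B: matrix_algebra_gradings H R n by (rule B)
  obtain X \<sigma> f where b0: "subgroup (A.supp \<Gamma>) G" "gbasis (A.sub (A.supp \<Gamma>)) D X \<sigma>"
    "\<forall>t\<in>A.supp \<Gamma>. \<Gamma> t = {r \<odot>\<^bsub>D\<^esub> X t | r. True}"
    "\<forall>t\<in>carrier G. t \<notin> A.supp \<Gamma> \<longrightarrow> \<Gamma> t = {\<zero>\<^bsub>D\<^esub>}"
    "qdata (A.sub (A.supp \<Gamma>)) (comm_factor \<sigma>) (square_sign \<sigma>) f" "card (A.supp \<Gamma>) = 2 * (n * n)"
    by (rule A.grading_basis[OF Gam])
  note b = b0(2) b0(3)[rule_format] b0(5) b0(6)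
  obtain X' \<sigma>' f' where b'0: "subgroup (B.supp \<Gamma>') H" "gbasis (B.sub (B.supp \<Gamma>')) R X' \<sigma>'"
    "\<forall>t\<in>B.supp \<Gamma>'. \<Gamma>' t = {r \<odot>\<^bsub>R\<^esub> X' t | r. True}"
    "\<forall>t\<in>carrier H. t \<notin> B.supp \<Gamma>' \<longrightarrow> \<Gamma>' t = {\<zero>\<^bsub>R\<^esub>}"
    "qdata (B.sub (B.supp \<Gamma>')) (comm_factor \<sigma>') (square_sign \<sigma>') f'" "card (B.supp \<Gamma>') = 2 * (n * n)"
    by (rule B.grading_basis[OF Gam'])
  note b' = b'0(2) b'0(3)[rule_format] b'0(5) b'0(6)
  obtain \<alpha> where al: "qiso (A.sub (A.supp \<Gamma>)) (comm_factor \<sigma>) (square_sign \<sigma>) (B.sub (B.supp \<Gamma>')) (comm_factor \<sigma>') (square_sign \<sigma>') \<alpha>"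
    using qiso_exists[OF b(3) b'(3)] b(4) b'(4) el by auto
  obtain \<phi> where phi: "\<phi> \<in> alg_iso D R" "\<forall>t\<in>carrier (A.sub (A.supp \<Gamma>)). \<exists>c. c \<noteq> 0 \<and> \<phi> (X t) = c \<odot>\<^bsub>R\<^esub> X' (\<alpha> t)"
    by (rule qiso_graded_iso[OF b(1) b'(1) b(3) al])
  have bij: "bij_betw \<alpha> (A.supp \<Gamma>) (B.supp \<Gamma>')" using al by (simp add: qiso_def iso_def)
  have "\<phi> ` \<Gamma> t = \<Gamma>' (\<alpha> t)" if t: "t \<in> A.supp \<Gamma>" for t
  proof -
    obtain c where c: "c \<noteq> 0" "\<phi> (X t) = c \<odot>\<^bsub>R\<^esub> X' (\<alpha> t)" using phi(2) t by auto
    have at: "\<alpha> t \<in> B.supp \<Gamma>'" by (rule bij_betwE[OF bij, rule_format, OF t])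
    show ?thesis unfolding b(2)[OF t] b'(2)[OF at]
      by (rule image_line[OF phi(1) B.D _ _ c]) (use gbasisD(8)[OF b(1)] gbasisD(8)[OF b'(1)] t at in auto)
  qed
  then show ?thesis unfolding gradings_equivalent_def using phi(1) bij by blast
qed

section \<open>Quadratic pairs and triples versus commutation factors and signs\<close>

lemma comm_group_subgroup:
  assumes "comm_group G" "subgroup T G"
  shows "comm_group (G\<lparr>carrier := T\<rparr>)"
proof -
  interpret G: comm_group G by fact
  interpret T: group "G\<lparr>carrier := T\<rparr>" by (rule subgroup.subgroup_is_group[OF assms(2) G.is_group])
  show ?thesis
    by (rule T.group_comm_groupI) (use subgroup.mem_carrier[OF assms(2)] G.m_comm in auto)
qed

text \<open>Exponent four bounds the values of a real bicharacter and makes the generator of the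
  squares an involution.\<close>

lemma Z2_pow_Z4_fourth_power:
  assumes "x \<in> carrier (Z2_pow_Z4 k)"
  shows "(x \<otimes>\<^bsub>Z2_pow_Z4 k\<^esub> x) \<otimes>\<^bsub>Z2_pow_Z4 k\<^esub> (x \<otimes>\<^bsub>Z2_pow_Z4 k\<^esub> x) = \<one>\<^bsub>Z2_pow_Z4 k\<^esub>"
proof -
  obtain g h where x: "x = (g, h)" "g \<in> carrier (Z2_pow k)" "h \<in> carrier Z4"
    using assms unfolding Z2_pow_Z4_def by auto
  have "(h \<otimes>\<^bsub>Z4\<^esub> h) \<otimes>\<^bsub>Z4\<^esub> (h \<otimes>\<^bsub>Z4\<^esub> h) = \<one>\<^bsub>Z4\<^esub>" using x(3) unfolding Z4_carrier by (elim insertE emptyE) simp_all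
  moreover have "(g \<otimes>\<^bsub>Z2_pow k\<^esub> g) \<otimes>\<^bsub>Z2_pow k\<^esub> (g \<otimes>\<^bsub>Z2_pow k\<^esub> g) = \<one>\<^bsub>Z2_pow k\<^esub>"
    unfolding Z2_pow_square[OF x(2)] by (rule Z2_pow_square[OF Group.monoid.one_closed[OF Group.group.is_monoid[OF group_Z2_pow]]])
  ultimately show ?thesis unfolding x(1) Z2_pow_Z4_def by simp
qed

lemma iso_fourth_power:
  fixes T (structure)
  assumes "T \<cong> K" "Group.group T" "Group.group K"
    and K: "\<And>x. x \<in> carrier K \<Longrightarrow> (x \<otimes>\<^bsub>K\<^esub> x) \<otimes>\<^bsub>K\<^esub> (x \<otimes>\<^bsub>K\<^esub> x) = \<one>\<^bsub>K\<^esub>" and t: "t \<in> carrier T"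
  shows "(t \<otimes> t) \<otimes> (t \<otimes> t) = \<one>"
proof -
  obtain h where h: "h \<in> iso T K" using assms(1) by (auto simp: is_iso_def)
  interpret group_hom T K h using assms(2,3) h by (simp add: group_hom_def group_hom_axioms_def iso_def)
  have inj: "inj_on h (carrier T)" using h by (auto simp: iso_def bij_betw_def)
  have "h ((t \<otimes> t) \<otimes> (t \<otimes> t)) = h \<one>" using K[of "h t"] t by simp
  then show ?thesis using inj_onD[OF inj] t by blast
qed

lemma (in group) generate_involution:
  assumes f: "f \<in> carrier G" "f \<otimes> f = \<one>"
  shows "generate G {f} = {\<one>, f}"
proof
  have i: "inv f = f" using inv_equality[OF f(2)] f(1) by simp
  show "generate G {f} \<subseteq> {\<one>, f}"
  proof
    fix x assume "x \<in> generate G {f}"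
    then show "x \<in> {\<one>, f}" by (induction rule: generate.induct) (use f i in auto)
  qed
  show "{\<one>, f} \<subseteq> generate G {f}" by (auto intro: generate.one generate.incl)
qed

lemma assoc_bichar_eq:
  "u \<in> carrier T \<Longrightarrow> v \<in> carrier T \<Longrightarrow> assoc_bichar T \<mu> (u, v) = \<mu> (u \<otimes>\<^bsub>T\<^esub> v) * inverse (\<mu> u) * inverse (\<mu> v)"
  by (simp add: assoc_bichar_def)

text \<open>In an elementary group the associated bicharacter is automatically alternating, since
  its value at \<open>(u, u)\<close> is \<open>\<mu> (u^2)\<close> divided by the square of a sign.
  The element \<open>f\<close> is supplied by type II.\<close>

lemma quadratic_pair_qdata:
  assumes G: "comm_group G" and P: "(T, \<mu>) \<in> quadratic_pairs G m"
  obtains f where "qdata (G\<lparr>carrier := T\<rparr>) (\<lambda>u v. assoc_bichar (G\<lparr>carrier := T\<rparr>) \<mu> (u, v)) \<mu> f"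
    "\<forall>t\<in>T. t \<otimes>\<^bsub>G\<^esub> t = \<one>\<^bsub>G\<^esub>" "card T = 2 ^ (2 * m + 1)"
proof -
  let ?K = "G\<lparr>carrier := T\<rparr>"
  have T: "subgroup T G" and i: "?K \<cong> Z2_pow (2 * m + 1)" and q: "quadratic_form ?K \<mu>" and II: "quad_type_II ?K \<mu>"
    using P by (auto simp: quadratic_pairs_def)
  interpret K: comm_group ?K by (rule comm_group_subgroup[OF G T])
  have sq: "t \<otimes>\<^bsub>?K\<^esub> t = \<one>\<^bsub>?K\<^esub>" if "t \<in> carrier ?K" for t
    using iso_square(1)[OF i K.is_group group_Z2_pow] Z2_pow_square that by blast
  have c: "card T = 2 ^ (2 * m + 1)" using iso_square(2)[OF i K.is_group group_Z2_pow] card_Z2_pow by simp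
  have fin: "finite T" by (rule card_ge_0_finite) (simp add: c)
  have m: "\<mu> t = 1 \<or> \<mu> t = -1" if "t \<in> carrier ?K" for t
    using q that unfolding quadratic_form_def by (auto dest: PiE_mem)
  have m1: "\<mu> \<one>\<^bsub>?K\<^esub> = 1" using q by (simp add: quadratic_form_def)
  let ?b = "\<lambda>u v. assoc_bichar ?K \<mu> (u, v)"
  have b: "?b u v = \<mu> (u \<otimes>\<^bsub>?K\<^esub> v) * \<mu> u * \<mu> v" if "u \<in> carrier ?K" "v \<in> carrier ?K" for u v
    unfolding assoc_bichar_eq[OF that] using m[OF that(1)] m[OF that(2)] by auto
  obtain f where f: "f \<in> carrier ?K" "f \<noteq> \<one>\<^bsub>?K\<^esub>" "bichar_radical ?K (assoc_bichar ?K \<mu>) = {\<one>\<^bsub>?K\<^esub>, f}" "\<mu> f = -1"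
    using II unfolding quad_type_II_def by blast
  have "qdata ?K ?b \<mu> f"
  proof (rule qdata.intro[OF K.comm_group_axioms], rule qdata_axioms.intro)
    show "finite (carrier ?K)" using fin by simp
    fix u v assume uv: "u \<in> carrier ?K" "v \<in> carrier ?K"
    show "?b u v = 1 \<or> ?b u v = -1"
      unfolding b[OF uv] using m[OF uv(1)] m[OF uv(2)] m[OF K.m_closed[OF uv]] by auto
    show "?b u v = ?b v u" unfolding b[OF uv] b[OF uv(2,1)] K.m_comm[OF uv] by simp
    show "\<mu> (u \<otimes>\<^bsub>?K\<^esub> v) = \<mu> u * \<mu> v * ?b u v"
      unfolding b[OF uv] using m[OF uv(1)] m[OF uv(2)] by auto
  next
    fix u assume u: "u \<in> carrier ?K"
    show "?b u u = 1" unfolding b[OF u u] sq[OF u] m1 using m[OF u] by auto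
    show "u \<otimes>\<^bsub>?K\<^esub> u = \<one>\<^bsub>?K\<^esub> \<or> u \<otimes>\<^bsub>?K\<^esub> u = f" using sq[OF u] by blast
    show "\<mu> u = 1 \<or> \<mu> u = -1" by (rule m[OF u])
    have "u \<in> bichar_radical ?K (assoc_bichar ?K \<mu>) \<longleftrightarrow> u = \<one>\<^bsub>?K\<^esub> \<or> u = f" unfolding f(3) by simp
    then show "(\<forall>v\<in>carrier ?K. ?b v u = 1) \<longleftrightarrow> u = \<one>\<^bsub>?K\<^esub> \<or> u = f"
      unfolding bichar_radical_def using u by simp
  next
    fix u v w assume "u \<in> carrier ?K" "v \<in> carrier ?K" "w \<in> carrier ?K"
    then show "?b (u \<otimes>\<^bsub>?K\<^esub> v) w = ?b u w * ?b v w"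
      using q unfolding quadratic_form_def multiplicative_in_each_def by blast
  qed (rule f)+
  then show thesis using that sq c by simp
qed

text \<open>Restricting \<open>\<mu>\<close> brings it into the extensional form in which pairs are
  compared. The last clause says that in the elementary case the commutation factors are recovered
  from the signs.\<close>

lemma qdata_quadratic_pair:
  fixes G (structure)
  assumes T: "subgroup T G" and i: "G\<lparr>carrier := T\<rparr> \<cong> Z2_pow (2 * m + 1)" and q: "qdata (G\<lparr>carrier := T\<rparr>) \<beta> \<mu> f"
  shows "(T, restrict \<mu> T) \<in> quadratic_pairs G m" "\<forall>t\<in>T. t \<otimes> t = \<one>"
    and "\<And>u v. u \<in> T \<Longrightarrow> v \<in> T \<Longrightarrow> assoc_bichar (G\<lparr>carrier := T\<rparr>) (restrict \<mu> T) (u, v) = \<beta> u v"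
proof -
  let ?K = "G\<lparr>carrier := T\<rparr>"
  let ?m = "restrict \<mu> T"
  interpret q: qdata ?K \<beta> \<mu> f by (rule q)
  have sq: "t \<otimes>\<^bsub>?K\<^esub> t = \<one>\<^bsub>?K\<^esub>" if "t \<in> carrier ?K" for t
    using iso_square(1)[OF i q.is_group group_Z2_pow] Z2_pow_square that by blast
  then show "\<forall>t\<in>T. t \<otimes> t = \<one>" by simp
  have m: "\<mu> t = 1 \<or> \<mu> t = -1" if "t \<in> carrier ?K" for t by (rule q.mu_val[OF that sq[OF that]])
  have b: "assoc_bichar ?K ?m (u, v) = \<beta> u v" if uv: "u \<in> carrier ?K" "v \<in> carrier ?K" for u v
  proof -
    have "?m (u \<otimes>\<^bsub>?K\<^esub> v) = \<mu> u * \<mu> v * \<beta> u v" "?m u = \<mu> u" "?m v = \<mu> v"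
      using q.mu_mult[OF uv sq[OF uv(1)] sq[OF uv(2)]] q.m_closed[OF uv] uv by simp_all
    then show ?thesis unfolding assoc_bichar_eq[OF uv] using m[OF uv(1)] m[OF uv(2)] by auto
  qed
  then show "\<And>u v. u \<in> T \<Longrightarrow> v \<in> T \<Longrightarrow> assoc_bichar ?K ?m (u, v) = \<beta> u v" by simp
  have "multiplicative_in_each ?K (assoc_bichar ?K ?m)"
    unfolding multiplicative_in_each_def
  proof (intro ballI)
    fix u v w assume uvw: "u \<in> carrier ?K" "v \<in> carrier ?K" "w \<in> carrier ?K"
    show "assoc_bichar ?K ?m (u \<otimes>\<^bsub>?K\<^esub> v, w) = assoc_bichar ?K ?m (u, w) * assoc_bichar ?K ?m (v, w) \<and>
      assoc_bichar ?K ?m (w, u \<otimes>\<^bsub>?K\<^esub> v) = assoc_bichar ?K ?m (w, u) * assoc_bichar ?K ?m (w, v)"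
      unfolding b[OF q.m_closed[OF uvw(1,2)] uvw(3)] b[OF uvw(3) q.m_closed[OF uvw(1,2)]] b[OF uvw(1,3)] b[OF uvw(2,3)]
        b[OF uvw(3,1)] b[OF uvw(3,2)] using q.beta_mult[OF uvw] q.beta_mult_r[OF uvw] by blast
  qed
  moreover have "?m \<in> carrier ?K \<rightarrow>\<^sub>E {1, -1}" using m by auto
  moreover have "?m \<one>\<^bsub>?K\<^esub> = 1" using q.mu_one q.one_closed by simp
  ultimately have "quadratic_form ?K ?m" unfolding quadratic_form_def by blast
  moreover have "bichar_radical ?K (assoc_bichar ?K ?m) = {\<one>\<^bsub>?K\<^esub>, f}"
  proof -
    have "bichar_radical ?K (assoc_bichar ?K ?m) = {t \<in> carrier ?K. \<forall>u\<in>carrier ?K. \<beta> u t = 1}"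
      unfolding bichar_radical_def by (intro Collect_cong conj_cong ball_cong refl) (simp only: b)
    also have "\<dots> = {\<one>\<^bsub>?K\<^esub>, f}" using q.radical q.one_closed q.f_closed by blast
    finally show ?thesis .
  qed
  moreover have "?m f = -1" using q.mu_f q.f_closed by simp
  ultimately have "quadratic_form ?K ?m" "quad_type_II ?K ?m"
    unfolding quad_type_II_def using q.f_closed q.f_ne by blast+
  then show "(T, ?m) \<in> quadratic_pairs G m" unfolding quadratic_pairs_def using T i by simp
qed

text \<open>A triple provides a real bicharacter with a radical of two elements and, separately, a
  generator \<open>f\<close> of the squares. What has to be shown is that \<open>\<beta>\<close>
  takes only the values 1 and -1 and that \<open>f\<close> is the nontrivial element of the
  radical.\<close>

lemma quadratic_triple_qdata:
  fixes G (structure)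
  assumes G: "comm_group G" and P: "(T, \<beta>, \<mu>) \<in> quadratic_triples G m"
  obtains f where "qdata (G\<lparr>carrier := T\<rparr>) (\<lambda>u v. \<beta> (u, v)) \<mu> f" "card T = 2 ^ (2 * m - 1) * 4"
    "\<not> (\<forall>t\<in>T. t \<otimes> t = \<one>)"
proof -
  let ?K = "G\<lparr>carrier := T\<rparr>" and ?T2 = "two_torsion G T"
  let ?K2 = "G\<lparr>carrier := ?T2\<rparr>"
  interpret G: comm_group G by (rule G)
  have T: "subgroup T G" and i: "?K \<cong> Z2_pow_Z4 (2 * m - 1)" and al: "alternating_bicharacter ?K \<beta>"
    and II: "bichar_type_II ?K \<beta>" and q: "quadratic_form ?K2 \<mu>"
    and ab: "restrict \<beta> (?T2 \<times> ?T2) = assoc_bichar ?K2 \<mu>"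
    and ex: "\<exists>f\<in>T. generate G {f} = squares G T \<and> \<mu> f = -1"
    using P unfolding quadratic_triples_def by auto
  obtain f where f: "f \<in> T" "generate G {f} = squares G T" "\<mu> f = -1" using ex by blast
  interpret K: comm_group ?K by (rule comm_group_subgroup[OF G T])
  have TG: "t \<in> carrier G" if "t \<in> T" for t using subgroup.mem_carrier[OF T that] .
  have four: "(t \<otimes>\<^bsub>?K\<^esub> t) \<otimes>\<^bsub>?K\<^esub> (t \<otimes>\<^bsub>?K\<^esub> t) = \<one>\<^bsub>?K\<^esub>" if "t \<in> carrier ?K" for t
    by (rule iso_fourth_power[OF i K.is_group group_Z2_pow_Z4 Z2_pow_Z4_fourth_power that])
  have nsq: "\<not> (\<forall>t\<in>T. t \<otimes> t = \<one>)"
    using iso_square(1)[OF i K.is_group group_Z2_pow_Z4] Z2_pow_Z4_not_square[of "2 * m - 1"] by simp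
  have c: "card T = 2 ^ (2 * m - 1) * 4" using iso_square(2)[OF i K.is_group group_Z2_pow_Z4] card_Z2_pow_Z4 by simp
  have fin: "finite T" by (rule card_ge_0_finite) (simp add: c)
  have "f \<in> squares G T" unfolding f(2)[symmetric] by (rule generate.incl) simp
  then obtain s where s: "s \<in> T" "f = s \<otimes> s" unfolding squares_def by blast
  have ff: "f \<otimes> f = \<one>" using four[of s] s by simp
  have sqs: "squares G T = {\<one>, f}" using G.generate_involution[OF TG[OF f(1)] ff] f(2) by simp
  have m: "\<mu> t = 1 \<or> \<mu> t = -1" if "t \<in> ?T2" for t
    using q that unfolding quadratic_form_def by (auto dest: PiE_mem)
  have m1: "\<mu> \<one> = 1" using q by (simp add: quadratic_form_def)
  have bm: "\<beta> (u \<otimes>\<^bsub>?K\<^esub> v, w) = \<beta> (u, w) * \<beta> (v, w)" "\<beta> (w, u \<otimes>\<^bsub>?K\<^esub> v) = \<beta> (w, u) * \<beta> (w, v)"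
    if "u \<in> carrier ?K" "v \<in> carrier ?K" "w \<in> carrier ?K" for u v w
    using al that unfolding alternating_bicharacter_def multiplicative_in_each_def by blast+
  have bd: "\<beta> (t, t) = 1" if "t \<in> carrier ?K" for t using al that unfolding alternating_bicharacter_def by blast
  have b0: "\<beta> (u, v) \<noteq> 0" if "u \<in> carrier ?K" "v \<in> carrier ?K" for u v
    using al that unfolding alternating_bicharacter_def by (auto dest: PiE_mem)
  have b1: "\<beta> (\<one>\<^bsub>?K\<^esub>, v) = 1" "\<beta> (v, \<one>\<^bsub>?K\<^esub>) = 1" if "v \<in> carrier ?K" for v
    using bm[OF K.one_closed K.one_closed that] b0[OF K.one_closed that] b0[OF that K.one_closed] by simp_all
  \<comment> \<open>Exponent four gives only that the fourth power is 1; among real numbers this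
    leaves the two signs.\<close>
  have bv: "\<beta> (u, v) = 1 \<or> \<beta> (u, v) = -1" if uv: "u \<in> carrier ?K" "v \<in> carrier ?K" for u v
  proof -
    have "\<beta> (u, v) * \<beta> (u, v) * (\<beta> (u, v) * \<beta> (u, v)) = \<beta> ((u \<otimes>\<^bsub>?K\<^esub> u) \<otimes>\<^bsub>?K\<^esub> (u \<otimes>\<^bsub>?K\<^esub> u), v)"
      unfolding bm(1)[OF K.m_closed[OF uv(1,1)] K.m_closed[OF uv(1,1)] uv(2)] bm(1)[OF uv(1,1,2)] by simp
    also have "\<dots> = 1" unfolding four[OF uv(1)] by (rule b1(1)[OF uv(2)])
    finally have "(\<beta> (u, v) ^ 2) ^ 2 = 1" by (simp only: power2_eq_square)
    then have "\<beta> (u, v) ^ 2 = 1 \<or> \<beta> (u, v) ^ 2 = -1" by (simp only: power2_eq_1_iff)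
    then have "\<beta> (u, v) ^ 2 = 1" using zero_le_power2[of "\<beta> (u, v)"] by linarith
    then show ?thesis by (simp only: power2_eq_1_iff)
  qed
  \<comment> \<open>\<open>f\<close> is a square, and the square of a sign is 1. So \<open>f\<close>
    lies in the radical, and with \<open>\<one>\<close> it exhausts the two elements there; it
    differs from \<open>\<one>\<close> because \<open>\<mu>\<close> separates them.\<close>
  have ftriv: "\<beta> (u, f) = 1" if "u \<in> carrier ?K" for u
    using bm(2)[of s s u] bv[of u s] s that by auto
  have fne: "f \<noteq> \<one>" using f(3) m1 by auto
  have rad: "bichar_radical ?K \<beta> = {\<one>, f}"
  proof -
    have sub: "{\<one>, f} \<subseteq> bichar_radical ?K \<beta>" unfolding bichar_radical_def using ftriv b1(2) f(1) K.one_closed by auto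
    have c2: "card (bichar_radical ?K \<beta>) = 2" using II by (simp add: bichar_type_II_def)
    have "finite (bichar_radical ?K \<beta>)" by (rule card_ge_0_finite) (simp add: c2)
    then show ?thesis using card_subset_eq[OF _ sub] c2 fne by simp
  qed
  have "qdata ?K (\<lambda>u v. \<beta> (u, v)) \<mu> f"
  proof (rule qdata.intro[OF K.comm_group_axioms], rule qdata_axioms.intro)
    show "finite (carrier ?K)" using fin by simp
    show "f \<in> carrier ?K" "f \<noteq> \<one>\<^bsub>?K\<^esub>" "\<mu> f = -1" using f fne by simp_all
    fix u v assume uv: "u \<in> carrier ?K" "v \<in> carrier ?K"
    show "\<beta> (u, v) = 1 \<or> \<beta> (u, v) = -1" by (rule bv[OF uv])
    \<comment> \<open>Expanding the alternating condition at the product of \<open>u\<close> and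
      \<open>v\<close> gives antisymmetry, which for signs is the same as symmetry.\<close>
    have "1 = \<beta> (u, v) * \<beta> (v, u)"
      using bd[OF K.m_closed[OF uv]] bm(1)[OF uv K.m_closed[OF uv]] bm(2)[OF uv uv(1)] bm(2)[OF uv uv(2)] bd[OF uv(1)] bd[OF uv(2)] by simp
    then show "\<beta> (u, v) = \<beta> (v, u)" using bv[OF uv] bv[OF uv(2,1)] by auto
    assume sq: "u \<otimes>\<^bsub>?K\<^esub> u = \<one>\<^bsub>?K\<^esub>" "v \<otimes>\<^bsub>?K\<^esub> v = \<one>\<^bsub>?K\<^esub>"
    then have t2: "u \<in> ?T2" "v \<in> ?T2" using uv by (simp_all add: two_torsion_def)
    have "\<beta> (u, v) = restrict \<beta> (?T2 \<times> ?T2) (u, v)" using t2 by simp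
    also have "\<dots> = \<mu> (u \<otimes> v) * inverse (\<mu> u) * inverse (\<mu> v)" unfolding ab using t2 by (simp add: assoc_bichar_def)
    finally show "\<mu> (u \<otimes>\<^bsub>?K\<^esub> v) = \<mu> u * \<mu> v * \<beta> (u, v)" using m[OF t2(1)] m[OF t2(2)] by auto
  next
    fix u assume u: "u \<in> carrier ?K"
    show "\<beta> (u, u) = 1" by (rule bd[OF u])
    have "u \<otimes> u \<in> squares G T" using u by (auto simp: squares_def)
    then show "u \<otimes>\<^bsub>?K\<^esub> u = \<one>\<^bsub>?K\<^esub> \<or> u \<otimes>\<^bsub>?K\<^esub> u = f" unfolding sqs by simp
    show "\<mu> u = 1 \<or> \<mu> u = -1" if "u \<otimes>\<^bsub>?K\<^esub> u = \<one>\<^bsub>?K\<^esub>" by (rule m) (use u that in \<open>simp add: two_torsion_def\<close>)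
    have "u \<in> bichar_radical ?K \<beta> \<longleftrightarrow> u = \<one>\<^bsub>?K\<^esub> \<or> u = f" unfolding rad by simp
    then show "(\<forall>v\<in>carrier ?K. \<beta> (v, u) = 1) \<longleftrightarrow> u = \<one>\<^bsub>?K\<^esub> \<or> u = f"
      unfolding bichar_radical_def using u by simp
  qed (rule bm)
  then show thesis using that c nsq by blast
qed

lemma qdata_quadratic_triple:
  fixes G (structure)
  assumes G: "comm_group G" and T: "subgroup T G" and i: "G\<lparr>carrier := T\<rparr> \<cong> Z2_pow_Z4 (2 * m - 1)"
    and q: "qdata (G\<lparr>carrier := T\<rparr>) (\<lambda>u v. \<beta> (u, v)) \<mu> f"
  shows "(T, restrict \<beta> (T \<times> T), restrict \<mu> (two_torsion G T)) \<in> quadratic_triples G m"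
    "\<not> (\<forall>t\<in>T. t \<otimes> t = \<one>)"
proof -
  let ?K = "G\<lparr>carrier := T\<rparr>" and ?T2 = "two_torsion G T"
  let ?K2 = "G\<lparr>carrier := ?T2\<rparr>" and ?b = "restrict \<beta> (T \<times> T)" and ?m = "restrict \<mu> (two_torsion G T)"
  interpret G: comm_group G by (rule G)
  interpret q: qdata ?K "\<lambda>u v. \<beta> (u, v)" \<mu> f by (rule q)
  have TG: "t \<in> carrier G" if "t \<in> T" for t using subgroup.mem_carrier[OF T that] .
  show nsq: "\<not> (\<forall>t\<in>T. t \<otimes> t = \<one>)"
    using iso_square(1)[OF i q.is_group group_Z2_pow_Z4] Z2_pow_Z4_not_square[of "2 * m - 1"] by simp
  have fT: "f \<in> T" and ff: "f \<otimes> f = \<one>" using q.f_closed q.f_square by simp_all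
  have b: "?b (u, v) = \<beta> (u, v)" if "u \<in> T" "v \<in> T" for u v using that by simp
  have "?b (u \<otimes>\<^bsub>?K\<^esub> v, w) = ?b (u, w) * ?b (v, w) \<and> ?b (w, u \<otimes>\<^bsub>?K\<^esub> v) = ?b (w, u) * ?b (w, v)"
    if uvw: "u \<in> carrier ?K" "v \<in> carrier ?K" "w \<in> carrier ?K" for u v w
    using q.beta_mult[OF uvw] q.beta_mult_r[OF uvw] q.m_closed[OF uvw(1,2)] uvw by simp
  moreover have "?b \<in> (carrier ?K \<times> carrier ?K) \<rightarrow>\<^sub>E (UNIV - {0})"
  proof (rule PiE_I)
    fix x assume "x \<in> carrier ?K \<times> carrier ?K"
    then obtain u v where "x = (u, v)" "u \<in> carrier ?K" "v \<in> carrier ?K" by blast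
    then show "?b x \<in> UNIV - {0}" using q.beta_val[of u v] by auto
  qed simp
  moreover have "?b (t, t) = 1" if "t \<in> carrier ?K" for t using q.beta_alt[OF that] that by simp
  ultimately have al: "alternating_bicharacter ?K ?b"
    unfolding alternating_bicharacter_def multiplicative_in_each_def by blast
  have "bichar_radical ?K ?b = {t \<in> carrier ?K. \<forall>u\<in>carrier ?K. \<beta> (u, t) = 1}"
    unfolding bichar_radical_def by (intro Collect_cong conj_cong ball_cong refl) simp
  also have "\<dots> = {\<one>\<^bsub>?K\<^esub>, f}" using q.radical q.one_closed q.f_closed by blast
  finally have II: "bichar_type_II ?K ?b" unfolding bichar_type_II_def using q.f_ne by simp
  have t2: "t \<in> carrier ?K" "t \<otimes>\<^bsub>?K\<^esub> t = \<one>\<^bsub>?K\<^esub>" if "t \<in> ?T2" for t using that by (simp_all add: two_torsion_def)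
  have t2m: "u \<otimes>\<^bsub>?K\<^esub> v \<in> ?T2" if "u \<in> ?T2" "v \<in> ?T2" for u v
    using q.square_mult[OF t2(1)[OF that(1)] t2(1)[OF that(2)]] q.m_closed[OF t2(1)[OF that(1)] t2(1)[OF that(2)]]
      t2(2)[OF that(1)] t2(2)[OF that(2)] q.one_closed by (simp add: two_torsion_def)
  have m: "\<mu> t = 1 \<or> \<mu> t = -1" if "t \<in> ?T2" for t by (rule q.mu_val[OF t2[OF that]])
  have ab: "assoc_bichar ?K2 ?m (u, v) = \<beta> (u, v)" if uv: "u \<in> ?T2" "v \<in> ?T2" for u v
  proof -
    have "?m (u \<otimes> v) = \<mu> u * \<mu> v * \<beta> (u, v)"
      using q.mu_mult[OF t2(1)[OF uv(1)] t2(1)[OF uv(2)] t2(2)[OF uv(1)] t2(2)[OF uv(2)]] t2m[OF uv] by simp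
    then show ?thesis using m[OF uv(1)] m[OF uv(2)] uv by (auto simp: assoc_bichar_eq)
  qed
  have "multiplicative_in_each ?K2 (assoc_bichar ?K2 ?m)"
    unfolding multiplicative_in_each_def
  proof (intro ballI)
    fix u v w assume "u \<in> carrier ?K2" "v \<in> carrier ?K2" "w \<in> carrier ?K2"
    then have uvw: "u \<in> ?T2" "v \<in> ?T2" "w \<in> ?T2" by simp_all
    have e: "u \<otimes>\<^bsub>?K2\<^esub> v = u \<otimes>\<^bsub>?K\<^esub> v" by simp
    show "assoc_bichar ?K2 ?m (u \<otimes>\<^bsub>?K2\<^esub> v, w) = assoc_bichar ?K2 ?m (u, w) * assoc_bichar ?K2 ?m (v, w) \<and>
      assoc_bichar ?K2 ?m (w, u \<otimes>\<^bsub>?K2\<^esub> v) = assoc_bichar ?K2 ?m (w, u) * assoc_bichar ?K2 ?m (w, v)"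
      unfolding e ab[OF t2m[OF uvw(1,2)] uvw(3)] ab[OF uvw(3) t2m[OF uvw(1,2)]] ab[OF uvw(1,3)] ab[OF uvw(2,3)]
        ab[OF uvw(3,1)] ab[OF uvw(3,2)]
      using q.beta_mult[OF t2(1)[OF uvw(1)] t2(1)[OF uvw(2)] t2(1)[OF uvw(3)]]
        q.beta_mult_r[OF t2(1)[OF uvw(1)] t2(1)[OF uvw(2)] t2(1)[OF uvw(3)]] by blast
  qed
  moreover have "?m \<in> carrier ?K2 \<rightarrow>\<^sub>E {1, -1}" using m by auto
  moreover have "?m \<one>\<^bsub>?K2\<^esub> = 1" using q.mu_one q.one_closed by (simp add: two_torsion_def TG[unfolded atomize_imp] G.one_closed)
  ultimately have qf: "quadratic_form ?K2 ?m" unfolding quadratic_form_def by blast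
  have r: "restrict ?b (?T2 \<times> ?T2) = assoc_bichar ?K2 ?m"
  proof
    fix x show "restrict ?b (?T2 \<times> ?T2) x = assoc_bichar ?K2 ?m x"
    proof (cases "x \<in> ?T2 \<times> ?T2")
      case True
      then obtain u v where x: "x = (u, v)" "u \<in> ?T2" "v \<in> ?T2" by blast
      then show ?thesis using ab[OF x(2,3)] t2(1)[OF x(2)] t2(1)[OF x(3)] by simp
    next
      case False
      then show ?thesis unfolding assoc_bichar_def by (simp add: restrict_def)
    qed
  qed
  \<comment> \<open>An element of order four exists by the isomorphism type, and its square can only
    be \<open>f\<close>; so the squares are exactly \<open>\<one>\<close> and
    \<open>f\<close>.\<close>
  obtain t where t: "t \<in> T" "t \<otimes> t \<noteq> \<one>" using nsq by blast
  then have tf: "t \<otimes> t = f" using q.square[of t] by simp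
  have "squares G T = {\<one>, f}"
  proof
    show "squares G T \<subseteq> {\<one>, f}" using q.square unfolding squares_def by auto
    have "\<one> \<in> squares G T" unfolding squares_def by (intro CollectI exI[of _ "\<one>"]) (simp add: subgroup.one_closed[OF T])
    moreover have "f \<in> squares G T" unfolding squares_def using t tf by blast
    ultimately show "{\<one>, f} \<subseteq> squares G T" by blast
  qed
  then have "generate G {f} = squares G T" using G.generate_involution[OF TG[OF fT] ff] by simp
  moreover have "?m f = -1" using q.mu_f fT ff by (simp add: two_torsion_def)
  ultimately have "\<exists>f\<in>T. generate G {f} = squares G T \<and> ?m f = -1" using fT by blast
  then show "(T, ?b, ?m) \<in> quadratic_triples G m" unfolding quadratic_triples_def using T i al II qf r by blast
qed

lemma square_signs_cong:
  "(\<And>t. t \<in> S \<Longrightarrow> \<mu> t = \<mu>' t) \<Longrightarrow> square_signs D \<Gamma> S \<mu> \<longleftrightarrow> square_signs D \<Gamma> S \<mu>'"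
  by (simp add: square_signs_def)

lemma commutation_factors_cong:
  "(\<And>u v. u \<in> S \<Longrightarrow> v \<in> S \<Longrightarrow> \<beta> (u, v) = \<beta>' (u, v)) \<Longrightarrow> commutation_factors D \<Gamma> S \<beta> \<longleftrightarrow> commutation_factors D \<Gamma> S \<beta>'"
  by (simp add: commutation_factors_def)

lemma two_torsion_elementary: "(\<forall>t\<in>T. t \<otimes>\<^bsub>G\<^esub> t = \<one>\<^bsub>G\<^esub>) \<Longrightarrow> two_torsion G T = T"
  by (auto simp: two_torsion_def)

section \<open>Classification of the gradings and membership of the representatives\<close>

context matrix_algebra_gradings
begin

lemma support_structure:
  assumes "\<Gamma> \<in> division_gradings_dim1 G D"
  shows "\<exists>m. n = 2 ^ m \<and> subgroup (supp \<Gamma>) G \<and>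
    (sub (supp \<Gamma>) \<cong> Z2_pow (2 * m + 1) \<or> m \<ge> 1 \<and> sub (supp \<Gamma>) \<cong> Z2_pow_Z4 (2 * m - 1))"
proof -
  obtain X \<sigma> f where b: "subgroup (supp \<Gamma>) G" "gbasis (sub (supp \<Gamma>)) D X \<sigma>"
    "\<forall>t\<in>supp \<Gamma>. \<Gamma> t = {r \<odot> X t | r. True}"
    "\<forall>t\<in>carrier G. t \<notin> supp \<Gamma> \<longrightarrow> \<Gamma> t = {\<zero>}"
    "qdata (sub (supp \<Gamma>)) (comm_factor \<sigma>) (square_sign \<sigma>) f" "card (supp \<Gamma>) = 2 * (n * n)"
    by (rule grading_basis[OF assms])
  show ?thesis using qdata.group_structure[OF b(5), of n] b(1,6) by simp
qed

text \<open>The pair omits \<open>\<beta>\<close> because in an elementary group it is the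
  associated bicharacter of \<open>\<mu>\<close>; comparing two gradings therefore requires
  recovering the commutation factors from the signs. The algebra \<open>R\<close> serves only to
  realise every pair.\<close>

lemma quadratic_pairs_classify:
  assumes m: "n = 2 ^ m" and g: "gbasis T' R X' \<sigma>'"
    and R: "isomorphic_algebras R (cmat_algebra n)"
    and el: "\<forall>t\<in>carrier T'. t \<otimes>\<^bsub>T'\<^esub> t = \<one>\<^bsub>T'\<^esub>"
  defines "S \<equiv> division_gradings_dim1_supp G D (Z2_pow (2 * m + 1))"
  shows "\<exists>F. bij_betw F (isomorphism_classes G D S) (quadratic_pairs G m) \<and>
    (\<forall>C\<in>isomorphism_classes G D S. \<forall>\<Gamma>\<in>C. \<forall>T \<mu>. F C = (T, \<mu>) \<longrightarrow> T = supp \<Gamma> \<and> square_signs D \<Gamma> T \<mu>)"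
proof -
  have "\<exists>F. bij_betw F (isomorphism_classes G D S) (quadratic_pairs G m) \<and>
    (\<forall>C\<in>isomorphism_classes G D S. \<forall>\<Gamma>\<in>C. fst (F C) = supp \<Gamma> \<and> square_signs D \<Gamma> (fst (F C)) (snd (F C)))"
proof (rule classification_by_data)
  have S: "\<Gamma> \<in> division_gradings_dim1 G D" "sub (supp \<Gamma>) \<cong> Z2_pow (2 * m + 1)" if "\<Gamma> \<in> S" for \<Gamma>
    using that by (simp_all add: S_def division_gradings_dim1_supp_def)
  have Q: "subgroup T G" "\<mu> \<in> T \<rightarrow>\<^sub>E {1, -1}" "sub T \<cong> Z2_pow (2 * m + 1)" if "(T, \<mu>) \<in> quadratic_pairs G m" for T \<mu>
    using that by (simp_all add: quadratic_pairs_def quadratic_form_def)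
  have Qm: "\<mu> \<in> T \<rightarrow> {1, -1}" if "(T, \<mu>) \<in> quadratic_pairs G m" for T \<mu>
    using Q(2)[OF that] unfolding PiE_def by (rule IntD1)
  have Qsq: "\<forall>t\<in>T. t \<otimes>\<^bsub>G\<^esub> t = \<one>\<^bsub>G\<^esub>" if "(T, \<mu>) \<in> quadratic_pairs G m" for T \<mu>
    by (rule quadratic_pair_qdata[OF G that])
  have data: "\<exists>\<mu>. (supp \<Gamma>, \<mu>) \<in> quadratic_pairs G m \<and> square_signs D \<Gamma> (supp \<Gamma>) \<mu> \<and>
      commutation_factors D \<Gamma> (supp \<Gamma>) (assoc_bichar (sub (supp \<Gamma>)) \<mu>)" if Gam: "\<Gamma> \<in> S" for \<Gamma>
  proof -
    obtain \<beta> \<mu> f where d: "qdata (sub (supp \<Gamma>)) (\<lambda>u v. \<beta> (u, v)) \<mu> f" "commutation_factors D \<Gamma> (supp \<Gamma>) \<beta>"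
      "square_signs D \<Gamma> (two_torsion G (supp \<Gamma>)) \<mu>"
      by (rule grading_data[OF S(1)[OF Gam]])
    obtain X \<sigma> f' where T: "subgroup (supp \<Gamma>) G" by (rule grading_basis[OF S(1)[OF Gam]])
    note p = qdata_quadratic_pair[OF T S(2)[OF Gam] d(1)]
    have "square_signs D \<Gamma> (supp \<Gamma>) (restrict \<mu> (supp \<Gamma>))"
      using d(3) unfolding two_torsion_elementary[OF p(2)] by (subst square_signs_cong[of _ _ \<mu>]) simp_all
    moreover have "commutation_factors D \<Gamma> (supp \<Gamma>) (assoc_bichar (sub (supp \<Gamma>)) (restrict \<mu> (supp \<Gamma>)))"
      by (subst commutation_factors_cong[of _ _ \<beta>]) (use p(3) d(2) in simp_all)
    ultimately show ?thesis using p(1) by blast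
  qed
  have uniq: "\<mu> = \<mu>'" if "\<Gamma> \<in> S" "(supp \<Gamma>, \<mu>) \<in> quadratic_pairs G m" "(supp \<Gamma>, \<mu>') \<in> quadratic_pairs G m"
    "square_signs D \<Gamma> (supp \<Gamma>) \<mu>" "square_signs D \<Gamma> (supp \<Gamma>) \<mu>'" for \<Gamma> \<mu> \<mu>'
  proof (rule PiE_ext[OF Q(2)[OF that(2)] Q(2)[OF that(3)]])
    fix t assume t: "t \<in> supp \<Gamma>"
    show "\<mu> t = \<mu>' t"
      by (rule square_signs_unique[OF S(1)[OF that(1)] _ that(4,5) _ _ t])
        (simp_all only: two_torsion_elementary[OF Qsq[OF that(2)]] Qm[OF that(2)] Qm[OF that(3)] subset_refl)
  qed
  show "\<exists>q\<in>quadratic_pairs G m. fst q = supp \<Gamma> \<and> square_signs D \<Gamma> (fst q) (snd q)" if h: "\<Gamma> \<in> S" for \<Gamma>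
  proof -
    obtain \<mu> where d: "(supp \<Gamma>, \<mu>) \<in> quadratic_pairs G m" "square_signs D \<Gamma> (supp \<Gamma>) \<mu>" using data[OF h] by blast
    show ?thesis by (rule bexI[OF _ d(1)]) (simp add: d(2))
  qed
  show "q = q'" if h: "\<Gamma> \<in> S" "q \<in> quadratic_pairs G m" "q' \<in> quadratic_pairs G m"
    "fst q = supp \<Gamma> \<and> square_signs D \<Gamma> (fst q) (snd q)" "fst q' = supp \<Gamma> \<and> square_signs D \<Gamma> (fst q') (snd q')" for \<Gamma> q q'
  proof -
    obtain T \<mu> T' \<mu>' where e: "q = (T, \<mu>)" "q' = (T', \<mu>')" by fastforce
    have T: "T = supp \<Gamma>" "T' = supp \<Gamma>" using h(4,5) unfolding e by simp_all
    have "\<mu> = \<mu>'" by (rule uniq[OF h(1)]) (use h(2-5) in \<open>simp_all only: e T fst_conv snd_conv\<close>)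
    then show ?thesis unfolding e T by simp
  qed
  show "gradings_isomorphic G D \<Gamma> D \<Gamma>' \<longleftrightarrow>
      (\<exists>q\<in>quadratic_pairs G m. (fst q = supp \<Gamma> \<and> square_signs D \<Gamma> (fst q) (snd q)) \<and>
        (fst q = supp \<Gamma>' \<and> square_signs D \<Gamma>' (fst q) (snd q)))" if Gam: "\<Gamma> \<in> S" "\<Gamma>' \<in> S" for \<Gamma> \<Gamma>'
  proof
    assume i: "gradings_isomorphic G D \<Gamma> D \<Gamma>'"
    obtain \<mu> where d: "(supp \<Gamma>, \<mu>) \<in> quadratic_pairs G m" "square_signs D \<Gamma> (supp \<Gamma>) \<mu>" using data[OF Gam(1)] by blast
    have "supp \<Gamma> \<subseteq> carrier G" by (auto simp: grading_support_def)
    from isomorphic_same_data(3)[OF i S(1)[OF Gam(1)] this d(2)] isomorphic_same_data(1)[OF i S(1)[OF Gam(1)]] d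
    show "\<exists>q\<in>quadratic_pairs G m. (fst q = supp \<Gamma> \<and> square_signs D \<Gamma> (fst q) (snd q)) \<and>
        (fst q = supp \<Gamma>' \<and> square_signs D \<Gamma>' (fst q) (snd q))" by (intro bexI[OF _ d(1)]) simp
  next
    assume "\<exists>q\<in>quadratic_pairs G m. (fst q = supp \<Gamma> \<and> square_signs D \<Gamma> (fst q) (snd q)) \<and>
        (fst q = supp \<Gamma>' \<and> square_signs D \<Gamma>' (fst q) (snd q))"
    then obtain T \<mu> where q: "(T, \<mu>) \<in> quadratic_pairs G m" "supp \<Gamma> = T" "square_signs D \<Gamma> T \<mu>"
      "supp \<Gamma>' = T" "square_signs D \<Gamma>' T \<mu>" by auto
    \<comment> \<open>The commutation factors are known for the sign function that comes with the
      grading; by uniqueness that function is \<open>\<mu>\<close>.\<close>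
    have c: "commutation_factors D \<Delta> T (assoc_bichar (sub T) \<mu>)" if D: "\<Delta> \<in> S" "supp \<Delta> = T" "square_signs D \<Delta> T \<mu>" for \<Delta>
    proof -
      obtain \<mu>' where d: "(supp \<Delta>, \<mu>') \<in> quadratic_pairs G m" "square_signs D \<Delta> (supp \<Delta>) \<mu>'"
        "commutation_factors D \<Delta> (supp \<Delta>) (assoc_bichar (sub (supp \<Delta>)) \<mu>')" using data[OF D(1)] by blast
      have "\<mu>' = \<mu>" by (rule uniq[OF D(1) d(1) _ d(2)]) (use q(1) D in simp_all)
      then show ?thesis using d(3) D(2) by simp
    qed
    have t2: "two_torsion G T = T" by (rule two_torsion_elementary[OF Qsq[OF q(1)]])
    show "gradings_isomorphic G D \<Gamma> D \<Gamma>'"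
      by (rule same_data_isomorphic[where \<mu> = \<mu>, OF S(1)[OF Gam(1)] S(1)[OF Gam(2)] q(2,4) c[OF Gam(1) q(2,3)] c[OF Gam(2) q(4,5)]])
        (simp_all only: t2 q(3,5) Qm[OF q(1)])
  qed
  show "\<exists>\<Gamma>\<in>S. fst q = supp \<Gamma> \<and> square_signs D \<Gamma> (fst q) (snd q)" if q: "q \<in> quadratic_pairs G m" for q
  proof -
    obtain T \<mu> where e: "q = (T, \<mu>)" by fastforce
    note q' = q[unfolded e]
    obtain f where f: "qdata (sub T) (\<lambda>u v. assoc_bichar (sub T) \<mu> (u, v)) \<mu> f" "\<forall>t\<in>T. t \<otimes>\<^bsub>G\<^esub> t = \<one>\<^bsub>G\<^esub>" "card T = 2 ^ (2 * m + 1)"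
      by (rule quadratic_pair_qdata[OF G q'])
    have "card T = 2 * (n * n)" unfolding f(3) m by (simp add: power_add mult_2)
    then obtain \<Gamma> where "\<Gamma> \<in> division_gradings_dim1 G D" "supp \<Gamma> = T" "commutation_factors D \<Gamma> T (assoc_bichar (sub T) \<mu>)"
      "square_signs D \<Gamma> (two_torsion G T) \<mu>"
      by (rule grading_of_data[OF Q(1)[OF q'] f(1) g R]) (use f(2) el in simp_all)
    then show ?thesis using Q(3)[OF q'] two_torsion_elementary[OF f(2)]
      by (intro bexI[of _ \<Gamma>]) (simp_all add: e S_def division_gradings_dim1_supp_def)
  qed
qed
  then obtain F where F: "bij_betw F (isomorphism_classes G D S) (quadratic_pairs G m)"
    "\<forall>C\<in>isomorphism_classes G D S. \<forall>\<Gamma>\<in>C. fst (F C) = supp \<Gamma> \<and> square_signs D \<Gamma> (fst (F C)) (snd (F C))"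
    by (elim exE conjE)
  show ?thesis
  proof (rule exI[of _ F], intro conjI ballI allI impI F(1))
    fix C \<Gamma> T \<mu> assume C: "C \<in> isomorphism_classes G D S" "\<Gamma> \<in> C" and e: "F C = (T, \<mu>)"
    show "T = supp \<Gamma>" "square_signs D \<Gamma> T \<mu>"
      using F(2)[rule_format, OF C] unfolding e fst_conv snd_conv by (rule conjunct1, rule conjunct2)
  qed
qed

text \<open>The signs see only the 2-torsion, so the commutation factors involving elements of order
  four have to be recorded in the datum itself.\<close>

lemma quadratic_triples_classify:
  assumes m: "n = 2 ^ m" "m \<ge> 1" and g: "gbasis T' R X' \<sigma>'"
    and R: "isomorphic_algebras R (cmat_algebra n)"
    and el: "\<not> (\<forall>t\<in>carrier T'. t \<otimes>\<^bsub>T'\<^esub> t = \<one>\<^bsub>T'\<^esub>)"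
  defines "S \<equiv> division_gradings_dim1_supp G D (Z2_pow_Z4 (2 * m - 1))"
  shows "\<exists>F. bij_betw F (isomorphism_classes G D S) (quadratic_triples G m) \<and>
    (\<forall>C\<in>isomorphism_classes G D S. \<forall>\<Gamma>\<in>C. \<forall>T \<beta> \<mu>. F C = (T, \<beta>, \<mu>) \<longrightarrow>
      T = supp \<Gamma> \<and> commutation_factors D \<Gamma> T \<beta> \<and> square_signs D \<Gamma> (two_torsion G T) \<mu>)"
proof (rule classification_by_data)
  let ?P = "\<lambda>\<Gamma> q. \<forall>T \<beta> \<mu>. q = (T, \<beta>, \<mu>) \<longrightarrow>
      T = supp \<Gamma> \<and> commutation_factors D \<Gamma> T \<beta> \<and> square_signs D \<Gamma> (two_torsion G T) \<mu>"
  have S: "\<Gamma> \<in> division_gradings_dim1 G D" "sub (supp \<Gamma>) \<cong> Z2_pow_Z4 (2 * m - 1)" if "\<Gamma> \<in> S" for \<Gamma>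
    using that by (simp_all add: S_def division_gradings_dim1_supp_def)
  have Q: "subgroup T G" "\<mu> \<in> two_torsion G T \<rightarrow>\<^sub>E {1, -1}" "sub T \<cong> Z2_pow_Z4 (2 * m - 1)"
    "\<beta> \<in> (T \<times> T) \<rightarrow>\<^sub>E (UNIV - {0})" if "(T, \<beta>, \<mu>) \<in> quadratic_triples G m" for T \<beta> \<mu>
    using that by (simp_all add: quadratic_triples_def quadratic_form_def alternating_bicharacter_def)
  have Qm: "\<mu> \<in> two_torsion G T \<rightarrow> {1, -1}" if "(T, \<beta>, \<mu>) \<in> quadratic_triples G m" for T \<beta> \<mu>
    using Q(2)[OF that] unfolding PiE_def by (rule IntD1)
  have data: "\<exists>q\<in>quadratic_triples G m. ?P \<Gamma> q" if Gam: "\<Gamma> \<in> S" for \<Gamma>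
  proof -
    obtain \<beta> \<mu> f where d: "qdata (sub (supp \<Gamma>)) (\<lambda>u v. \<beta> (u, v)) \<mu> f" "commutation_factors D \<Gamma> (supp \<Gamma>) \<beta>"
      "square_signs D \<Gamma> (two_torsion G (supp \<Gamma>)) \<mu>"
      by (rule grading_data[OF S(1)[OF Gam]])
    obtain X \<sigma> f' where T: "subgroup (supp \<Gamma>) G" by (rule grading_basis[OF S(1)[OF Gam]])
    note p = qdata_quadratic_triple[OF G T S(2)[OF Gam] d(1)]
    have "square_signs D \<Gamma> (two_torsion G (supp \<Gamma>)) (restrict \<mu> (two_torsion G (supp \<Gamma>)))"
      by (subst square_signs_cong[of _ _ \<mu>]) (use d(3) in simp_all)
    moreover have "commutation_factors D \<Gamma> (supp \<Gamma>) (restrict \<beta> (supp \<Gamma> \<times> supp \<Gamma>))"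
      by (subst commutation_factors_cong[of _ _ \<beta>]) (use d(2) in simp_all)
    ultimately show ?thesis by (intro bexI[OF _ p(1)]) simp
  qed
  then show "\<exists>q\<in>quadratic_triples G m. ?P \<Gamma> q" if "\<Gamma> \<in> S" for \<Gamma> using that .
  show "q = q'" if h: "\<Gamma> \<in> S" "q \<in> quadratic_triples G m" "q' \<in> quadratic_triples G m" "?P \<Gamma> q" "?P \<Gamma> q'" for \<Gamma> q q'
  proof -
    let ?T = "supp \<Gamma>"
    obtain T \<beta> \<mu> T' \<beta>' \<mu>' where e0: "q = (T, \<beta>, \<mu>)" "q' = (T', \<beta>', \<mu>')" by (cases q; cases q') blast
    have T: "T = ?T" "T' = ?T" using h(4,5) unfolding e0 by simp_all
    note e = e0[unfolded T]
    note q = h(2)[unfolded e] h(3)[unfolded e]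
    have P: "commutation_factors D \<Gamma> ?T \<beta>" "commutation_factors D \<Gamma> ?T \<beta>'"
      "square_signs D \<Gamma> (two_torsion G ?T) \<mu>" "square_signs D \<Gamma> (two_torsion G ?T) \<mu>'"
      using h(4,5) unfolding e by simp_all
    have "\<beta> = \<beta>'"
    proof (rule PiE_ext[OF Q(4)[OF q(1)] Q(4)[OF q(2)]])
      fix x assume "x \<in> ?T \<times> ?T"
      then show "\<beta> x = \<beta>' x" using commutation_factors_unique[OF S(1)[OF h(1)] P(1,2)] by auto
    qed
    moreover have "\<mu> = \<mu>'"
    proof (rule PiE_ext[OF Q(2)[OF q(1)] Q(2)[OF q(2)]])
      fix t assume t: "t \<in> two_torsion G ?T"
      show "\<mu> t = \<mu>' t"
        by (rule square_signs_unique[OF S(1)[OF h(1)] subset_refl P(3,4) _ _ t])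
          (rule Qm[OF q(1)] Qm[OF q(2)])+
    qed
    ultimately show ?thesis unfolding e by simp
  qed
  show "gradings_isomorphic G D \<Gamma> D \<Gamma>' \<longleftrightarrow> (\<exists>q\<in>quadratic_triples G m. ?P \<Gamma> q \<and> ?P \<Gamma>' q)"
    if Gam: "\<Gamma> \<in> S" "\<Gamma>' \<in> S" for \<Gamma> \<Gamma>'
  proof
    assume i: "gradings_isomorphic G D \<Gamma> D \<Gamma>'"
    obtain q where q: "q \<in> quadratic_triples G m" "?P \<Gamma> q" using data[OF Gam(1)] by blast
    have "supp \<Gamma> \<subseteq> carrier G" by (auto simp: grading_support_def)
    moreover from this have "two_torsion G (supp \<Gamma>) \<subseteq> carrier G" by (auto simp: two_torsion_def)
    ultimately have "?P \<Gamma>' q"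
      using isomorphic_same_data[OF i S(1)[OF Gam(1)]] q(2) by (cases q) simp
    then show "\<exists>q\<in>quadratic_triples G m. ?P \<Gamma> q \<and> ?P \<Gamma>' q" using q by blast
  next
    assume "\<exists>q\<in>quadratic_triples G m. ?P \<Gamma> q \<and> ?P \<Gamma>' q"
    then obtain T \<beta> \<mu> where q: "(T, \<beta>, \<mu>) \<in> quadratic_triples G m" "supp \<Gamma> = T" "supp \<Gamma>' = T"
      "commutation_factors D \<Gamma> T \<beta>" "commutation_factors D \<Gamma>' T \<beta>"
      "square_signs D \<Gamma> (two_torsion G T) \<mu>" "square_signs D \<Gamma>' (two_torsion G T) \<mu>" by auto
    show "gradings_isomorphic G D \<Gamma> D \<Gamma>'"
      by (rule same_data_isomorphic[OF S(1)[OF Gam(1)] S(1)[OF Gam(2)] q(2-7) Qm[OF q(1)]])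
  qed
  show "\<exists>\<Gamma>\<in>S. ?P \<Gamma> q" if q: "q \<in> quadratic_triples G m" for q
  proof -
    obtain T \<beta> \<mu> where e: "q = (T, \<beta>, \<mu>)" by (cases q) auto
    note q' = q[unfolded e]
    obtain f where f: "qdata (sub T) (\<lambda>u v. \<beta> (u, v)) \<mu> f" "card T = 2 ^ (2 * m - 1) * 4" "\<not> (\<forall>t\<in>T. t \<otimes>\<^bsub>G\<^esub> t = \<one>\<^bsub>G\<^esub>)"
      by (rule quadratic_triple_qdata[OF G q'])
    \<comment> \<open>With \<open>m = Suc k\<close> the subtraction in \<open>2 * m - 1\<close> is
      genuine and the order of \<open>T\<close> becomes \<open>2 n^2\<close>.\<close>
    obtain k where k: "m = Suc k" using m(2) by (cases m) auto
    then have e': "2 * m - 1 = Suc (k + k)" by simp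
    have "card T = 2 * (n * n)" unfolding f(2) m(1) e' unfolding power_Suc power_add k by simp
    then obtain \<Gamma> where "\<Gamma> \<in> division_gradings_dim1 G D" "supp \<Gamma> = T" "commutation_factors D \<Gamma> T \<beta>"
      "square_signs D \<Gamma> (two_torsion G T) \<mu>"
      by (rule grading_of_data[OF Q(1)[OF q'] f(1) g R]) (use f(3) el in \<open>simp_all only: simp_thms\<close>)
    then show ?thesis using Q(3)[OF q']
      by (intro bexI[of _ \<Gamma>]) (simp_all add: e S_def division_gradings_dim1_supp_def)
  qed
qed

end

text \<open>The isomorphism type of the grading group is not computed from its definition: the
  structure theorem, applied to the representative itself, leaves two possibilities with the same
  \<open>m\<close>, and the exponent decides between them.\<close>

lemma representative_grading:
  assumes K: "comm_group K" and g: "gbasis K R X \<sigma>" and n: "n \<ge> 1" and m: "n = 2 ^ m"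
    and R: "isomorphic_algebras R (cmat_algebra n)"
    and Gam: "\<forall>g\<in>carrier K. \<Gamma> g = {r \<odot>\<^bsub>R\<^esub> X g | r. True}"
  shows "matrix_algebra_gradings K R n" "\<Gamma> \<in> division_gradings_dim1 K R" "grading_support K R \<Gamma> = carrier K"
    and "\<forall>t\<in>carrier K. t \<otimes>\<^bsub>K\<^esub> t = \<one>\<^bsub>K\<^esub> \<Longrightarrow> \<Gamma> \<in> division_gradings_dim1_supp K R (Z2_pow (2 * m + 1))"
    and "\<not> (\<forall>t\<in>carrier K. t \<otimes>\<^bsub>K\<^esub> t = \<one>\<^bsub>K\<^esub>) \<Longrightarrow> \<Gamma> \<in> division_gradings_dim1_supp K R (Z2_pow_Z4 (2 * m - 1))"
proof -
  interpret K: comm_group K by (rule K)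
  have KK: "K\<lparr>carrier := carrier K\<rparr> = K" by simp
  have g': "gbasis (K\<lparr>carrier := carrier K\<rparr>) R X \<sigma>" unfolding KK by (rule g)
  note gr = gbasis_grading[OF K K.subgroup_self g' Gam[rule_format]]
  show d: "\<Gamma> \<in> division_gradings_dim1 K R" and s: "grading_support K R \<Gamma> = carrier K" by (rule gr, simp, simp)+
  show M: "matrix_algebra_gradings K R n" by (rule matrix_algebra_gradings.intro[OF K n gbasisD(1)[OF g] R])
  obtain m' where m': "n = 2 ^ m'" "K \<cong> Z2_pow (2 * m' + 1) \<or> m' \<ge> 1 \<and> K \<cong> Z2_pow_Z4 (2 * m' - 1)"
    using matrix_algebra_gradings.support_structure[OF M d] unfolding s KK by (elim exE conjE)
  have "m' = m" using m m'(1) by simp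
  then have i: "K \<cong> Z2_pow (2 * m + 1) \<or> K \<cong> Z2_pow_Z4 (2 * m - 1)" using m'(2) by blast
  have 1: "\<forall>t\<in>carrier K. t \<otimes>\<^bsub>K\<^esub> t = \<one>\<^bsub>K\<^esub>" if "K \<cong> Z2_pow (2 * m + 1)"
    using iso_square(1)[OF that K.is_group group_Z2_pow] Z2_pow_square by blast
  have 2: "\<not> (\<forall>t\<in>carrier K. t \<otimes>\<^bsub>K\<^esub> t = \<one>\<^bsub>K\<^esub>)" if "K \<cong> Z2_pow_Z4 (2 * m - 1)"
    using iso_square(1)[OF that K.is_group group_Z2_pow_Z4] Z2_pow_Z4_not_square[of "2 * m - 1"] by simp
  show "\<Gamma> \<in> division_gradings_dim1_supp K R (Z2_pow (2 * m + 1))" if "\<forall>t\<in>carrier K. t \<otimes>\<^bsub>K\<^esub> t = \<one>\<^bsub>K\<^esub>"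
  proof -
    have "K \<cong> Z2_pow (2 * m + 1)" using i 2 that by blast
    then show ?thesis unfolding division_gradings_dim1_supp_def mem_Collect_eq s KK using d by blast
  qed
  show "\<Gamma> \<in> division_gradings_dim1_supp K R (Z2_pow_Z4 (2 * m - 1))" if "\<not> (\<forall>t\<in>carrier K. t \<otimes>\<^bsub>K\<^esub> t = \<one>\<^bsub>K\<^esub>)"
  proof -
    have "K \<cong> Z2_pow_Z4 (2 * m - 1)" using i 1 that by blast
    then show ?thesis unfolding division_gradings_dim1_supp_def mem_Collect_eq s KK using d by blast
  qed
qed

lemma complex_algebra_iso: "(\<lambda>z. mat 1 1 (\<lambda>_. z)) \<in> alg_iso complex_algebra (matrix_algebra 1 :: (real, complex mat) module)"
proof (rule alg_isoI)
  show "bij_betw (\<lambda>z. mat 1 1 (\<lambda>_. z)) (carrier complex_algebra) (carrier (matrix_algebra 1 :: (real, complex mat) module))"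
    by (rule bij_betwI[where g = "\<lambda>A. A $$ (0, 0)"]) (auto intro!: eq_matI)
qed (auto intro!: eq_matI simp: scalar_prod_def)

lemma product_square_K4:
  assumes "g \<in> (\<Pi>\<^sub>E i\<in>I. carrier K4)"
  shows "g \<otimes>\<^bsub>product_group I (\<lambda>_. K4)\<^esub> g = \<one>\<^bsub>product_group I (\<lambda>_. K4)\<^esub>"
proof -
  have "g i \<otimes>\<^bsub>K4\<^esub> g i = \<one>\<^bsub>K4\<^esub>" if "i \<in> I" for i
    using PiE_mem[OF assms that] unfolding K4_carrier by (elim insertE emptyE) simp_all
  then show ?thesis unfolding mult_product_group one_product_group by (rule restrict_ext)
qed

lemma rep1_gbasis:
  assumes n: "n = 2 ^ m"
  obtains X \<sigma> where "gbasis (rep1_group m) (rep1_algebra m) X \<sigma>"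
    "isomorphic_algebras (rep1_algebra m) (cmat_algebra n)"
    "\<forall>g\<in>carrier (rep1_group m). rep1_grading m g = {r \<odot>\<^bsub>rep1_algebra m\<^esub> X g | r. True}"
    "\<forall>t\<in>carrier (rep1_group m). t \<otimes>\<^bsub>rep1_group m\<^esub> t = \<one>\<^bsub>rep1_group m\<^esub>"
proof -
  obtain s where s: "gbasis K4 M2R pauli s" using gbasis_pauli by blast
  obtain s' where s': "gbasis Z2 complex_algebra c_unit s'" using gbasis_complex by blast
  note t = tensor_representative[OF complex_algebra_iso order_refl s' C_grading_eq s, where k = m]
  obtain \<sigma> where 1: "gbasis (rep1_group m) (rep1_algebra m)
      (\<lambda>(g, h). pure_tensor {..<m} (\<lambda>_. M2R) complex_algebra (\<lambda>i\<in>{..<m}. pauli (g i), c_unit h)) \<sigma>"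
    using t(2) unfolding rep1_group_def rep1_algebra_def by blast
  show thesis
  proof (rule that[OF 1])
    show "isomorphic_algebras (rep1_algebra m) (cmat_algebra n)"
      using t(1) unfolding rep1_algebra_def n mult_1_right .
    show "\<forall>g\<in>carrier (rep1_group m). rep1_grading m g = {r \<odot>\<^bsub>rep1_algebra m\<^esub>
      (case g of (g, h) \<Rightarrow> pure_tensor {..<m} (\<lambda>_. M2R) complex_algebra (\<lambda>i\<in>{..<m}. pauli (g i), c_unit h)) | r. True}"
    proof
      fix x assume "x \<in> carrier (rep1_group m)"
      then obtain g h where x: "x = (g, h)" "g \<in> (\<Pi>\<^sub>E i\<in>{..<m}. carrier K4)" "h \<in> carrier Z2"
        unfolding rep1_group_def carrier_DirProd carrier_product_group by blast
      show "rep1_grading m x = {r \<odot>\<^bsub>rep1_algebra m\<^esub>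
        (case x of (g, h) \<Rightarrow> pure_tensor {..<m} (\<lambda>_. M2R) complex_algebra (\<lambda>i\<in>{..<m}. pauli (g i), c_unit h)) | r. True}"
        unfolding x(1) prod.case rep1_grading_def rep1_algebra_def by (rule t(3)[rule_format, OF x(2,3)])
    qed
    show "\<forall>t\<in>carrier (rep1_group m). t \<otimes>\<^bsub>rep1_group m\<^esub> t = \<one>\<^bsub>rep1_group m\<^esub>"
    proof
      fix x assume "x \<in> carrier (rep1_group m)"
      then obtain g h where x: "x = (g, h)" "g \<in> (\<Pi>\<^sub>E i\<in>{..<m}. carrier K4)" "h \<in> carrier Z2"
        unfolding rep1_group_def carrier_DirProd carrier_product_group by blast
      have "h \<otimes>\<^bsub>Z2\<^esub> h = \<one>\<^bsub>Z2\<^esub>" using x(3) unfolding Z2_carrier by (elim insertE emptyE) simp_all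
      then show "x \<otimes>\<^bsub>rep1_group m\<^esub> x = \<one>\<^bsub>rep1_group m\<^esub>"
        unfolding rep1_group_def x(1) mult_DirProd one_DirProd product_square_K4[OF x(2)] by (simp only:)
    qed
  qed
qed

lemma rep2_gbasis:
  assumes n: "n = 2 ^ m" and m: "m \<ge> 1"
  obtains X \<sigma> where "gbasis (rep2_group m) (rep2_algebra m) X \<sigma>"
    "isomorphic_algebras (rep2_algebra m) (cmat_algebra n)"
    "\<forall>g\<in>carrier (rep2_group m). rep2_grading m g = {r \<odot>\<^bsub>rep2_algebra m\<^esub> X g | r. True}"
    "\<not> (\<forall>t\<in>carrier (rep2_group m). t \<otimes>\<^bsub>rep2_group m\<^esub> t = \<one>\<^bsub>rep2_group m\<^esub>)"
proof -
  let ?k = "m - 1"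
  obtain s where s: "gbasis K4 M2R pauli s" using gbasis_pauli by blast
  obtain s' where s': "gbasis Z2Z4 M2C m2c s'" using gbasis_m2c by blast
  have "id \<in> alg_iso M2C (matrix_algebra 2 :: (real, complex mat) module)" by (rule alg_isoI) simp_all
  note t = tensor_representative[OF this one_le_numeral s' M2C_grading_eq s, where k = ?k]
  obtain \<sigma> where 1: "gbasis (rep2_group m) (rep2_algebra m)
      (\<lambda>(g, h). pure_tensor {..<?k} (\<lambda>_. M2R) M2C (\<lambda>i\<in>{..<?k}. pauli (g i), m2c h)) \<sigma>"
    using t(2) unfolding rep2_group_def rep2_algebra_def by blast
  have e: "2 ^ ?k * 2 = n" unfolding n using m by (cases m) simp_all
  show thesis
  proof (rule that[OF 1])
    show "isomorphic_algebras (rep2_algebra m) (cmat_algebra n)"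
      using t(1) unfolding rep2_algebra_def e .
    show "\<forall>g\<in>carrier (rep2_group m). rep2_grading m g = {r \<odot>\<^bsub>rep2_algebra m\<^esub>
      (case g of (g, h) \<Rightarrow> pure_tensor {..<?k} (\<lambda>_. M2R) M2C (\<lambda>i\<in>{..<?k}. pauli (g i), m2c h)) | r. True}"
    proof
      fix x assume "x \<in> carrier (rep2_group m)"
      then obtain g h where x: "x = (g, h)" "g \<in> (\<Pi>\<^sub>E i\<in>{..<?k}. carrier K4)" "h \<in> carrier Z2Z4"
        unfolding rep2_group_def carrier_DirProd carrier_product_group by blast
      show "rep2_grading m x = {r \<odot>\<^bsub>rep2_algebra m\<^esub>
        (case x of (g, h) \<Rightarrow> pure_tensor {..<?k} (\<lambda>_. M2R) M2C (\<lambda>i\<in>{..<?k}. pauli (g i), m2c h)) | r. True}"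
        unfolding x(1) prod.case rep2_grading_def rep2_algebra_def by (rule t(3)[rule_format, OF x(2,3)])
    qed
    \<comment> \<open>The generator \<open>b\<close> of the cyclic factor of order four, neutral in
      all other coordinates.\<close>
    let ?t = "(\<one>\<^bsub>product_group {..<?k} (\<lambda>_. K4)\<^esub>, (0, 1)) :: (nat \<Rightarrow> int \<times> int) \<times> (int \<times> int)"
    have "(0, 1) \<otimes>\<^bsub>Z2Z4\<^esub> (0, 1) \<noteq> \<one>\<^bsub>Z2Z4\<^esub>" by simp
    then have "?t \<otimes>\<^bsub>rep2_group m\<^esub> ?t \<noteq> \<one>\<^bsub>rep2_group m\<^esub>"
      unfolding rep2_group_def mult_DirProd one_DirProd by blast
    moreover have "\<one>\<^bsub>product_group {..<?k} (\<lambda>_. K4)\<^esub> \<in> carrier (product_group {..<?k} (\<lambda>_. K4))"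
      by (auto simp: K4_carrier)
    then have "?t \<in> carrier (rep2_group m)" unfolding rep2_group_def carrier_DirProd by (simp add: Z4_carrier Z2_carrier)
    ultimately show "\<not> (\<forall>t\<in>carrier (rep2_group m). t \<otimes>\<^bsub>rep2_group m\<^esub> t = \<one>\<^bsub>rep2_group m\<^esub>)" by blast
  qed
qed

context matrix_algebra_gradings
begin

lemma rep1_representative:
  assumes m: "n = 2 ^ m"
  shows "ualg (rep1_algebra m)"
    and "isomorphic_algebras (rep1_algebra m) (cmat_algebra n)"
    and "rep1_grading m \<in> division_gradings_dim1_supp (rep1_group m) (rep1_algebra m) (Z2_pow (2 * m + 1))"
    and "\<And>\<Gamma>. \<Gamma> \<in> division_gradings_dim1_supp G D (Z2_pow (2 * m + 1)) \<Longrightarrow>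
      gradings_equivalent G D \<Gamma> (rep1_group m) (rep1_algebra m) (rep1_grading m)"
    and "\<exists>F. bij_betw F (isomorphism_classes G D (division_gradings_dim1_supp G D (Z2_pow (2 * m + 1)))) (quadratic_pairs G m) \<and>
      (\<forall>C\<in>isomorphism_classes G D (division_gradings_dim1_supp G D (Z2_pow (2 * m + 1))). \<forall>\<Gamma>\<in>C.
        \<forall>T \<mu>. F C = (T, \<mu>) \<longrightarrow> T = supp \<Gamma> \<and> square_signs D \<Gamma> T \<mu>)"
proof -
  obtain X \<sigma> where R: "gbasis (rep1_group m) (rep1_algebra m) X \<sigma>"
    "isomorphic_algebras (rep1_algebra m) (cmat_algebra n)"
    "\<forall>g\<in>carrier (rep1_group m). rep1_grading m g = {r \<odot>\<^bsub>rep1_algebra m\<^esub> X g | r. True}"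
    "\<forall>t\<in>carrier (rep1_group m). t \<otimes>\<^bsub>rep1_group m\<^esub> t = \<one>\<^bsub>rep1_group m\<^esub>"
    by (rule rep1_gbasis[OF m])
  note r = representative_grading[OF gbasisD(2)[OF R(1)] R(1) n m R(2) R(3)]
  show "gradings_equivalent G D \<Gamma> (rep1_group m) (rep1_algebra m) (rep1_grading m)"
    if "\<Gamma> \<in> division_gradings_dim1_supp G D (Z2_pow (2 * m + 1))" for \<Gamma>
  proof (rule gradings_equivalentI[OF matrix_algebra_gradings_axioms r(1) _ r(2)])
    show "\<Gamma> \<in> division_gradings_dim1 G D" using that by (simp add: division_gradings_dim1_supp_def)
    then obtain X \<sigma> f where T: "subgroup (supp \<Gamma>) G" by (rule grading_basis)
    have i: "sub (supp \<Gamma>) \<cong> Z2_pow (2 * m + 1)" using that by (simp add: division_gradings_dim1_supp_def)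
    have "\<forall>t\<in>supp \<Gamma>. t \<otimes>\<^bsub>G\<^esub> t = \<one>\<^bsub>G\<^esub>"
      using iso_square(1)[OF i subgroup.subgroup_is_group[OF T G.is_group] group_Z2_pow] Z2_pow_square by simp
    then show "(\<forall>t\<in>supp \<Gamma>. t \<otimes>\<^bsub>G\<^esub> t = \<one>\<^bsub>G\<^esub>) \<longleftrightarrow> (\<forall>t\<in>grading_support (rep1_group m) (rep1_algebra m) (rep1_grading m).
        t \<otimes>\<^bsub>rep1_group m\<^esub> t = \<one>\<^bsub>rep1_group m\<^esub>)" unfolding r(3) using R(4) by (intro iffI)
  qed
  show "ualg (rep1_algebra m)" by (rule gbasisD(1)[OF R(1)])
  show "isomorphic_algebras (rep1_algebra m) (cmat_algebra n)" by (rule R(2))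
  show "rep1_grading m \<in> division_gradings_dim1_supp (rep1_group m) (rep1_algebra m) (Z2_pow (2 * m + 1))" by (rule r(4)[OF R(4)])
  show "\<exists>F. bij_betw F (isomorphism_classes G D (division_gradings_dim1_supp G D (Z2_pow (2 * m + 1)))) (quadratic_pairs G m) \<and>
      (\<forall>C\<in>isomorphism_classes G D (division_gradings_dim1_supp G D (Z2_pow (2 * m + 1))). \<forall>\<Gamma>\<in>C.
        \<forall>T \<mu>. F C = (T, \<mu>) \<longrightarrow> T = supp \<Gamma> \<and> square_signs D \<Gamma> T \<mu>)"
    by (rule quadratic_pairs_classify[OF m R(1,2,4)])
qed

lemma rep2_representative:
  assumes m: "n = 2 ^ m" and m1: "m \<ge> 1"
  shows "ualg (rep2_algebra m)"
    and "isomorphic_algebras (rep2_algebra m) (cmat_algebra n)"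
    and "rep2_grading m \<in> division_gradings_dim1_supp (rep2_group m) (rep2_algebra m) (Z2_pow_Z4 (2 * m - 1))"
    and "\<And>\<Gamma>. \<Gamma> \<in> division_gradings_dim1_supp G D (Z2_pow_Z4 (2 * m - 1)) \<Longrightarrow>
      gradings_equivalent G D \<Gamma> (rep2_group m) (rep2_algebra m) (rep2_grading m)"
    and "\<exists>F. bij_betw F (isomorphism_classes G D (division_gradings_dim1_supp G D (Z2_pow_Z4 (2 * m - 1)))) (quadratic_triples G m) \<and>
      (\<forall>C\<in>isomorphism_classes G D (division_gradings_dim1_supp G D (Z2_pow_Z4 (2 * m - 1))). \<forall>\<Gamma>\<in>C.
        \<forall>T \<beta> \<mu>. F C = (T, \<beta>, \<mu>) \<longrightarrow> T = supp \<Gamma> \<and> commutation_factors D \<Gamma> T \<beta> \<and> square_signs D \<Gamma> (two_torsion G T) \<mu>)"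
proof -
  obtain X \<sigma> where R: "gbasis (rep2_group m) (rep2_algebra m) X \<sigma>"
    "isomorphic_algebras (rep2_algebra m) (cmat_algebra n)"
    "\<forall>g\<in>carrier (rep2_group m). rep2_grading m g = {r \<odot>\<^bsub>rep2_algebra m\<^esub> X g | r. True}"
    "\<not> (\<forall>t\<in>carrier (rep2_group m). t \<otimes>\<^bsub>rep2_group m\<^esub> t = \<one>\<^bsub>rep2_group m\<^esub>)"
    by (rule rep2_gbasis[OF m m1])
  note r = representative_grading[OF gbasisD(2)[OF R(1)] R(1) n m R(2) R(3)]
  show "gradings_equivalent G D \<Gamma> (rep2_group m) (rep2_algebra m) (rep2_grading m)"
    if "\<Gamma> \<in> division_gradings_dim1_supp G D (Z2_pow_Z4 (2 * m - 1))" for \<Gamma>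
  proof (rule gradings_equivalentI[OF matrix_algebra_gradings_axioms r(1) _ r(2)])
    show "\<Gamma> \<in> division_gradings_dim1 G D" using that by (simp add: division_gradings_dim1_supp_def)
    then obtain X \<sigma> f where T: "subgroup (supp \<Gamma>) G" by (rule grading_basis)
    have i: "sub (supp \<Gamma>) \<cong> Z2_pow_Z4 (2 * m - 1)" using that by (simp add: division_gradings_dim1_supp_def)
    have "\<not> (\<forall>t\<in>supp \<Gamma>. t \<otimes>\<^bsub>G\<^esub> t = \<one>\<^bsub>G\<^esub>)"
      using iso_square(1)[OF i subgroup.subgroup_is_group[OF T G.is_group] group_Z2_pow_Z4] Z2_pow_Z4_not_square[of "2 * m - 1"] by simp
    then show "(\<forall>t\<in>supp \<Gamma>. t \<otimes>\<^bsub>G\<^esub> t = \<one>\<^bsub>G\<^esub>) \<longleftrightarrow> (\<forall>t\<in>grading_support (rep2_group m) (rep2_algebra m) (rep2_grading m).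
        t \<otimes>\<^bsub>rep2_group m\<^esub> t = \<one>\<^bsub>rep2_group m\<^esub>)" unfolding r(3) using R(4) by (simp only: simp_thms)
  qed
  show "ualg (rep2_algebra m)" by (rule gbasisD(1)[OF R(1)])
  show "isomorphic_algebras (rep2_algebra m) (cmat_algebra n)" by (rule R(2))
  show "rep2_grading m \<in> division_gradings_dim1_supp (rep2_group m) (rep2_algebra m) (Z2_pow_Z4 (2 * m - 1))" by (rule r(5)[OF R(4)])
  show "\<exists>F. bij_betw F (isomorphism_classes G D (division_gradings_dim1_supp G D (Z2_pow_Z4 (2 * m - 1)))) (quadratic_triples G m) \<and>
      (\<forall>C\<in>isomorphism_classes G D (division_gradings_dim1_supp G D (Z2_pow_Z4 (2 * m - 1))). \<forall>\<Gamma>\<in>C.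
        \<forall>T \<beta> \<mu>. F C = (T, \<beta>, \<mu>) \<longrightarrow> T = supp \<Gamma> \<and> commutation_factors D \<Gamma> T \<beta> \<and> square_signs D \<Gamma> (two_torsion G T) \<mu>)"
    by (rule quadratic_triples_classify[OF m m1 R(1,2,4)])
qed

end

text \<open>The clauses about \<open>F C\<close> pin the bijections down: a class is sent to the
  support, the signs and, in the second family, the commutation factors of any of its members, so
  each correspondence is the natural one and not merely an equality of cardinalities. If
  \<open>n\<close> is not a power of two, the first part says that no such grading exists and the
  other parts are vacuous.\<close>

theorem theorem16:
  fixes G :: "('g, 'c) monoid_scheme" and D :: "(real, 'd) module" and n :: nat
  assumes G: "comm_group G"
    and n: "n \<ge> 1"
    and D: "unital_real_algebra D"
    and iso: "isomorphic_algebras D (matrix_algebra n :: (real, complex mat) module)"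
  shows
    "(\<forall>\<Gamma> \<in> division_gradings_dim1 G D.
        \<exists>m. n = 2 ^ m \<and> subgroup (grading_support G D \<Gamma>) G \<and>
          (G\<lparr>carrier := grading_support G D \<Gamma>\<rparr> \<cong> Z2_pow (2 * m + 1) \<or>
           m \<ge> 1 \<and> G\<lparr>carrier := grading_support G D \<Gamma>\<rparr> \<cong> Z2_pow_Z4 (2 * m - 1))) \<and>
     (\<forall>m. n = 2 ^ m \<longrightarrow>
        (let S = division_gradings_dim1_supp G D (Z2_pow (2 * m + 1)) in
          (\<exists>F. bij_betw F (isomorphism_classes G D S) (quadratic_pairs G m) \<and>
             (\<forall>C \<in> isomorphism_classes G D S. \<forall>\<Gamma> \<in> C. \<forall>T \<mu>. F C = (T, \<mu>) \<longrightarrow>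
                T = grading_support G D \<Gamma> \<and> square_signs D \<Gamma> T \<mu>)) \<and>
          unital_real_algebra (rep1_algebra m) \<and>
          isomorphic_algebras (rep1_algebra m) (matrix_algebra n :: (real, complex mat) module) \<and>
          rep1_grading m \<in>
            division_gradings_dim1_supp (rep1_group m) (rep1_algebra m) (Z2_pow (2 * m + 1)) \<and>
          (\<forall>\<Gamma> \<in> S. gradings_equivalent G D \<Gamma> (rep1_group m) (rep1_algebra m) (rep1_grading m)))) \<and>
     (\<forall>m\<ge>1. n = 2 ^ m \<longrightarrow>
        (let S = division_gradings_dim1_supp G D (Z2_pow_Z4 (2 * m - 1)) in
          (\<exists>F. bij_betw F (isomorphism_classes G D S) (quadratic_triples G m) \<and>
             (\<forall>C \<in> isomorphism_classes G D S. \<forall>\<Gamma> \<in> C. \<forall>T \<beta> \<mu>. F C = (T, \<beta>, \<mu>) \<longrightarrow>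
                T = grading_support G D \<Gamma> \<and> commutation_factors D \<Gamma> T \<beta> \<and>
                square_signs D \<Gamma> (two_torsion G T) \<mu>)) \<and>
          unital_real_algebra (rep2_algebra m) \<and>
          isomorphic_algebras (rep2_algebra m) (matrix_algebra n :: (real, complex mat) module) \<and>
          rep2_grading m \<in>
            division_gradings_dim1_supp (rep2_group m) (rep2_algebra m) (Z2_pow_Z4 (2 * m - 1)) \<and>
          (\<forall>\<Gamma> \<in> S. gradings_equivalent G D \<Gamma> (rep2_group m) (rep2_algebra m) (rep2_grading m))))"
proof -
  interpret matrix_algebra_gradings G D n
    by (rule matrix_algebra_gradings.intro[OF G n D[unfolded unital_real_algebra_ualg] iso])
  show ?thesis
    unfolding Let_def unital_real_algebra_ualg
    by (intro conjI ballI allI impI; (rule support_structure rep1_representative rep2_representative; assumption))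
qed

end
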